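(* Let $G \in H^1((0,1); L^2(\mathbb{R}))$. There exist nontrivial, independent linear functionals $\ell_0, \ell_1 : \mathcal{P} \to \mathbb{R}$, and linear functionals $\beta_0, \beta_1$ (acting on source terms and taking values in $\mathbb{R}$), such that if the data $(\Xi_L, \Xi_R) \in \mathcal{P}$ satisfy the constraints $$\Xi_L''(0) = -G_{Left}(0), \qquad \Xi_R''(0) = -G_{Right}(0), \qquad \ell_1(\Xi_L, \Xi_R) = \beta_1(G), \qquad \ell_0(\Xi_L, \Xi_R) = \beta_0(G),$$ then the unique weak solution $\Omega$ of $$\rho\, \partial_t \Omega - \partial_\rho^2 \Omega = G \ \text{ in } (0,1)\times\mathbb{R}, \quad \Omega|_{t=0} = \Xi_L \ (\rho>0), \quad \Omega|_{t=1} = \Xi_R \ (\rho<0), \quad \Omega|_{\rho\to\pm\infty} = 0,$$ satisfies $\Omega \in H^1((0,1); H^1(\mathbb{R}))$.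
   Context: Coordinates are $(t,\rho) \in (0,1)\times\mathbb{R}$. $\mathcal{P}$ denotes the space of pairs $(\Xi_L,\Xi_R)$ with $\Xi_L \in C_c^\infty([0,\infty))$ and $\Xi_R \in C_c^\infty((-\infty,0])$ (smooth up to $\rho=0$). $G_{Left}(\rho) := G(0,\rho)$ for $\rho>0$ and $G_{Right}(\rho) := G(1,\rho)$ for $\rho<0$; $G_{Left}(0), G_{Right}(0)$ are their one-sided values at $\rho = 0$, assumed to make sense. It is known that the boundary value problem has a unique solution in $C^0((0,1);H^1(\mathbb{R}))$ (with the data attained in the trace sense); this is the "unique weak solution".
   Formalization: That the one-sided values G_Left(0), G_Right(0) make sense is taken to include, besides the limit, square integrability of (G_Left − G_Left(0))/√|ρ| and (G_Right − G_Right(0))/√|ρ| near ρ = 0; with the limit alone the claim fails, e.g. G = 1/√(ln(1/ρ)) near 0+. *)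

theory Defs
  imports "HOL-Analysis.Analysis"
begin

subsection \<open>Test functions and lateral data\<close>

definition deriv_on :: "real set \<Rightarrow> (real \<Rightarrow> real) \<Rightarrow> real \<Rightarrow> real" where
  "deriv_on S f = (\<lambda>x. vector_derivative f (at x within S))"

text \<open>
  The space of smooth compactly supported functions on an interval \<open>S\<close>, extended by zero to the
  real line. Derivatives are taken within \<open>S\<close>. For open \<open>S\<close> these are the usual test functions;
  for \<open>S = {0..}\<close> or \<open>S = {..0}\<close> smoothness is one-sided up to the end point, the function need
  not vanish there, and the extension by zero may jump.
\<close>

definition Cc_infty :: "real set \<Rightarrow> (real \<Rightarrow> real) set" where
  "Cc_infty S = {f. (\<forall>n. (deriv_on S ^^ n) f differentiable_on S) \<and>
                    (\<exists>K. compact K \<and> K \<subseteq> S \<and> (\<forall>x. x \<notin> K \<longrightarrow> f x = 0))}"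

definition data_space :: "((real \<Rightarrow> real) \<times> (real \<Rightarrow> real)) set" where
  "data_space = Cc_infty {0..} \<times> Cc_infty {..0}"

subsection \<open>Sobolev and Bochner spaces\<close>

text \<open>
  Elements of the function spaces are represented by Borel functions. An element of
  \<open>L\<^sup>2((0,1); L\<^sup>2(\<real>))\<close> is a function \<open>u t \<rho>\<close> that is jointly measurable and square integrable on
  the strip.
\<close>

definition square_integrable :: "'a measure \<Rightarrow> ('a \<Rightarrow> real) \<Rightarrow> bool" where
  "square_integrable M f \<longleftrightarrow> f \<in> borel_measurable M \<and> integrable M (\<lambda>x. (f x)\<^sup>2)"

abbreviation time :: "real measure" where
  "time \<equiv> restrict_space lborel {0<..<1}"

abbreviation strip :: "(real \<times> real) measure" where
  "strip \<equiv> time \<Otimes>\<^sub>M lborel"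

definition has_weak_deriv :: "(real \<Rightarrow> real) \<Rightarrow> (real \<Rightarrow> real) \<Rightarrow> bool" where
  "has_weak_deriv f g \<longleftrightarrow>
     (\<forall>\<psi>\<in>Cc_infty UNIV. (LINT \<rho>|lborel. f \<rho> * deriv \<psi> \<rho>) = - (LINT \<rho>|lborel. g \<rho> * \<psi> \<rho>))"

text \<open>
  The weak derivative of a function of time with values in \<open>L\<^sup>2(\<real>)\<close>: the two sides of the defining
  identity are Bochner integrals, that is, elements of \<open>L\<^sup>2(\<real>)\<close>, whence the equality for almost
  every \<open>\<rho>\<close>.
\<close>

definition has_weak_time_deriv :: "(real \<Rightarrow> real \<Rightarrow> real) \<Rightarrow> (real \<Rightarrow> real \<Rightarrow> real) \<Rightarrow> bool" where
  "has_weak_time_deriv u v \<longleftrightarrow>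
     (\<forall>\<phi>\<in>Cc_infty {0<..<1}. AE \<rho> in lborel.
        (LINT t|time. deriv \<phi> t * u t \<rho>) = - (LINT t|time. \<phi> t * v t \<rho>))"

definition L2_L2 :: "(real \<Rightarrow> real \<Rightarrow> real) set" where
  "L2_L2 = {u. square_integrable strip (\<lambda>(t, \<rho>). u t \<rho>)}"

definition L2_H1 :: "(real \<Rightarrow> real \<Rightarrow> real) set" where
  "L2_H1 = {u \<in> L2_L2. \<exists>w\<in>L2_L2. AE t in time. has_weak_deriv (u t) (w t)}"

definition H1_L2 :: "(real \<Rightarrow> real \<Rightarrow> real) set" where
  "H1_L2 = {u \<in> L2_L2. \<exists>v\<in>L2_L2. has_weak_time_deriv u v}"

definition H1_H1 :: "(real \<Rightarrow> real \<Rightarrow> real) set" where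
  "H1_H1 = {u \<in> L2_H1. \<exists>v\<in>L2_H1. has_weak_time_deriv u v}"

definition C0_L2 :: "real set \<Rightarrow> (real \<Rightarrow> real \<Rightarrow> real) set" where
  "C0_L2 I = {u. (\<forall>t\<in>I. square_integrable lborel (u t)) \<and>
     (\<forall>s\<in>I. ((\<lambda>t. LINT \<rho>|lborel. (u t \<rho> - u s \<rho>)\<^sup>2) \<longlongrightarrow> 0) (at s within I))}"

definition C0_H1 :: "real set \<Rightarrow> (real \<Rightarrow> real \<Rightarrow> real) set" where
  "C0_H1 I = {u \<in> C0_L2 I. \<exists>w\<in>C0_L2 I. \<forall>t\<in>I. has_weak_deriv (u t) (w t)}"

subsection \<open>Boundary values of the source\<close>

text \<open>\<open>g\<close> is the value at time \<open>s\<close> of the representative of \<open>G\<close> in \<open>C\<^sup>0([0,1]; L\<^sup>2(\<real>))\<close>.\<close>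

definition time_trace :: "(real \<Rightarrow> real \<Rightarrow> real) \<Rightarrow> real \<Rightarrow> (real \<Rightarrow> real) \<Rightarrow> bool" where
  "time_trace G s g \<longleftrightarrow>
     (\<exists>H\<in>C0_L2 {0..1}. (AE (t, \<rho>) in strip. G t \<rho> = H t \<rho>) \<and> H s = g)"

text \<open>
  The value at \<open>0\<close>, from within \<open>S = {0<..}\<close> or \<open>S = {..<0}\<close>, of an \<open>L\<^sup>2\<close> function \<open>g\<close>. It is the
  one-sided limit of a representative, and it makes sense if moreover \<open>(g - c) / sqrt \<bar>\<rho>\<bar>\<close> is square
  integrable near \<open>0\<close>, as is the case when \<open>g\<close> is one-sidedly Hoelder continuous at \<open>0\<close> or
  \<open>H\<^sup>1\<close> on one side of \<open>0\<close>. The limit alone is not enough here. If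
  \<open>\<Omega> \<in> H\<^sup>1((0,1); H\<^sup>1(\<real>))\<close> solves the equation below, then \<open>W = \<partial>\<^sub>t\<Omega>\<close> has
  \<open>W \<in> L\<^sup>2((0,1); H\<^sup>1)\<close> and \<open>\<rho> \<partial>\<^sub>tW \<in> L\<^sup>2((0,1); H\<^sup>-\<^sup>1)\<close>, hence
  \<open>sqrt \<bar>\<rho>\<bar> W \<in> C\<^sup>0([0,1]; L\<^sup>2)\<close>; since \<open>\<rho> W = G + \<Xi>\<^sub>L''\<close> at \<open>t = 0\<close>, \<open>\<rho> > 0\<close>, the function
  \<open>(G(0,\<rho>) + \<Xi>\<^sub>L''(\<rho>)) / sqrt \<rho>\<close> is square integrable. That fails, for instance, if
  \<open>G(0,\<rho>) = 1 / sqrt (ln (1 / \<rho>))\<close> for small \<open>\<rho> > 0\<close>, although the one-sided limit exists.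
\<close>

definition one_sided_value :: "real set \<Rightarrow> (real \<Rightarrow> real) \<Rightarrow> real \<Rightarrow> bool" where
  "one_sided_value S g c \<longleftrightarrow>
     (\<exists>h. (AE \<rho> in lborel. \<rho> \<in> S \<longrightarrow> h \<rho> = g \<rho>) \<and> (h \<longlongrightarrow> c) (at 0 within S)) \<and>
     (\<exists>\<delta>>0. (\<integral>\<^sup>+\<rho>\<in>S \<inter> {-\<delta><..<\<delta>}. ennreal ((g \<rho> - c)\<^sup>2 / \<bar>\<rho>\<bar>) \<partial>lborel) < \<infinity>)"

subsection \<open>The boundary value problem\<close>

text \<open>
  For each time \<open>t\<close> the continuous representative of the element \<open>\<Omega> t\<close> of \<open>H\<^sup>1(\<real>)\<close> is used. The
  equation holds in the sense of distributions; products \<open>\<phi>(t) \<psi>(\<rho>)\<close> span a dense set of test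
  functions. The data are attained in the trace space \<open>L\<^sup>2(\<bar>\<rho>\<bar> d\<rho>)\<close> of the equation. The weight
  cannot be replaced by convergence away from \<open>\<rho> = 0\<close>, which would admit homogeneous solutions that
  are singular at the points \<open>(0,0)\<close> and \<open>(1,0)\<close>, and uniqueness would fail.
\<close>

definition weak_solution ::
  "(real \<Rightarrow> real \<Rightarrow> real) \<Rightarrow> (real \<Rightarrow> real) \<Rightarrow> (real \<Rightarrow> real) \<Rightarrow> (real \<Rightarrow> real \<Rightarrow> real) \<Rightarrow> bool" where
  "weak_solution G \<Xi>\<^sub>L \<Xi>\<^sub>R \<Omega> \<longleftrightarrow>
     \<Omega> \<in> C0_H1 {0<..<1} \<and> (\<forall>t\<in>{0<..<1}. continuous_on UNIV (\<Omega> t)) \<and>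
     (\<forall>\<phi>\<in>Cc_infty {0<..<1}. \<forall>\<psi>\<in>Cc_infty UNIV.
        (LINT (t, \<rho>)|strip. - (\<rho> * \<Omega> t \<rho> * deriv \<phi> t * \<psi> \<rho>) - \<Omega> t \<rho> * \<phi> t * deriv (deriv \<psi>) \<rho>) =
        (LINT (t, \<rho>)|strip. G t \<rho> * \<phi> t * \<psi> \<rho>)) \<and>
     ((\<lambda>t. \<integral>\<^sup>+\<rho>\<in>{0<..}. ennreal (\<bar>\<rho>\<bar> * (\<Omega> t \<rho> - \<Xi>\<^sub>L \<rho>)\<^sup>2) \<partial>lborel) \<longlongrightarrow> 0) (at_right 0) \<and>
     ((\<lambda>t. \<integral>\<^sup>+\<rho>\<in>{..<0}. ennreal (\<bar>\<rho>\<bar> * (\<Omega> t \<rho> - \<Xi>\<^sub>R \<rho>)\<^sup>2) \<partial>lborel) \<longlongrightarrow> 0) (at_left 1) \<and>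
     (\<forall>t\<in>{0<..<1}. (\<Omega> t \<longlongrightarrow> 0) at_top \<and> (\<Omega> t \<longlongrightarrow> 0) at_bot)"

subsection \<open>Linear functionals\<close>

definition linear_on_data :: "((real \<Rightarrow> real) \<times> (real \<Rightarrow> real) \<Rightarrow> real) \<Rightarrow> bool" where
  "linear_on_data l \<longleftrightarrow>
     (\<forall>(f, g)\<in>data_space. \<forall>(f', g')\<in>data_space. \<forall>a b.
        l (\<lambda>x. a * f x + b * f' x, \<lambda>x. a * g x + b * g' x) = a * l (f, g) + b * l (f', g'))"

definition nontrivial_on_data :: "((real \<Rightarrow> real) \<times> (real \<Rightarrow> real) \<Rightarrow> real) \<Rightarrow> bool" where
  "nontrivial_on_data l \<longleftrightarrow> (\<exists>p\<in>data_space. l p \<noteq> 0)"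

definition independent_on_data ::
  "((real \<Rightarrow> real) \<times> (real \<Rightarrow> real) \<Rightarrow> real) \<Rightarrow> ((real \<Rightarrow> real) \<times> (real \<Rightarrow> real) \<Rightarrow> real) \<Rightarrow> bool" where
  "independent_on_data l l' \<longleftrightarrow>
     (\<forall>a b. (\<forall>p\<in>data_space. a * l p + b * l' p = 0) \<longrightarrow> a = 0 \<and> b = 0)"

text \<open>The second conjunct says that the functional is well defined on classes of functions that
  agree almost everywhere.\<close>

definition linear_on_sources :: "((real \<Rightarrow> real \<Rightarrow> real) \<Rightarrow> real) \<Rightarrow> bool" where
  "linear_on_sources b \<longleftrightarrow>
     (\<forall>G\<in>H1_L2. \<forall>G'\<in>H1_L2. \<forall>c d. b (\<lambda>t \<rho>. c * G t \<rho> + d * G' t \<rho>) = c * b G + d * b G') \<and>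
     (\<forall>G\<in>H1_L2. \<forall>G'\<in>H1_L2. (AE (t, \<rho>) in strip. G t \<rho> = G' t \<rho>) \<longrightarrow> b G = b G')"

end

theory Submission
  imports Defs "HOL-Library.Function_Algebras"
begin

text \<open>
  The time derivative \<open>W = \<partial>\<^sub>t\<Omega>\<close> should solve the same equation with source \<open>\<partial>\<^sub>tG\<close> and with the
  lateral data \<open>(G + \<Xi>'') / \<rho>\<close>, read off from the equation at \<open>t = 0\<close>, \<open>\<rho> > 0\<close> and at \<open>t = 1\<close>,
  \<open>\<rho> < 0\<close>; the conditions on \<open>\<Xi>\<^sub>L''(0)\<close> and \<open>\<Xi>\<^sub>R''(0)\<close> put these data into \<open>L\<^sup>2(\<bar>\<rho>\<bar> d\<rho>)\<close>. A weak
  \<open>W\<close> with \<open>\<partial>\<^sub>\<rho>W \<in> L\<^sup>2\<close> exists by duality: the adjoint problem satisfies an a priori estimate,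
  obtained with the multiplier \<open>2 + (t - 1/2) \<rho> / sqrt (1 + \<rho>\<^sup>2)\<close>. Integrating \<open>W\<close> in time from
  \<open>\<Xi>\<^sub>L\<close> for \<open>\<rho> > 0\<close>, and backwards from \<open>\<Xi>\<^sub>R\<close> for \<open>\<rho> < 0\<close>, gives a function \<open>\<Omega>'\<close> that solves the
  problem up to two numbers: its jump \<open>j\<close> across \<open>\<rho> = 0\<close>, and a multiple \<open>\<kappa>\<close> of \<open>\<delta>\<^sub>0\<close> in the equation.
  If both vanish, then \<open>\<Omega>'\<close> lies in \<open>H\<^sup>1(H\<^sup>1)\<close> and solves the problem, and an energy estimate
  for time averages gives \<open>\<Omega> = \<Omega>'\<close>.

  The possible \<open>(G, \<Xi>\<^sub>L, \<Xi>\<^sub>R, j, \<kappa>)\<close> form a linear space. Choosing \<open>j\<close> and \<open>\<kappa>\<close> linearly by means of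
  a Hamel basis and separating the contribution of \<open>G\<close> from that of the data yields the functionals. As
  \<open>\<Xi>\<^sub>L''(0) + G\<^sub>L(0)\<close> and \<open>\<Xi>\<^sub>R''(0) + G\<^sub>R(0)\<close> vanish under the constraints, multiples of them may be added
  to make the two functionals independent.
\<close>

text \<open>The coefficient rho changes sign, so the equation runs forward in time for rho > 0 and
  backward for rho < 0. Test functions must vanish at \<open>t = 0\<close> for rho <= 0 and at
  \<open>t = 1\<close> for rho >= 0, which excludes those that are constant in time. The weak
  equation for \<open>W\<close> therefore only shows that the time-integrated equation has, for each
  spatial test function \<open>k\<close>, a defect that does not depend on time. To evaluate it,
  \<open>k\<close> is cut at rho = 0 and the halves are weighted by \<open>1 - t\<close> and
  \<open>t\<close>. The halves are continuous only if \<open>k 0 = 0\<close>; this is the origin of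
  \<kappa>, since the value at one \<open>k\<close> with \<open>k 0 = 1\<close> stays free. The jump
  arises because the integrations from the two ends need not match at rho = 0.

  No uniqueness of \<open>W\<close> is established, so the two numbers form a relation with the
  source and the data, from which a linear selection is made. The selection lives on the space of
  all quintuples: a source alone or data alone may violate the conditions on the second derivatives,
  and the values at \<open>(G, 0, 0)\<close> and \<open>(0, f, g)\<close> then come from linear
  extension only.\<close>

type_synonym field = "real \<Rightarrow> real \<Rightarrow> real"

abbreviation strip_measurable :: "field \<Rightarrow> bool" where
  "strip_measurable F \<equiv> (\<lambda>(t, x). F t x) \<in> borel_measurable strip"

abbreviation plane_measurable :: "field \<Rightarrow> bool" where
  "plane_measurable F \<equiv> (\<lambda>(t, x). F t x) \<in> borel_measurable (borel \<Otimes>\<^sub>M borel)"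

abbreviation lateral :: "real set \<Rightarrow> (real \<Rightarrow> real) \<Rightarrow> ennreal" where
  "lateral S w \<equiv> (\<integral>\<^sup>+x\<in>S. ennreal (\<bar>x\<bar> * (w x)\<^sup>2) \<partial>lborel)"

lemmas LINT_cong = Bochner_Integration.integral_cong[OF refl]
  and LINT_add = Bochner_Integration.integral_add and LINT_diff = Bochner_Integration.integral_diff
  and integrable_le = Bochner_Integration.integrable_bound

subsection \<open>Smooth bump functions\<close>

text \<open>Derivatives are given by witnesses, so that closure under sums, products and affine
  substitutions is a short induction. The iterated \<open>deriv_on\<close> of
  \<open>Cc_infty\<close> is less convenient for this; \<open>Cc_inftyI\<close> translates
  back.\<close>

primrec times_differentiable :: "nat \<Rightarrow> (real \<Rightarrow> real) \<Rightarrow> bool" where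
  "times_differentiable 0 f = True"
| "times_differentiable (Suc n) f =
     (\<exists>f'. (\<forall>x. (f has_real_derivative f' x) (at x)) \<and> times_differentiable n f')"

lemma times_differentiable_Suc_D:
  "times_differentiable (Suc n) f \<Longrightarrow> times_differentiable n f"
proof (induction n arbitrary: f)
  case (Suc n)
  then obtain f' where "\<forall>x. (f has_real_derivative f' x) (at x)" "times_differentiable (Suc n) f'"
    unfolding times_differentiable.simps(2)[of "Suc n"] by blast
  then show ?case using Suc.IH[of f'] unfolding times_differentiable.simps(2)[of n f] by blast
qed simp

lemma times_differentiable_add:
  "times_differentiable n f \<Longrightarrow> times_differentiable n g \<Longrightarrow> times_differentiable n (\<lambda>x. f x + g x)"
proof (induction n arbitrary: f g)
  case (Suc n)
  then obtain f' g' where "\<forall>x. (f has_real_derivative f' x) (at x)" "times_differentiable n f'"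
    "\<forall>x. (g has_real_derivative g' x) (at x)" "times_differentiable n g'" by auto
  then show ?case using Suc.IH[of f' g'] by (auto intro!: exI[of _ "\<lambda>x. f' x + g' x"] derivative_intros)
qed simp

lemma times_differentiable_mult:
  "times_differentiable n f \<Longrightarrow> times_differentiable n g \<Longrightarrow> times_differentiable n (\<lambda>x. f x * g x)"
proof (induction n arbitrary: f g)
  case (Suc n)
  then obtain f' g' where *: "\<forall>x. (f has_real_derivative f' x) (at x)" "times_differentiable n f'"
    "\<forall>x. (g has_real_derivative g' x) (at x)" "times_differentiable n g'" by auto
  have "times_differentiable n (\<lambda>x. f' x * g x + g' x * f x)"
    using Suc * times_differentiable_Suc_D by (intro times_differentiable_add Suc.IH) auto
  then show ?case using * by (auto intro!: exI[of _ "\<lambda>x. f' x * g x + g' x * f x"] DERIV_mult)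
qed simp

lemma times_differentiable_const: "times_differentiable n (\<lambda>x. c)"
  by (induction n arbitrary: c) (simp_all, rule exI[of _ "\<lambda>x. 0"], simp)

lemma times_differentiable_affine:
  "times_differentiable n f \<Longrightarrow> times_differentiable n (\<lambda>x. f (a * x + b))"
proof (induction n arbitrary: f)
  case (Suc n)
  then obtain f' where *: "\<forall>x. (f has_real_derivative f' x) (at x)" "times_differentiable n f'" by auto
  have "((\<lambda>x. f (a * x + b)) has_real_derivative a * f' (a * x + b)) (at x)" for x
  proof -
    have "((\<lambda>x. a * x + b) has_real_derivative a) (at x)" by (rule derivative_eq_intros refl | simp)+
    from DERIV_chain2[OF *(1)[rule_format] this] show ?thesis by (simp add: mult.commute)
  qed
  then show ?case using Suc.IH[OF *(2)]
    by (auto intro!: exI[of _ "\<lambda>x. a * f' (a * x + b)"] times_differentiable_mult times_differentiable_const)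
qed simp

text \<open>The classical flat function \<open>exp (- (1 / x))\<close>, with a polynomial factor in
  \<open>1 / x\<close> because the family so obtained is closed under differentiation.\<close>

definition flat_exp :: "real poly \<Rightarrow> real \<Rightarrow> real" where
  "flat_exp q x = (if 0 < x then poly q (1 / x) * exp (- (1 / x)) else 0)"

lemma tendsto_poly_exp_minus: "((\<lambda>y. poly q y * exp (- y)) \<longlongrightarrow> 0) at_top" for q :: "real poly"
proof -
  have "((\<lambda>y. \<Sum>i\<le>degree q. coeff q i * (y ^ i / exp y)) \<longlongrightarrow> (\<Sum>i\<le>degree q. coeff q i * 0)) at_top"
    by (intro tendsto_intros tendsto_power_div_exp_0)
  then show ?thesis by (simp add: poly_altdef sum_distrib_right exp_minus divide_inverse mult.assoc)
qed

text \<open>With \<open>y = 1 / x\<close>, the derivative of \<open>q(y) exp(-y)\<close> in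
  \<open>x\<close> is \<open>y^2 (q - q')(y) exp(-y)\<close>. At \<open>x = 0\<close> the right
  difference quotient is \<open>y q(y) exp(-y)\<close>, which tends to zero as \<open>y\<close>
  grows.\<close>

lemma flat_exp_has_derivative:
  "(flat_exp q has_real_derivative flat_exp ([:0, 0, 1:] * (q - pderiv q)) x) (at x)"
proof -
  consider "x < 0" | "x = 0" | "x > 0" by linarith
  then show ?thesis
  proof cases
    case 1
    have "((\<lambda>x. 0) has_real_derivative 0) (at x)" by simp
    then have "(flat_exp q has_real_derivative 0) (at x)"
      by (rule has_field_derivative_transform_within_open[of _ _ _ "{..<0}"]) (use 1 in \<open>auto simp: flat_exp_def\<close>)
    then show ?thesis using 1 by (simp add: flat_exp_def)
  next
    case 3
    have "((\<lambda>x. poly q (1 / x) * exp (- (1 / x))) has_real_derivative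
       poly (pderiv q) (1 / x) * (- (1 / x^2)) * exp (- (1 / x)) + poly q (1 / x) * (exp (- (1 / x)) * (1 / x^2))) (at x)"
      using 3 by (auto intro!: derivative_eq_intros DERIV_chain2[OF poly_DERIV] simp: power2_eq_square)
    then have "(flat_exp q has_real_derivative
       poly (pderiv q) (1 / x) * (- (1 / x^2)) * exp (- (1 / x)) + poly q (1 / x) * (exp (- (1 / x)) * (1 / x^2))) (at x)"
      by (rule has_field_derivative_transform_within_open[of _ _ _ "{0<..}"]) (use 3 in \<open>auto simp: flat_exp_def\<close>)
    then show ?thesis using 3 by (simp add: flat_exp_def power2_eq_square field_simps)
  next
    case 2
    have "((\<lambda>y. poly ([:0,1:] * q) (1 / y) * exp (- (1 / y))) \<longlongrightarrow> 0) (at_right (0::real))"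
      using filterlim_compose[OF tendsto_poly_exp_minus[of "[:0,1:] * q"] filterlim_inverse_at_top_right]
      by (simp add: inverse_eq_divide)
    then have "((\<lambda>y. flat_exp q y / y) \<longlongrightarrow> 0) (at_right 0)"
      by (rule Lim_transform_eventually) (auto simp: flat_exp_def eventually_at_filter)
    moreover have "((\<lambda>y. flat_exp q y / y) \<longlongrightarrow> 0) (at_left 0)"
      by (rule Lim_transform_eventually[of "\<lambda>_. 0"]) (auto simp: flat_exp_def eventually_at_filter)
    ultimately have "((\<lambda>y. flat_exp q y / y) \<longlongrightarrow> 0) (at 0)"
      by (simp add: filterlim_split_at_real)
    then show ?thesis using 2 by (simp add: has_field_derivative_iff flat_exp_def)
  qed
qed

lemma times_differentiable_flat_exp: "times_differentiable n (flat_exp q)"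
proof (induction n arbitrary: q)
  case (Suc n)
  then show ?case using flat_exp_has_derivative[of q] by (simp, intro exI conjI allI)
qed simp

text \<open>The scaling by \<open>Suc n\<close> steepens the flanks while the support stays
  \<open>[a, b]\<close>: the bumps stay below 1 and tend pointwise to the indicator of the open
  interval, as dominated convergence requires.\<close>

definition bump :: "real \<Rightarrow> real \<Rightarrow> nat \<Rightarrow> real \<Rightarrow> real" where
  "bump a b n x = flat_exp 1 (real (Suc n) * (x - a)) * flat_exp 1 (real (Suc n) * (b - x))"

lemma times_differentiable_bump: "times_differentiable k (bump a b n)"
proof -
  have "times_differentiable k (\<lambda>x. flat_exp 1 (real (Suc n) * x + (- real (Suc n) * a)) *
      flat_exp 1 (- real (Suc n) * x + real (Suc n) * b))"
    by (intro times_differentiable_mult times_differentiable_affine times_differentiable_flat_exp)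
  moreover have "bump a b n = (\<lambda>x. flat_exp 1 (real (Suc n) * x + (- real (Suc n) * a)) *
      flat_exp 1 (- real (Suc n) * x + real (Suc n) * b))"
    unfolding bump_def by (intro ext) (simp add: algebra_simps del: of_nat_Suc)
  ultimately show ?thesis by simp
qed

lemma bump_nonneg: "0 \<le> bump a b n x"
  and bump_le_1: "bump a b n x \<le> 1"
  and bump_pos: "a < x \<Longrightarrow> x < b \<Longrightarrow> 0 < bump a b n x"
  and bump_outside: "x \<le> a \<or> b \<le> x \<Longrightarrow> bump a b n x = 0"
  by (auto simp: bump_def flat_exp_def zero_less_mult_iff intro!: mult_le_one simp del: of_nat_Suc)

lemma bump_tendsto: "(\<lambda>n. bump a b n x) \<longlonglongrightarrow> indicator {a<..<b} x"
proof (cases "x \<in> {a<..<b}")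
  case True
  have *: "(\<lambda>n. flat_exp 1 (real (Suc n) * c)) \<longlonglongrightarrow> 1" if "c > 0" for c
  proof -
    have "(\<lambda>n. exp (- (inverse (real (Suc n)) * (1 / c)))) \<longlonglongrightarrow> exp (- (0 * (1 / c)))"
      by (intro tendsto_intros LIMSEQ_inverse_real_of_nat)
    then show ?thesis using that by (simp add: flat_exp_def inverse_eq_divide del: of_nat_Suc)
  qed
  have "(\<lambda>n. bump a b n x) \<longlonglongrightarrow> 1 * 1" unfolding bump_def using True by (intro tendsto_mult *) auto
  with True show ?thesis by simp
next
  case False
  then have "bump a b n x = 0" for n using bump_outside[of x a b n] by fastforce
  with False show ?thesis by simp
qed

lemma times_differentiable_continuous:
  "times_differentiable (Suc n) f \<Longrightarrow> continuous_on S f"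
  by (simp, metis continuous_at_imp_continuous_on DERIV_isCont)

text \<open>As \<open>f\<close> vanishes up to \<open>p\<close>, the lower limit can be moved to a
  point \<open>a\<close> left of both \<open>p\<close> and \<open>x\<close>; then \<open>x\<close>
  is interior and the fundamental theorem applies. For \<open>x < p\<close> the integral over the
  empty interval is zero, which is the right value.\<close>

lemma times_differentiable_integral:
  assumes "times_differentiable n f" and cont: "continuous_on UNIV f" and sup: "\<And>x. x \<le> p \<Longrightarrow> f x = 0"
  shows "times_differentiable n (\<lambda>x. integral {p..x} f)"
    and "((\<lambda>x. integral {p..x} f) has_real_derivative f x) (at x)"
proof -
  show D: "((\<lambda>x. integral {p..x} f) has_real_derivative f x) (at x)" for x
  proof -
    define a where "a = min p x - 1"
    have eq: "integral {p..y} f = integral {a..y} f" if "y \<in> {a<..}" for y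
    proof (cases "y \<le> p")
      case True
      have "integral {a..y} f = integral {a..y} (\<lambda>x. 0)" using True sup by (intro integral_cong) auto
      moreover have "integral {p..y} f = 0" using True sup by (cases "p = y") auto
      ultimately show ?thesis by simp
    next
      case False
      have "integral {a..p} f + integral {p..y} f = integral {a..y} f"
        using False that by (intro Henstock_Kurzweil_Integration.integral_combine integrable_continuous_real continuous_on_subset[OF cont])
          (auto simp: a_def)
      moreover have "integral {a..p} f = integral {a..p} (\<lambda>x. 0)" using sup by (intro integral_cong) auto
      ultimately show ?thesis by simp
    qed
    have "((\<lambda>x. integral {a..x} f) has_real_derivative f x) (at x within {a..x+1})"
      by (rule integral_has_real_derivative[OF continuous_on_subset[OF cont]]) (auto simp: a_def)
    then have "((\<lambda>x. integral {a..x} f) has_real_derivative f x) (at x)"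
      by (subst (asm) at_within_interior) (auto simp: a_def)
    then show ?thesis
      by (rule has_field_derivative_transform_within_open[of _ _ _ "{a<..}"]) (auto simp: eq a_def)
  qed
  show "times_differentiable n (\<lambda>x. integral {p..x} f)"
    by (rule times_differentiable_Suc_D) (use D assms(1) in auto)
qed

section \<open>Test functions as members of \<open>Cc_infty\<close>\<close>

lemma Cc_inftyE:
  assumes "f \<in> Cc_infty S"
  obtains K where "compact K" "K \<subseteq> S" "\<And>x. x \<notin> K \<Longrightarrow> f x = 0"
  using assms[unfolded Cc_infty_def mem_Collect_eq, THEN conjunct2] by (elim exE conjE) (rule that, auto)

lemma Cc_infty_differentiable: "f \<in> Cc_infty S \<Longrightarrow> (deriv_on S ^^ n) f differentiable_on S"
  by (simp only: Cc_infty_def mem_Collect_eq)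

lemma deriv_on_cong:
  assumes "\<And>y. y \<in> S \<Longrightarrow> f y = g y" "x \<in> S"
  shows "deriv_on S f x = deriv_on S g x"
proof -
  have "(f has_vector_derivative d) (at x within S) = (g has_vector_derivative d) (at x within S)" for d
    using has_vector_derivative_transform[OF assms(2), of g f d] has_vector_derivative_transform[OF assms(2), of f g d] assms(1)
    by metis
  then show ?thesis by (simp add: deriv_on_def vector_derivative_def)
qed

lemma deriv_on_pow_cong:
  assumes "\<And>y. y \<in> S \<Longrightarrow> f y = g y" "x \<in> S"
  shows "(deriv_on S ^^ n) f x = (deriv_on S ^^ n) g x"
  using assms(2)
proof (induction n arbitrary: x)
  case (Suc n)
  then show ?case using deriv_on_cong[of S "(deriv_on S ^^ n) f" "(deriv_on S ^^ n) g" x] by simp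
qed (simp add: assms(1))

lemma deriv_on_open:
  assumes "open S" "x \<in> S" "(f has_real_derivative d) (at x)"
  shows "deriv_on S f x = d"
  using assms at_within_open[of x S] vector_derivative_at[of f d x]
  by (simp add: deriv_on_def has_real_derivative_iff_has_vector_derivative)

lemma Cc_inftyI:
  assumes "\<And>n. times_differentiable n f" "open S" "compact K" "K \<subseteq> S" "\<And>x. x \<notin> K \<Longrightarrow> f x = 0"
  shows "f \<in> Cc_infty S"
proof -
  \<comment> \<open>Outside the closure of \<open>S\<close> the iterates of
    \<open>deriv_on S\<close> have no prescribed values, so the induction only claims agreement on
    \<open>S\<close> with a globally smooth function.\<close>
  have "\<exists>g. (\<forall>k. times_differentiable k g) \<and> (\<forall>x\<in>S. (deriv_on S ^^ n) f x = g x)" for n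
  proof (induction n)
    case (Suc n)
    then obtain g where g: "\<forall>k. times_differentiable k g" "\<forall>x\<in>S. (deriv_on S ^^ n) f x = g x" by auto
    have D: "\<forall>x. (g has_real_derivative deriv g x) (at x)"
    proof -
      obtain g' where "\<forall>x. (g has_real_derivative g' x) (at x)" using g(1)[THEN spec[of _ "Suc 0"]] by auto
      then show ?thesis using DERIV_imp_deriv by metis
    qed
    have "times_differentiable k (deriv g)" for k
    proof -
      obtain g' where "\<forall>x. (g has_real_derivative g' x) (at x)" "times_differentiable k g'"
        using g(1)[THEN spec[of _ "Suc k"]] by auto
      moreover have "deriv g = g'" using calculation(1) DERIV_imp_deriv by blast
      ultimately show ?thesis by simp
    qed
    moreover have "(deriv_on S ^^ Suc n) f x = deriv g x" if "x \<in> S" for x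
      using deriv_on_cong[of S "(deriv_on S ^^ n) f" g x] g(2) that deriv_on_open[OF assms(2) that] D by auto
    ultimately show ?case by blast
  qed (use assms in auto)
  moreover have "f differentiable_on S" if h: "\<forall>k. times_differentiable k g" "\<forall>x\<in>S. f x = g x" for f g
  proof -
    obtain g' where "\<forall>x. (g has_real_derivative g' x) (at x)" using h(1)[THEN spec[of _ "Suc 0"]] by auto
    then have "g differentiable_on S"
      unfolding differentiable_on_def by (metis differentiable_at_withinI real_differentiable_def)
    then show ?thesis using h(2)
      by (metis (no_types, lifting) differentiable_on_def differentiable_transform_within zero_less_one)
  qed
  ultimately have "(deriv_on S ^^ n) f differentiable_on S" for n by meson
  then show ?thesis unfolding Cc_infty_def using assms(3-5) by (intro CollectI conjI allI exI[of _ K]) auto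
qed

text \<open>The derivative exists at every real \<open>x\<close>: off \<open>S\<close> the function
  vanishes on the open complement of the compact set \<open>K\<close>.\<close>

lemma Cc_infty_open_DERIV:
  assumes "f \<in> Cc_infty S" "open S"
  shows "(f has_real_derivative deriv f x) (at x)"
proof -
  obtain K where K: "compact K" "K \<subseteq> S" "\<And>x. x \<notin> K \<Longrightarrow> f x = 0" using assms(1) by (rule Cc_inftyE) blast
  have "\<exists>d. (f has_real_derivative d) (at x)"
  proof (cases "x \<in> S")
    case True
    have "(deriv_on S ^^ 0) f differentiable_on S" using assms(1) by (rule Cc_infty_differentiable)
    then have "f differentiable (at x)" using True assms(2) at_within_open[of x S]
      by (auto simp: differentiable_on_def)
    then show ?thesis by (simp add: real_differentiable_def)
  next
    case False
    have "((\<lambda>x. 0) has_real_derivative 0) (at x)" by simp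
    then have "(f has_real_derivative 0) (at x)"
      by (rule has_field_derivative_transform_within_open[of _ _ _ "- K"]) (use False K compact_imp_closed in auto)
    then show ?thesis ..
  qed
  then show ?thesis using DERIV_imp_deriv by blast
qed

lemma deriv_Cc_infty:
  assumes "f \<in> Cc_infty S" "open S"
  shows "deriv f \<in> Cc_infty S"
proof -
  obtain K where K: "compact K" "K \<subseteq> S" "\<And>x. x \<notin> K \<Longrightarrow> f x = 0" using assms(1) by (rule Cc_inftyE) blast
  have z: "deriv f x = 0" if "x \<notin> K" for x
  proof -
    have "((\<lambda>x. 0) has_real_derivative 0) (at x)" by simp
    then have "(f has_real_derivative 0) (at x)"
      by (rule has_field_derivative_transform_within_open[of _ _ _ "- K"]) (use that K compact_imp_closed in auto)
    then show ?thesis by (rule DERIV_imp_deriv)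
  qed
  have "(deriv_on S ^^ n) (deriv f) x = (deriv_on S ^^ Suc n) f x" if "x \<in> S" for n x
    using deriv_on_pow_cong[of S "deriv f" "deriv_on S f" x n] that
      deriv_on_open[OF assms(2) _ Cc_infty_open_DERIV[OF assms]] by (simp add: funpow_swap1)
  moreover have "(deriv_on S ^^ Suc n) f differentiable_on S" for n
    using assms(1) by (rule Cc_infty_differentiable)
  ultimately have "(deriv_on S ^^ n) (deriv f) differentiable_on S" for n
    by (metis (no_types, lifting) differentiable_on_def differentiable_transform_within zero_less_one)
  then show ?thesis unfolding Cc_infty_def using K z by (intro CollectI conjI allI exI[of _ K]) auto
qed

lemma Cc_infty_open_continuous: "f \<in> Cc_infty S \<Longrightarrow> open S \<Longrightarrow> continuous_on T f"
  by (meson Cc_infty_open_DERIV DERIV_continuous_on has_field_derivative_at_within)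

section \<open>Calculus with Lebesgue integrals on the line\<close>

lemma (in pair_sigma_finite) integrable_pair_mult:
  fixes f :: "'a \<Rightarrow> real" and g :: "'b \<Rightarrow> real"
  assumes [intro]: "integrable M1 f" "integrable M2 g"
  shows "integrable (M1 \<Otimes>\<^sub>M M2) (\<lambda>(x, y). f x * g y)"
proof (rule Fubini_integrable)
  have [measurable]: "f \<in> borel_measurable M1" "g \<in> borel_measurable M2" using assms by auto
  show "(\<lambda>(x, y). f x * g y) \<in> borel_measurable (M1 \<Otimes>\<^sub>M M2)" by measurable
  have "(\<lambda>x. LINT y|M2. norm (f x * g y)) = (\<lambda>x. \<bar>f x\<bar> * (LINT y|M2. \<bar>g y\<bar>))"
    by (simp add: abs_mult)
  then show "integrable M1 (\<lambda>x. LINT y|M2. norm (case (x, y) of (x, y) \<Rightarrow> f x * g y))"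
    using assms by simp
qed (use assms in simp)

lemma DERIV_imp_continuous_on:
  fixes f :: "real \<Rightarrow> real"
  assumes "\<And>x. (f has_real_derivative f' x) (at x)"
  shows "continuous_on S f"
  using assms by (intro continuous_at_imp_continuous_on ballI DERIV_isCont)

lemma borel_measurable_DERIV:
  fixes f :: "real \<Rightarrow> real"
  assumes "\<And>x. (f has_real_derivative f' x) (at x)"
  shows "f \<in> borel_measurable borel"
  using assms by (intro borel_measurable_continuous_onI DERIV_imp_continuous_on)

lemma FTC_Icc_lborel:
  fixes f :: "real \<Rightarrow> real"
  assumes "a \<le> b" "\<And>x. (f has_real_derivative f' x) (at x)" "continuous_on UNIV f'"
  shows "(LINT x|lborel. indicator {a..b} x * f' x) = f b - f a"
  using integral_FTC_Icc[of a b f f'] assms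
  by (simp add: has_real_derivative_iff_has_vector_derivative has_vector_derivative_at_within continuous_on_subset)

lemma integrable_Icc_continuous:
  fixes f :: "real \<Rightarrow> real"
  shows "continuous_on {a..b} f \<Longrightarrow> integrable lborel (\<lambda>x. indicator {a..b} x * f x)"
  using borel_integrable_compact[of "{a..b}" f] by simp

lemma bounded_on_Icc:
  fixes f :: "real \<Rightarrow> real"
  assumes "continuous_on UNIV f"
  obtains B where "B \<ge> 0" "\<And>x. x \<in> {a..b} \<Longrightarrow> \<bar>f x\<bar> \<le> B"
proof -
  have "compact (f ` {a..b})" using assms by (intro compact_continuous_image continuous_on_subset[OF assms]) auto
  then obtain B where "\<forall>y\<in>f ` {a..b}. norm y \<le> B" using compact_imp_bounded bounded_iff by metis
  then have "\<And>x. x \<in> {a..b} \<Longrightarrow> \<bar>f x\<bar> \<le> max 0 B" by (simp add: le_max_iff_disj)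
  then show thesis by (intro that[of "max 0 B"]) auto
qed

text \<open>Since \<open>g\<close> is merely integrable, its primitive need not be differentiable
  everywhere. Instead Fubini is applied on the triangle \<open>p <= s <= x <= q\<close>, and the
  inner integral of \<open>f'\<close> is evaluated by the fundamental theorem.\<close>

lemma integral_by_parts_primitive:
  fixes f g :: "real \<Rightarrow> real"
  assumes pq: "p \<le> q" and D: "\<And>x. (f has_real_derivative f' x) (at x)" and cont: "continuous_on UNIV f'"
    and g: "integrable lborel g"
  shows "(LINT x|lborel. indicator {p..q} x * (f' x * (LINT s|lborel. indicator {p..x} s * g s))) =
     f q * (LINT s|lborel. indicator {p..q} s * g s) - (LINT x|lborel. indicator {p..q} x * (f x * g x))"
proof -
  have [measurable]: "f' \<in> borel_measurable borel" "g \<in> borel_measurable borel" "f \<in> borel_measurable borel"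
    using cont g D borel_measurable_DERIV by (auto intro: borel_measurable_continuous_onI)
  obtain B where B: "B \<ge> 0" "\<And>x. x \<in> {p..q} \<Longrightarrow> \<bar>f' x\<bar> \<le> B" by (rule bounded_on_Icc[OF cont]) blast
  obtain B' where B': "B' \<ge> 0" "\<And>x. x \<in> {p..q} \<Longrightarrow> \<bar>f x\<bar> \<le> B'"
    by (rule bounded_on_Icc[OF DERIV_imp_continuous_on[OF D], of p q]) blast
  define h where "h x s = (if p \<le> s \<and> s \<le> x \<and> x \<le> q then f' x * g s else 0)" for x s
  have [measurable]: "(\<lambda>(x, s). h x s) \<in> borel_measurable (lborel \<Otimes>\<^sub>M lborel)"
    unfolding h_def by measurable
  have "integrable (lborel \<Otimes>\<^sub>M lborel) (\<lambda>(x, s). (indicator {p..q} x * B) * g s)"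
    using g by (intro lborel_pair.integrable_pair_mult) (auto simp: integrable_indicator_iff emeasure_lborel_Icc_eq)
  then have int: "integrable (lborel \<Otimes>\<^sub>M lborel) (\<lambda>(x, s). h x s)"
    by (rule integrable_le)
      (use B in \<open>auto simp: h_def abs_mult indicator_def intro!: mult_right_mono AE_I2\<close>)
  have "(LINT x|lborel. indicator {p..q} x * (f' x * (LINT s|lborel. indicator {p..x} s * g s))) = (LINT x|lborel. LINT s|lborel. h x s)"
  proof (intro LINT_cong)
    fix x :: real
    have "indicator {p..q} x * (f' x * (LINT s|lborel. indicator {p..x} s * g s)) =
      (LINT s|lborel. indicator {p..q} x * (f' x * (indicator {p..x} s * g s)))" by simp
    also have "\<dots> = (LINT s|lborel. h x s)"
      by (intro LINT_cong) (auto simp: h_def indicator_def)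
    finally show "indicator {p..q} x * (f' x * (LINT s|lborel. indicator {p..x} s * g s)) = (LINT s|lborel. h x s)" .
  qed
  also have "\<dots> = (LINT s|lborel. LINT x|lborel. h x s)"
    using lborel_pair.Fubini_integral[OF int] by simp
  also have "\<dots> = (LINT s|lborel. f q * (indicator {p..q} s * g s) - indicator {p..q} s * (f s * g s))"
  proof (intro LINT_cong)
    fix s :: real
    have "(LINT x|lborel. h x s) = (LINT x|lborel. indicator {p..q} s * g s * (indicator {s..q} x * f' x))"
      by (intro LINT_cong) (auto simp: h_def indicator_def)
    also have "\<dots> = indicator {p..q} s * g s * (f q - f s)"
      using FTC_Icc_lborel[OF _ D cont, of s q] by (cases "s \<le> q") auto
    finally show "(LINT x|lborel. h x s) = f q * (indicator {p..q} s * g s) - indicator {p..q} s * (f s * g s)"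
      by (simp add: algebra_simps)
  qed
  also have "\<dots> = f q * (LINT s|lborel. indicator {p..q} s * g s) - (LINT x|lborel. indicator {p..q} x * (f x * g x))"
  proof -
    have "integrable lborel (\<lambda>s. indicator {p..q} s * g s)"
      by (rule integrable_le[OF g]) (auto simp: indicator_def)
    moreover have "integrable lborel (\<lambda>x. indicator {p..q} x * (f x * g x))"
      by (rule integrable_le[where f="\<lambda>x. B' * g x"])
        (use g in \<open>auto simp: indicator_def abs_mult intro!: mult_right_mono B' order_trans[OF B'(2)]\<close>)
    ultimately show ?thesis by (subst LINT_diff) auto
  qed
  finally show ?thesis .
qed

subsection \<open>Primitives and the lemma of du Bois-Reymond\<close>

text \<open>The signed indicator of the interval between 0 and \<open>x\<close>. It turns the
  primitive with base point 0 into one Lebesgue integral for either sign of \<open>x\<close>, with a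
  jointly measurable kernel; this gives measurability of \<open>prim (V t) x\<close> in
  \<open>(t, x)\<close>.\<close>

definition interval_sign :: "real \<Rightarrow> real \<Rightarrow> real" where
  "interval_sign x r = indicator {0<..x} r - indicator {x<..0} r"

lemma interval_sign_measurable [measurable]: "(\<lambda>(x, r). interval_sign x r) \<in> borel_measurable (borel \<Otimes>\<^sub>M borel)"
proof -
  have "(\<lambda>(x, r). interval_sign x r) = (\<lambda>(x, r). (if 0 < r \<and> r \<le> x then 1 else 0) - (if x < r \<and> r \<le> 0 then 1 else 0))"
    by (auto simp: interval_sign_def indicator_def fun_eq_iff)
  then show ?thesis by simp
qed

lemma abs_interval_sign_le: "\<bar>interval_sign x r\<bar> \<le> indicator {-\<bar>x\<bar>..\<bar>x\<bar>} r"
  by (auto simp: interval_sign_def indicator_def)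

definition prim :: "(real \<Rightarrow> real) \<Rightarrow> real \<Rightarrow> real" where
  "prim g x = (LINT r|lborel. interval_sign x r * g r)"

definition locally_integrable :: "(real \<Rightarrow> real) \<Rightarrow> bool" where
  "locally_integrable g \<longleftrightarrow> (\<forall>R. integrable lborel (\<lambda>r. indicator {-R..R} r * g r))"

lemma locally_integrable_measurable: "locally_integrable g \<Longrightarrow> g \<in> borel_measurable borel"
proof (rule borel_measurable_LIMSEQ_real)
  show "(\<lambda>n. indicator {-real n..real n} x * g x) \<longlonglongrightarrow> g x" for x
  proof (rule tendsto_eventually)
    show "\<forall>\<^sub>F n in sequentially. indicator {-real n..real n} x * g x = g x"
      using eventually_ge_at_top[of "nat \<lceil>\<bar>x\<bar>\<rceil>"] by eventually_elim (auto simp: indicator_def abs_le_iff nat_le_iff ceiling_le_iff)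
  qed
qed (metis borel_measurable_integrable locally_integrable_def measurable_lborel2)

lemma locally_integrable_Icc:
  assumes "locally_integrable g"
  shows "integrable lborel (\<lambda>r. indicator {p..q} r * g r)"
proof -
  have [measurable]: "g \<in> borel_measurable borel" using locally_integrable_measurable assms by auto
  show ?thesis
    by (rule integrable_le[OF assms[unfolded locally_integrable_def, rule_format, of "max \<bar>p\<bar> \<bar>q\<bar>"]])
     (auto simp: indicator_def)
qed

lemma prim_integrable:
  assumes "locally_integrable g"
  shows "integrable lborel (\<lambda>r. interval_sign x r * g r)"
proof -
  have [measurable]: "g \<in> borel_measurable borel" using locally_integrable_measurable assms by auto
  show ?thesis
    by (rule integrable_le[OF assms[unfolded locally_integrable_def, rule_format, of "\<bar>x\<bar>"]])
     (use abs_interval_sign_le[of x] in \<open>auto simp: abs_mult intro!: mult_right_mono\<close>)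
qed

lemma prim_diff:
  assumes "locally_integrable g" "x \<le> y"
  shows "prim g y - prim g x = (LINT r|lborel. indicator {x..y} r * g r)"
proof -
  have "prim g y - prim g x = (LINT r|lborel. interval_sign y r * g r - interval_sign x r * g r)"
    unfolding prim_def by (rule LINT_diff[symmetric]) (intro prim_integrable assms)+
  also have "\<dots> = (LINT r|lborel. indicator {x<..y} r * g r)"
    by (intro LINT_cong) (use assms in \<open>auto simp: interval_sign_def indicator_def\<close>)
  also have "\<dots> = (LINT r|lborel. indicator {x..y} r * g r)"
  proof (rule integral_cong_AE)
    have [measurable]: "g \<in> borel_measurable borel" using locally_integrable_measurable assms by auto
    show "(\<lambda>r. indicator {x<..y} r * g r) \<in> borel_measurable lborel" "(\<lambda>r. indicator {x..y} r * g r) \<in> borel_measurable lborel"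
      by measurable
    show "AE r in lborel. indicator {x<..y} r * g r = indicator {x..y} r * g r"
      using AE_lborel_singleton[of x] by eventually_elim (auto simp: indicator_def)
  qed
  finally show ?thesis .
qed

lemma prim_0 [simp]: "prim g 0 = 0"
  by (simp add: prim_def interval_sign_def)

lemma prim_continuous:
  assumes g: "locally_integrable g"
  shows "continuous_on UNIV (prim g)"
proof -
  have [measurable]: "g \<in> borel_measurable borel" using locally_integrable_measurable assms by auto
  have "isCont (prim g) x" for x
    unfolding isCont_def tendsto_at_iff_sequentially comp_def
  proof (intro allI impI)
    fix X assume "\<forall>i::nat. X i \<in> UNIV - {x}" and X: "X \<longlonglongrightarrow> x"
    then have ne: "X i \<noteq> x" for i by auto
    obtain R where R: "\<And>i. \<bar>X i\<bar> \<le> R" using convergent_imp_Bseq[OF convergentI[OF X]] by (auto simp: Bseq_def)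
    show "(\<lambda>i. prim g (X i)) \<longlonglongrightarrow> prim g x"
      unfolding prim_def
    proof (rule integral_dominated_convergence[where w="\<lambda>r. \<bar>indicator {-R..R} r * g r\<bar>"])
      show "integrable lborel (\<lambda>r. \<bar>indicator {-R..R} r * g r\<bar>)"
        using g unfolding locally_integrable_def by auto
      show "AE r in lborel. norm (interval_sign (X i) r * g r) \<le> \<bar>indicator {-R..R} r * g r\<bar>" for i
      proof (rule AE_I2)
        fix r
        have "\<bar>interval_sign (X i) r\<bar> \<le> indicator {-R..R} r"
          using R[of i] by (intro order_trans[OF abs_interval_sign_le]) (auto simp: indicator_def)
        then show "norm (interval_sign (X i) r * g r) \<le> \<bar>indicator {-R..R} r * g r\<bar>"
          by (simp add: abs_mult mult_right_mono)
      qed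
      show "AE r in lborel. (\<lambda>i. interval_sign (X i) r * g r) \<longlonglongrightarrow> interval_sign x r * g r"
        \<comment> \<open>The kernel converges at every \<open>r\<close> except possibly
          \<open>r = x\<close>.\<close>
        using AE_lborel_singleton[of x]
      proof eventually_elim
        case (elim r)
        have "\<forall>\<^sub>F i in sequentially. interval_sign (X i) r = interval_sign x r"
        proof (cases "r < x")
          case True
          from order_tendstoD(1)[OF X this] show ?thesis by eventually_elim (use True in \<open>auto simp: interval_sign_def indicator_def\<close>)
        next
          case False
          with elim have "x < r" by auto
          from order_tendstoD(2)[OF X this] show ?thesis by eventually_elim (use \<open>x < r\<close> in \<open>auto simp: interval_sign_def indicator_def\<close>)
        qed
        then show ?case by (intro tendsto_mult tendsto_const tendsto_eventually)
      qed
    qed auto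
  qed
  then show ?thesis by (simp add: continuous_at_imp_continuous_on)
qed

text \<open>The direct half of the lemma of du Bois-Reymond: every \<open>c + prim g\<close> has
  weak derivative \<open>g\<close>. The constant is invisible because \<open>f'\<close> has integral
  zero.\<close>

lemma integral_deriv_mult_prim:
  fixes f :: "real \<Rightarrow> real"
  assumes D: "\<And>x. (f has_real_derivative f' x) (at x)" and cont: "continuous_on UNIV f'"
    and g: "locally_integrable g" and sup: "\<And>x. x \<notin> {p<..<q} \<Longrightarrow> f x = 0" and "p \<le> q"
  shows "(LINT x|lborel. f' x * (c + prim g x)) = - (LINT x|lborel. f x * g x)"
proof -
  have z: "f' x = 0" if "x \<notin> {p..q}" for x
  proof -
    have "((\<lambda>x. 0) has_real_derivative 0) (at x)" by simp
    then have "(f has_real_derivative 0) (at x)"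
      by (rule has_field_derivative_transform_within_open[of _ _ _ "- {p..q}"]) (use that sup in auto)
    then show ?thesis using D DERIV_unique by blast
  qed
  have [measurable]: "f' \<in> borel_measurable borel"
    using cont D borel_measurable_DERIV by (auto intro: borel_measurable_continuous_onI)
  have cprim: "continuous_on UNIV (prim g)" by (rule prim_continuous[OF g])
  define G where "G x = (LINT s|lborel. indicator {p..x} s * (indicator {p..q} s * g s))" for x
  have G: "prim g x - prim g p = G x" if "x \<in> {p..q}" for x
    using prim_diff[OF g, of p x] that unfolding G_def
    by (auto intro!: Bochner_Integration.integral_cong split: split_indicator)
  have i1: "integrable lborel (\<lambda>x. indicator {p..q} x * (f' x * (c + prim g p)))"
    by (intro integrable_Icc_continuous continuous_on_mult continuous_on_const continuous_on_subset[OF cont]) auto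
  have "integrable lborel (\<lambda>x. indicator {p..q} x * (f' x * (prim g x - prim g p)))"
    by (intro integrable_Icc_continuous continuous_on_mult continuous_on_diff continuous_on_const
        continuous_on_subset[OF cont] continuous_on_subset[OF cprim]) auto
  then have i2: "integrable lborel (\<lambda>x. indicator {p..q} x * (f' x * G x))"
    by (rule Bochner_Integration.integrable_cong[THEN iffD1, rotated 2]) (auto simp: G indicator_def)
  have "(LINT x|lborel. f' x * (c + prim g x)) =
      (LINT x|lborel. indicator {p..q} x * (f' x * (c + prim g p)) + indicator {p..q} x * (f' x * G x))"
    by (intro LINT_cong) (auto simp: G[symmetric] z indicator_def algebra_simps)
  also have "\<dots> = (c + prim g p) * (LINT x|lborel. indicator {p..q} x * f' x) + (LINT x|lborel. indicator {p..q} x * (f' x * G x))"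
  proof -
    have "(LINT x|lborel. indicator {p..q} x * (f' x * (c + prim g p))) = (LINT x|lborel. (c + prim g p) * (indicator {p..q} x * f' x))"
      by (intro LINT_cong) simp
    then show ?thesis using i1 i2 by (subst LINT_add) simp_all
  qed
  also have "(LINT x|lborel. indicator {p..q} x * f' x) = 0"
    using FTC_Icc_lborel[OF \<open>p \<le> q\<close> D cont] sup[of p] sup[of q] by simp
  also have "(LINT x|lborel. indicator {p..q} x * (f' x * G x)) = - (LINT x|lborel. indicator {p..q} x * (f x * (indicator {p..q} x * g x)))"
    unfolding G_def using integral_by_parts_primitive[OF \<open>p \<le> q\<close> D cont locally_integrable_Icc[OF g, of p q]] sup[of q] by simp
  also have "(LINT x|lborel. indicator {p..q} x * (f x * (indicator {p..q} x * g x))) = (LINT x|lborel. f x * g x)"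
    by (intro LINT_cong) (use sup in \<open>auto simp: indicator_def\<close>)
  finally show ?thesis by simp
qed

text \<open>Half lines generate the Borel sets and are stable under intersection, so the integral of
  \<open>h\<close> vanishes over every Borel set. The bound \<open>b\<close> on the support yields
  total integral zero, which the step for complements requires.\<close>

lemma AE_zero_if_integral_atMost_zero:
  fixes h :: "real \<Rightarrow> real"
  assumes h: "integrable lborel h" and 0: "\<And>x. (LINT r|lborel. indicator {..x} r * h r) = 0"
    and sup: "\<And>r. r > b \<Longrightarrow> h r = 0"
  shows "AE r in lborel. h r = 0"
proof (rule density_unique_real[OF h, of "\<lambda>_. 0"])
  have [measurable]: "h \<in> borel_measurable borel" using h by auto
  have all: "(LINT r|lborel. h r) = 0"
    using 0[of b] sup by (subst (asm) Bochner_Integration.integral_cong[of lborel lborel _ h]) (auto simp: indicator_def)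
  have int: "set_integrable lborel A h" if "A \<in> sets borel" for A
    unfolding set_integrable_def using that by (intro integrable_mult_indicator h) auto
  have "(LINT x:A|lborel. h x) = 0" if "A \<in> sigma_sets UNIV (range atMost)" for A
  proof -
    have "Int_stable (range (atMost :: real \<Rightarrow> real set))" "range (atMost :: real \<Rightarrow> real set) \<subseteq> Pow UNIV"
      by (auto simp: Int_stable_def)
    from this that show ?thesis
  proof (induction rule: sigma_sets_induct_disjoint)
    case (basic A) then show ?case using 0 by (auto simp: set_lebesgue_integral_def)
  next
    case (compl A)
    then have [measurable]: "A \<in> sets borel" by (simp add: borel_eq_atMost)
    have "(LINT x:A \<union> (UNIV - A)|lborel. h x) = (LINT x:A|lborel. h x) + (LINT x:UNIV - A|lborel. h x)"
      by (intro set_integral_Un int) auto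
    with compl all show ?case by (simp add: set_lebesgue_integral_def)
  next
    case (union A)
    then have *: "A i \<in> sets borel" for i by (auto simp: borel_eq_atMost)
    have "(LINT x:\<Union>(range A)|lborel. h x) = (\<Sum>i. LINT x:A i|lborel. h x)"
      using union * by (intro lebesgue_integral_countable_add int) (auto simp: disjoint_family_on_def)
    then show ?case using union by simp
  qed (auto simp: set_lebesgue_integral_def)
  qed
  then show "(LINT x:A|lborel. h x) = (LINT x:A|lborel. 0)" if "A \<in> sets lborel" for A
    using that by (simp add: borel_eq_atMost)
qed simp

text \<open>The primitive of \<open>F\<close> cut off to \<open>[A, B]\<close> is continuous and
  constant on the rationals, hence constant. Rational end points are what the countable family of
  test functions below provides.\<close>

lemma AE_zero_if_integral_rational_zero:
  assumes F: "locally_integrable F"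
    and 0: "\<And>a b. a \<in> \<rat> \<Longrightarrow> b \<in> \<rat> \<Longrightarrow> A \<le> a \<Longrightarrow> a < b \<Longrightarrow> b \<le> B \<Longrightarrow> (LINT r|lborel. indicator {a..b} r * F r) = 0"
    and AB: "A \<in> \<rat>" "B \<in> \<rat>" "A < B"
  shows "AE r in lborel. r \<in> {A..B} \<longrightarrow> F r = 0"
proof -
  define h where "h r = indicator {A..B} r * F r" for r
  have h: "integrable lborel h" unfolding h_def by (rule locally_integrable_Icc[OF F])
  have [measurable]: "h \<in> borel_measurable borel" using h by auto
  have lh: "locally_integrable h"
    unfolding locally_integrable_def
    by (intro allI integrable_le[OF h]) (auto simp: indicator_def)
  have ab: "(LINT r|lborel. indicator {a..b} r * h r) = 0" if "a \<in> \<rat>" "b \<in> \<rat>" for a b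
  proof -
    have eq: "indicator {a..b} r * h r = indicator {max a A..min b B} r * F r" for r
      by (auto simp: h_def indicator_def)
    consider "max a A < min b B" | "max a A = min b B" | "max a A > min b B" by linarith
    then show ?thesis
    proof cases
      case 1
      then show ?thesis unfolding eq using that AB by (intro 0) (auto simp: max_def min_def)
    next
      case 2
      have "AE r in lborel. indicator {max a A..min b B} r * F r = 0"
        using AE_lborel_singleton[of "max a A"] by eventually_elim (use 2 in \<open>auto simp: indicator_def\<close>)
      then show ?thesis unfolding eq by (rule integral_eq_zero_AE)
    next
      case 3
      then have "{max a A..min b B} = {}" by auto
      then show ?thesis unfolding eq by simp
    qed
  qed
  have const: "prim h x = prim h A" for x
  proof (rule continuous_constant_on_closure[of \<rat> "prim h" "prim h A" x])
    show "prim h x = prim h A" if "x \<in> \<rat>" for x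
    proof (cases "A \<le> x")
      case True then show ?thesis using prim_diff[OF lh True] ab[OF AB(1) that] by simp
    next
      case False then have "x \<le> A" by simp
      then show ?thesis using prim_diff[OF lh \<open>x \<le> A\<close>] ab[OF that AB(1)] by simp
    qed
  qed (simp_all add: prim_continuous[OF lh] Rats_closure_real)
  have "AE r in lborel. h r = 0"
  proof (rule AE_zero_if_integral_atMost_zero[OF h, where b=B])
    fix x
    have "(LINT r|lborel. indicator {..x} r * h r) = (LINT r|lborel. indicator {min A x..x} r * h r)"
      by (intro LINT_cong) (simp add: h_def indicator_def)
    also have "\<dots> = 0" using prim_diff[OF lh, of "min A x" x] const[of x] const[of "min A x"] by simp
    finally show "(LINT r|lborel. indicator {..x} r * h r) = 0" .
  next
    fix r assume "B < r"
    then show "h r = 0" by (simp add: h_def)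
  qed
  then show ?thesis by eventually_elim (auto simp: h_def)
qed

definition bump_integral :: "real \<Rightarrow> real \<Rightarrow> nat \<Rightarrow> real" where
  "bump_integral a b n = (LINT x|lborel. bump a b n x)"

text \<open>Subtracting a multiple of one reference bump on \<open>(p, q)\<close> makes the integral
  zero, so that the primitive again has compact support and is a test function.\<close>

definition mean_zero_bump :: "real \<Rightarrow> real \<Rightarrow> real \<Rightarrow> real \<Rightarrow> nat \<Rightarrow> real \<Rightarrow> real" where
  "mean_zero_bump p q a b n x = bump a b n x - bump_integral a b n / bump_integral p q 0 * bump p q 0 x"

definition test_primitive :: "real \<Rightarrow> real \<Rightarrow> real \<Rightarrow> real \<Rightarrow> nat \<Rightarrow> real \<Rightarrow> real" where
  "test_primitive p q a b n x = integral {min a p..x} (mean_zero_bump p q a b n)"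

lemma bump_continuous: "continuous_on S (bump a b n)"
  by (rule times_differentiable_continuous[OF times_differentiable_bump])

lemma bump_measurable [measurable]: "bump a b n \<in> borel_measurable borel"
  by (intro borel_measurable_continuous_onI bump_continuous)

lemma indicator_mult_bump: "indicator {a..b} x * bump a b n x = bump a b n x"
  by (cases "x \<in> {a..b}") (auto simp: not_le bump_outside)

lemma bump_integrable: "integrable lborel (bump a b n)"
proof -
  have "integrable lborel (\<lambda>x. indicator {a..b} x * bump a b n x)"
    by (intro integrable_Icc_continuous bump_continuous)
  then show ?thesis by (simp add: indicator_mult_bump)
qed

lemma bump_integral_pos:
  assumes "a < b" shows "bump_integral a b n > 0"
proof -
  have "bump_integral a b n \<noteq> 0"
  proof
    assume "bump_integral a b n = 0"
    then have "AE x in lborel. bump a b n x = 0"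
      unfolding bump_integral_def by (subst (asm) integral_nonneg_eq_0_iff_AE) (auto simp: bump_integrable bump_nonneg)
    then have "AE x in lborel. x \<notin> {a<..<b}"
      by eventually_elim (use bump_pos[of a _ b n] in force)
    then have "emeasure lborel {a<..<b} = 0" by (subst (asm) AE_iff_null_sets[symmetric]) (auto simp: null_sets_def)
    then show False using assms by simp
  qed
  then show ?thesis using bump_nonneg by (auto simp: bump_integral_def less_le intro!: integral_nonneg_AE)
qed

lemma times_differentiable_mean_zero_bump: "times_differentiable k (mean_zero_bump p q a b n)"
proof -
  have "times_differentiable k (\<lambda>x. bump a b n x + - (bump_integral a b n / bump_integral p q 0) * bump p q 0 x)"
    by (intro times_differentiable_add times_differentiable_mult times_differentiable_const times_differentiable_bump)
  then show ?thesis by (simp add: mean_zero_bump_def[abs_def])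
qed

lemma mean_zero_bump_outside: "x \<notin> {min a p<..<max b q} \<Longrightarrow> mean_zero_bump p q a b n x = 0"
  by (subst mean_zero_bump_def, subst (1 2) bump_outside) auto

lemma indicator_mult_mean_zero_bump:
  "indicator {min a p..max b q} x * mean_zero_bump p q a b n x = mean_zero_bump p q a b n x"
proof (cases "x \<in> {min a p<..<max b q}")
  case False then show ?thesis by (subst (1 2) mean_zero_bump_outside) auto
qed simp

lemma mean_zero_bump_integrable: "integrable lborel (mean_zero_bump p q a b n)"
  unfolding mean_zero_bump_def[abs_def] by (intro Bochner_Integration.integrable_diff integrable_mult_right bump_integrable)

lemma test_primitive_DERIV:
  "(test_primitive p q a b n has_real_derivative mean_zero_bump p q a b n x) (at x)"
  unfolding test_primitive_def[abs_def]
  by (rule times_differentiable_integral(2)[where n=0])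
    (auto intro!: times_differentiable_continuous[OF times_differentiable_mean_zero_bump] mean_zero_bump_outside)

lemma test_primitive_outside:
  assumes "p < q" "x \<notin> {min a p<..<max b q}"
  shows "test_primitive p q a b n x = 0"
proof (cases "x \<le> min a p")
  case True
  then show ?thesis by (cases "x = min a p") (auto simp: test_primitive_def)
next
  case False
  with assms have x: "x \<ge> max b q" by auto
  have "(LINT y|lborel. indicator {min a p..x} y * mean_zero_bump p q a b n y) = integral {min a p..x} (mean_zero_bump p q a b n)"
    using set_borel_integral_eq_integral(2)[of "{min a p..x}" "mean_zero_bump p q a b n"]
      integrable_Icc_continuous[OF times_differentiable_continuous[OF times_differentiable_mean_zero_bump]]
    by (simp add: set_lebesgue_integral_def set_integrable_def)
  moreover have "(LINT y|lborel. indicator {min a p..x} y * mean_zero_bump p q a b n y) = (LINT y|lborel. mean_zero_bump p q a b n y)"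
  proof (intro LINT_cong)
    fix y
    show "indicator {min a p..x} y * mean_zero_bump p q a b n y = mean_zero_bump p q a b n y"
    proof (cases "y \<in> {min a p<..<max b q}")
      case False then show ?thesis by (subst (1 2) mean_zero_bump_outside) auto
    qed (use x in auto)
  qed
  moreover have "(LINT y|lborel. mean_zero_bump p q a b n y) = 0"
    unfolding mean_zero_bump_def[abs_def]
    using bump_integral_pos[OF \<open>p < q\<close>, of 0] bump_integrable by (simp add: bump_integral_def[symmetric])
  ultimately show ?thesis by (simp add: test_primitive_def)
qed

lemma test_primitive_Cc_infty:
  assumes "open I" "is_interval I" "p < q" "a < b" "{p..q} \<subseteq> I" "{a..b} \<subseteq> I"
  shows "test_primitive p q a b n \<in> Cc_infty I"
proof (rule Cc_inftyI[where K="{min a p..max b q}"])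
  show "times_differentiable k (test_primitive p q a b n)" for k
    unfolding test_primitive_def[abs_def]
    by (rule times_differentiable_integral(1))
      (auto intro!: times_differentiable_mean_zero_bump times_differentiable_continuous[OF times_differentiable_mean_zero_bump] mean_zero_bump_outside)
  show "{min a p..max b q} \<subseteq> I"
  proof
    fix x assume x: "x \<in> {min a p..max b q}"
    have "min a p \<in> I" "max b q \<in> I" using assms by (auto simp: min_def max_def)
    then show "x \<in> I" using mem_is_interval_1_I[OF \<open>is_interval I\<close>] x by (metis atLeastAtMost_iff)
  qed
qed (use assms test_primitive_outside in \<open>auto\<close>)

text \<open>Countably many test functions that suffice in \<open>du_Bois_Reymond\<close>.
  Countability allows identities that hold for almost every time, with a null set for each test
  function, to hold for all of them outside one null set.\<close>

definition test_family :: "real set \<Rightarrow> (real \<Rightarrow> real) set" where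
  "test_family I = (let (p, q) = (SOME (p, q). p < q \<and> {p..q} \<subseteq> I) in
     (\<lambda>(a, b, n). test_primitive p q a b n) ` ({(a, b, n). a \<in> \<rat> \<and> b \<in> \<rat> \<and> a < b \<and> {a..b} \<subseteq> I}))"

lemma countable_test_family: "countable (test_family I)"
proof -
  have "countable {(a::real, b::real, n::nat). a \<in> \<rat> \<and> b \<in> \<rat> \<and> a < b \<and> {a..b} \<subseteq> I}"
    by (rule countable_subset[of _ "\<rat> \<times> \<rat> \<times> UNIV"]) (auto intro!: countable_SIGMA countable_rat)
  then show ?thesis by (simp add: test_family_def split: prod.split)
qed

lemma open_contains_rational_Icc:
  assumes "open I" "x \<in> I"
  obtains a b :: real where "a \<in> \<rat>" "b \<in> \<rat>" "a < x" "x < b" "{a..b} \<subseteq> I"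
proof -
  obtain e where e: "e > 0" "ball x e \<subseteq> I" using assms open_contains_ball by blast
  obtain a where "a \<in> \<rat>" "x - e < a" "a < x" using Rats_dense_in_real[of "x - e" x] e by auto
  moreover obtain b where "b \<in> \<rat>" "x < b" "b < x + e" using Rats_dense_in_real[of x "x + e"] e by auto
  moreover have "{a..b} \<subseteq> ball x e" using calculation by (auto simp: dist_real_def)
  ultimately show thesis using that e by blast
qed

lemma test_family_obtain:
  assumes "open I" "I \<noteq> {}"
  obtains p q where "p < q" "{p..q} \<subseteq> I"
    "test_family I = (\<lambda>(a, b, n). test_primitive p q a b n) ` ({(a, b, n). a \<in> \<rat> \<and> b \<in> \<rat> \<and> a < b \<and> {a..b} \<subseteq> I})"
proof -
  obtain x where "x \<in> I" using assms by auto
  then have "\<exists>pq. fst pq < snd pq \<and> {fst pq..snd pq} \<subseteq> I"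
    using open_contains_rational_Icc[OF assms(1)] by (metis fst_conv less_trans snd_conv)
  then have "(case (SOME (p, q). p < q \<and> {p..q} \<subseteq> I) of (p, q) \<Rightarrow> p < q \<and> {p..q} \<subseteq> I)"
    by (intro someI_ex[of "\<lambda>(p, q). p < q \<and> {p..q} \<subseteq> I"]) auto
  then show thesis using that unfolding test_family_def by (auto split: prod.splits simp: Let_def)
qed

lemma test_family_subset: "open I \<Longrightarrow> is_interval I \<Longrightarrow> test_family I \<subseteq> Cc_infty I"
proof (cases "I = {}")
  case False
  assume I: "open I" "is_interval I"
  obtain p q where pq: "p < q" "{p..q} \<subseteq> I" and
    T: "test_family I = (\<lambda>(a, b, n). test_primitive p q a b n) ` ({(a, b, n). a \<in> \<rat> \<and> b \<in> \<rat> \<and> a < b \<and> {a..b} \<subseteq> I})"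
    by (rule test_family_obtain[OF I(1) False])
  show ?thesis unfolding T using pq I by (auto intro: test_primitive_Cc_infty)
next
  case True then show ?thesis by (auto simp: test_family_def)
qed

text \<open>Testing with the primitive of a mean zero bump shows that \<open>F = f - prim g\<close>
  has the same weighted mean \<open>c\<close> against every rational bump in \<open>I\<close> as
  against the reference bump. Sharpening the bumps to indicators leaves \<open>F - c\<close> with
  integral zero over all rational intervals in \<open>I\<close>.\<close>

lemma du_Bois_Reymond:
  assumes I: "open I" "is_interval I" and ne: "I \<noteq> {}"
    and f: "locally_integrable f" and g: "locally_integrable g"
    and test: "\<And>u. u \<in> test_family I \<Longrightarrow> (LINT x|lborel. deriv u x * f x) = - (LINT x|lborel. u x * g x)"
  obtains c where "AE x in lborel. x \<in> I \<longrightarrow> f x = c + prim g x"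
proof -
  obtain p q where pq: "p < q" "{p..q} \<subseteq> I" and
    T: "test_family I = (\<lambda>(a, b, n). test_primitive p q a b n) ` ({(a, b, n). a \<in> \<rat> \<and> b \<in> \<rat> \<and> a < b \<and> {a..b} \<subseteq> I})"
    by (rule test_family_obtain[OF I(1) ne])
  define F where "F x = f x - prim g x" for x
  have [measurable]: "f \<in> borel_measurable borel" "prim g \<in> borel_measurable borel"
    using locally_integrable_measurable f prim_continuous[OF g] by (auto intro: borel_measurable_continuous_onI)
  have Fi: "integrable lborel (\<lambda>r. indicator {a..b} r * F r)" for a b
    unfolding F_def right_diff_distrib
    by (intro Bochner_Integration.integrable_diff locally_integrable_Icc f integrable_Icc_continuous continuous_on_subset[OF prim_continuous[OF g]]) auto
  have [measurable]: "F \<in> borel_measurable borel" unfolding F_def by measurable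
  have bF: "integrable lborel (\<lambda>r. bump a b n r * F r)" for a b n
    by (rule integrable_le[OF Fi[of a b]])
      (use bump_outside[of _ a b n] bump_nonneg[of a b n] bump_le_1[of a b n] in \<open>auto simp: indicator_def abs_mult intro!: mult_left_le_one_le AE_I2\<close>)
  define c where "c = (LINT x|lborel. bump p q 0 x * F x) / bump_integral p q 0"
  have eq: "(LINT x|lborel. bump a b n x * F x) = bump_integral a b n * c"
    if "a \<in> \<rat>" "b \<in> \<rat>" "a < b" "{a..b} \<subseteq> I" for a b n
  proof -
    let ?u = "test_primitive p q a b n"
    have D: "deriv ?u = mean_zero_bump p q a b n" using test_primitive_DERIV DERIV_imp_deriv by blast
    have i1: "integrable lborel (\<lambda>x. deriv ?u x * F x)"
      unfolding D mean_zero_bump_def left_diff_distrib mult.assoc by (intro Bochner_Integration.integrable_diff bF integrable_mult_right)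
    have cp: "continuous_on UNIV (\<lambda>x. deriv ?u x * prim g x)"
      unfolding D by (intro continuous_on_mult prim_continuous g times_differentiable_continuous[OF times_differentiable_mean_zero_bump])
    have "integrable lborel (\<lambda>x. indicator {min a p..max b q} x * (deriv ?u x * prim g x))"
      by (intro integrable_Icc_continuous continuous_on_subset[OF cp]) auto
    then have i2: "integrable lborel (\<lambda>x. deriv ?u x * prim g x)"
      unfolding D mult.assoc[symmetric] indicator_mult_mean_zero_bump .
    have "(LINT x|lborel. deriv ?u x * F x) + (LINT x|lborel. deriv ?u x * prim g x) = (LINT x|lborel. deriv ?u x * f x)"
      using i1 i2 by (subst LINT_add[symmetric]) (auto simp: F_def algebra_simps)
    also have "\<dots> = - (LINT x|lborel. ?u x * g x)"
      by (rule test, unfold T, rule image_eqI[of _ _ "(a, b, n)"]) (use that in simp_all)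
    also have "\<dots> = (LINT x|lborel. deriv ?u x * prim g x)"
      using integral_deriv_mult_prim[of ?u "deriv ?u" g "min a p" "max b q" 0] test_primitive_outside[OF pq(1), of _ a b n] g
        test_primitive_DERIV times_differentiable_continuous[OF times_differentiable_mean_zero_bump] that pq
      by (simp add: D)
    finally have "(LINT x|lborel. deriv ?u x * F x) = 0" by simp
    moreover have "(LINT x|lborel. deriv ?u x * F x) = (LINT x|lborel. bump a b n x * F x)
        - bump_integral a b n / bump_integral p q 0 * (LINT x|lborel. bump p q 0 x * F x)"
      unfolding D mean_zero_bump_def left_diff_distrib mult.assoc
      by (subst LINT_diff) (use bF in auto)
    ultimately show ?thesis by (simp add: c_def)
  qed
  have Fc: "locally_integrable (\<lambda>x. F x - c)"
    unfolding locally_integrable_def right_diff_distrib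
    by (intro allI Bochner_Integration.integrable_diff Fi integrable_Icc_continuous continuous_on_const)
  have zero: "(LINT r|lborel. indicator {a..b} r * (F r - c)) = 0"
    if ab: "a \<in> \<rat>" "b \<in> \<rat>" "a < b" "{a..b} \<subseteq> I" for a b
  proof -
    have "(\<lambda>n. LINT r|lborel. bump a b n r * (F r - c)) \<longlonglongrightarrow> (LINT r|lborel. indicator {a<..<b} r * (F r - c))"
    proof (rule integral_dominated_convergence[where w="\<lambda>r. \<bar>indicator {a..b} r * (F r - c)\<bar>"])
      show "integrable lborel (\<lambda>r. \<bar>indicator {a..b} r * (F r - c)\<bar>)"
        by (intro integrable_abs locally_integrable_Icc Fc)
      show "AE r in lborel. norm (bump a b n r * (F r - c)) \<le> \<bar>indicator {a..b} r * (F r - c)\<bar>" for n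
        using bump_outside[of _ a b n] bump_nonneg[of a b n] bump_le_1[of a b n]
        by (auto simp: indicator_def abs_mult intro!: mult_left_le_one_le AE_I2)
      show "AE r in lborel. (\<lambda>n. bump a b n r * (F r - c)) \<longlonglongrightarrow> indicator {a<..<b} r * (F r - c)"
        by (intro AE_I2 tendsto_mult tendsto_const bump_tendsto)
    qed auto
    moreover have "(LINT r|lborel. bump a b n r * (F r - c)) = 0" for n
    proof -
      have "(LINT r|lborel. bump a b n r * (F r - c)) = (LINT r|lborel. bump a b n r * F r) - (LINT r|lborel. bump a b n r * c)"
        unfolding right_diff_distrib by (intro LINT_diff bF) (simp add: bump_integrable)
      then show ?thesis using eq[OF ab, of n] by (simp add: bump_integral_def)
    qed
    ultimately have "(LINT r|lborel. indicator {a<..<b} r * (F r - c)) = 0"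
      by (simp add: LIMSEQ_const_iff)
    moreover have "(LINT r|lborel. indicator {a<..<b} r * (F r - c)) = (LINT r|lborel. indicator {a..b} r * (F r - c))"
    proof (rule integral_cong_AE)
      show "AE r in lborel. indicator {a<..<b} r * (F r - c) = indicator {a..b} r * (F r - c)"
        using AE_lborel_singleton[of a] AE_lborel_singleton[of b] by eventually_elim (auto simp: indicator_def)
    qed auto
    ultimately show ?thesis by simp
  qed
  have "AE r in lborel. \<forall>(a, b) \<in> {(a, b). a \<in> \<rat> \<and> b \<in> \<rat> \<and> a < b \<and> {a..b} \<subseteq> I}. r \<in> {a..b} \<longrightarrow> F r - c = 0"
  proof (subst AE_ball_countable)
    show "countable {(a, b). a \<in> \<rat> \<and> b \<in> \<rat> \<and> a < b \<and> {a..b} \<subseteq> I}"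
      by (rule countable_subset[of _ "\<rat> \<times> \<rat>"]) (auto intro!: countable_SIGMA countable_rat)
    show "\<forall>y\<in>{(a, b). a \<in> \<rat> \<and> b \<in> \<rat> \<and> a < b \<and> {a..b} \<subseteq> I}. AE x in lborel. case y of (a, b) \<Rightarrow> x \<in> {a..b} \<longrightarrow> F x - c = 0"
    proof (clarify)
      fix a b assume ab: "a \<in> \<rat>" "b \<in> \<rat>" "a < b" "{a..b} \<subseteq> I"
      show "AE x in lborel. x \<in> {a..b} \<longrightarrow> F x - c = 0"
      proof (rule AE_zero_if_integral_rational_zero[OF Fc])
        fix a' b' assume "a' \<in> \<rat>" "b' \<in> \<rat>" "a \<le> a'" "a' < b'" "b' \<le> b"
        with ab show "(LINT r|lborel. indicator {a'..b'} r * (F r - c)) = 0" by (intro zero) auto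
      qed (use ab in auto)
    qed
  qed
  then have "AE x in lborel. x \<in> I \<longrightarrow> f x = c + prim g x"
  proof eventually_elim
    case (elim x)
    show ?case
    proof
      assume "x \<in> I"
      then obtain a b where "a \<in> \<rat>" "b \<in> \<rat>" "a < x" "x < b" "{a..b} \<subseteq> I" by (rule open_contains_rational_Icc[OF I(1)])
      then have "F x - c = 0" using elim[rule_format, of "(a, b)"] by auto
      then show "f x = c + prim g x" by (simp add: F_def)
    qed
  qed
  then show thesis by (rule that)
qed

subsection \<open>Square integrable functions\<close>

text \<open>A version of \<open>square_integrable\<close> with values in a Euclidean space: the
  Riesz theorem is applied below to pairs, one component for \<open>W\<close> and one for its space
  derivative.\<close>

definition sqint :: "'a measure \<Rightarrow> ('a \<Rightarrow> 'b::euclidean_space) \<Rightarrow> bool" where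
  "sqint M f \<longleftrightarrow> f \<in> borel_measurable M \<and> integrable M (\<lambda>x. (norm (f x))^2)"

abbreviation sqint_strip :: "field \<Rightarrow> bool" where
  "sqint_strip F \<equiv> sqint strip (\<lambda>(t, x). F t x)"

lemma sqint_measurable: "sqint M f \<Longrightarrow> f \<in> borel_measurable M"
  by (simp add: sqint_def)

lemma sqint_integrable: "sqint M f \<Longrightarrow> integrable M (\<lambda>x. (norm (f x))^2)"
  by (simp add: sqint_def)

lemma sqint_eq_square_integrable: "sqint M f \<longleftrightarrow> square_integrable M f" for f :: "'a \<Rightarrow> real"
  by (simp add: sqint_def square_integrable_def)

lemma abs_inner_le_squares: "\<bar>x \<bullet> y\<bar> \<le> (norm x)^2 + (norm y)^2"
proof -
  have "\<bar>x \<bullet> y\<bar> \<le> norm x * norm y" by (rule Cauchy_Schwarz_ineq2)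
  also have "2 * (norm x * norm y) \<le> (norm x)^2 + (norm y)^2" using sum_squares_bound[of "norm x" "norm y"] by simp
  finally show ?thesis by (smt (verit) mult_nonneg_nonneg norm_ge_zero)
qed

lemma integrable_inner_sqint:
  assumes "sqint M f" "sqint M g"
  shows "integrable M (\<lambda>x. f x \<bullet> g x)"
proof (rule integrable_le)
  have [measurable]: "f \<in> borel_measurable M" "g \<in> borel_measurable M" using assms by (auto simp: sqint_def)
  show "(\<lambda>x. f x \<bullet> g x) \<in> borel_measurable M" by measurable
  show "integrable M (\<lambda>x. (norm (f x))^2 + (norm (g x))^2)" using assms by (auto simp: sqint_def)
  show "AE x in M. norm (f x \<bullet> g x) \<le> norm ((norm (f x))^2 + (norm (g x))^2)"
    using abs_inner_le_squares by (auto intro!: AE_I2)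
qed

lemma sqint_scaleR: "sqint M f \<Longrightarrow> sqint M (\<lambda>x. c *\<^sub>R f x)"
  by (auto simp: sqint_def power_mult_distrib)

lemma norm_add_squared: "(norm (x + y))^2 = (norm x)^2 + 2 * (x \<bullet> y) + (norm y)^2"
  by (simp add: power2_norm_eq_inner inner_add_left inner_add_right inner_commute)

lemma sqint_add:
  assumes f: "sqint M f" and g: "sqint M g"
  shows "sqint M (\<lambda>x. f x + g x)"
  unfolding sqint_def norm_add_squared
  using assms integrable_inner_sqint[OF f g] by (auto simp: sqint_def)

lemma sqint_diff: "sqint M f \<Longrightarrow> sqint M g \<Longrightarrow> sqint M (\<lambda>x. f x - g x)"
  using sqint_add[of M f "\<lambda>x. (-1) *\<^sub>R g x"] sqint_scaleR[of M g "-1"] by simp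

lemma integral_norm_add_scaleR_squared:
  assumes f: "sqint M f" and g: "sqint M g"
  shows "(LINT x|M. (norm (f x + s *\<^sub>R g x))^2) =
    (LINT x|M. (norm (f x))^2) + 2 * s * (LINT x|M. f x \<bullet> g x) + s^2 * (LINT x|M. (norm (g x))^2)"
  unfolding norm_add_squared using integrable_inner_sqint[OF f g] sqint_integrable[OF f] sqint_integrable[OF g]
  by (simp add: power_mult_distrib mult.assoc)

lemma quadratic_nonneg_imp:
  fixes a b c :: real
  assumes "\<And>s. 0 \<le> a + 2 * s * b + s^2 * c" "0 \<le> a" "0 \<le> c"
  shows "b^2 \<le> a * c"
proof (cases "c = 0")
  case True
  have "b = 0"
  proof (rule ccontr)
    assume "b \<noteq> 0"
    \<comment> \<open>As \<open>c = 0\<close> here, this \<open>s\<close> makes the expression equal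
      to -1.\<close>
    then show False using assms(1)[of "- (a + 1) / (2 * b)"] True by (simp add: field_simps)
  qed
  with True show ?thesis by simp
next
  case False
  then show ?thesis using assms(1)[of "- b / c"] assms(3) by (simp add: field_simps power2_eq_square split: if_splits)
qed

lemma integral_Cauchy_Schwarz:
  assumes f: "sqint M f" and g: "sqint M g"
  shows "(LINT x|M. f x \<bullet> g x)^2 \<le> (LINT x|M. (norm (f x))^2) * (LINT x|M. (norm (g x))^2)"
proof (rule quadratic_nonneg_imp)
  fix s
  show "0 \<le> (LINT x|M. (norm (f x))^2) + 2 * s * (LINT x|M. f x \<bullet> g x) + s^2 * (LINT x|M. (norm (g x))^2)"
    unfolding integral_norm_add_scaleR_squared[OF f g, symmetric] by simp
qed simp_all

lemma sqint_norm: "sqint M f \<Longrightarrow> sqint M (\<lambda>x. norm (f x))"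
  by (auto simp: sqint_def)

text \<open>The positive weight \<open>w\<close> in L2 turns an L2 Cauchy sequence into an L1 Cauchy
  sequence by the Cauchy-Schwarz inequality. An almost everywhere convergent subsequence then
  exists, and division by \<open>w\<close> gives the pointwise limit. Fatou's lemma upgrades
  pointwise to L2 convergence.\<close>

lemma L2_complete:
  fixes f :: "nat \<Rightarrow> 'a \<Rightarrow> 'b::euclidean_space" and w :: "'a \<Rightarrow> real"
  assumes w: "sqint M w" "\<And>x. x \<in> space M \<Longrightarrow> 0 < w x"
    and f: "\<And>n. sqint M (f n)"
    and Cauchy: "\<And>e. e > 0 \<Longrightarrow> \<exists>N. \<forall>i\<ge>N. \<forall>j\<ge>N. (LINT x|M. (norm (f i x - f j x))^2) < e"
  obtains u r where "strict_mono r" "sqint M u" "(\<lambda>n. LINT x|M. (norm (f (r n) x - u x))^2) \<longlonglongrightarrow> 0"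
proof -
  have [measurable]: "w \<in> borel_measurable M" "f n \<in> borel_measurable M" for n using w f by (auto simp: sqint_def)
  have wf: "integrable M (\<lambda>x. w x *\<^sub>R f n x)" for n
  proof (rule integrable_le[OF integrable_inner_sqint[OF w(1) sqint_norm[OF f[of n]]]])
    show "AE x in M. norm (w x *\<^sub>R f n x) \<le> norm (w x \<bullet> norm (f n x))"
      by (intro AE_I2) (simp add: abs_mult)
  qed measurable
  let ?W = "LINT x|M. (norm (w x))^2"
  have "\<exists>N. \<forall>i\<ge>N. \<forall>j\<ge>N. (LINT x|M. norm (w x *\<^sub>R f i x - w x *\<^sub>R f j x)) < e" if "e > 0" for e
  proof -
    have pos: "0 < e^2 / (?W + 1)" using that by (simp add: add_nonneg_pos)
    obtain N where N: "\<And>i j. i \<ge> N \<Longrightarrow> j \<ge> N \<Longrightarrow> (LINT x|M. (norm (f i x - f j x))^2) < e^2 / (?W + 1)"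
      using Cauchy[OF pos] by blast
    have "(LINT x|M. norm (w x *\<^sub>R f i x - w x *\<^sub>R f j x)) < e" if "i \<ge> N" "j \<ge> N" for i j
    proof -
      have "(LINT x|M. norm (w x *\<^sub>R f i x - w x *\<^sub>R f j x)) = (LINT x|M. w x \<bullet> norm (f i x - f j x))"
        using w(2) by (intro LINT_cong) (simp add: scaleR_diff_right[symmetric] less_imp_le)
      also have "\<dots>^2 \<le> ?W * (LINT x|M. (norm (norm (f i x - f j x)))^2)"
        by (rule integral_Cauchy_Schwarz[OF w(1) sqint_norm[OF sqint_diff[OF f f]]])
      also have "\<dots> \<le> (?W + 1) * (LINT x|M. (norm (f i x - f j x))^2)" by (simp add: mult_right_mono)
      also have "\<dots> < (?W + 1) * (e^2 / (?W + 1))"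
        using N[OF that] by (intro mult_strict_left_mono) (auto simp: add_nonneg_pos)
      also have "\<dots> = e^2"
      proof -
        have "?W + 1 > 0" by (intro add_nonneg_pos) auto
        then show ?thesis by simp
      qed
      finally show ?thesis using \<open>e > 0\<close> by (simp add: power2_less_imp_less)
    qed
    then show ?thesis by blast
  qed
  then obtain r where r: "strict_mono r" and AEC: "AE x in M. Cauchy (\<lambda>i. w x *\<^sub>R f (r i) x)"
    by (rule cauchy_L1_AE_cauchy_subseq[OF wf]) blast
  define u where "u x = lim (\<lambda>i. f (r i) x)" for x
  have [measurable]: "u \<in> borel_measurable M" unfolding u_def by measurable
  have lim: "AE x in M. (\<lambda>i. f (r i) x) \<longlonglongrightarrow> u x"
    using AEC AE_space
  proof eventually_elim
    case (elim x)
    then obtain l where "(\<lambda>i. w x *\<^sub>R f (r i) x) \<longlonglongrightarrow> l" using Cauchy_convergent convergentD by blast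
    then have "(\<lambda>i. inverse (w x) *\<^sub>R (w x *\<^sub>R f (r i) x)) \<longlonglongrightarrow> inverse (w x) *\<^sub>R l" by (intro tendsto_intros)
    then have "(\<lambda>i. f (r i) x) \<longlonglongrightarrow> inverse (w x) *\<^sub>R l" using w(2)[OF elim(2)] by simp
    then show ?case unfolding u_def by (metis convergentI convergent_LIMSEQ_iff)
  qed
  have fat: "\<exists>N. \<forall>n\<ge>N. (\<integral>\<^sup>+x. ennreal ((norm (f (r n) x - u x))^2) \<partial>M) \<le> ennreal e" if e: "e > 0" for e
  proof -
    obtain N where N: "\<And>i j. i \<ge> N \<Longrightarrow> j \<ge> N \<Longrightarrow> (LINT x|M. (norm (f i x - f j x))^2) < e"
      using Cauchy[OF e] by blast
    have "(\<integral>\<^sup>+x. ennreal ((norm (f (r n) x - u x))^2) \<partial>M) \<le> ennreal e" if "n \<ge> N" for n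
    proof -
      have "(\<integral>\<^sup>+x. ennreal ((norm (f (r n) x - u x))^2) \<partial>M) =
         (\<integral>\<^sup>+x. liminf (\<lambda>m. ennreal ((norm (f (r n) x - f (r m) x))^2)) \<partial>M)"
      proof (rule nn_integral_cong_AE, use lim in eventually_elim)
        case (elim x)
        have "(\<lambda>m. ennreal ((norm (f (r n) x - f (r m) x))^2)) \<longlonglongrightarrow> ennreal ((norm (f (r n) x - u x))^2)"
          by (intro tendsto_ennrealI tendsto_intros elim)
        then show ?case using lim_imp_Liminf[OF sequentially_bot] by metis
      qed
      also have "\<dots> \<le> liminf (\<lambda>m. \<integral>\<^sup>+x. ennreal ((norm (f (r n) x - f (r m) x))^2) \<partial>M)"
        by (rule nn_integral_liminf) measurable
      also have "\<dots> \<le> ennreal e"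
      proof (rule Liminf_le)
        show "\<forall>\<^sub>F m in sequentially. (\<integral>\<^sup>+x. ennreal ((norm (f (r n) x - f (r m) x))^2) \<partial>M) \<le> ennreal e"
          using eventually_ge_at_top[of N]
        proof eventually_elim
          case (elim m)
          have "r n \<ge> N" "r m \<ge> N" using that elim seq_suble[OF r, of n] seq_suble[OF r, of m] by linarith+
          then have "(LINT x|M. (norm (f (r n) x - f (r m) x))^2) < e" by (rule N)
          then show ?case
            by (subst nn_integral_eq_integral) (auto simp: sqint_integrable[OF sqint_diff[OF f f]] intro!: ennreal_leI)
        qed
      qed simp
      finally show ?thesis .
    qed
    then show ?thesis by blast
  qed
  have sq: "sqint M (\<lambda>x. f (r n) x - u x) \<and> (LINT x|M. (norm (f (r n) x - u x))^2) \<le> e"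
    if "e > 0" "(\<integral>\<^sup>+x. ennreal ((norm (f (r n) x - u x))^2) \<partial>M) \<le> ennreal e" for n e
  proof -
    have "integrable M (\<lambda>x. (norm (f (r n) x - u x))^2)"
      by (rule integrableI_bounded) (use that in \<open>auto intro: le_less_trans\<close>)
    moreover from this have "ennreal (LINT x|M. (norm (f (r n) x - u x))^2) \<le> ennreal e"
      using that by (subst (asm) nn_integral_eq_integral) auto
    ultimately show ?thesis using that by (auto simp: sqint_def ennreal_le_iff)
  qed
  have "sqint M u"
  proof -
    obtain N where "(\<integral>\<^sup>+x. ennreal ((norm (f (r N) x - u x))^2) \<partial>M) \<le> ennreal 1" using fat[of 1] by auto
    then have "sqint M (\<lambda>x. f (r N) x - u x)" using sq[of 1 N] by auto
    from sqint_diff[OF f[of "r N"] this] show ?thesis by simp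
  qed
  moreover have "(\<lambda>n. LINT x|M. (norm (f (r n) x - u x))^2) \<longlonglongrightarrow> 0"
  proof (rule LIMSEQ_I)
    fix e :: real assume "e > 0"
    then obtain N where "\<forall>n\<ge>N. (\<integral>\<^sup>+x. ennreal ((norm (f (r n) x - u x))^2) \<partial>M) \<le> ennreal (e / 2)" using fat[of "e / 2"] by auto
    then have "\<forall>n\<ge>N. (LINT x|M. (norm (f (r n) x - u x))^2) \<le> e / 2" using sq[of "e / 2"] \<open>e > 0\<close> by auto
    then show "\<exists>N. \<forall>n\<ge>N. norm ((LINT x|M. (norm (f (r n) x - u x))^2) - 0) < e" using \<open>e > 0\<close> by force
  qed
  ultimately show thesis using that r by blast
qed

lemma parallelogram_arith:
  fixes m :: real
  assumes "m \<le> S / 4 - (k + l)" "S = a + 2 * c + b" "a - 2 * k < m + d" "b - 2 * l < m + e"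
  shows "a - 2 * c + b \<le> 2 * (d + e)"
  using assms by argo

text \<open>\<open>\<A>\<close> is the graph of a linear functional. Keeping it as a relation avoids
  a separate proof that \<open>l\<close> depends on \<open>X\<close> only; the bound takes care of
  this. The representing \<open>u\<close> is the limit of a minimising sequence for the squared norm
  minus \<open>2 * l\<close>, which converges by the parallelogram identity.\<close>

lemma Riesz_L2:
  fixes \<A> :: "(('a \<Rightarrow> 'b::euclidean_space) \<times> real) set" and w :: "'a \<Rightarrow> real"
  assumes w: "sqint M w" "\<And>x. x \<in> space M \<Longrightarrow> 0 < w x"
    and sq: "\<And>X l. (X, l) \<in> \<A> \<Longrightarrow> sqint M X"
    and comb: "\<And>X l Y k c. (X, l) \<in> \<A> \<Longrightarrow> (Y, k) \<in> \<A> \<Longrightarrow> ((\<lambda>x. X x + c *\<^sub>R Y x), l + c * k) \<in> \<A>"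
    and ne: "\<A> \<noteq> {}"
    and bound: "\<And>X l. (X, l) \<in> \<A> \<Longrightarrow> l\<^sup>2 \<le> C * (LINT x|M. (norm (X x))^2)"
  obtains u where "sqint M u" "\<And>X l. (X, l) \<in> \<A> \<Longrightarrow> l = (LINT x|M. u x \<bullet> X x)"
proof -
  define N where "N X = (LINT x|M. (norm (X x :: 'b))^2)" for X
  define J where "J p = N (fst p) - 2 * snd p" for p :: "('a \<Rightarrow> 'b) \<times> real"
  have J_ge: "- \<bar>C\<bar> \<le> J p" if "p \<in> \<A>" for p
  proof -
    obtain X l where p: "p = (X, l)" by (cases p)
    have "l^2 \<le> \<bar>C\<bar> * N X" using bound[of X l] that p unfolding N_def
      by (smt (verit) Bochner_Integration.integral_nonneg mult_right_mono zero_le_power2)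
    moreover have "N X \<ge> 0" by (simp add: N_def)
    moreover have "0 \<le> (\<bar>C\<bar> - N X)^2" by simp
    ultimately have "(2 * l)^2 \<le> (\<bar>C\<bar> + N X)^2" by (simp add: power2_eq_square algebra_simps)
    then have "2 * l \<le> \<bar>C\<bar> + N X" using \<open>N X \<ge> 0\<close> by (meson abs_ge_zero add_nonneg_nonneg power2_le_imp_le)
    then show ?thesis by (simp add: J_def p)
  qed
  define m where "m = Inf (J ` \<A>)"
  have bdd: "bdd_below (J ` \<A>)" using J_ge by (auto intro!: bdd_belowI[of _ "- \<bar>C\<bar>"])
  have m_le: "m \<le> J p" if "p \<in> \<A>" for p unfolding m_def by (intro cInf_lower bdd imageI that)
  have "\<exists>p\<in>\<A>. J p < m + 1 / real (Suc n)" for n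
    using cInf_lessD[of "J ` \<A>" "m + 1 / real (Suc n)"] ne by (auto simp: m_def)
  then obtain p where p: "\<And>n. p n \<in> \<A>" "\<And>n. J (p n) < m + 1 / real (Suc n)" by metis
  define f l where "f n = fst (p n)" and "l n = snd (p n)" for n
  have fl: "(f n, l n) \<in> \<A>" for n using p(1)[of n] by (simp add: f_def l_def)
  have f: "sqint M (f n)" for n using sq[OF fl] .
  have Jn: "N (f n) - 2 * l n < m + 1 / real (Suc n)" for n using p(2)[of n] by (simp add: J_def f_def l_def)
  have diff: "N (\<lambda>x. f i x - f j x) \<le> 2 * (1 / real (Suc i) + 1 / real (Suc j))" for i j
  proof -
    \<comment> \<open>The hypothesis \<open>comb\<close> only forms \<open>X + c Y\<close>; the
      midpoint of \<open>f i\<close> and \<open>f j\<close> is reached by first halving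
      \<open>f i\<close>.\<close>
    have "((\<lambda>x. f i x + (-1/2) *\<^sub>R f i x), l i + (-1/2) * l i) \<in> \<A>" by (rule comb[OF fl fl])
    from comb[OF this fl[of j], of "1/2"]
    have "((\<lambda>x. f i x + (-1/2) *\<^sub>R f i x + (1/2) *\<^sub>R f j x), l i + (-1/2) * l i + 1/2 * l j) \<in> \<A>" .
    moreover have "f i x + (-1/2) *\<^sub>R f i x + (1/2) *\<^sub>R f j x = (1/2) *\<^sub>R (f i x + f j x)" for x
      by (simp add: algebra_simps) (metis scaleR_half_double scaleR_add_right)
    moreover have "l i + (-1/2) * l i + 1/2 * l j = (l i + l j) / 2" by simp
    ultimately have "((\<lambda>x. (1/2) *\<^sub>R (f i x + f j x)), (l i + l j) / 2) \<in> \<A>" by (simp add: add_divide_distrib)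
    from m_le[OF this] have "m \<le> N (\<lambda>x. f i x + 1 *\<^sub>R f j x) / 4 - (l i + l j)"
      by (simp add: J_def N_def power_divide add_divide_distrib)
    then have "N (f i) - 2 * (LINT x|M. f i x \<bullet> f j x) + N (f j) \<le> 2 * (1 / real (Suc i) + 1 / real (Suc j))"
      using integral_norm_add_scaleR_squared[OF f f, of i 1 j]
      by (intro parallelogram_arith[OF _ _ Jn Jn]) (simp_all add: N_def)
    moreover have "N (\<lambda>x. f i x - f j x) = N (f i) - 2 * (LINT x|M. f i x \<bullet> f j x) + N (f j)"
      using integral_norm_add_scaleR_squared[OF f f, of i "-1" j] by (simp add: N_def)
    ultimately show ?thesis by simp
  qed
  have Cauchy: "\<exists>K. \<forall>i\<ge>K. \<forall>j\<ge>K. (LINT x|M. (norm (f i x - f j x))^2) < e" if e: "e > 0" for e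
  proof -
    obtain K where K: "1 / real (Suc K) < e / 4" using nat_approx_posE[of "e / 4"] e by auto
    have "(LINT x|M. (norm (f i x - f j x))^2) < e" if "i \<ge> K" "j \<ge> K" for i j
    proof -
      have "1 / real (Suc i) \<le> 1 / real (Suc K)" "1 / real (Suc j) \<le> 1 / real (Suc K)" using that by (auto simp: field_simps)
      then show ?thesis using diff[of i j] K unfolding N_def by simp
    qed
    then show ?thesis by blast
  qed
  obtain u r where r: "strict_mono r" and u: "sqint M u" and lim: "(\<lambda>n. N (\<lambda>x. f (r n) x - u x)) \<longlonglongrightarrow> 0"
    unfolding N_def by (rule L2_complete[where f=f, OF w f Cauchy])
  have "k = (LINT x|M. u x \<bullet> Y x)" if Yk: "(Y, k) \<in> \<A>" for Y k
  proof -
    have Y: "sqint M Y" using sq[OF Yk] .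
    have "(\<lambda>n. (LINT x|M. (f (r n) x - u x) \<bullet> Y x)) \<longlonglongrightarrow> 0"
    proof (rule Lim_null_comparison)
      show "\<forall>\<^sub>F n in sequentially. norm (LINT x|M. (f (r n) x - u x) \<bullet> Y x) \<le> sqrt (N (\<lambda>x. f (r n) x - u x) * N Y)"
        using integral_Cauchy_Schwarz[OF sqint_diff[OF f u] Y] unfolding N_def
        by (intro always_eventually allI real_le_rsqrt) simp
      have "(\<lambda>n. sqrt (N (\<lambda>x. f (r n) x - u x) * N Y)) \<longlonglongrightarrow> sqrt (0 * N Y)" by (intro tendsto_intros lim)
      then show "(\<lambda>n. sqrt (N (\<lambda>x. f (r n) x - u x) * N Y)) \<longlonglongrightarrow> 0" by simp
    qed
    then have "(\<lambda>n. (LINT x|M. (f (r n) x - u x) \<bullet> Y x) + (LINT x|M. u x \<bullet> Y x)) \<longlonglongrightarrow> 0 + (LINT x|M. u x \<bullet> Y x)"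
      by (intro tendsto_intros)
    moreover have "(LINT x|M. (f (r n) x - u x) \<bullet> Y x) + (LINT x|M. u x \<bullet> Y x) = (LINT x|M. f (r n) x \<bullet> Y x)" for n
      using integrable_inner_sqint[OF f[of "r n"] Y] integrable_inner_sqint[OF u Y] by (simp add: inner_diff_left)
    ultimately have limY: "(\<lambda>n. LINT x|M. f (r n) x \<bullet> Y x) \<longlonglongrightarrow> (LINT x|M. u x \<bullet> Y x)" by simp
    \<comment> \<open>Moving by \<open>s\<close> in direction \<open>Y\<close> from the minimising
      sequence cannot go below the infimum. In the limit this is a nonnegative quadratic in
      \<open>s\<close> without constant term, so its linear coefficient must vanish.\<close>
    have ge: "0 \<le> 2 * s * ((LINT x|M. u x \<bullet> Y x) - k) + s^2 * N Y" for s
    proof (rule LIMSEQ_le_const)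
      have "(\<lambda>n. 1 / real (Suc n)) \<longlonglongrightarrow> 0" using LIMSEQ_inverse_real_of_nat by (simp add: inverse_eq_divide)
      then have "(\<lambda>n. 1 / real (Suc (r n))) \<longlonglongrightarrow> 0" using LIMSEQ_subseq_LIMSEQ[OF _ r] by (simp add: comp_def)
      then have "(\<lambda>n. 1 / real (Suc (r n)) + (2 * s * ((LINT x|M. f (r n) x \<bullet> Y x) - k) + s^2 * N Y)) \<longlonglongrightarrow>
         0 + (2 * s * ((LINT x|M. u x \<bullet> Y x) - k) + s^2 * N Y)" by (intro tendsto_intros limY)
      then show "(\<lambda>n. 1 / real (Suc (r n)) + (2 * s * ((LINT x|M. f (r n) x \<bullet> Y x) - k) + s^2 * N Y)) \<longlonglongrightarrow>
         2 * s * ((LINT x|M. u x \<bullet> Y x) - k) + s^2 * N Y" by simp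
      have "0 \<le> 1 / real (Suc (r n)) + (2 * s * ((LINT x|M. f (r n) x \<bullet> Y x) - k) + s^2 * N Y)" for n
        using m_le[OF comb[OF fl[of "r n"] Yk, of s]] Jn[of "r n"] integral_norm_add_scaleR_squared[OF f[of "r n"] Y, of s]
        by (simp add: J_def N_def algebra_simps)
      then show "\<exists>K. \<forall>n\<ge>K. 0 \<le> 1 / real (Suc (r n)) + (2 * s * ((LINT x|M. f (r n) x \<bullet> Y x) - k) + s^2 * N Y)" by blast
    qed
    have "((LINT x|M. u x \<bullet> Y x) - k)^2 \<le> 0 * N Y"
      by (rule quadratic_nonneg_imp) (use ge in \<open>auto simp: N_def\<close>)
    then show ?thesis by simp
  qed
  with u show thesis by (rule that)
qed

section \<open>Integration over the time interval and over the strip\<close>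

lemma space_time [simp]: "space time = {0<..<1}"
  by (simp add: space_restrict_space)

lemma emeasure_time_space: "emeasure time (space time) = 1"
  by (subst emeasure_restrict_space) auto

interpretation time: finite_measure time
  by standard (subst emeasure_time_space, simp)

interpretation strip: pair_sigma_finite time lborel ..

lemma measurable_time_ident: "(\<lambda>t. t) \<in> borel_measurable time"
  by (rule measurable_restrict_space1) simp

lemma measurable_time: "f \<in> borel_measurable borel \<Longrightarrow> f \<in> borel_measurable time"
  by (rule measurable_restrict_space1) simp

lemma measurable_strip:
  assumes "plane_measurable f"
  shows "strip_measurable f"
proof -
  have "(\<lambda>p. (fst p, snd p)) \<in> strip \<rightarrow>\<^sub>M (borel \<Otimes>\<^sub>M borel :: (real \<times> real) measure)"
    by (intro measurable_Pair measurable_compose[OF measurable_fst measurable_time_ident]) simp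
  from measurable_compose[OF this assms] show ?thesis by (simp add: split_beta)
qed

lemma integral_time:
  fixes f :: "real \<Rightarrow> real"
  shows "(LINT t|time. f t) = (LINT t|lborel. indicator {0<..<1} t * f t)"
  by (subst integral_restrict_space) auto

lemma integrable_time_iff:
  fixes f :: "real \<Rightarrow> real"
  shows "integrable time f \<longleftrightarrow> integrable lborel (\<lambda>t. indicator {0<..<1} t * f t)"
  by (subst integrable_restrict_space) auto

lemma AE_time_iff: "(AE t in time. P t) \<longleftrightarrow> (AE t in lborel. t \<in> {0<..<1} \<longrightarrow> P t)"
  by (rule AE_restrict_space_iff) auto

lemma integral_time_Icc:
  fixes f :: "real \<Rightarrow> real"
  assumes "f \<in> borel_measurable borel"
  shows "(LINT t|time. f t) = (LINT t|lborel. indicator {0..1} t * f t)"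
  unfolding integral_time
proof (rule integral_cong_AE)
  show "AE t in lborel. indicator {0<..<1} t * f t = indicator {0..1} t * f t"
    using AE_lborel_singleton[of 0] AE_lborel_singleton[of 1] by eventually_elim (auto simp: indicator_def)
qed (use assms in auto)

lemma integrable_bounded_support:
  fixes h :: "real \<Rightarrow> real"
  assumes "h \<in> borel_measurable borel" "\<And>x. \<bar>h x\<bar> \<le> C" "\<And>x. \<bar>x\<bar> > R \<Longrightarrow> h x = 0"
  shows "integrable lborel h"
proof (rule integrable_le)
  show "integrable lborel (\<lambda>x. indicator {-R..R} x * C)"
    by (auto simp: integrable_indicator_iff emeasure_lborel_Icc_eq)
  show "AE x in lborel. norm (h x) \<le> norm (indicator {-R..R} x * C)"
  proof (rule AE_I2)
    fix x show "norm (h x) \<le> norm (indicator {-R..R} x * C)"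
      using assms(2)[of x] assms(3)[of x] by (cases "\<bar>x\<bar> > R") (auto simp: indicator_def abs_le_iff)
  qed
qed (use assms in simp)

lemma integrable_strip_bounded_support:
  assumes "plane_measurable h"
    "\<And>t x. t \<in> {0<..<1} \<Longrightarrow> \<bar>h t x\<bar> \<le> C" "\<And>t x. t \<in> {0<..<1} \<Longrightarrow> \<bar>x\<bar> > R \<Longrightarrow> h t x = (0::real)"
  shows "integrable strip (\<lambda>(t, x). h t x)"
proof (rule integrable_le)
  show "integrable strip (\<lambda>(t, x). C * indicator {-R..R} x)"
    by (rule strip.integrable_pair_mult) (auto simp: emeasure_lborel_Icc_eq)
  show "AE p in strip. norm (case p of (t, x) \<Rightarrow> h t x) \<le> norm (case p of (t, x) \<Rightarrow> C * indicator {-R..R} x)"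
  proof (rule AE_I2)
    fix p assume "p \<in> space strip"
    then obtain t x where p: "p = (t, x)" "t \<in> {0<..<1}" by (auto simp: space_pair_measure)
    show "norm (case p of (t, x) \<Rightarrow> h t x) \<le> norm (case p of (t, x) \<Rightarrow> C * indicator {-R..R} x)"
      using assms(2)[OF p(2), of x] assms(3)[OF p(2), of x] p(1) by (cases "\<bar>x\<bar> > R") (auto simp: indicator_def abs_le_iff)
  qed
qed (use assms(1) measurable_strip in blast)

lemma strip_integral_eq_t_rho:
  fixes h :: "field"
  assumes "integrable strip (\<lambda>(t, x). h t x)"
  shows "(LINT (t, x)|strip. h t x) = (LINT t|time. LINT x|lborel. h t x)"
  using strip.integral_fst'[OF assms] by simp

lemma strip_integral_eq_rho_t:
  fixes h :: "field"
  assumes "integrable strip (\<lambda>(t, x). h t x)"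
  shows "(LINT (t, x)|strip. h t x) = (LINT x|lborel. LINT t|time. h t x)"
  using strip.Fubini_integral[OF assms] strip_integral_eq_t_rho[OF assms] by simp

text \<open>A fundamental theorem with one exceptional point, because test functions cut at 0 have a
  kink there.\<close>

lemma integral_deriv_kink:
  fixes f :: "real \<Rightarrow> real"
  assumes cont: "continuous_on UNIV f" and D: "\<And>x. x \<noteq> 0 \<Longrightarrow> (f has_real_derivative f' x) (at x)"
    and meas: "f' \<in> borel_measurable borel" and B: "\<And>x. \<bar>f' x\<bar> \<le> C"
    and sup: "\<And>x. \<bar>x\<bar> > R \<Longrightarrow> f x = 0" "\<And>x. \<bar>x\<bar> > R \<Longrightarrow> f' x = 0"
  shows "(LINT x|lborel. f' x) = 0"
proof -
  define r where "r = \<bar>R\<bar> + 1"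
  have r: "r > \<bar>R\<bar>" "r > R" "- r < R" "r > 0" by (auto simp: r_def)
  have "(f' has_integral f r - f (- r)) {- r..r}"
  proof (rule fundamental_theorem_of_calculus_interior_strong[of "{0}"])
    show "(f has_vector_derivative f' x) (at x)" if "x \<in> {- r<..<r} - {0}" for x
      using D[of x] that by (auto simp: has_real_derivative_iff_has_vector_derivative)
  qed (use r continuous_on_subset[OF cont] in auto)
  then have hi: "(f' has_integral 0) {- r..r}" using sup(1)[of r] sup(1)[of "-r"] r by simp
  have int: "integrable lborel f'" by (rule integrable_bounded_support[OF meas B sup(2)]) auto
  have "set_integrable lborel {-r..r} f'"
    unfolding set_integrable_def by (intro integrable_mult_indicator int) simp
  then have "(LINT x:{-r..r}|lborel. f' x) = integral {-r..r} f'" by (rule set_borel_integral_eq_integral(2))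
  also have "\<dots> = 0" using hi by (rule integral_unique)
  also have "(LINT x:{-r..r}|lborel. f' x) = (LINT x|lborel. f' x)"
    unfolding set_lebesgue_integral_def
  proof (intro LINT_cong)
    fix x show "indicator {-r..r} x *\<^sub>R f' x = f' x"
      using sup(2)[of x] r by (cases "\<bar>x\<bar> > R") (auto simp: indicator_def abs_le_iff)
  qed
  finally show ?thesis .
qed

lemma integral_deriv_time:
  fixes f :: "real \<Rightarrow> real"
  assumes cont: "continuous_on {0..1} f" and D: "\<And>t. t \<in> {0<..<1} \<Longrightarrow> (f has_real_derivative f' t) (at t)"
    and meas: "f' \<in> borel_measurable borel" and B: "\<And>t. t \<in> {0<..<1} \<Longrightarrow> \<bar>f' t\<bar> \<le> C"
  shows "(LINT t|time. f' t) = f 1 - f 0" and "integrable time f'"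
proof -
  have "(f' has_integral f 1 - f 0) {0..1}"
    using D by (intro fundamental_theorem_of_calculus_interior cont) (auto simp: has_real_derivative_iff_has_vector_derivative)
  then have hi: "(f' has_integral f 1 - f 0) {0<..<1}" using has_integral_open_interval[of f' "f 1 - f 0" 0 1] by simp
  show int: "integrable time f'"
    by (rule integrable_le[of time "\<lambda>_. C"])
      (use B meas measurable_time in \<open>auto intro!: AE_I2 order_trans[OF B]\<close>)
  then have "set_integrable lborel {0<..<1} f'" by (simp add: integrable_time_iff set_integrable_def)
  then have "(LINT x:{0<..<1}|lborel. f' x) = integral {0<..<1} f'" by (rule set_borel_integral_eq_integral(2))
  with hi show "(LINT t|time. f' t) = f 1 - f 0"
    by (simp add: integral_unique integral_time set_lebesgue_integral_def)
qed

subsection \<open>Coercivity of the adjoint problem\<close>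

text \<open>\<open>jap\<close> is the Japanese bracket. In the energy identity the time derivative
  of \<open>multiplier\<close> contributes \<open>x * mult_slope x\<close>, which is nonnegative and
  comparable to |x| at infinity, so it controls the weighted square of the function. The constant 2
  keeps the multiplier positive, so that the gradient term and the lateral terms have the right
  sign.\<close>

definition jap :: "real \<Rightarrow> real" where "jap x = sqrt (1 + x^2)"
definition mult_slope :: "real \<Rightarrow> real" where "mult_slope x = x / jap x"
definition multiplier :: "field" where "multiplier t x = 2 + (t - 1/2) * mult_slope x"

lemma jap_ge_1: "1 \<le> jap x"
  by (simp add: jap_def)

lemma jap_pos: "0 < jap x"
  using jap_ge_1[of x] by linarith

lemma jap_squared: "(jap x)^2 = 1 + x^2"
  by (simp add: jap_def)

lemma abs_le_jap: "\<bar>x\<bar> \<le> jap x"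
  unfolding jap_def by (rule real_le_rsqrt) simp

lemma jap_le: "jap x \<le> 1 + \<bar>x\<bar>"
  unfolding jap_def by (rule real_le_lsqrt) (auto simp: power2_eq_square algebra_simps)

lemma jap_measurable [measurable]: "jap \<in> borel_measurable borel"
  unfolding jap_def[abs_def] by measurable

lemma mult_slope_measurable [measurable]: "mult_slope \<in> borel_measurable borel"
  unfolding mult_slope_def[abs_def] by measurable

lemma mult_slope_DERIV: "(mult_slope has_real_derivative 1 / (jap x) ^ 3) (at x)"
proof -
  have p: "1 + x^2 > 0" by (simp add: add_pos_nonneg)
  have J: "(jap has_real_derivative x / jap x) (at x)"
    unfolding jap_def[abs_def] using p by (auto intro!: derivative_eq_intros simp: field_simps)
  have "(mult_slope has_real_derivative (1 * jap x - x * (x / jap x)) / (jap x * jap x)) (at x)"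
    unfolding mult_slope_def[abs_def] using jap_pos[of x] by (intro DERIV_divide DERIV_ident J) auto
  moreover have "(1 * jap x - x * (x / jap x)) / (jap x * jap x) = ((jap x)^2 - x^2) / (jap x) ^ 3"
    using jap_pos[of x] by (simp add: field_simps power2_eq_square power3_eq_cube)
  ultimately show ?thesis by (simp add: jap_squared)
qed

lemma abs_mult_slope_le_1: "\<bar>mult_slope x\<bar> \<le> 1"
  using abs_le_jap[of x] jap_pos[of x] by (simp add: mult_slope_def abs_divide)

lemma mult_slope_squared: "(mult_slope x)^2 = 1 - 1 / (jap x)^2"
proof -
  have "1 + x^2 \<noteq> 0" using jap_pos[of x] jap_squared[of x] by (metis less_irrefl zero_eq_power2)
  then show ?thesis by (simp add: mult_slope_def power_divide jap_squared field_simps)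
qed

lemma mult_slope_times: "x * mult_slope x = jap x - 1 / jap x"
  using jap_pos[of x] jap_squared[of x] by (simp add: mult_slope_def field_simps power2_eq_square)

lemma multiplier_bounds:
  assumes "t \<in> {0..1}"
  shows "3 / 2 \<le> multiplier t x" "multiplier t x \<le> 5 / 2"
proof -
  have "\<bar>(t - 1/2) * mult_slope x\<bar> \<le> 1/2 * 1"
  proof (unfold abs_mult, intro mult_mono abs_mult_slope_le_1)
    show "\<bar>t - 1/2\<bar> \<le> 1/2" using assms unfolding atLeastAtMost_iff abs_le_iff by argo
  qed auto
  then show "3 / 2 \<le> multiplier t x" "multiplier t x \<le> 5 / 2"
    by (auto simp: multiplier_def abs_le_iff)
qed

lemma quadratic_form_nonneg:
  fixes A D E :: real
  assumes "D^2 \<le> 4 * A * E" "E > 0"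
  shows "0 \<le> A * a^2 + D * a * b + E * b^2"
proof -
  have "4 * E * (A * a^2 + D * a * b + E * b^2) = (4 * A * E - D^2) * a^2 + (D * a + 2 * E * b)^2"
    by (simp add: power2_eq_square algebra_simps)
  moreover have "0 \<le> \<dots>" using assms by (intro add_nonneg_nonneg mult_nonneg_nonneg) auto
  ultimately have "0 \<le> 4 * E * (A * a^2 + D * a * b + E * b^2)" by simp
  moreover have "0 < 4 * E" using assms(2) by simp
  ultimately show ?thesis by (metis mult_pos_neg not_less)
qed

text \<open>Read \<open>a\<close> as the value and \<open>b\<close> as the space derivative of a
  test function. With \<open>y = 1 / jap x\<close> the square of \<open>mult_slope x\<close> is
  \<open>1 - y^2\<close>, and the claim becomes a discriminant bound that is uniform in
  \<open>y\<close>.\<close>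

lemma coercivity_pointwise:
  assumes t: "t \<in> {0..1}"
  shows "1/8 * (jap x * a^2 + b^2) \<le> 1/2 * (x * mult_slope x * a^2) + (t - 1/2) * (1 / (jap x) ^ 3) * a * b + multiplier t x * b^2
     + 1/4 * (1 / (jap x) ^ 3 * a^2 + 2 * mult_slope x * a * b)"
proof -
  define y where "y = 1 / jap x"
  have y: "0 < y" "y \<le> 1" using jap_pos[of x] jap_ge_1[of x] by (auto simp: y_def)
  define k where "k = mult_slope x"
  have k2: "k^2 = 1 - y^2" by (simp add: k_def y_def mult_slope_squared power_divide)
  \<comment> \<open>The coefficients of \<open>a^2\<close> and \<open>a * b\<close> in the right
    side minus the left side; the coefficient of \<open>b^2\<close> is at least
    \<open>3/2 - 1/8 = 11/8\<close>.\<close>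
  define A D where "A = 3/8 * jap x - 1/2 * y + 1/4 * y ^ 3" and "D = (t - 1/2) * y ^ 3 + k / 2"
  have Jy: "jap x * y = 1" using jap_pos[of x] by (simp add: y_def)
  have z: "(y^2 - 1)^2 \<ge> 0" by simp
  \<comment> \<open>This equals \<open>1/8 + (y^2 - 1)^2 / 4\<close>: the term with the factor 1/4
    completes the square.\<close>
  have "A * y = 3/8 - 1/2 * y^2 + 1/4 * (y^2)^2"
    using Jy by (simp add: A_def power2_eq_square power3_eq_cube algebra_simps)
  then have "1/8 \<le> A * y" using z by (simp add: power2_eq_square algebra_simps)
  moreover have "A * y \<le> A"
  proof -
    have "0 \<le> A"
    proof (rule ccontr)
      assume "\<not> 0 \<le> A"
      then have "A * y < 0" using y by (intro mult_neg_pos) auto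
      then show False using \<open>1/8 \<le> A * y\<close> by simp
    qed
    then show ?thesis using y by (simp add: mult_left_le)
  qed
  ultimately have A: "1/8 \<le> A" by simp
  have tb: "\<bar>t - 1/2\<bar> \<le> 1/2" using t unfolding atLeastAtMost_iff abs_le_iff by argo
  have "\<bar>(t - 1/2) * y ^ 3\<bar> \<le> 1/2 * y ^ 3" using tb y by (simp add: abs_mult)
  then have "((t - 1/2) * y ^ 3)^2 \<le> (1/2 * y ^ 3)^2" using y by (intro abs_le_square_iff[THEN iffD1]) auto
  also have "\<dots> \<le> 1/4 * y^2"
  proof -
    have "(y ^ 3)^2 \<le> y^2" using power_decreasing[of 2 6 y] y by (simp flip: power_mult)
    then show ?thesis by (simp add: power_mult_distrib power_divide)
  qed
  finally have "((t - 1/2) * y ^ 3)^2 \<le> 1/4 * y^2" .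
  moreover have "D^2 \<le> 2 * ((t - 1/2) * y ^ 3)^2 + 2 * (k / 2)^2"
    unfolding D_def using sum_squares_bound[of "(t - 1/2) * y ^ 3" "k / 2"] by (simp add: power2_sum)
  moreover have "(k / 2)^2 = k^2 / 4" by (simp add: power_divide)
  \<comment> \<open>The two contributions \<open>y^2 / 2\<close> and \<open>(1 - y^2) / 2\<close>
    add up to 1/2.\<close>
  ultimately have "D^2 \<le> 1/2" using k2 by argo
  then have "D^2 \<le> 4 * A * (11/8)" using A by simp
  from quadratic_form_nonneg[OF this, of a b] have "0 \<le> A * a^2 + D * a * b + 11/8 * b^2" by simp
  moreover have "3/2 * b^2 \<le> multiplier t x * b^2" using multiplier_bounds(1)[OF t] by (intro mult_right_mono) auto
  moreover have "x * mult_slope x * a^2 = (jap x - y) * a^2" unfolding mult_slope_times by (simp add: y_def)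
  moreover have "1 / (jap x) ^ 3 = y ^ 3" by (simp add: y_def power_divide)
  moreover have "A * a^2 + D * a * b + 11/8 * b^2 = 1/2 * ((jap x - y) * a^2) + (t - 1/2) * y ^ 3 * a * b + 3/2 * b^2
     + 1/4 * (y ^ 3 * a^2 + 2 * k * a * b) - 1/8 * (jap x * a^2 + b^2)"
    unfolding A_def D_def by (simp add: field_simps)
  ultimately show ?thesis unfolding k_def[symmetric] by (simp only:)
qed

lemma measurable_strip_any: "f \<in> borel \<Otimes>\<^sub>M borel \<rightarrow>\<^sub>M N \<Longrightarrow> f \<in> strip \<rightarrow>\<^sub>M N"
proof -
  assume f: "f \<in> borel \<Otimes>\<^sub>M borel \<rightarrow>\<^sub>M N"
  have "(\<lambda>p. (fst p, snd p)) \<in> strip \<rightarrow>\<^sub>M (borel \<Otimes>\<^sub>M borel :: (real \<times> real) measure)"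
    by (intro measurable_Pair measurable_compose[OF measurable_fst measurable_time_ident]) simp
  from measurable_compose[OF this f] show ?thesis by simp
qed

lemma measurable_slice_right:
  assumes "(\<lambda>(t, x). f t x) \<in> borel \<Otimes>\<^sub>M borel \<rightarrow>\<^sub>M N"
  shows "f t \<in> borel \<rightarrow>\<^sub>M N"
proof -
  have "(\<lambda>x. (t, x)) \<in> borel \<rightarrow>\<^sub>M borel \<Otimes>\<^sub>M borel" by simp
  from measurable_compose[OF this assms] show ?thesis by simp
qed

lemma measurable_slice_left:
  assumes "(\<lambda>(t, x). f t x) \<in> borel \<Otimes>\<^sub>M borel \<rightarrow>\<^sub>M N"
  shows "(\<lambda>t. f t x) \<in> borel \<rightarrow>\<^sub>M N"
proof -
  have "(\<lambda>t. (t, x)) \<in> borel \<rightarrow>\<^sub>M borel \<Otimes>\<^sub>M borel" by simp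
  from measurable_compose[OF this assms] show ?thesis by simp
qed

text \<open>
  In the weak formulation \<open>W\<close> is paired with \<open>- \<rho> \<partial>\<^sub>tu + \<partial>\<^sub>\<rho>v\<close> and a second unknown \<open>V\<close> with \<open>\<partial>\<^sub>\<rho>u + v\<close>:
  varying \<open>v\<close> forces \<open>V = \<partial>\<^sub>\<rho>W\<close>, varying \<open>u\<close> gives the equation. The conditions \<open>initial\<close> and \<open>final\<close>
  leave \<open>u\<close> free exactly where \<open>W\<close> has lateral data. Functions may have a kink at \<open>\<rho> = 0\<close>.
\<close>

locale test_pair =
  fixes u ut ur v vr :: "field" and R B :: real
  assumes meas [measurable]: "plane_measurable u"
      "plane_measurable ut"
      "plane_measurable ur"
      "plane_measurable v"
      "plane_measurable vr"
    and bounded: "t \<in> {0..1} \<Longrightarrow> \<bar>u t x\<bar> \<le> B" "t \<in> {0..1} \<Longrightarrow> \<bar>ut t x\<bar> \<le> B" "t \<in> {0..1} \<Longrightarrow> \<bar>ur t x\<bar> \<le> B"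
      "t \<in> {0..1} \<Longrightarrow> \<bar>v t x\<bar> \<le> B" "t \<in> {0..1} \<Longrightarrow> \<bar>vr t x\<bar> \<le> B"
    and support: "t \<in> {0..1} \<Longrightarrow> \<bar>x\<bar> > R \<Longrightarrow> u t x = 0" "t \<in> {0..1} \<Longrightarrow> \<bar>x\<bar> > R \<Longrightarrow> ut t x = 0"
      "t \<in> {0..1} \<Longrightarrow> \<bar>x\<bar> > R \<Longrightarrow> ur t x = 0" "t \<in> {0..1} \<Longrightarrow> \<bar>x\<bar> > R \<Longrightarrow> v t x = 0"
      "t \<in> {0..1} \<Longrightarrow> \<bar>x\<bar> > R \<Longrightarrow> vr t x = 0"
    and space_cont: "t \<in> {0<..<1} \<Longrightarrow> continuous_on UNIV (u t)" "t \<in> {0<..<1} \<Longrightarrow> continuous_on UNIV (v t)"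
    and space_deriv: "t \<in> {0<..<1} \<Longrightarrow> x \<noteq> 0 \<Longrightarrow> (u t has_real_derivative ur t x) (at x)"
      "t \<in> {0<..<1} \<Longrightarrow> x \<noteq> 0 \<Longrightarrow> (v t has_real_derivative vr t x) (at x)"
    and time_cont: "continuous_on {0..1} (\<lambda>t. u t x)"
    and time_deriv: "t \<in> {0<..<1} \<Longrightarrow> ((\<lambda>t. u t x) has_real_derivative ut t x) (at t)"
    and initial: "x \<le> 0 \<Longrightarrow> u 0 x = 0" and final: "0 \<le> x \<Longrightarrow> u 1 x = 0"
begin

definition "energy = (LINT (t, x)|strip. jap x * (u t x)^2 + (ur t x)^2)"
text \<open>For each \<open>x\<close> at most one of \<open>u 0 x\<close> and \<open>u 1 x\<close>
  is nonzero, so the sum stands for whichever lateral value is free.\<close>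

definition "boundary_energy = (LINT x|lborel. \<bar>x\<bar> * (u 0 x + u 1 x)^2)"
text \<open>\<open>dual_pair\<close> consists of the multiplier times \<open>u\<close> and the space
  derivative of that product. The factors \<open>sqrt (jap x)\<close> cancel in the inner product;
  they are placed so that the Riesz representative controls \<open>W\<close> with the weight
  \<open>jap\<close>.\<close>

definition "test_image = (\<lambda>(t, x). ((- (x * ut t x) + vr t x) / sqrt (jap x), ur t x + v t x))"
definition "dual_pair = (\<lambda>(t, x). (sqrt (jap x) * (multiplier t x * u t x),
    (t - 1/2) * (1 / (jap x) ^ 3) * u t x + multiplier t x * ur t x))"

lemma B_nonneg: "0 \<le> B"
  using bounded(1)[of 0 0] by simp

lemma slice_meas [measurable]: "u t \<in> borel_measurable borel" "ur t \<in> borel_measurable borel"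
  "v t \<in> borel_measurable borel" "vr t \<in> borel_measurable borel"
  "(\<lambda>t. u t x) \<in> borel_measurable borel" "(\<lambda>t. ut t x) \<in> borel_measurable borel"
  by (intro measurable_slice_right measurable_slice_left meas)+

lemma jap_le_R: "\<bar>x\<bar> \<le> R \<Longrightarrow> jap x \<le> 1 + R"
  using jap_le[of x] by linarith

lemma integrable_strip_local:
  assumes "plane_measurable h"
    and "\<And>t x. t \<in> {0<..<1} \<Longrightarrow> \<bar>x\<bar> \<le> R \<Longrightarrow> \<bar>h t x\<bar> \<le> C"
    and sup: "\<And>t x. t \<in> {0<..<1} \<Longrightarrow> \<bar>x\<bar> > R \<Longrightarrow> h t x = (0::real)"
  shows "integrable strip (\<lambda>(t, x). h t x)"
proof (rule integrable_strip_bounded_support[where C="max C 0" and R=R])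
  show "\<bar>h t x\<bar> \<le> max C 0" if "t \<in> {0<..<1}" for t x
    using assms(2,3)[OF that, of x] by (cases "\<bar>x\<bar> \<le> R") (auto simp: le_max_iff_disj)
qed (use assms in auto)

lemma energy_integrable: "integrable strip (\<lambda>(t, x). jap x * (u t x)^2 + (ur t x)^2)"
proof (rule integrable_strip_local[where C="(1 + R) * B^2 + B^2"])
  fix t x :: real assume t: "t \<in> {0<..<1}" and r: "\<bar>x\<bar> \<le> R"
  have "(u t x)^2 \<le> B^2" "(ur t x)^2 \<le> B^2"
    using bounded(1,3)[of t x] t B_nonneg by (auto simp: abs_le_square_iff[symmetric])
  then have "jap x * (u t x)^2 + (ur t x)^2 \<le> (1 + R) * B^2 + B^2"
    using jap_le_R[OF r] jap_pos[of x] r by (intro add_mono mult_mono) auto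
  then show "\<bar>jap x * (u t x)^2 + (ur t x)^2\<bar> \<le> (1 + R) * B^2 + B^2"
    using jap_pos[of x] by simp
qed (auto simp: support)

lemma boundary_integrable: "integrable lborel (\<lambda>x. \<bar>x\<bar> * (u 0 x + u 1 x)^2)"
proof (rule integrable_bounded_support[where R=R and C="\<bar>R\<bar> * (2 * B)^2"])
  fix x :: real
  show "\<bar>\<bar>x\<bar> * (u 0 x + u 1 x)^2\<bar> \<le> \<bar>R\<bar> * (2 * B)^2"
  proof (cases "\<bar>x\<bar> \<le> R")
    case True
    have "\<bar>u 0 x + u 1 x\<bar> \<le> \<bar>2 * B\<bar>" using bounded(1)[of 0 x] bounded(1)[of 1 x] by simp
    then have "(u 0 x + u 1 x)^2 \<le> (2 * B)^2" by (simp only: abs_le_square_iff)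
    with True show ?thesis by (auto simp: abs_mult intro!: mult_mono)
  qed (simp add: support)
  show "\<bar>x\<bar> > R \<Longrightarrow> \<bar>x\<bar> * (u 0 x + u 1 x)^2 = 0" by (simp add: support)
qed measurable

lemma test_image_measurable [measurable]: "test_image \<in> borel_measurable (borel \<Otimes>\<^sub>M borel)"
  unfolding test_image_def by measurable

lemma multiplier_measurable [measurable]: "plane_measurable multiplier"
  unfolding multiplier_def by measurable

lemma dual_pair_measurable [measurable]: "dual_pair \<in> borel_measurable (borel \<Otimes>\<^sub>M borel)"
  unfolding dual_pair_def by measurable

lemma sqint_test_image: "sqint strip test_image"
proof -
  have eq: "(norm (test_image (t, x)))^2 = (- (x * ut t x) + vr t x)^2 / jap x + (ur t x + v t x)^2" for t x
    using jap_pos[of x] by (simp add: test_image_def norm_Pair power_divide)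
  have "integrable strip (\<lambda>(t, x). (- (x * ut t x) + vr t x)^2 / jap x + (ur t x + v t x)^2)"
  proof (rule integrable_strip_local[where C="(R * B + B)^2 + (B + B)^2"])
    fix t x :: real assume t: "t \<in> {0<..<1}" and r: "\<bar>x\<bar> \<le> R"
    have t': "t \<in> {0..1}" using t by auto
    have "\<bar>x * ut t x\<bar> \<le> R * B" unfolding abs_mult using r bounded(2)[OF t'] by (intro mult_mono) auto
    then have "\<bar>- (x * ut t x) + vr t x\<bar> \<le> \<bar>R * B + B\<bar>" using bounded(5)[OF t', of x] by linarith
    then have "(- (x * ut t x) + vr t x)^2 \<le> (R * B + B)^2" by (simp only: abs_le_square_iff)
    moreover have "(- (x * ut t x) + vr t x)^2 / jap x \<le> (- (x * ut t x) + vr t x)^2 / 1"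
      using jap_ge_1[of x] by (intro divide_left_mono) auto
    moreover have "\<bar>ur t x + v t x\<bar> \<le> \<bar>B + B\<bar>" using bounded(3)[OF t', of x] bounded(4)[OF t', of x] by linarith
    then have "(ur t x + v t x)^2 \<le> (B + B)^2" by (simp only: abs_le_square_iff)
    moreover have "0 \<le> (- (x * ut t x) + vr t x)^2 / jap x" using jap_pos[of x] by simp
    ultimately show "\<bar>(- (x * ut t x) + vr t x)\<^sup>2 / jap x + (ur t x + v t x)^2\<bar> \<le> (R * B + B)^2 + (B + B)^2"
      by simp
  qed (auto simp: support)
  moreover have "(\<lambda>p. (norm (test_image p))^2) = (\<lambda>(t, x). (- (x * ut t x) + vr t x)^2 / jap x + (ur t x + v t x)^2)"
    by (auto simp: fun_eq_iff eq)
  ultimately show ?thesis unfolding sqint_def by (auto intro: measurable_strip_any test_image_measurable)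
qed

lemma norm_dual_pair_le:
  assumes "t \<in> {0..1}"
  shows "(norm (dual_pair (t, x)))^2 \<le> 16 * (jap x * (u t x)^2 + (ur t x)^2)"
proof -
  let ?m = "multiplier t x" and ?a = "(t - 1/2) * (1 / (jap x) ^ 3)"
  have m: "?m\<^sup>2 \<le> (5/2)^2" using multiplier_bounds[OF assms, of x] by (intro power_mono) auto
  have tb: "\<bar>t - 1/2\<bar> \<le> 1/2" using assms unfolding atLeastAtMost_iff abs_le_iff by argo
  have "\<bar>?a\<bar> \<le> 1/2 * 1" unfolding abs_mult
    using tb jap_ge_1[of x] jap_pos[of x] by (intro mult_mono) (auto simp: field_simps)
  then have "?a\<^sup>2 \<le> (1/2)^2" by (intro abs_le_square_iff[THEN iffD1]) auto
  then have a: "?a\<^sup>2 * (u t x)^2 \<le> 1/4 * (jap x * (u t x)^2)"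
    using jap_ge_1[of x] mult_right_mono[of 1 "jap x" "(u t x)^2"] mult_right_mono[of "?a\<^sup>2" "(1/2)^2" "(u t x)^2"]
    by (simp add: power_divide)
  have "(norm (dual_pair (t, x)))^2 = jap x * (?m\<^sup>2 * (u t x)^2) + (?a * u t x + ?m * ur t x)^2"
    using jap_pos[of x] by (simp add: dual_pair_def norm_Pair power_mult_distrib)
  also have "(?a * u t x + ?m * ur t x)^2 \<le> 2 * (?a * u t x)^2 + 2 * (?m * ur t x)^2"
    using sum_squares_bound[of "?a * u t x" "?m * ur t x"] by (simp add: power2_sum)
  also have "\<dots> \<le> 1/2 * (jap x * (u t x)^2) + 2 * ((5/2)^2 * (ur t x)^2)"
    unfolding power_mult_distrib[of ?a] power_mult_distrib[of ?m]
    using a mult_right_mono[OF m, of "(ur t x)^2"] by simp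
  also have "jap x * (?m\<^sup>2 * (u t x)^2) \<le> jap x * ((5/2)^2 * (u t x)^2)"
    using m jap_pos[of x] by (intro mult_left_mono mult_right_mono) auto
  finally have "(norm (dual_pair (t, x)))^2 \<le> jap x * ((5/2)^2 * (u t x)^2) + (1/2 * (jap x * (u t x)^2) + 2 * ((5/2)^2 * (ur t x)^2))"
    by simp
  moreover have "0 \<le> jap x * (u t x)^2" "0 \<le> (ur t x)^2" using jap_pos[of x] by auto
  moreover have "jap x * ((5/2)^2 * (u t x)^2) = 25/4 * (jap x * (u t x)^2)" "2 * ((5/2)^2 * (ur t x)^2) = 25/2 * (ur t x)^2"
    by (simp_all add: power_divide)
  ultimately show ?thesis by argo
qed

text \<open>Bounds are asked for \<open>\<bar>x\<bar> <= R\<close> only, since a factor such as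
  \<open>x\<close> is unbounded; products with a test function still vanish beyond
  \<open>R\<close>.\<close>

definition locally_bounded :: "field \<Rightarrow> bool" where
  "locally_bounded h \<longleftrightarrow> plane_measurable h \<and>
     (\<exists>C. \<forall>t\<in>{0..1}. \<forall>x. \<bar>x\<bar> \<le> R \<longrightarrow> \<bar>h t x\<bar> \<le> C)"

lemma locally_boundedI:
  assumes "plane_measurable h"
    "\<And>t x. t \<in> {0..1} \<Longrightarrow> \<bar>x\<bar> \<le> R \<Longrightarrow> \<bar>h t x\<bar> \<le> C"
  shows "locally_bounded h"
  using assms unfolding locally_bounded_def by blast

lemma locally_bounded_add:
  assumes "locally_bounded f" "locally_bounded g"
  shows "locally_bounded (\<lambda>t x. f t x + g t x)"
proof -
  obtain C C' where C: "\<forall>t\<in>{0..1}. \<forall>x. \<bar>x\<bar> \<le> R \<longrightarrow> \<bar>f t x\<bar> \<le> C" "\<forall>t\<in>{0..1}. \<forall>x. \<bar>x\<bar> \<le> R \<longrightarrow> \<bar>g t x\<bar> \<le> C'"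
    using assms unfolding locally_bounded_def by blast
  have [measurable]: "plane_measurable f" "plane_measurable g"
    using assms unfolding locally_bounded_def by blast+
  show ?thesis
  proof (rule locally_boundedI)
    show "\<bar>f t x + g t x\<bar> \<le> C + C'" if "t \<in> {0..1}" "\<bar>x\<bar> \<le> R" for t x
      using C(1)[rule_format, OF that] C(2)[rule_format, OF that] by linarith
  qed measurable
qed

lemma locally_bounded_mult:
  assumes "locally_bounded f" "locally_bounded g"
  shows "locally_bounded (\<lambda>t x. f t x * g t x)"
proof -
  obtain C C' where C: "\<forall>t\<in>{0..1}. \<forall>x. \<bar>x\<bar> \<le> R \<longrightarrow> \<bar>f t x\<bar> \<le> C" "\<forall>t\<in>{0..1}. \<forall>x. \<bar>x\<bar> \<le> R \<longrightarrow> \<bar>g t x\<bar> \<le> C'"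
    using assms unfolding locally_bounded_def by blast
  have [measurable]: "plane_measurable f" "plane_measurable g"
    using assms unfolding locally_bounded_def by blast+
  show ?thesis
  proof (rule locally_boundedI)
    show "\<bar>f t x * g t x\<bar> \<le> \<bar>C\<bar> * \<bar>C'\<bar>" if "t \<in> {0..1}" "\<bar>x\<bar> \<le> R" for t x
      using C(1)[rule_format, OF that] C(2)[rule_format, OF that] unfolding abs_mult by (intro mult_mono) auto
  qed measurable
qed

lemma locally_bounded_const: "locally_bounded (\<lambda>t x. c)"
  by (rule locally_boundedI[where C="\<bar>c\<bar>"]) auto

lemma locally_bounded_rho: "locally_bounded (\<lambda>t x. x)"
  by (rule locally_boundedI[where C=R]) auto

lemma locally_bounded_slope: "locally_bounded (\<lambda>t x. mult_slope x)"
  by (rule locally_boundedI[where C=1]) (auto simp: abs_mult_slope_le_1)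

lemma locally_bounded_slope_deriv: "locally_bounded (\<lambda>t x. 1 / (jap x) ^ 3)"
proof (rule locally_boundedI[where C=1])
  show "\<bar>1 / (jap x) ^ 3\<bar> \<le> 1" for x using jap_ge_1[of x] jap_pos[of x] by (simp add: field_simps)
qed measurable

lemma locally_bounded_time: "locally_bounded (\<lambda>t x. t - 1/2)"
  by (rule locally_boundedI[where C=1]) (auto simp: abs_le_iff)

lemma locally_bounded_multiplier: "locally_bounded multiplier"
  unfolding multiplier_def[abs_def]
  by (intro locally_bounded_add locally_bounded_mult locally_bounded_const locally_bounded_slope locally_bounded_time)

lemma locally_bounded_tests: "locally_bounded u" "locally_bounded ut" "locally_bounded ur"
  "locally_bounded v" "locally_bounded vr"
  by (rule locally_boundedI[OF meas(1) bounded(1)] locally_boundedI[OF meas(2) bounded(2)]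
      locally_boundedI[OF meas(3) bounded(3)] locally_boundedI[OF meas(4) bounded(4)]
      locally_boundedI[OF meas(5) bounded(5)]; assumption)+

lemmas locally_bounded_intros = locally_bounded_add locally_bounded_mult locally_bounded_const locally_bounded_rho
  locally_bounded_slope locally_bounded_slope_deriv locally_bounded_time locally_bounded_multiplier locally_bounded_tests

lemma integrable_locally_bounded:
  assumes "locally_bounded h" "\<And>t x. t \<in> {0<..<1} \<Longrightarrow> \<bar>x\<bar> > R \<Longrightarrow> h t x = 0"
  shows "integrable strip (\<lambda>(t, x). h t x)"
proof -
  obtain C where "\<forall>t\<in>{0..1}. \<forall>x. \<bar>x\<bar> \<le> R \<longrightarrow> \<bar>h t x\<bar> \<le> C"
    using assms unfolding locally_bounded_def by blast
  moreover have "plane_measurable h"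
    using assms unfolding locally_bounded_def by blast
  ultimately show ?thesis
    by (intro integrable_strip_local[where C=C] assms(2)) auto
qed

lemma locally_bounded_bound:
  assumes "locally_bounded h" "\<And>t x. t \<in> {0<..<1} \<Longrightarrow> \<bar>x\<bar> > R \<Longrightarrow> h t x = 0"
  obtains C where "\<And>t x. t \<in> {0<..<1} \<Longrightarrow> \<bar>h t x\<bar> \<le> C"
proof -
  obtain C where C: "\<forall>t\<in>{0..1}. \<forall>x. \<bar>x\<bar> \<le> R \<longrightarrow> \<bar>h t x\<bar> \<le> C"
    using assms unfolding locally_bounded_def by blast
  have "\<bar>h t x\<bar> \<le> max C 0" if "t \<in> {0<..<1}" for t x
    using C[rule_format, of t x] assms(2)[OF that, of x] that by (cases "\<bar>x\<bar> \<le> R") (auto simp: le_max_iff_disj)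
  then show thesis by (rule that)
qed

lemma integral_space_deriv:
  assumes h: "locally_bounded h" and sup: "\<And>t x. t \<in> {0<..<1} \<Longrightarrow> \<bar>x\<bar> > R \<Longrightarrow> h t x = 0"
    and f: "\<And>t. t \<in> {0<..<1} \<Longrightarrow> continuous_on UNIV (f t)"
      "\<And>t x. t \<in> {0<..<1} \<Longrightarrow> x \<noteq> 0 \<Longrightarrow> (f t has_real_derivative h t x) (at x)"
      "\<And>t x. t \<in> {0<..<1} \<Longrightarrow> \<bar>x\<bar> > R \<Longrightarrow> f t x = 0"
  shows "(LINT (t, x)|strip. h t x) = 0"
proof -
  obtain C where C: "\<And>t x. t \<in> {0<..<1} \<Longrightarrow> \<bar>h t x\<bar> \<le> C" using locally_bounded_bound[OF h sup] by blast
  have m: "plane_measurable h" using h by (simp add: locally_bounded_def)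
  have "(LINT x|lborel. h t x) = 0" if t: "t \<in> {0<..<1}" for t
    by (rule integral_deriv_kink[of "f t" "h t" C R]) (use f C sup t measurable_slice_right[OF m] in auto)
  then have "(LINT t|time. LINT x|lborel. h t x) = (LINT t|time. 0)"
    by (intro LINT_cong) simp
  then show ?thesis using strip_integral_eq_t_rho[OF integrable_locally_bounded[OF h sup]] by simp
qed

text \<open>
  The pairing of \<open>test_image\<close> and \<open>dual_pair\<close> is the integral of \<open>- T1 + T2 + T3\<close>, where \<open>T1\<close> is the
  time derivative of \<open>\<rho> m u\<^sup>2 / 2\<close> with \<open>m\<close> the multiplier, and \<open>T2\<close> is the space derivative of \<open>m u v\<close>. The
  coefficient of \<open>u\<^sup>2\<close> in \<open>T3\<close> degenerates at \<open>\<rho> = 0\<close>; this is repaired by adding a multiple of the null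
  Lagrangian \<open>T4\<close>, the space derivative of \<open>\<rho> u\<^sup>2 / sqrt (1 + \<rho>\<^sup>2)\<close>.
\<close>

definition "T1 t x = 1/2 * (x * mult_slope x * (u t x * u t x)) + x * multiplier t x * u t x * ut t x"
definition "T2 t x = (t - 1/2) * (1 / (jap x) ^ 3) * u t x * v t x + multiplier t x * ur t x * v t x + multiplier t x * u t x * vr t x"
definition "T3 t x = 1/2 * (x * mult_slope x * (u t x * u t x)) + (t - 1/2) * (1 / (jap x) ^ 3) * u t x * ur t x + multiplier t x * (ur t x * ur t x)"
definition "T4 t x = 1 / (jap x) ^ 3 * (u t x * u t x) + 2 * mult_slope x * u t x * ur t x"

lemma T_locally_bounded: "locally_bounded T1" "locally_bounded T2" "locally_bounded T3" "locally_bounded T4"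
  unfolding T1_def[abs_def] T2_def[abs_def] T3_def[abs_def] T4_def[abs_def] by (intro locally_bounded_intros)+

lemma T_support: assumes "t \<in> {0<..<1}" "\<bar>x\<bar> > R"
  shows "T1 t x = 0" "T2 t x = 0" "T3 t x = 0" "T4 t x = 0"
  using assms by (simp_all add: T1_def T2_def T3_def T4_def support)

lemma T_integrable: "integrable strip (\<lambda>(t, x). T1 t x)" "integrable strip (\<lambda>(t, x). T2 t x)"
  "integrable strip (\<lambda>(t, x). T3 t x)" "integrable strip (\<lambda>(t, x). T4 t x)"
  by (intro integrable_locally_bounded T_locally_bounded T_support; assumption)+

lemma multiplier_space_DERIV: "(multiplier t has_real_derivative (t - 1/2) * (1 / (jap x) ^ 3)) (at x)"
proof -
  have "((\<lambda>x. 2 + (t - 1/2) * mult_slope x) has_real_derivative 0 + (t - 1/2) * (1 / (jap x) ^ 3)) (at x)"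
    by (intro DERIV_add DERIV_const DERIV_cmult mult_slope_DERIV)
  then show ?thesis by (simp add: multiplier_def[abs_def])
qed

lemma integral_T2: "(LINT (t, x)|strip. T2 t x) = 0"
proof (rule integral_space_deriv[OF T_locally_bounded(2) T_support(2)])
  fix t :: real assume t: "t \<in> {0<..<1}"
  show "continuous_on UNIV (\<lambda>x. multiplier t x * u t x * v t x)"
    by (intro continuous_on_mult space_cont[OF t] DERIV_imp_continuous_on[OF multiplier_space_DERIV])
  show "((\<lambda>x. multiplier t x * u t x * v t x) has_real_derivative T2 t x) (at x)" if "x \<noteq> 0" for x
    using DERIV_mult[OF DERIV_mult[OF multiplier_space_DERIV space_deriv(1)[OF t that]] space_deriv(2)[OF t that]]
    by (simp add: T2_def algebra_simps)
qed (auto simp: support)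

lemma integral_T4: "(LINT (t, x)|strip. T4 t x) = 0"
proof (rule integral_space_deriv[OF T_locally_bounded(4) T_support(4)])
  fix t :: real assume t: "t \<in> {0<..<1}"
  show "continuous_on UNIV (\<lambda>x. mult_slope x * (u t x * u t x))"
    by (intro continuous_on_mult space_cont[OF t] DERIV_imp_continuous_on[OF mult_slope_DERIV])
  show "((\<lambda>x. mult_slope x * (u t x * u t x)) has_real_derivative T4 t x) (at x)" if "x \<noteq> 0" for x
    using DERIV_mult[OF mult_slope_DERIV DERIV_mult[OF space_deriv(1)[OF t that] space_deriv(1)[OF t that]]]
    by (simp add: T4_def algebra_simps)
qed (auto simp: support)

text \<open>For each \<open>x\<close> the end time at which \<open>u\<close> is not forced to vanish
  is the one where the boundary term has the good sign: \<open>t = 0\<close> for positive and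
  \<open>t = 1\<close> for negative \<open>x\<close>. The factor 3/4 is half of the lower bound 3/2
  of the multiplier.\<close>

lemma integral_T1: "(LINT (t, x)|strip. T1 t x) \<le> - (3/4 * boundary_energy)"
proof -
  obtain C where C: "\<And>t x. t \<in> {0<..<1} \<Longrightarrow> \<bar>T1 t x\<bar> \<le> C" using locally_bounded_bound[OF T_locally_bounded(1) T_support(1)] by blast
  have m: "plane_measurable T1" using T_locally_bounded(1) by (simp add: locally_bounded_def)
  have "(LINT t|time. T1 t x) \<le> - (3/4 * (\<bar>x\<bar> * (u 0 x + u 1 x)^2))" for x
  proof -
    have "(LINT t|time. T1 t x) = 1/2 * (x * multiplier 1 x * (u 1 x * u 1 x)) - 1/2 * (x * multiplier 0 x * (u 0 x * u 0 x))"
    proof (rule integral_deriv_time(1)[of "\<lambda>t. 1/2 * (x * multiplier t x * (u t x * u t x))" _ C])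
      have M: "((\<lambda>t. multiplier t x) has_real_derivative mult_slope x) (at t)" for t
        unfolding multiplier_def by (auto intro!: derivative_eq_intros)
      show "continuous_on {0..1} (\<lambda>t. 1/2 * (x * multiplier t x * (u t x * u t x)))"
        by (intro continuous_on_mult continuous_on_const time_cont DERIV_imp_continuous_on[OF M])
      show "((\<lambda>t. 1/2 * (x * multiplier t x * (u t x * u t x))) has_real_derivative T1 t x) (at t)" if "t \<in> {0<..<1}" for t
        using DERIV_cmult[OF DERIV_mult[OF M DERIV_mult[OF time_deriv[OF that, of x] time_deriv[OF that, of x]]], of "x / 2"]
        by (simp add: T1_def algebra_simps)
    qed (use C measurable_slice_left[OF m] in auto)
    also have "\<dots> \<le> - (3/4 * (\<bar>x\<bar> * (u 0 x + u 1 x)^2))"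
    proof (cases "x \<ge> 0")
      case True
      have "3/2 * (x * (u 0 x * u 0 x)) \<le> multiplier 0 x * (x * (u 0 x * u 0 x))"
        using multiplier_bounds(1)[of 0 x] True by (intro mult_right_mono) auto
      then show ?thesis using True final[OF True] by (simp add: power2_eq_square algebra_simps)
    next
      case False
      have "3/2 * (- x * (u 1 x * u 1 x)) \<le> multiplier 1 x * (- x * (u 1 x * u 1 x))"
        using multiplier_bounds(1)[of 1 x] False by (intro mult_right_mono mult_nonneg_nonneg[OF _ zero_le_square]) auto
      then show ?thesis using False initial[of x] by (simp add: power2_eq_square algebra_simps)
    qed
    finally show ?thesis .
  qed
  then have "(LINT x|lborel. LINT t|time. T1 t x) \<le> (LINT x|lborel. - (3/4 * (\<bar>x\<bar> * (u 0 x + u 1 x)^2)))"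
    using strip.integrable_snd[OF T_integrable(1)] boundary_integrable by (intro integral_mono) auto
  then show ?thesis
    using strip_integral_eq_rho_t[OF T_integrable(1)] by (simp add: boundary_energy_def)
qed

lemma coercivity: "1/8 * energy + 3/4 * boundary_energy \<le> (LINT p|strip. test_image p \<bullet> dual_pair p)"
proof -
  have inner: "test_image (t, x) \<bullet> dual_pair (t, x) = - T1 t x + T2 t x + T3 t x" for t x
  proof -
    have "(- (x * ut t x) + vr t x) / sqrt (jap x) * (sqrt (jap x) * (multiplier t x * u t x))
       = (- (x * ut t x) + vr t x) * (multiplier t x * u t x)" using jap_pos[of x] by simp
    then have "test_image (t, x) \<bullet> dual_pair (t, x) = (- (x * ut t x) + vr t x) * (multiplier t x * u t x)
        + (ur t x + v t x) * ((t - 1/2) * (1 / (jap x) ^ 3) * u t x + multiplier t x * ur t x)"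
      by (simp add: test_image_def dual_pair_def)
    moreover define s where "s = (t - 1/2) * (1 / (jap x) ^ 3)"
    ultimately show ?thesis unfolding T1_def T2_def T3_def s_def[symmetric] by (simp add: algebra_simps)
  qed
  have "(LINT p|strip. test_image p \<bullet> dual_pair p) = (LINT (t, x)|strip. - T1 t x + T2 t x + T3 t x)"
    by (intro LINT_cong) (auto simp: inner)
  also have "\<dots> = - (LINT (t, x)|strip. T1 t x) + (LINT (t, x)|strip. T2 t x) + (LINT (t, x)|strip. T3 t x)"
    using T_integrable by (simp add: split_beta')
  also have "\<dots> \<ge> 3/4 * boundary_energy + (LINT (t, x)|strip. T3 t x)"
    using integral_T1 integral_T2 by simp
  finally have 1: "3/4 * boundary_energy + (LINT (t, x)|strip. T3 t x) \<le> (LINT p|strip. test_image p \<bullet> dual_pair p)" .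
  have "1/8 * energy = (LINT (t, x)|strip. 1/8 * (jap x * (u t x)^2 + (ur t x)^2))"
    unfolding energy_def by (simp add: split_beta')
  also have "\<dots> \<le> (LINT (t, x)|strip. T3 t x + 1/4 * T4 t x)"
  proof (rule integral_mono)
    show "integrable strip (\<lambda>(t, x). 1/8 * (jap x * (u t x)^2 + (ur t x)^2))"
      using integrable_mult_right[OF energy_integrable, of "1/8"] by (simp add: split_beta')
    show "integrable strip (\<lambda>(t, x). T3 t x + 1/4 * T4 t x)" using T_integrable by (simp add: split_beta')
    fix p assume "p \<in> space strip"
    then obtain t x where p: "p = (t, x)" "t \<in> {0..1}" by (auto simp: space_pair_measure)
    show "(case p of (t, x) \<Rightarrow> 1/8 * (jap x * (u t x)^2 + (ur t x)^2)) \<le> (case p of (t, x) \<Rightarrow> T3 t x + 1/4 * T4 t x)"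
      using coercivity_pointwise[OF p(2), of x "u t x" "ur t x"] unfolding p(1) T3_def T4_def by (simp add: power2_eq_square)
  qed
  also have "\<dots> = (LINT (t, x)|strip. T3 t x) + 1/4 * (LINT (t, x)|strip. T4 t x)"
    using T_integrable by (simp add: split_beta')
  finally show ?thesis using 1 integral_T4 by simp
qed

lemma energy_nonneg: "0 \<le> energy"
  unfolding energy_def by (rule Bochner_Integration.integral_nonneg) (auto simp: jap_pos less_imp_le)

lemma boundary_energy_nonneg: "0 \<le> boundary_energy"
  unfolding boundary_energy_def by (rule Bochner_Integration.integral_nonneg) auto

lemma sqint_dual_pair: "sqint strip dual_pair" and integral_dual_pair: "(LINT p|strip. (norm (dual_pair p))^2) \<le> 16 * energy"
proof -
  have i: "integrable strip (\<lambda>(t, x). 16 * (jap x * (u t x)^2 + (ur t x)^2))"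
    using integrable_mult_right[OF energy_integrable, of 16] by (simp add: split_beta')
  have le: "(norm (dual_pair p))^2 \<le> (case p of (t, x) \<Rightarrow> 16 * (jap x * (u t x)^2 + (ur t x)^2))" if "p \<in> space strip" for p
  proof -
    obtain t x where p: "p = (t, x)" "t \<in> {0..1}" using \<open>p \<in> space strip\<close> by (auto simp: space_pair_measure)
    show ?thesis using norm_dual_pair_le[OF p(2), of x] p(1) by simp
  qed
  have [measurable]: "dual_pair \<in> borel_measurable strip" by (intro measurable_strip_any dual_pair_measurable)
  have i': "integrable strip (\<lambda>p. (norm (dual_pair p))^2)"
  proof (rule integrable_le[OF i])
    show "AE p in strip. norm ((norm (dual_pair p))^2) \<le> norm (case p of (t, x) \<Rightarrow> 16 * (jap x * (u t x)^2 + (ur t x)^2))"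
    proof (rule AE_I2)
      fix p assume "p \<in> space strip"
      from order_trans[OF le[OF this] abs_ge_self]
      show "norm ((norm (dual_pair p))^2) \<le> norm (case p of (t, x) \<Rightarrow> 16 * (jap x * (u t x)^2 + (ur t x)^2))"
        by simp
    qed
  qed measurable
  then show "sqint strip dual_pair" by (simp add: sqint_def)
  have "(LINT p|strip. (norm (dual_pair p))^2) \<le> (LINT (t, x)|strip. 16 * (jap x * (u t x)^2 + (ur t x)^2))"
    using le by (intro integral_mono i i')
  then show "(LINT p|strip. (norm (dual_pair p))^2) \<le> 16 * energy"
    by (simp add: energy_def split_beta' del: distrib_left_numeral)
qed

text \<open>Cauchy-Schwarz and \<open>integral_dual_pair\<close> bound the square of the coercive
  expression by \<open>16 * energy\<close> times the squared norm of the image. Cancelling one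
  factor \<open>energy\<close> gives 1024 = 64 * 16; inserting this again gives the boundary bound,
  with 128^2 = 16 * 1024.\<close>

lemma energy_le: "energy \<le> 1024 * (LINT p|strip. (norm (test_image p))^2)"
  and boundary_energy_le: "boundary_energy \<le> 256 * (LINT p|strip. (norm (test_image p))^2)"
proof -
  define x where "x = (LINT p|strip. (norm (test_image p))^2)"
  have x: "0 \<le> x" by (simp add: x_def)
  have "(1/8 * energy + 3/4 * boundary_energy)^2 \<le> (LINT p|strip. test_image p \<bullet> dual_pair p)^2"
    using coercivity energy_nonneg boundary_energy_nonneg by (intro power_mono) auto
  also have "\<dots> \<le> x * (LINT p|strip. (norm (dual_pair p))^2)"
    unfolding x_def by (rule integral_Cauchy_Schwarz[OF sqint_test_image sqint_dual_pair])
  also have "\<dots> \<le> x * (16 * energy)" by (intro mult_left_mono integral_dual_pair x)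
  finally have *: "(1/8 * energy + 3/4 * boundary_energy)^2 \<le> x * (16 * energy)" .
  have "(1/8 * energy)^2 \<le> (1/8 * energy + 3/4 * boundary_energy)^2"
    using energy_nonneg boundary_energy_nonneg by (intro power_mono) auto
  with * have "energy * energy \<le> (1024 * x) * energy" by (simp add: power2_eq_square)
  then have e: "energy \<le> 1024 * x" using energy_nonneg x by (cases "energy = 0") (auto simp: mult_le_cancel_right)
  then show "energy \<le> 1024 * (LINT p|strip. (norm (test_image p))^2)" by (simp add: x_def)
  have "(3/4 * boundary_energy)^2 \<le> (1/8 * energy + 3/4 * boundary_energy)^2"
    using energy_nonneg boundary_energy_nonneg by (intro power_mono) auto
  also have "\<dots> \<le> x * (16 * (1024 * x))" using * e x by (meson mult_left_mono order_trans zero_le_numeral)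
  also have "\<dots> = (128 * x)^2" by (simp add: power2_eq_square)
  finally have "3/4 * boundary_energy \<le> 128 * x" by (rule power2_le_imp_le) (use x in simp)
  then have "boundary_energy \<le> 256 * x" using x by argo
  then show "boundary_energy \<le> 256 * (LINT p|strip. (norm (test_image p))^2)" by (simp add: x_def)
qed

end

lemma abs_add_mult_le:
  fixes a b c :: real
  assumes "\<bar>a\<bar> \<le> B" "\<bar>b\<bar> \<le> B'"
  shows "\<bar>a + c * b\<bar> \<le> B + \<bar>c\<bar> * B'"
proof -
  have "\<bar>a + c * b\<bar> \<le> \<bar>a\<bar> + \<bar>c\<bar> * \<bar>b\<bar>" using abs_triangle_ineq[of a "c * b"] by (simp add: abs_mult)
  also have "\<dots> \<le> B + \<bar>c\<bar> * B'" using assms by (intro add_mono mult_left_mono) auto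
  finally show ?thesis .
qed

lemma test_pair_add_mult:
  assumes "test_pair f ft fr v vr R B" "test_pair f' ft' fr' v' vr' R' B'"
  shows "test_pair (\<lambda>t x. f t x + c * f' t x) (\<lambda>t x. ft t x + c * ft' t x) (\<lambda>t x. fr t x + c * fr' t x)
     (\<lambda>t x. v t x + c * v' t x) (\<lambda>t x. vr t x + c * vr' t x) (max R R') (B + \<bar>c\<bar> * B')"
proof -
  interpret a: test_pair f ft fr v vr R B by fact
  interpret b: test_pair f' ft' fr' v' vr' R' B' by fact
  note [measurable] = a.meas b.meas
  show ?thesis
  proof
    show "plane_measurable (\<lambda>t x. f t x + c * f' t x)"
      "plane_measurable (\<lambda>t x. ft t x + c * ft' t x)"
      "plane_measurable (\<lambda>t x. fr t x + c * fr' t x)"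
      "plane_measurable (\<lambda>t x. v t x + c * v' t x)"
      "plane_measurable (\<lambda>t x. vr t x + c * vr' t x)"
      by measurable
  next
    fix t x :: real assume "t \<in> {0..1}"
    then show "\<bar>f t x + c * f' t x\<bar> \<le> B + \<bar>c\<bar> * B'" "\<bar>ft t x + c * ft' t x\<bar> \<le> B + \<bar>c\<bar> * B'"
      "\<bar>fr t x + c * fr' t x\<bar> \<le> B + \<bar>c\<bar> * B'" "\<bar>v t x + c * v' t x\<bar> \<le> B + \<bar>c\<bar> * B'"
      "\<bar>vr t x + c * vr' t x\<bar> \<le> B + \<bar>c\<bar> * B'"
      by (intro abs_add_mult_le a.bounded b.bounded; assumption)+
  next
    fix t x :: real assume "t \<in> {0..1}" "max R R' < \<bar>x\<bar>"
    then show "f t x + c * f' t x = 0" "ft t x + c * ft' t x = 0" "fr t x + c * fr' t x = 0"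
      "v t x + c * v' t x = 0" "vr t x + c * vr' t x = 0"
      by (simp_all add: a.support b.support)
  next
    fix t :: real assume "t \<in> {0<..<1}"
    then show "continuous_on UNIV (\<lambda>x. f t x + c * f' t x)" "continuous_on UNIV (\<lambda>x. v t x + c * v' t x)"
      by (intro continuous_on_add continuous_on_mult continuous_on_const a.space_cont b.space_cont; assumption)+
  next
    fix t x :: real assume h: "t \<in> {0<..<1}" "x \<noteq> 0"
    show "((\<lambda>x. f t x + c * f' t x) has_real_derivative fr t x + c * fr' t x) (at x)"
      "((\<lambda>x. v t x + c * v' t x) has_real_derivative vr t x + c * vr' t x) (at x)"
      by (intro DERIV_add DERIV_cmult a.space_deriv b.space_deriv h)+
  next
    fix x show "continuous_on {0..1} (\<lambda>t. f t x + c * f' t x)"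
      by (intro continuous_on_add continuous_on_mult continuous_on_const a.time_cont b.time_cont)
  next
    fix t x :: real assume "t \<in> {0<..<1}"
    then show "((\<lambda>t. f t x + c * f' t x) has_real_derivative ft t x + c * ft' t x) (at t)"
      by (intro DERIV_add DERIV_cmult a.time_deriv b.time_deriv; assumption)+
  qed (simp_all add: a.initial b.initial a.final b.final)
qed

subsection \<open>Weak solutions for the time derivative\<close>

lemma AE_nonzero: "AE x in lborel. x \<noteq> (0::real)"
  by (rule AE_lborel_singleton)

lemma LINT_cong_nonzero:
  fixes f g :: "real \<Rightarrow> real"
  assumes "\<And>x. x \<noteq> 0 \<Longrightarrow> f x = g x"
  shows "integrable lborel f \<longleftrightarrow> integrable lborel g" "(LINT x|lborel. f x) = (LINT x|lborel. g x)"
  by (rule integrable_discrete_difference[where X="{0}"] integral_discrete_difference[where X="{0}"]; use assms in auto)+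

abbreviation pairing where
  "pairing U V ft fr v vr \<equiv> LINT (t, x)|strip. U t x * (- (x * ft t x) + vr t x) + V t x * (fr t x + v t x)"

abbreviation test_load where
  "test_load g b f \<equiv> (LINT (t, x)|strip. g t x * f t x) + (LINT x|lborel. b x * (f 0 x + f 1 x))"

text \<open>By \<open>energy_le\<close> and \<open>boundary_energy_le\<close> the load is a bounded
  functional of the image of the adjoint operator, so the Riesz theorem represents it. The
  hypothesis on \<open>b\<close> says that the lateral datum \<open>b y / \<bar>y\<bar>\<close> is
  square integrable with respect to the weight \<open>\<bar>y\<bar>\<close>.\<close>

lemma exists_weak_pair:
  fixes g :: "field" and b :: "real \<Rightarrow> real"
  assumes g: "sqint_strip g" and b: "b \<in> borel_measurable borel" "integrable lborel (\<lambda>y. (b y)^2 / \<bar>y\<bar>)"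
  obtains U V :: "field" where
    "sqint_strip (\<lambda>t y. sqrt (jap y) * U t y)" "sqint_strip V"
    "\<And>f ft fr v vr R B. test_pair f ft fr v vr R B \<Longrightarrow>
       pairing U V ft fr v vr = test_load g b f"
proof -
  note [measurable] = b(1)
  define load where "load f = test_load g b f"
    for f :: "field"
  define \<A> where "\<A> = {(X, l). \<exists>f ft fr v vr R B. test_pair f ft fr v vr R B \<and>
      X = test_pair.test_image ft fr v vr \<and> l = load f}"
  \<comment> \<open>The boundary term is split into \<open>b y / sqrt \<bar>y\<bar>\<close> and
    \<open>sqrt \<bar>y\<bar> * (f 0 y + f 1 y)\<close>, the second factor being controlled by
    \<open>boundary_energy\<close>; only \<open>y = 0\<close> is lost.\<close>
  define bw where "bw y = b y / sqrt \<bar>y\<bar>" for y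
  have bw: "sqint lborel bw"
    using b by (simp add: sqint_def bw_def[abs_def] power_divide)
  have pieces: "sqint_strip f" "sqint lborel (\<lambda>y. sqrt \<bar>y\<bar> * (f 0 y + f 1 y))"
     "(LINT (t, y)|strip. (f t y)^2) \<le> test_pair.energy f fr"
     "integrable lborel (\<lambda>y. b y * (f 0 y + f 1 y))"
     "(LINT y|lborel. b y * (f 0 y + f 1 y)) = (LINT y|lborel. bw y \<bullet> (sqrt \<bar>y\<bar> * (f 0 y + f 1 y)))"
    if tp: "test_pair f ft fr v vr R B" for f ft fr v vr R B
  proof -
    interpret test_pair f ft fr v vr R B by fact
    have le: "(f t y)^2 \<le> jap y * (f t y)^2 + (fr t y)^2" for t y
      using jap_ge_1[of y] mult_right_mono[of 1 "jap y" "(f t y)^2"] by (simp add: add_increasing2)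
    have [measurable]: "strip_measurable f" by (rule measurable_strip[OF meas(1)])
    have i: "integrable strip (\<lambda>p. (case p of (t, y) \<Rightarrow> f t y)^2)"
    proof (rule integrable_le[OF energy_integrable])
      show "AE p in strip. norm ((case p of (t, y) \<Rightarrow> f t y)^2) \<le> norm (case p of (t, y) \<Rightarrow> jap y * (f t y)^2 + (fr t y)^2)"
        using order_trans[OF le abs_ge_self] by (intro AE_I2) (auto simp: split_beta')
    qed measurable
    then show "sqint_strip f" by (simp add: sqint_def)
    show "(LINT (t, y)|strip. (f t y)^2) \<le> energy"
      unfolding energy_def using i le by (intro integral_mono energy_integrable) (auto simp: split_beta')
    show s: "sqint lborel (\<lambda>y. sqrt \<bar>y\<bar> * (f 0 y + f 1 y))"
      using boundary_integrable by (simp add: sqint_def power_mult_distrib)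
    have e: "b y * (f 0 y + f 1 y) = bw y \<bullet> (sqrt \<bar>y\<bar> * (f 0 y + f 1 y))" if "y \<noteq> 0" for y
      using that by (simp add: bw_def)
    show "(LINT y|lborel. b y * (f 0 y + f 1 y)) = (LINT y|lborel. bw y \<bullet> (sqrt \<bar>y\<bar> * (f 0 y + f 1 y)))"
      by (rule LINT_cong_nonzero(2), rule e)
    show "integrable lborel (\<lambda>y. b y * (f 0 y + f 1 y))"
      by (rule LINT_cong_nonzero(1)[THEN iffD2, OF _ integrable_inner_sqint[OF bw s]], rule e)
  qed
  have gphi: "integrable strip (\<lambda>(t, y). g t y * f t y)" if "test_pair f ft fr v vr R B" for f ft fr v vr R B
    using integrable_inner_sqint[OF g pieces(1)[OF that]] by (simp add: split_beta')
  \<comment> \<open>A positive integrable function bounded by 1 is square integrable and serves as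
    the weight in \<open>Riesz_L2\<close>.\<close>
  obtain w0 :: "real \<times> real \<Rightarrow> real" where w0: "w0 \<in> borel_measurable strip" "\<And>x. w0 x > 0" "\<And>x. w0 x \<le> 1" "integrable strip w0"
    using strip.obtain_positive_integrable_function by blast
  have "integrable strip (\<lambda>x. (w0 x)^2)"
    by (rule integrable_le[OF w0(4)])
      (use w0 in \<open>auto intro!: AE_I2 simp: power2_eq_square abs_mult mult_left_le less_imp_le\<close>)
  then have w: "sqint strip w0" using w0 by (simp add: sqint_def)
  \<comment> \<open>The factor 2 comes from squaring a sum, 1024 and 256 from the two a priori
    bounds.\<close>
  define K where "K = 2 * (LINT (t, y)|strip. (g t y)^2) * 1024 + 2 * (LINT y|lborel. (bw y)^2) * 256"
  obtain u :: "real \<times> real \<Rightarrow> real \<times> real" where u: "sqint strip u" and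
    uX: "\<And>X l. (X, l) \<in> \<A> \<Longrightarrow> l = (LINT x|strip. u x \<bullet> X x)"
  proof (rule Riesz_L2[OF w w0(2), where \<A>=\<A> and C=K])
    fix X l assume "(X, l) \<in> \<A>"
    then obtain f ft fr v vr R B where tp: "test_pair f ft fr v vr R B"
      and X: "X = test_pair.test_image ft fr v vr" and l: "l = load f" unfolding \<A>_def by blast
    interpret test_pair f ft fr v vr R B by fact
    show "sqint strip X" unfolding X by (rule sqint_test_image)
    define x where "x = (LINT p|strip. (norm (test_image p))^2)"
    have x: "x \<ge> 0" by (simp add: x_def)
    have "(LINT (t, y)|strip. g t y * f t y)^2 \<le> (LINT (t, y)|strip. (g t y)^2) * (LINT (t, y)|strip. (f t y)^2)"
      using integral_Cauchy_Schwarz[OF g pieces(1)[OF tp]] by (simp add: split_beta')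
    also have "\<dots> \<le> (LINT (t, y)|strip. (g t y)^2) * (1024 * x)"
      using pieces(3)[OF tp] energy_le unfolding x_def
      by (intro mult_left_mono order_trans[OF pieces(3)[OF tp] energy_le]) (auto intro: Bochner_Integration.integral_nonneg)
    finally have 1: "(LINT (t, y)|strip. g t y * f t y)^2 \<le> (LINT (t, y)|strip. (g t y)^2) * (1024 * x)" .
    have "(LINT y|lborel. b y * (f 0 y + f 1 y))^2 \<le> (LINT y|lborel. (bw y)^2) * boundary_energy"
      using integral_Cauchy_Schwarz[OF bw pieces(2)[OF tp]] unfolding pieces(5)[OF tp] boundary_energy_def
      by (simp add: power_mult_distrib)
    also have "\<dots> \<le> (LINT y|lborel. (bw y)^2) * (256 * x)"
      using boundary_energy_le unfolding x_def by (intro mult_left_mono) auto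
    finally have 2: "(LINT y|lborel. b y * (f 0 y + f 1 y))^2 \<le> (LINT y|lborel. (bw y)^2) * (256 * x)" .
    have "l^2 \<le> 2 * (LINT (t, y)|strip. g t y * f t y)^2 + 2 * (LINT y|lborel. b y * (f 0 y + f 1 y))^2"
      unfolding l load_def power2_sum
      using sum_squares_bound[of "LINT (t, y)|strip. g t y * f t y" "LINT y|lborel. b y * (f 0 y + f 1 y)"] by simp
    also have "\<dots> \<le> 2 * ((LINT (t, y)|strip. (g t y)^2) * (1024 * x)) + 2 * ((LINT y|lborel. (bw y)^2) * (256 * x))"
      using 1 2 by simp
    also have "\<dots> = K * x" unfolding K_def by (simp add: algebra_simps)
    finally show "l^2 \<le> K * (LINT x|strip. (norm (X x))^2)" unfolding x_def X .
  next
    fix X l Y k c assume "(X, l) \<in> \<A>" "(Y, k) \<in> \<A>"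
    then obtain f ft fr v vr R B f' ft' fr' v' vr' R' B' where tp: "test_pair f ft fr v vr R B"
      and X: "X = test_pair.test_image ft fr v vr" "l = load f"
      and tp': "test_pair f' ft' fr' v' vr' R' B'"
      and Y: "Y = test_pair.test_image ft' fr' v' vr'" "k = load f'" unfolding \<A>_def by blast
    note sum = test_pair_add_mult[OF tp tp', of c]
    have "(\<lambda>x. X x + c *\<^sub>R Y x) = test_pair.test_image (\<lambda>t y. ft t y + c * ft' t y) (\<lambda>t y. fr t y + c * fr' t y)
       (\<lambda>t y. v t y + c * v' t y) (\<lambda>t y. vr t y + c * vr' t y)"
      unfolding X Y test_pair.test_image_def[OF tp] test_pair.test_image_def[OF tp'] test_pair.test_image_def[OF sum]
      by (auto simp: fun_eq_iff algebra_simps add_divide_distrib diff_divide_distrib)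
    moreover have "l + c * k = load (\<lambda>t y. f t y + c * f' t y)"
    proof -
      have "(LINT (t, y)|strip. g t y * (f t y + c * f' t y)) =
        (LINT (t, y)|strip. g t y * f t y) + c * (LINT (t, y)|strip. g t y * f' t y)"
        using gphi[OF tp] gphi[OF tp'] unfolding split_beta'
        by (simp add: distrib_left mult.left_commute[of _ c] del: mult.left_commute)
      moreover have "(LINT y|lborel. b y * (f 0 y + c * f' 0 y + (f 1 y + c * f' 1 y))) =
         (LINT y|lborel. b y * (f 0 y + f 1 y) + c * (b y * (f' 0 y + f' 1 y)))"
        by (intro LINT_cong) (simp add: algebra_simps)
      moreover have "\<dots> = (LINT y|lborel. b y * (f 0 y + f 1 y)) + c * (LINT y|lborel. b y * (f' 0 y + f' 1 y))"
        using pieces(4)[OF tp] pieces(4)[OF tp'] by simp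
      ultimately show ?thesis unfolding X Y load_def by (simp add: algebra_simps)
    qed
    ultimately show "((\<lambda>x. X x + c *\<^sub>R Y x), l + c * k) \<in> \<A>" unfolding \<A>_def using sum by blast
  next
    have "test_pair (\<lambda>_ _. 0) (\<lambda>_ _. 0) (\<lambda>_ _. 0) (\<lambda>_ _. 0) (\<lambda>_ _. 0) 0 0" by standard auto
    then show "\<A> \<noteq> {}" unfolding \<A>_def by blast
  qed blast
  have um: "u \<in> borel_measurable strip" using u by (simp add: sqint_def)
  have fu: "(\<lambda>p. fst (u p)) \<in> borel_measurable strip" "(\<lambda>p. snd (u p)) \<in> borel_measurable strip"
    using um by (auto simp: borel_prod[symmetric])
  have nu: "(norm (u p))^2 = (fst (u p))^2 + (snd (u p))^2" for p by (cases "u p") (simp add: norm_Pair)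
  have su: "sqint strip (\<lambda>p. fst (u p))" "sqint strip (\<lambda>p. snd (u p))"
    unfolding sqint_def using fu u
    by (auto intro!: integrable_le[OF sqint_integrable[OF u]] AE_I2 simp: nu)
  define U V where "U t y = fst (u (t, y)) / sqrt (jap y)" and "V t y = snd (u (t, y))" for t y
  have U: "sqrt (jap y) * U t y = fst (u (t, y))" for t y using jap_pos[of y] by (simp add: U_def)
  show thesis
  proof (rule that[of U V])
    show "sqint_strip (\<lambda>t y. sqrt (jap y) * U t y)" unfolding U using su(1) by (simp add: split_beta')
    show "sqint_strip V" unfolding V_def using su(2) by (simp add: split_beta')
    fix f ft fr v vr R B assume tp: "test_pair f ft fr v vr R B"
    have "pairing U V ft fr v vr
       = (LINT p|strip. u p \<bullet> test_pair.test_image ft fr v vr p)"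
      by (intro LINT_cong)
       (auto simp: test_pair.test_image_def[OF tp] U_def V_def inner_prod_def)
    also have "\<dots> = load f" using tp by (intro uX[symmetric]) (unfold \<A>_def, blast)
    finally show "pairing U V ft fr v vr = test_load g b f" by (simp add: load_def)
  qed
qed

subsection \<open>Integration in time\<close>

definition tint :: "(real \<Rightarrow> real) \<Rightarrow> real \<Rightarrow> real" where
  "tint g t = (LINT s|time. indicator {..t} s * g s)"

lemma integrable_time_indicator:
  fixes g :: "real \<Rightarrow> real"
  assumes "integrable time g"
  shows "integrable time (\<lambda>s. indicator {..t} s * g s)"
proof (rule integrable_le[OF assms])
  have [measurable]: "g \<in> borel_measurable time" using assms by auto
  have [measurable]: "(\<lambda>s. indicator {..t} s :: real) \<in> borel_measurable time" by (rule measurable_time) simp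
  show "(\<lambda>s. indicator {..t} s * g s) \<in> borel_measurable time" by measurable
qed (auto simp: indicator_def)

lemma tint_0: "tint g 0 = 0"
proof -
  have "tint g 0 = (LINT s|time. 0)" unfolding tint_def
    by (intro LINT_cong) (auto simp: indicator_def)
  then show ?thesis by simp
qed

lemma tint_1: "tint g 1 = (LINT s|time. g s)"
  unfolding tint_def by (intro LINT_cong) (auto simp: indicator_def)

lemma locally_integrable_time:
  assumes "integrable time g"
  shows "locally_integrable (\<lambda>s. indicator {0<..<1} s * g s)"
proof -
  have i: "integrable lborel (\<lambda>s. indicator {0<..<1} s * g s)" using assms by (simp add: integrable_time_iff)
  show ?thesis unfolding locally_integrable_def
    using integrable_mult_indicator[OF _ i] by simp
qed

lemma tint_eq_prim:
  assumes "t \<in> {0..1}"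
  shows "tint g t = prim (\<lambda>s. indicator {0<..<1} s * g s) t"
  unfolding tint_def prim_def integral_time
  by (intro LINT_cong) (use assms in \<open>auto simp: indicator_def interval_sign_def\<close>)

lemma tint_continuous: "integrable time g \<Longrightarrow> continuous_on {0..1} (tint g)"
  by (rule continuous_on_eq[OF continuous_on_subset[OF prim_continuous[OF locally_integrable_time]]])
    (simp_all add: tint_eq_prim)

lemma time_du_Bois_Reymond:
  assumes f: "integrable time f" and g: "integrable time g"
    and test: "\<And>u. u \<in> test_family {0<..<1} \<Longrightarrow> (LINT t|time. deriv u t * f t) = - (LINT t|time. u t * g t)"
  obtains c where "AE t in time. f t = c + tint g t"
proof -
  have I: "open {0<..<1::real}" "is_interval {0<..<1::real}" "{0<..<1::real} \<noteq> {}" by (auto simp: is_interval_oo)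
  obtain c where "AE t in lborel. t \<in> {0<..<1} \<longrightarrow> indicator {0<..<1} t * f t = c + prim (\<lambda>s. indicator {0<..<1} s * g s) t"
  proof (rule du_Bois_Reymond[OF I locally_integrable_time[OF f] locally_integrable_time[OF g]])
    fix u :: "real \<Rightarrow> real" assume "u \<in> test_family {0<..<1}"
    from test[OF this] show "(LINT x|lborel. deriv u x * (indicator {0<..<1} x * f x)) = - (LINT x|lborel. u x * (indicator {0<..<1} x * g x))"
      by (simp add: integral_time mult.left_commute)
  qed blast
  then have "AE t in time. f t = c + tint g t"
    unfolding AE_time_iff by eventually_elim (auto simp: tint_eq_prim)
  then show thesis by (rule that)
qed

lemma integrable_time_times:
  fixes g E :: "real \<Rightarrow> real"
  assumes "integrable time g" "E \<in> borel_measurable borel" "\<And>t. t \<in> {0<..<1} \<Longrightarrow> \<bar>E t\<bar> \<le> C"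
  shows "integrable time (\<lambda>t. E t * g t)"
proof (rule integrable_le)
  show "integrable time (\<lambda>t. C * g t)" using assms by simp
  have [measurable]: "g \<in> borel_measurable time" "E \<in> borel_measurable time" using assms measurable_time by auto
  show "(\<lambda>t. E t * g t) \<in> borel_measurable time" by measurable
  show "AE t in time. norm (E t * g t) \<le> norm (C * g t)"
  proof (rule AE_I2)
    fix t assume "t \<in> space time"
    then have "\<bar>E t\<bar> \<le> \<bar>C\<bar>" using assms(3)[of t] by auto
    then show "norm (E t * g t) \<le> norm (C * g t)" by (simp add: abs_mult mult_right_mono)
  qed
qed

text \<open>Integration by parts against \<open>1 - t\<close>, which vanishes at the final time. The
  time weights \<open>1 - t\<close> and \<open>t\<close> of the half-line identities below produce
  means of \<open>tint\<close> in this way.\<close>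

lemma integral_tint:
  assumes g: "integrable time g"
  shows "(LINT t|time. tint g t) = (LINT t|time. (1 - t) * g t)"
proof -
  have "(LINT x|lborel. indicator {0..1} x * (1 * (LINT s|lborel. indicator {0..x} s * (indicator {0<..<1} s * g s)))) =
     1 * (LINT s|lborel. indicator {0..1} s * (indicator {0<..<1} s * g s)) - (LINT x|lborel. indicator {0..1} x * (x * (indicator {0<..<1} x * g x)))"
    using g by (intro integral_by_parts_primitive[of 0 1 "\<lambda>x. x"]) (auto simp: integrable_time_iff)
  moreover have "(LINT x|lborel. indicator {0..1} x * (1 * (LINT s|lborel. indicator {0..x} s * (indicator {0<..<1} s * g s)))) = (LINT t|time. tint g t)"
  proof -
    have "(LINT x|lborel. indicator {0..1} x * (1 * (LINT s|lborel. indicator {0..x} s * (indicator {0<..<1} s * g s)))) =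
      (LINT x|lborel. indicator {0..1} x * prim (\<lambda>s. indicator {0<..<1} s * g s) x)"
      unfolding prim_def
      by (intro LINT_cong) (auto simp: indicator_def interval_sign_def intro!: Bochner_Integration.integral_cong)
    also have "\<dots> = (LINT t|time. prim (\<lambda>s. indicator {0<..<1} s * g s) t)"
      by (intro integral_time_Icc[symmetric] borel_measurable_continuous_onI prim_continuous locally_integrable_time g)
    also have "\<dots> = (LINT t|time. tint g t)"
      by (intro LINT_cong) (simp add: tint_eq_prim)
    finally show ?thesis .
  qed
  moreover have "(LINT s|lborel. indicator {0..1} s * (indicator {0<..<1} s * g s)) = (LINT t|time. g t)"
    unfolding integral_time by (intro LINT_cong) (auto simp: indicator_def)
  moreover have "(LINT x|lborel. indicator {0..1} x * (x * (indicator {0<..<1} x * g x))) = (LINT t|time. t * g t)"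
    unfolding integral_time by (intro LINT_cong) (auto simp: indicator_def)
  moreover have "(LINT t|time. (1 - t) * g t) = (LINT t|time. g t) - (LINT t|time. t * g t)"
    unfolding left_diff_distrib mult_1 by (intro LINT_diff g integrable_time_times[where C=1]) auto
  ultimately show ?thesis by simp
qed

text \<open>The points of agreement are dense, so continuity extends the equality to the end times 0
  and 1, where traces are read off.\<close>

lemma time_AE_eq_imp_eq:
  fixes f g :: "real \<Rightarrow> real"
  assumes "AE t in time. f t = g t" "continuous_on {0..1} f" "continuous_on {0..1} g" "t \<in> {0..1}"
  shows "f t = g t"
proof -
  let ?D = "{t\<in>{0<..<1}. f t = g t}"
  have "{0<..<1} \<subseteq> closure ?D"
  proof
    fix x :: real assume x: "x \<in> {0<..<1}"
    show "x \<in> closure ?D" unfolding closure_approachable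
    proof (intro allI impI)
      fix e :: real assume e: "e > 0"
      define a b where "a = max 0 (x - e)" and "b = min 1 (x + e)"
      have ab: "a < b" "a < x" "x < b" using x e by (auto simp: a_def b_def)
      show "\<exists>y\<in>?D. dist y x < e"
      proof (rule ccontr)
        assume "\<not> ?thesis"
        have none: "f y \<noteq> g y" if "y \<in> {a<..<b}" for y
        proof
          assume "f y = g y"
          moreover have "0 < y" "y < 1" "dist y x < e" using that by (auto simp: a_def b_def dist_real_def)
          ultimately show False using \<open>\<not> (\<exists>y\<in>?D. dist y x < e)\<close> by auto
        qed
        have "AE y in lborel. y \<notin> {a<..<b}"
          using assms(1) unfolding AE_time_iff by eventually_elim (use none in \<open>auto simp: a_def b_def\<close>)
        then have "emeasure lborel {a<..<b} = 0" by (subst (asm) AE_iff_null_sets[symmetric]) (auto simp: null_sets_def)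
        then show False using ab by simp
      qed
    qed
  qed
  from closure_mono[OF this] have "{0..1} \<subseteq> closure ?D" by (simp add: closure_greaterThanLessThan)
  moreover have "closure ?D \<subseteq> {0..1}" by (rule closure_minimal) auto
  ultimately have cl: "closure ?D = {0..1}" by (rule equalityI[rotated])
  have "f t - g t = 0"
    by (rule continuous_constant_on_closure[of ?D "\<lambda>t. f t - g t"]) (use assms cl in \<open>auto intro!: continuous_on_diff\<close>)
  then show ?thesis by simp
qed

section \<open>Slices, weak time derivatives and traces\<close>

lemma sqint_cong_AE:
  assumes "sqint M f" "AE x in M. f x = g x" "g \<in> borel_measurable M"
  shows "sqint M g"
proof -
  have "integrable M (\<lambda>x. (norm (g x))^2)"
    using assms by (intro integrable_cong_AE[THEN iffD1, OF _ _ _ sqint_integrable[OF assms(1)]]) (auto simp: sqint_def)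
  then show ?thesis using assms(3) by (simp add: sqint_def)
qed

lemma sqint_mult_bounded:
  fixes f k :: "'a \<Rightarrow> real"
  assumes f: "sqint M f" and [measurable]: "k \<in> borel_measurable M" and k: "\<And>x. x \<in> space M \<Longrightarrow> \<bar>k x\<bar> \<le> C"
  shows "sqint M (\<lambda>x. k x * f x)"
proof -
  have [measurable]: "f \<in> borel_measurable M" using f by (simp add: sqint_def)
  have "integrable M (\<lambda>x. (norm (k x * f x))^2)"
  proof (rule integrable_le[OF integrable_mult_right[OF sqint_integrable[OF f], of "C^2"]])
    show "AE x in M. norm ((norm (k x * f x))^2) \<le> norm (C^2 * (norm (f x))^2)"
    proof (rule AE_I2)
      fix x assume "x \<in> space M"
      then have "\<bar>k x\<bar> \<le> \<bar>C\<bar>" using k[of x] by auto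
      then have "(k x)^2 \<le> C^2" by (simp only: abs_le_square_iff)
      then show "norm ((norm (k x * f x))^2) \<le> norm (C^2 * (norm (f x))^2)"
        by (simp add: power_mult_distrib mult_right_mono)
    qed
  qed measurable
  then show ?thesis by (simp add: sqint_def)
qed

lemma sqint_strip_space:
  assumes "sqint lborel k"
  shows "sqint_strip (\<lambda>t x. k x)"
proof -
  have "integrable strip (\<lambda>(t, x). 1 * (norm (k x))^2)"
    by (rule strip.integrable_pair_mult) (use assms in \<open>auto simp: sqint_def\<close>)
  moreover have "strip_measurable (\<lambda>t x. k x)"
    using sqint_measurable[OF assms] by measurable
  ultimately show ?thesis by (simp add: sqint_def split_beta')
qed

text \<open>Pairing with a spatial test function reduces statements about fields to scalar functions
  of time, to which \<open>time_du_Bois_Reymond\<close> applies.\<close>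

definition slice :: "field \<Rightarrow> (real \<Rightarrow> real) \<Rightarrow> real \<Rightarrow> real" where
  "slice F k t = (LINT x|lborel. F t x * k x)"

lemma integrable_strip_slice:
  fixes F :: "field" and k :: "real \<Rightarrow> real"
  assumes "sqint_strip F" "sqint lborel k"
  shows "integrable strip (\<lambda>(t, x). F t x * k x)"
  using integrable_inner_sqint[OF assms(1) sqint_strip_space[OF assms(2)]] by (simp add: split_beta')

lemma integrable_slice:
  fixes F :: "field" and k :: "real \<Rightarrow> real"
  assumes "sqint_strip F" "sqint lborel k"
  shows "integrable time (slice F k)"
  unfolding slice_def[abs_def] using strip.integrable_fst[OF integrable_strip_slice[OF assms]] .

lemma integrable_strip_time_slice:
  fixes F :: "field" and k :: "real \<Rightarrow> real"
  assumes F: "sqint_strip F" and k: "sqint lborel k"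
    and E: "E \<in> borel_measurable borel" "\<And>t. t \<in> {0<..<1} \<Longrightarrow> \<bar>E t\<bar> \<le> C"
  shows "integrable strip (\<lambda>(t, x). E t * (F t x * k x))"
    and "(LINT (t, x)|strip. E t * (F t x * k x)) = (LINT t|time. E t * slice F k t)"
proof -
  have [measurable]: "strip_measurable (\<lambda>t x. E t)" using measurable_time[OF E(1)] by measurable
  have "sqint strip (\<lambda>p. (case p of (t, x) \<Rightarrow> E t) * (case p of (t, x) \<Rightarrow> F t x))"
    by (rule sqint_mult_bounded[OF F, where C=C]) (use E in \<open>auto simp: space_pair_measure\<close>)
  then have "sqint_strip (\<lambda>t x. E t * F t x)" by (simp add: split_beta')
  from integrable_strip_slice[OF this k] show i: "integrable strip (\<lambda>(t, x). E t * (F t x * k x))" by (simp add: mult.assoc)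
  show "(LINT (t, x)|strip. E t * (F t x * k x)) = (LINT t|time. E t * slice F k t)"
    unfolding strip_integral_eq_t_rho[OF i] slice_def by simp
qed

lemma open_unit: "open {0<..<1::real}"
  by simp

lemma Cc_infty_bounded:
  assumes "u \<in> Cc_infty S" "open S"
  obtains B where "B \<ge> 0" "\<And>t. t \<in> {a..b} \<Longrightarrow> \<bar>u t\<bar> \<le> B" "\<And>t. t \<in> {a..b} \<Longrightarrow> \<bar>deriv u t\<bar> \<le> B"
proof -
  obtain B1 where B1: "B1 \<ge> 0" "\<And>x. x \<in> {a..b} \<Longrightarrow> \<bar>u x\<bar> \<le> B1"
    using bounded_on_Icc[OF Cc_infty_open_continuous[OF assms]] by metis
  obtain B2 where B2: "B2 \<ge> 0" "\<And>x. x \<in> {a..b} \<Longrightarrow> \<bar>deriv u x\<bar> \<le> B2"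
    using bounded_on_Icc[OF Cc_infty_open_continuous[OF deriv_Cc_infty[OF assms] assms(2)]] by metis
  show thesis by (rule that[of "max B1 B2"]) (use B1 B2 in \<open>auto simp: le_max_iff_disj\<close>)
qed

lemma Cc_infty_measurable: "u \<in> Cc_infty S \<Longrightarrow> open S \<Longrightarrow> u \<in> borel_measurable borel"
  by (intro borel_measurable_continuous_onI Cc_infty_open_continuous)

text \<open>Fubini's theorem turns the identity for almost every \<open>x\<close> into a weak time
  derivative of the scalar function \<open>slice G k\<close>.\<close>

lemma slice_weak_time_deriv:
  assumes G: "sqint_strip G" and g: "sqint_strip g"
    and w: "has_weak_time_deriv G g" and k: "sqint lborel k"
  obtains c where "AE t in time. slice G k t = c + tint (slice g k) t"
proof (rule time_du_Bois_Reymond[OF integrable_slice[OF G k] integrable_slice[OF g k]])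
  fix u :: "real \<Rightarrow> real" assume "u \<in> test_family {0<..<1}"
  then have u: "u \<in> Cc_infty {0<..<1}" using test_family_subset[of "{0<..<1}"] by (auto simp: is_interval_oo)
  obtain B where B: "\<And>t. t \<in> {0..1} \<Longrightarrow> \<bar>u t\<bar> \<le> B" "\<And>t. t \<in> {0..1} \<Longrightarrow> \<bar>deriv u t\<bar> \<le> B"
    using Cc_infty_bounded[OF u open_unit, of 0 1] by metis
  have m: "u \<in> borel_measurable borel" "deriv u \<in> borel_measurable borel"
    using Cc_infty_measurable[OF u] Cc_infty_measurable[OF deriv_Cc_infty[OF u]] by auto
  have i1: "integrable strip (\<lambda>(t, x). deriv u t * (G t x * k x))" and e1: "(LINT (t, x)|strip. deriv u t * (G t x * k x)) = (LINT t|time. deriv u t * slice G k t)"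
    using integrable_strip_time_slice[OF G k m(2), of B] B by auto
  have i2: "integrable strip (\<lambda>(t, x). u t * (g t x * k x))" and e2: "(LINT (t, x)|strip. u t * (g t x * k x)) = (LINT t|time. u t * slice g k t)"
    using integrable_strip_time_slice[OF g k m(1), of B] B by auto
  have ae: "AE x in lborel. (LINT t|time. deriv u t * G t x) = - (LINT t|time. u t * g t x)"
    using w u by (auto simp: has_weak_time_deriv_def)
  have "(LINT x|lborel. LINT t|time. deriv u t * (G t x * k x)) = (LINT x|lborel. - (LINT t|time. u t * (g t x * k x)))"
  proof (rule integral_cong_AE)
    show "(\<lambda>x. LINT t|time. deriv u t * (G t x * k x)) \<in> borel_measurable lborel"
      using strip.integrable_snd[OF i1] by auto
    show "(\<lambda>x. - (LINT t|time. u t * (g t x * k x))) \<in> borel_measurable lborel"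
      using strip.integrable_snd[OF i2] by auto
    show "AE x in lborel. (LINT t|time. deriv u t * (G t x * k x)) = - (LINT t|time. u t * (g t x * k x))"
      using ae by eventually_elim (simp add: mult.assoc[symmetric])
  qed
  then show "(LINT t|time. deriv u t * slice G k t) = - (LINT t|time. u t * slice g k t)"
    unfolding e1[symmetric] e2[symmetric] strip_integral_eq_rho_t[OF i1] strip_integral_eq_rho_t[OF i2] by simp
qed

lemma C0_L2_slice_continuous:
  assumes H: "H \<in> C0_L2 I" and k: "sqint lborel k"
  shows "continuous_on I (slice H k)"
  unfolding continuous_on_def
proof
  fix s assume s: "s \<in> I"
  have sq: "sqint lborel (H t)" if "t \<in> I" for t using H that by (auto simp: C0_L2_def sqint_eq_square_integrable)
  have lim: "((\<lambda>t. LINT x|lborel. (H t x - H s x)^2) \<longlongrightarrow> 0) (at s within I)" using H s by (auto simp: C0_L2_def)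
  have "((\<lambda>t. slice H k t - slice H k s) \<longlongrightarrow> 0) (at s within I)"
  proof (rule Lim_null_comparison)
    show "\<forall>\<^sub>F t in at s within I. norm (slice H k t - slice H k s) \<le> sqrt ((LINT x|lborel. (H t x - H s x)^2) * (LINT x|lborel. (k x)^2))"
      unfolding eventually_at_filter
    proof (intro always_eventually allI impI)
      fix t assume t: "t \<in> I"
      have "slice H k t - slice H k s = (LINT x|lborel. (H t x - H s x) \<bullet> k x)"
        using integrable_inner_sqint[OF sq[OF t] k] integrable_inner_sqint[OF sq[OF s] k]
        by (simp add: slice_def left_diff_distrib)
      then have "(slice H k t - slice H k s)^2 \<le> (LINT x|lborel. (H t x - H s x)^2) * (LINT x|lborel. (k x)^2)"
        using integral_Cauchy_Schwarz[OF sqint_diff[OF sq[OF t] sq[OF s]] k] by simp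
      then show "norm (slice H k t - slice H k s) \<le> sqrt ((LINT x|lborel. (H t x - H s x)^2) * (LINT x|lborel. (k x)^2))"
        by (intro real_le_rsqrt) simp
    qed
    have "((\<lambda>t. sqrt ((LINT x|lborel. (H t x - H s x)^2) * (LINT x|lborel. (k x)^2))) \<longlongrightarrow> sqrt (0 * (LINT x|lborel. (k x)^2))) (at s within I)"
      by (intro tendsto_intros lim)
    then show "((\<lambda>t. sqrt ((LINT x|lborel. (H t x - H s x)^2) * (LINT x|lborel. (k x)^2))) \<longlongrightarrow> 0) (at s within I)" by simp
  qed
  then show "(slice H k \<longlongrightarrow> slice H k s) (at s within I)" by (rule Lim_null[THEN iffD2])
qed

text \<open>Both sides are continuous up to the end times and agree almost everywhere in between.
  This ties the constant \<open>c\<close> to the traces of the source at 0 and at 1.\<close>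

lemma time_trace_slice:
  assumes G: "sqint_strip G" and g: "sqint_strip g" and k: "sqint lborel k"
    and c: "AE t in time. slice G k t = c + tint (slice g k) t"
    and tr: "time_trace G s Gs" and s: "s \<in> {0..1}"
  shows "(LINT x|lborel. Gs x * k x) = c + tint (slice g k) s"
proof -
  obtain H where H: "H \<in> C0_L2 {0..1}" "AE (t, x) in strip. G t x = H t x" "H s = Gs"
    using tr by (auto simp: time_trace_def)
  have "AE t in time. AE x in lborel. G t x = H t x"
    using strip.AE_pair[OF H(2)] by simp
  moreover have "AE t in time. slice G k t = c + tint (slice g k) t" by (rule c)
  moreover have "AE t in time. t \<in> space time" by (rule AE_space)
  ultimately have "AE t in time. slice H k t = c + tint (slice g k) t"
  proof eventually_elim
    case (elim t)
    have mG: "G t \<in> borel_measurable lborel"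
      using measurable_Pair2[OF sqint_measurable[OF G] elim(3)] by simp
    have mH: "H t \<in> borel_measurable lborel" using H(1) elim(3) by (auto simp: C0_L2_def square_integrable_def)
    have "slice H k t = slice G k t" unfolding slice_def
      using elim(1) mG mH sqint_measurable[OF k] by (intro integral_cong_AE) (auto elim: eventually_mono)
    with elim(2) show ?case by simp
  qed
  then have "slice H k s = c + tint (slice g k) s"
    by (rule time_AE_eq_imp_eq)
      (use s in \<open>auto intro!: C0_L2_slice_continuous H k continuous_on_add continuous_on_const tint_continuous integrable_slice g\<close>)
  then show ?thesis by (simp add: slice_def H(3))
qed

lemma sqint_locally_integrable:
  fixes f :: "real \<Rightarrow> real"
  assumes f: "sqint lborel f"
  shows "locally_integrable f"
  unfolding locally_integrable_def
proof
  fix R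
  have "sqint lborel (indicator {-R..R} :: real \<Rightarrow> real)"
  proof -
    have "integrable lborel (indicator {-R..R} :: real \<Rightarrow> real)" by (auto simp: emeasure_lborel_Icc_eq)
    moreover have "(\<lambda>x. (norm (indicator {-R..R} x :: real))^2) = indicator {-R..R}" by (auto simp: fun_eq_iff indicator_def)
    ultimately show ?thesis by (simp add: sqint_def)
  qed
  from integrable_inner_sqint[OF this f] show "integrable lborel (\<lambda>r. indicator {-R..R} r * f r)" by simp
qed

lemma AE_sqint_slice:
  fixes F :: "field"
  assumes "sqint_strip F"
  shows "AE t in time. sqint lborel (F t)"
proof -
  have "integrable strip (\<lambda>(t, x). (F t x)^2)" using sqint_integrable[OF assms] by (simp add: split_beta')
  from strip.AE_integrable_fst[OF this] AE_space show ?thesis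
  proof eventually_elim
    case (elim t)
    have "F t \<in> borel_measurable lborel" using measurable_Pair2[OF sqint_measurable[OF assms] elim(2)] by simp
    with elim(1) show ?case by (simp add: sqint_def)
  qed
qed

lemma sqint_le:
  fixes f :: "'a \<Rightarrow> real" and h :: "'a \<Rightarrow> real"
  assumes "sqint M f" "h \<in> borel_measurable M" "\<And>x. x \<in> space M \<Longrightarrow> \<bar>h x\<bar> \<le> \<bar>f x\<bar>"
  shows "sqint M h"
proof -
  have "integrable M (\<lambda>x. (norm (h x))^2)"
  proof (rule integrable_le[OF sqint_integrable[OF assms(1)]])
    show "AE x in M. norm ((norm (h x))^2) \<le> norm ((norm (f x))^2)"
      using assms(3) by (intro AE_I2) (simp add: abs_le_square_iff)
  qed (use assms in measurable)
  then show ?thesis using assms by (simp add: sqint_def)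
qed

lemma prim_measurable_strip:
  assumes "strip_measurable V"
  shows "strip_measurable (\<lambda>t y. prim (V t) y)"
proof -
  have "(\<lambda>x. (fst (fst x), snd x)) \<in> strip \<Otimes>\<^sub>M lborel \<rightarrow>\<^sub>M strip" by measurable
  from measurable_compose[OF this assms]
  have [measurable]: "(\<lambda>x. V (fst (fst x)) (snd x)) \<in> borel_measurable (strip \<Otimes>\<^sub>M lborel)" by simp
  have "(\<lambda>x. (snd (fst x), snd x)) \<in> strip \<Otimes>\<^sub>M lborel \<rightarrow>\<^sub>M (borel \<Otimes>\<^sub>M borel :: (real \<times> real) measure)" by measurable
  from measurable_compose[OF this interval_sign_measurable]
  have [measurable]: "(\<lambda>x. interval_sign (snd (fst x)) (snd x)) \<in> borel_measurable (strip \<Otimes>\<^sub>M lborel)" by simp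
  have "(\<lambda>p. LINT r|lborel. interval_sign (snd p) r * V (fst p) r) \<in> borel_measurable strip"
    by (rule lborel.borel_measurable_lebesgue_integral) (simp add: split_beta')
  then show ?thesis by (simp add: prim_def split_beta')
qed

lemma abs_prim_le:
  assumes g: "locally_integrable g" and x: "\<bar>x\<bar> \<le> R"
  shows "\<bar>prim g x\<bar> \<le> (LINT r|lborel. indicator {-R..R} r * \<bar>g r\<bar>)"
proof -
  have i: "integrable lborel (\<lambda>r. indicator {-R..R} r * \<bar>g r\<bar>)"
    using integrable_abs[OF locally_integrable_Icc[OF g, of "-R" R]] by (simp add: abs_mult)
  have "\<bar>prim g x\<bar> \<le> (LINT r|lborel. \<bar>interval_sign x r * g r\<bar>)"
    unfolding prim_def by (rule integral_abs_bound)
  also have "\<dots> \<le> (LINT r|lborel. indicator {-R..R} r * \<bar>g r\<bar>)"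
  proof (rule integral_mono)
    show "integrable lborel (\<lambda>r. \<bar>interval_sign x r * g r\<bar>)" by (intro integrable_abs prim_integrable g)
    fix r
    have "\<bar>interval_sign x r\<bar> \<le> indicator {-R..R} r"
      using x by (intro order_trans[OF abs_interval_sign_le]) (auto simp: indicator_def)
    then show "\<bar>interval_sign x r * g r\<bar> \<le> indicator {-R..R} r * \<bar>g r\<bar>" by (simp add: abs_mult mult_right_mono)
  qed (rule i)
  finally show ?thesis .
qed

lemma AE_strip_eqI:
  fixes f g :: "field"
  assumes f: "strip_measurable f" and g: "strip_measurable g"
    and eq: "AE t in time. AE x in lborel. f t x = g t x"
  shows "AE (t, x) in strip. f t x = g t x"
proof (rule strip.AE_pair_measure)
  note [measurable] = f g
  have "{p \<in> space strip. (case p of (t, x) \<Rightarrow> f t x) = (case p of (t, x) \<Rightarrow> g t x)} \<in> sets strip" by measurable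
  then show "{p \<in> space strip. case p of (t, x) \<Rightarrow> f t x = g t x} \<in> sets strip" by (simp add: split_beta')
qed (use eq in simp)

lemma Cc_infty_UNIV_bounds:
  assumes u: "u \<in> Cc_infty UNIV"
  obtains R B where "R > 0" "B \<ge> 0" "\<And>x. \<bar>x\<bar> \<ge> R \<Longrightarrow> u x = 0" "\<And>x. \<bar>u x\<bar> \<le> B"
proof -
  obtain K where K: "compact K" "\<And>x. x \<notin> K \<Longrightarrow> u x = 0" using Cc_inftyE[OF u] by metis
  obtain r where r: "\<And>x. x \<in> K \<Longrightarrow> \<bar>x\<bar> \<le> r" using compact_imp_bounded[OF K(1)] by (auto simp: bounded_iff)
  define R where "R = \<bar>r\<bar> + 1"
  have z: "u x = 0" if "\<bar>x\<bar> \<ge> R" for x using K(2)[of x] r[of x] that unfolding R_def by force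
  obtain B where B: "B \<ge> 0" "\<And>t. t \<in> {-R..R} \<Longrightarrow> \<bar>u t\<bar> \<le> B" using Cc_infty_bounded[OF u open_UNIV, of "-R" R] by metis
  have "\<bar>u x\<bar> \<le> B" for x
  proof (cases "\<bar>x\<bar> \<ge> R")
    case True then show ?thesis using z B(1) by simp
  next
    case False
    then have "x \<in> {-R..R}" by (auto simp: abs_if split: if_splits)
    then show ?thesis by (rule B(2))
  qed
  with z B(1) show thesis by (intro that[of R B]) (auto simp: R_def)
qed

lemma Cc_infty_sqint:
  assumes u: "u \<in> Cc_infty UNIV"
  shows "sqint lborel u"
proof -
  obtain R B where RB: "B \<ge> 0" "\<And>x. \<bar>x\<bar> \<ge> R \<Longrightarrow> u x = 0" "\<And>x. \<bar>u x\<bar> \<le> B"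
    using Cc_infty_UNIV_bounds[OF u] by metis
  have [measurable]: "u \<in> borel_measurable borel" by (rule Cc_infty_measurable[OF u open_UNIV])
  have "integrable lborel (\<lambda>x. (u x)^2)"
  proof (rule integrable_bounded_support[where C="B^2" and R=R])
    show "\<bar>(u x)\<^sup>2\<bar> \<le> B^2" for x using RB(1) RB(3)[of x] by (simp add: abs_le_square_iff[symmetric])
  qed (use RB in auto)
  then show ?thesis by (simp add: sqint_def)
qed

text \<open>The representative of \<open>W\<close> that is continuous in space: \<open>c t\<close>
  is its value at 0 and \<open>V t\<close> its weak space derivative.\<close>

definition profile_velocity :: "(real \<Rightarrow> real) \<Rightarrow> field \<Rightarrow> field" where
  "profile_velocity c V t x = c t + prim (V t) x"

text \<open>Local integrability is demanded at every time, not just almost every time, so that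
  \<open>prim (V t)\<close> is continuous for all \<open>t\<close>.\<close>

definition is_profile :: "(real \<Rightarrow> real) \<Rightarrow> field \<Rightarrow> bool" where
  "is_profile c V \<longleftrightarrow> integrable time c \<and> sqint_strip V \<and> (\<forall>t. locally_integrable (V t)) \<and>
     sqint_strip (\<lambda>t x. sqrt (jap x) * profile_velocity c V t x)"

lemma integrable_strip_prim:
  assumes V: "sqint_strip V" and loc: "\<And>t. locally_integrable (V t)"
  shows "integrable strip (\<lambda>(t, y). indicator {0..1} y * prim (V t) y)"
proof -
  have "sqint lborel (indicator {-1..1::real} :: real \<Rightarrow> real)"
  proof -
    have "integrable lborel (indicator {-1..1} :: real \<Rightarrow> real)" by (auto simp: emeasure_lborel_Icc_eq)
    moreover have "(\<lambda>x. (norm (indicator {-1..1} x :: real))^2) = indicator {-1..1::real}" by (auto simp: fun_eq_iff indicator_def)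
    ultimately show ?thesis by (simp add: sqint_def)
  qed
  moreover have "sqint_strip (\<lambda>t y. \<bar>V t y\<bar>)" using sqint_norm[OF V] by (simp add: split_beta')
  ultimately have i: "integrable time (slice (\<lambda>t y. \<bar>V t y\<bar>) (indicator {-1..1}))"
    by (intro integrable_slice)
  have "integrable strip (\<lambda>(t, y). slice (\<lambda>t y. \<bar>V t y\<bar>) (indicator {-1..1}) t * indicator {0..1} y)"
    by (intro strip.integrable_pair_mult i) (auto simp: emeasure_lborel_Icc_eq)
  then show ?thesis
  proof (rule integrable_le)
    have [measurable]: "strip_measurable (\<lambda>t y. prim (V t) y)"
      by (rule prim_measurable_strip[OF sqint_measurable[OF V]])
    show "strip_measurable (\<lambda>t y. indicator {0..1} y * prim (V t) y)" by measurable
    have "\<bar>indicator {0..1} y * prim (V t) y\<bar> \<le> \<bar>slice (\<lambda>t y. \<bar>V t y\<bar>) (indicator {-1..1}) t * indicator {0..1} y\<bar>" for t y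
    proof (cases "y \<in> {0..1}")
      case True
      then have "\<bar>prim (V t) y\<bar> \<le> (LINT r|lborel. indicator {-1..1} r * \<bar>V t r\<bar>)"
        by (intro abs_prim_le loc) auto
      also have "\<dots> \<le> \<bar>slice (\<lambda>t y. \<bar>V t y\<bar>) (indicator {-1..1}) t\<bar>"
        unfolding slice_def by (simp add: mult.commute)
      finally show ?thesis using True by simp
    qed simp
    then show "AE p in strip. norm (case p of (t, y) \<Rightarrow> indicator {0..1} y * prim (V t) y) \<le>
        norm (case p of (t, y) \<Rightarrow> slice (\<lambda>t y. \<bar>V t y\<bar>) (indicator {-1..1}) t * indicator {0..1} y)"
      by (intro AE_I2) auto
  qed
qed

lemma sqint_strip_unweighted:
  assumes U: "sqint_strip (\<lambda>t r. sqrt (jap r) * U t r)"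
  shows "sqint_strip U"
proof (rule sqint_le[OF U])
  have [measurable]: "strip_measurable (\<lambda>t r. sqrt (jap r))" by measurable
  have "(\<lambda>p. (case p of (t, r) \<Rightarrow> sqrt (jap r) * U t r) / (case p of (t, r) \<Rightarrow> sqrt (jap r))) \<in> borel_measurable strip"
    using sqint_measurable[OF U] by measurable
  also have "(\<lambda>p. (case p of (t, r) \<Rightarrow> sqrt (jap r) * U t r) / (case p of (t, r) \<Rightarrow> sqrt (jap r))) = (\<lambda>(t, r). U t r)"
    using jap_pos by (auto simp: fun_eq_iff less_imp_neq[symmetric])
  finally show "strip_measurable U" .
  fix p :: "real \<times> real"
  have "1 \<le> sqrt (jap (snd p))" using jap_ge_1[of "snd p"] by simp
  then show "\<bar>case p of (t, r) \<Rightarrow> U t r\<bar> \<le> \<bar>case p of (t, r) \<Rightarrow> sqrt (jap r) * U t r\<bar>"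
    by (auto simp: split_beta' abs_mult mult_le_cancel_right1)
qed

text \<open>Time enters the hypothesis \<open>weak\<close> through indicators of arbitrary Borel
  sets, which localises the identity to almost every time; du Bois-Reymond in space then gives the
  form \<open>c t + prim (V t) x\<close>.\<close>

lemma exists_profile:
  fixes U V :: "field"
  assumes U: "sqint_strip (\<lambda>t r. sqrt (jap r) * U t r)" and V: "sqint_strip V"
    and weak: "\<And>u A. u \<in> Cc_infty UNIV \<Longrightarrow> A \<in> sets borel \<Longrightarrow>
        (LINT (t, r)|strip. indicator A t * (U t r * deriv u r + V t r * u r)) = 0"
  obtains c V' where "is_profile c V'" "AE (t, r) in strip. V t r = V' t r"
    "AE (t, r) in strip. U t r = profile_velocity c V' t r"
proof -
  have mV: "strip_measurable V" using sqint_measurable[OF V] .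
  have sU: "sqint_strip U" by (rule sqint_strip_unweighted[OF U])
  note mU = sqint_measurable[OF sU]
  \<comment> \<open>At the exceptional times \<open>V\<close> is replaced by zero, so that every
    slice becomes locally integrable.\<close>
  define good where "good t \<longleftrightarrow> t \<in> {0<..<1} \<and> integrable lborel (\<lambda>r. (V t r)^2)" for t
  have good_meas [measurable]: "Measurable.pred time good"
  proof -
    have "Measurable.pred time (\<lambda>t. integrable lborel (\<lambda>r. (V t r)^2))"
      using mV by (intro lborel.borel_measurable_lebesgue_integrable) (simp add: split_beta')
    moreover have "Measurable.pred time (\<lambda>t. t \<in> {0<..<1})"
      using measurable_time_ident by measurable
    ultimately show ?thesis unfolding good_def by measurable
  qed
  define V' where "V' t r = (if good t then V t r else 0)" for t r
  have mV': "strip_measurable V'"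
  proof -
    have "Measurable.pred strip (\<lambda>p. good (fst p))" using good_meas by measurable
    then show ?thesis unfolding V'_def using mV by (simp add: split_beta')
  qed
  have AE_good: "AE t in time. good t"
    using AE_sqint_slice[OF V] AE_space by eventually_elim (auto simp: good_def sqint_def)
  have AE_V: "AE (t, r) in strip. V t r = V' t r"
    by (rule AE_strip_eqI[OF mV mV']) (use AE_good in \<open>eventually_elim, simp add: V'_def\<close>)
  have sV': "sqint_strip V'"
    by (rule sqint_cong_AE[OF V _ mV']) (use AE_V in \<open>simp add: split_beta'\<close>)
  have loc: "locally_integrable (V' t)" for t
  proof (cases "good t")
    case True
    then have "t \<in> space time" by (auto simp: good_def)
    then have "V t \<in> borel_measurable lborel" using measurable_Pair2[OF mV] by simp
    with True have "sqint lborel (V t)" by (simp add: good_def sqint_def)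
    then show ?thesis using True by (simp add: V'_def[abs_def] sqint_locally_integrable)
  qed (simp add: V'_def[abs_def] locally_integrable_def)
  \<comment> \<open>The constant of du Bois-Reymond depends on \<open>t\<close>. Written as a mean
    over \<open>[0, 1]\<close> in space it is integrable in time by Fubini.\<close>
  define c where "c t = (LINT r|lborel. indicator {0..1} r * (U t r - prim (V' t) r))" for t
  have ind: "sqint lborel (indicator {0..1::real} :: real \<Rightarrow> real)"
  proof -
    have "integrable lborel (indicator {0..1} :: real \<Rightarrow> real)" by (auto simp: emeasure_lborel_Icc_eq)
    moreover have "(\<lambda>x. (norm (indicator {0..1} x :: real))^2) = indicator {0..1::real}" by (auto simp: fun_eq_iff indicator_def)
    ultimately show ?thesis by (simp add: sqint_def)
  qed
  have "integrable strip (\<lambda>(t, r). indicator {0..1} r * (U t r - prim (V' t) r))"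
    using Bochner_Integration.integrable_diff[OF integrable_strip_slice[OF sU ind] integrable_strip_prim[OF sV' loc]]
    by (simp add: split_beta' right_diff_distrib mult.commute)
  from strip.integrable_fst[OF this] have ci: "integrable time c" unfolding c_def[abs_def] .
  have key: "AE t in time. (LINT r|lborel. U t r * deriv u r) = - (LINT r|lborel. V' t r * u r)"
    if u: "u \<in> Cc_infty UNIV" for u
  proof -
    have sz: "sqint lborel u" "sqint lborel (deriv u)" using Cc_infty_sqint[OF u] Cc_infty_sqint[OF deriv_Cc_infty[OF u]] by auto
    have s0: "integrable time (\<lambda>t. slice U (deriv u) t + slice V u t)"
      by (intro Bochner_Integration.integrable_add integrable_slice sU V sz)
    have "AE t in time. slice U (deriv u) t + slice V u t = 0"
    proof (rule density_unique_real[OF s0, of "\<lambda>_. 0"])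
      fix A assume A: "A \<in> sets time"
      then obtain A' where A': "A' \<in> sets borel" "A = {0<..<1} \<inter> A'" by (auto simp: sets_restrict_space)
      have [measurable]: "indicator A' \<in> borel_measurable borel" using A' by simp
      note i1 = integrable_strip_time_slice[OF sU sz(2), of "indicator A'" 1]
      note i2 = integrable_strip_time_slice[OF V sz(1), of "indicator A'" 1]
      have "0 = (LINT (t, r)|strip. indicator A' t * (U t r * deriv u r + V t r * u r))"
        by (rule weak[OF u A'(1), symmetric])
      also have "\<dots> = (LINT (t, r)|strip. indicator A' t * (U t r * deriv u r)) + (LINT (t, r)|strip. indicator A' t * (V t r * u r))"
        using i1(1) i2(1) by (simp add: split_beta' distrib_left)
      also have "\<dots> = (LINT t|time. indicator A' t * slice U (deriv u) t) + (LINT t|time. indicator A' t * slice V u t)"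
        using i1(2) i2(2) by simp
      also have "\<dots> = (LINT t|time. indicator A' t * (slice U (deriv u) t + slice V u t))"
        unfolding distrib_left
        by (intro LINT_add[symmetric] integrable_time_times[where C=1] integrable_slice sU V sz) auto
      also have "\<dots> = (LINT t:A|time. slice U (deriv u) t + slice V u t)"
        unfolding set_lebesgue_integral_def using A'(2)
        by (intro LINT_cong) (auto simp: indicator_def)
      finally show "(LINT t:A|time. slice U (deriv u) t + slice V u t) = (LINT t:A|time. 0)" by simp
    qed simp
    with AE_good show ?thesis by eventually_elim (auto simp: slice_def V'_def)
  qed
  \<comment> \<open>In \<open>key\<close> the exceptional set of times depends on the test function;
    over the countable test family it can be chosen uniformly.\<close>
  have "AE t in time. \<forall>u\<in>test_family UNIV. (LINT r|lborel. U t r * deriv u r) = - (LINT r|lborel. V' t r * u r)"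
    using key test_family_subset[of UNIV] by (subst AE_ball_countable[OF countable_test_family]) auto
  with AE_sqint_slice[OF sU] have "AE t in time. AE r in lborel. U t r = profile_velocity c V' t r"
  proof eventually_elim
    case (elim t)
    have lU: "locally_integrable (U t)" by (rule sqint_locally_integrable[OF elim(1)])
    obtain d where d: "AE x in lborel. x \<in> UNIV \<longrightarrow> U t x = d + prim (V' t) x"
      by (rule du_Bois_Reymond[OF open_UNIV is_interval_univ UNIV_not_empty lU loc[of t]])
        (use elim(2) in \<open>auto simp: mult.commute\<close>)
    have mUV: "U t \<in> borel_measurable borel" "prim (V' t) \<in> borel_measurable borel"
      using locally_integrable_measurable[OF lU] prim_continuous[OF loc[of t]] by (auto intro: borel_measurable_continuous_onI)
    have m: "(\<lambda>r. indicator {0..1} r * (U t r - prim (V' t) r)) \<in> borel_measurable lborel"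
      unfolding measurable_lborel2 by (intro borel_measurable_times borel_measurable_diff mUV) simp
    have e: "AE r in lborel. indicator {0..1} r * (U t r - prim (V' t) r) = indicator {0..1} r * d"
      using d by eventually_elim auto
    have "c t = (LINT r|lborel. indicator {0..1::real} r * d)"
      unfolding c_def by (rule integral_cong_AE[OF m _ e]) simp
    then have "c t = d" by simp
    then show ?case using d by (auto simp: profile_velocity_def)
  qed
  moreover have mW: "strip_measurable (\<lambda>t r. profile_velocity c V' t r)"
    unfolding profile_velocity_def using prim_measurable_strip[OF mV'] borel_measurable_integrable[OF ci] by (simp add: split_beta')
  ultimately have AE_U: "AE (t, r) in strip. U t r = profile_velocity c V' t r"
    using mU by (intro AE_strip_eqI)
  have "sqint_strip (\<lambda>t r. sqrt (jap r) * profile_velocity c V' t r)"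
    by (rule sqint_cong_AE[OF U]) (use AE_U mW in \<open>auto simp: split_beta'\<close>)
  then have "is_profile c V'" using ci sV' loc by (simp add: is_profile_def)
  then show thesis using AE_V AE_U by (rule that)
qed

definition profile_growth :: "(real \<Rightarrow> real) \<Rightarrow> field \<Rightarrow> field" where
  "profile_growth c V t x = tint (\<lambda>s. profile_velocity c V s x) t"

lemma is_profileD:
  assumes "is_profile c V"
  shows "integrable time c" "sqint_strip V" "locally_integrable (V t)"
    "sqint_strip (\<lambda>t x. sqrt (jap x) * profile_velocity c V t x)"
  using assms by (auto simp: is_profile_def)

lemma sqint_indicator_Icc: "sqint lborel (indicator {a..b::real} :: real \<Rightarrow> real)"
proof -
  have "integrable lborel (indicator {a..b} :: real \<Rightarrow> real)" by (auto simp: emeasure_lborel_Icc_eq)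
  moreover have "(\<lambda>x. (norm (indicator {a..b} x :: real))^2) = indicator {a..b}" by (auto simp: fun_eq_iff indicator_def)
  ultimately show ?thesis by (simp add: sqint_def)
qed

lemma interval_sign_measurable_slice [measurable]: "interval_sign x \<in> borel_measurable borel"
  by (rule measurable_slice_right[OF interval_sign_measurable])

lemma sqint_interval_sign: "sqint lborel (interval_sign x)"
  by (rule sqint_le[OF sqint_indicator_Icc[of "-\<bar>x\<bar>" "\<bar>x\<bar>"]])
    (auto intro: order_trans[OF abs_interval_sign_le])

lemma prim_eq_slice: "prim (V s) x = slice V (interval_sign x) s"
  by (simp add: prim_def slice_def mult.commute)

lemma tint_add:
  assumes "integrable time f" "integrable time g"
  shows "tint (\<lambda>s. f s + g s) t = tint f t + tint g t"
  unfolding tint_def distrib_left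
  by (intro LINT_add integrable_time_indicator assms)

lemma tint_mult: "tint (\<lambda>s. k * f s) t = k * tint f t"
  unfolding tint_def by (simp add: mult.left_commute[of _ k])

lemma slice_tint:
  fixes F :: "field"
  assumes F: "sqint_strip F" and k: "sqint lborel k"
  shows "(LINT x|lborel. tint (\<lambda>s. F s x) t * k x) = tint (slice F k) t"
    and "integrable lborel (\<lambda>x. tint (\<lambda>s. F s x) t * k x)"
proof -
  have i: "integrable strip (\<lambda>(s, x). indicator {..t} s * (F s x * k x))"
    "(LINT (s, x)|strip. indicator {..t} s * (F s x * k x)) = tint (slice F k) t"
    using integrable_strip_time_slice[OF F k, of "indicator {..t}" 1] by (simp_all add: tint_def)
  have eq: "(LINT s|time. indicator {..t} s * (F s x * k x)) = tint (\<lambda>s. F s x) t * k x" for x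
    unfolding tint_def by (simp add: mult.assoc[symmetric])
  show "(LINT x|lborel. tint (\<lambda>s. F s x) t * k x) = tint (slice F k) t"
    unfolding i(2)[symmetric] strip_integral_eq_rho_t[OF i(1)] eq ..
  show "integrable lborel (\<lambda>x. tint (\<lambda>s. F s x) t * k x)"
    using strip.integrable_snd[OF i(1)] by (simp add: eq)
qed

context
  fixes c V assumes prof: "is_profile c V"
begin

lemma velocity_measurable: "strip_measurable (\<lambda>t x. profile_velocity c V t x)"
  unfolding profile_velocity_def
  using prim_measurable_strip[OF sqint_measurable[OF is_profileD(2)[OF prof]]] borel_measurable_integrable[OF is_profileD(1)[OF prof]]
  by (simp add: split_beta')

lemma sqint_velocity: "sqint_strip (\<lambda>t x. profile_velocity c V t x)"
proof (rule sqint_le[OF is_profileD(4)[OF prof] velocity_measurable])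
  fix p :: "real \<times> real"
  have "1 \<le> sqrt (jap (snd p))" using jap_ge_1[of "snd p"] by simp
  then show "\<bar>case p of (t, x) \<Rightarrow> profile_velocity c V t x\<bar> \<le> \<bar>case p of (t, x) \<Rightarrow> sqrt (jap x) * profile_velocity c V t x\<bar>"
    by (auto simp: split_beta' abs_mult mult_le_cancel_right1)
qed

lemma integrable_prim_time: "integrable time (\<lambda>s. prim (V s) x)"
  unfolding prim_eq_slice by (intro integrable_slice is_profileD(2)[OF prof] sqint_interval_sign)

lemma integrable_velocity_time: "integrable time (\<lambda>s. profile_velocity c V s x)"
  unfolding profile_velocity_def
  by (intro Bochner_Integration.integrable_add is_profileD(1)[OF prof] integrable_prim_time)

lemma profile_growth_eq: "profile_growth c V t x = tint c t + tint (\<lambda>s. prim (V s) x) t"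
  unfolding profile_growth_def profile_velocity_def
  by (intro tint_add is_profileD(1)[OF prof] integrable_prim_time)

lemma profile_growth_at_0: "profile_growth c V t 0 = tint c t"
  by (simp add: profile_growth_def profile_velocity_def)

lemma profile_growth_time_0: "profile_growth c V 0 x = 0"
  by (simp add: profile_growth_def tint_0)

lemma integrable_strip_growth_kernel:
  "integrable strip (\<lambda>(s, r). indicator {..t} s * (V s r * interval_sign x r))"
  "(LINT (s, r)|strip. indicator {..t} s * (V s r * interval_sign x r)) = tint (\<lambda>s. prim (V s) x) t"
  using integrable_strip_time_slice[OF is_profileD(2)[OF prof] sqint_interval_sign, of "indicator {..t}" 1 x]
  by (simp_all add: tint_def prim_eq_slice)

text \<open>Dominated convergence with a kernel that moves in both variables; it fails to converge
  at most on the lines \<open>s = t\<close> and \<open>r = x\<close>, which are null sets.\<close>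

lemma continuous_growth_kernel: "continuous_on UNIV (\<lambda>(t, x). tint (\<lambda>s. prim (V s) x) t)"
proof -
  have "isCont (\<lambda>(t, x). tint (\<lambda>s. prim (V s) x) t) (t, x)" for t x
    unfolding isCont_def tendsto_at_iff_sequentially comp_def
  proof (intro allI impI)
    fix X :: "nat \<Rightarrow> real \<times> real" assume X: "X \<longlonglongrightarrow> (t, x)"
    have X1: "(\<lambda>i. fst (X i)) \<longlonglongrightarrow> t" and X2: "(\<lambda>i. snd (X i)) \<longlonglongrightarrow> x"
      using tendsto_fst[OF X] tendsto_snd[OF X] by auto
    obtain R where R: "\<And>i. \<bar>snd (X i)\<bar> \<le> R" using convergent_imp_Bseq[OF convergentI[OF X2]] by (auto simp: Bseq_def)
    have "(\<lambda>i. LINT p|strip. indicator {..fst (X i)} (fst p) * (V (fst p) (snd p) * interval_sign (snd (X i)) (snd p)))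
       \<longlonglongrightarrow> (LINT p|strip. indicator {..t} (fst p) * (V (fst p) (snd p) * interval_sign x (snd p)))"
    proof (rule integral_dominated_convergence[where w="\<lambda>p. \<bar>V (fst p) (snd p) * indicator {-R..R} (snd p)\<bar>"])
      show "integrable strip (\<lambda>p. \<bar>V (fst p) (snd p) * indicator {-R..R} (snd p)\<bar>)"
        using integrable_abs[OF integrable_strip_slice[OF is_profileD(2)[OF prof] sqint_indicator_Icc[of "-R" R]]] by (simp add: split_beta')
      show "(\<lambda>p. indicator {..t} (fst p) * (V (fst p) (snd p) * interval_sign x (snd p))) \<in> borel_measurable strip"
        using borel_measurable_integrable[OF integrable_strip_growth_kernel(1)[of t x]] by (simp add: split_beta')
      show "(\<lambda>p. indicator {..fst (X i)} (fst p) * (V (fst p) (snd p) * interval_sign (snd (X i)) (snd p))) \<in> borel_measurable strip" for i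
        using borel_measurable_integrable[OF integrable_strip_growth_kernel(1)[of "fst (X i)" "snd (X i)"]] by (simp add: split_beta')
      show "AE p in strip. norm (indicator {..fst (X i)} (fst p) * (V (fst p) (snd p) * interval_sign (snd (X i)) (snd p))) \<le>
          \<bar>V (fst p) (snd p) * indicator {-R..R} (snd p)\<bar>" for i
      proof (rule AE_I2)
        fix p :: "real \<times> real"
        have "\<bar>interval_sign (snd (X i)) (snd p)\<bar> \<le> indicator {-R..R} (snd p)"
          using R[of i] by (intro order_trans[OF abs_interval_sign_le]) (auto simp: indicator_def)
        from mult_left_mono[OF this abs_ge_zero, of "V (fst p) (snd p)"]
        show "norm (indicator {..fst (X i)} (fst p) * (V (fst p) (snd p) * interval_sign (snd (X i)) (snd p))) \<le>
          \<bar>V (fst p) (snd p) * indicator {-R..R} (snd p)\<bar>"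
          by (cases "fst p \<le> fst (X i)") (simp_all add: abs_mult)
      qed
      have "AE p in strip. fst p \<noteq> t \<and> snd p \<noteq> x"
      proof (rule strip.AE_pair_measure)
        show "{p \<in> space strip. fst p \<noteq> t \<and> snd p \<noteq> x} \<in> sets strip"
          using measurable_time_ident by measurable
        have "AE s in time. s \<noteq> t" using AE_lborel_singleton[of t] unfolding AE_time_iff by (rule eventually_mono) simp
        then show "AE s in time. AE r in lborel. fst (s, r) \<noteq> t \<and> snd (s, r) \<noteq> x"
          by (rule eventually_mono) (use AE_lborel_singleton[of x] in \<open>auto elim: eventually_mono\<close>)
      qed
      then show "AE p in strip. (\<lambda>i. indicator {..fst (X i)} (fst p) * (V (fst p) (snd p) * interval_sign (snd (X i)) (snd p)))
         \<longlonglongrightarrow> indicator {..t} (fst p) * (V (fst p) (snd p) * interval_sign x (snd p))"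
      proof eventually_elim
        case (elim p)
        have "\<forall>\<^sub>F i in sequentially. interval_sign (snd (X i)) (snd p) = interval_sign x (snd p)"
        proof (cases "snd p < x")
          case True
          from order_tendstoD(1)[OF X2 this] show ?thesis by eventually_elim (use True in \<open>auto simp: interval_sign_def indicator_def\<close>)
        next
          case False
          with elim have "x < snd p" by auto
          from order_tendstoD(2)[OF X2 this] show ?thesis by eventually_elim (use \<open>x < snd p\<close> in \<open>auto simp: interval_sign_def indicator_def\<close>)
        qed
        moreover have "\<forall>\<^sub>F i in sequentially. indicator {..fst (X i)} (fst p) = (indicator {..t} (fst p) :: real)"
        proof (cases "fst p < t")
          case True
          from order_tendstoD(1)[OF X1 this] show ?thesis by eventually_elim (use True in \<open>auto simp: indicator_def\<close>)
        next
          case False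
          with elim have "t < fst p" by auto
          from order_tendstoD(2)[OF X1 this] show ?thesis by eventually_elim (use \<open>t < fst p\<close> in \<open>auto simp: indicator_def\<close>)
        qed
        ultimately show ?case by (intro tendsto_mult tendsto_const tendsto_eventually)
      qed
    qed
    then show "(\<lambda>i. case X i of (t, x) \<Rightarrow> tint (\<lambda>s. prim (V s) x) t) \<longlonglongrightarrow> (case (t, x) of (t, x) \<Rightarrow> tint (\<lambda>s. prim (V s) x) t)"
      using integrable_strip_growth_kernel(2) by (simp add: split_beta')
  qed
  then show ?thesis by (auto intro: continuous_at_imp_continuous_on)
qed

lemma continuous_profile_growth: "continuous_on ({0..1} \<times> UNIV) (\<lambda>(t, x). profile_growth c V t x)"
proof -
  have "continuous_on ({0..1} \<times> UNIV) (\<lambda>p. tint c (fst p) + (case p of (t, x) \<Rightarrow> tint (\<lambda>s. prim (V s) x) t))"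
    by (intro continuous_on_add continuous_on_compose2[OF tint_continuous[OF is_profileD(1)[OF prof]] continuous_on_fst[OF continuous_on_id]]
        continuous_on_subset[OF continuous_growth_kernel]) auto
  then show ?thesis by (simp add: profile_growth_eq split_beta')
qed

lemma slice_growth:
  assumes k: "sqint lborel k"
  shows "slice (profile_growth c V) k t = tint (slice (profile_velocity c V) k) t"
    and "integrable lborel (\<lambda>x. profile_growth c V t x * k x)"
  using slice_tint[OF sqint_velocity k] by (simp_all add: slice_def profile_growth_def)

end

text \<open>The restriction to the half line \<open>x > 0\<close>, not the positive part of the
  values. At 0 both \<open>pos_part k\<close> and \<open>neg_part k\<close> are zero, so their sum
  gives back \<open>k\<close> away from 0 only.\<close>

definition pos_part :: "(real \<Rightarrow> real) \<Rightarrow> real \<Rightarrow> real" where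
  "pos_part k x = (if x > 0 then k x else 0)"

definition neg_part :: "(real \<Rightarrow> real) \<Rightarrow> real \<Rightarrow> real" where
  "neg_part k x = (if x < 0 then k x else 0)"

lemma pos_part_measurable [measurable]:
  assumes [measurable]: "k \<in> borel_measurable borel" shows "pos_part k \<in> borel_measurable borel"
  unfolding pos_part_def[abs_def] by measurable

lemma neg_part_measurable [measurable]:
  assumes [measurable]: "k \<in> borel_measurable borel" shows "neg_part k \<in> borel_measurable borel"
  unfolding neg_part_def[abs_def] by measurable

lemma sqint_pos_part:
  assumes k: "sqint lborel k" shows "sqint lborel (pos_part k)"
proof (rule sqint_le[OF k])
  show "pos_part k \<in> borel_measurable lborel" using sqint_measurable[OF k] by (simp add: pos_part_measurable)
qed (simp add: pos_part_def)

lemma sqint_neg_part: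
  assumes k: "sqint lborel k" shows "sqint lborel (neg_part k)"
proof (rule sqint_le[OF k])
  show "neg_part k \<in> borel_measurable lborel" using sqint_measurable[OF k] by (simp add: neg_part_measurable)
qed (simp add: neg_part_def)

lemma integral_pos_neg_part:
  assumes f: "integrable lborel (\<lambda>x. f x * k x)"
  shows "integrable lborel (\<lambda>x. f x * pos_part k x)" "integrable lborel (\<lambda>x. f x * neg_part k x)"
    "(LINT x|lborel. f x * pos_part k x) + (LINT x|lborel. f x * neg_part k x) = (LINT x|lborel. f x * k x)"
proof -
  have "integrable lborel (\<lambda>x. indicator {0<..} x *\<^sub>R (f x * k x))" by (intro integrable_mult_indicator f) simp
  moreover have "(\<lambda>x. indicator {0<..} x *\<^sub>R (f x * k x)) = (\<lambda>x. f x * pos_part k x)"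
    by (auto simp: fun_eq_iff pos_part_def indicator_def)
  ultimately show 1: "integrable lborel (\<lambda>x. f x * pos_part k x)" by simp
  have "integrable lborel (\<lambda>x. indicator {..<0} x *\<^sub>R (f x * k x))" by (intro integrable_mult_indicator f) simp
  moreover have "(\<lambda>x. indicator {..<0} x *\<^sub>R (f x * k x)) = (\<lambda>x. f x * neg_part k x)"
    by (auto simp: fun_eq_iff neg_part_def indicator_def)
  ultimately show 2: "integrable lborel (\<lambda>x. f x * neg_part k x)" by simp
  have "(LINT x|lborel. f x * pos_part k x + f x * neg_part k x) = (LINT x|lborel. f x * k x)"
    by (rule LINT_cong_nonzero(2)) (auto simp: pos_part_def neg_part_def)
  then show "(LINT x|lborel. f x * pos_part k x) + (LINT x|lborel. f x * neg_part k x) = (LINT x|lborel. f x * k x)"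
    using 1 2 by simp
qed

section \<open>Spatial test functions and integration by parts on half lines\<close>

locale space_test =
  fixes k :: "real \<Rightarrow> real"
  assumes k: "k \<in> Cc_infty UNIV"
begin

abbreviation "k' \<equiv> deriv k"
abbreviation "k'' \<equiv> deriv (deriv k)"

lemma test_mem: "k' \<in> Cc_infty UNIV" "k'' \<in> Cc_infty UNIV"
  using k by (auto intro: deriv_Cc_infty)

lemma test_DERIV: "(k has_real_derivative k' x) (at x)" "(k' has_real_derivative k'' x) (at x)"
  using k test_mem by (auto intro: Cc_infty_open_DERIV)

lemma test_cont: "continuous_on S k" "continuous_on S k'" "continuous_on S k''"
  using k test_mem by (auto intro: Cc_infty_open_continuous)

lemma test_measurable [measurable]: "k \<in> borel_measurable borel" "k' \<in> borel_measurable borel" "k'' \<in> borel_measurable borel"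
  using k test_mem by (auto intro: Cc_infty_measurable)

lemma test_sqint: "sqint lborel k" "sqint lborel k'" "sqint lborel k''"
  using k test_mem by (auto intro: Cc_infty_sqint)

lemma test_bounds:
  obtains R B where "R > 0" "B \<ge> 0" "\<And>x. \<bar>x\<bar> \<ge> R \<Longrightarrow> k x = 0 \<and> k' x = 0 \<and> k'' x = 0"
    "\<And>x. \<bar>k x\<bar> \<le> B" "\<And>x. \<bar>k' x\<bar> \<le> B" "\<And>x. \<bar>k'' x\<bar> \<le> B"
proof -
  obtain R0 B0 where 0: "R0 > 0" "B0 \<ge> 0" "\<And>x. \<bar>x\<bar> \<ge> R0 \<Longrightarrow> k x = 0" "\<And>x. \<bar>k x\<bar> \<le> B0"
    using Cc_infty_UNIV_bounds[OF k] by metis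
  obtain R1 B1 where 1: "R1 > 0" "B1 \<ge> 0" "\<And>x. \<bar>x\<bar> \<ge> R1 \<Longrightarrow> k' x = 0" "\<And>x. \<bar>k' x\<bar> \<le> B1"
    using Cc_infty_UNIV_bounds[OF test_mem(1)] by metis
  obtain R2 B2 where 2: "R2 > 0" "B2 \<ge> 0" "\<And>x. \<bar>x\<bar> \<ge> R2 \<Longrightarrow> k'' x = 0" "\<And>x. \<bar>k'' x\<bar> \<le> B2"
    using Cc_infty_UNIV_bounds[OF test_mem(2)] by metis
  show thesis
    by (rule that[of "max R0 (max R1 R2)" "max B0 (max B1 B2)"]) (use 0 1 2 in \<open>auto simp: le_max_iff_disj\<close>)
qed

lemma integrable_times_test:
  assumes "locally_integrable f"
  shows "integrable lborel (\<lambda>x. f x * k'' x)" "integrable lborel (\<lambda>x. f x * k' x)" "integrable lborel (\<lambda>x. f x * k x)"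
proof -
  have [measurable]: "f \<in> borel_measurable borel" using locally_integrable_measurable[OF assms] .
  obtain R B where RB: "\<And>x. \<bar>x\<bar> \<ge> R \<Longrightarrow> k x = 0 \<and> k' x = 0 \<and> k'' x = 0" "B \<ge> 0"
    "\<And>x. \<bar>k x\<bar> \<le> B" "\<And>x. \<bar>k' x\<bar> \<le> B" "\<And>x. \<bar>k'' x\<bar> \<le> B" using test_bounds by metis
  have i: "integrable lborel (\<lambda>r. B * (indicator {-R..R} r * f r))" using locally_integrable_Icc[OF assms] by simp
  have *: "integrable lborel (\<lambda>x. f x * h x)"
    if [measurable]: "h \<in> borel_measurable borel" and h: "\<And>x. \<bar>h x\<bar> \<le> B" "\<And>x. \<bar>x\<bar> \<ge> R \<Longrightarrow> h x = 0" for h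
  proof (rule integrable_le[OF i])
    show "AE x in lborel. norm (f x * h x) \<le> norm (B * (indicator {-R..R} x * f x))"
    proof (rule AE_I2)
      fix x show "norm (f x * h x) \<le> norm (B * (indicator {-R..R} x * f x))"
      proof (cases "\<bar>x\<bar> \<ge> R")
        case False
        then have "x \<in> {-R..R}" by (auto simp: abs_if split: if_splits)
        then show ?thesis using mult_right_mono[OF h(1)[of x] abs_ge_zero, of "f x"] RB(2) by (simp add: abs_mult mult.commute)
      qed (simp add: h)
    qed
  qed measurable
  show "integrable lborel (\<lambda>x. f x * k'' x)" "integrable lborel (\<lambda>x. f x * k' x)" "integrable lborel (\<lambda>x. f x * k x)"
    by (rule *; use RB in auto)+
qed

text \<open>Cutting at 0 leaves a boundary term there: \<open>d\<close> is the value of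
  \<open>d + prim v\<close> at 0, and it enters with opposite signs on the two sides.\<close>

lemma prim_by_parts:
  assumes v: "locally_integrable v"
  shows "(LINT x|lborel. v x * k' x) = - (LINT x|lborel. (d + prim v x) * k'' x)"
    "(LINT x|lborel. v x * pos_part k' x) = - (LINT x|lborel. (d + prim v x) * pos_part k'' x) - d * k' 0"
    "(LINT x|lborel. v x * neg_part k' x) = - (LINT x|lborel. (d + prim v x) * neg_part k'' x) + d * k' 0"
proof -
  obtain R where R: "R > 0" "\<And>x. \<bar>x\<bar> \<ge> R \<Longrightarrow> k x = 0 \<and> k' x = 0 \<and> k'' x = 0" using test_bounds by metis
  have cp: "continuous_on UNIV (\<lambda>x. d + prim v x)" by (intro continuous_on_add continuous_on_const prim_continuous v)
  have lp: "locally_integrable (\<lambda>x. d + prim v x)"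
    unfolding locally_integrable_def by (intro allI integrable_Icc_continuous continuous_on_subset[OF cp]) auto
  have "(LINT x|lborel. k'' x * (d + prim v x)) = - (LINT x|lborel. k' x * v x)"
  proof (rule integral_deriv_mult_prim[OF test_DERIV(2) test_cont(3) v])
    show "k' x = 0" if "x \<notin> {-R<..<R}" for x using R(2)[of x] that by (auto simp: abs_if)
  qed (use R in simp)
  then show full: "(LINT x|lborel. v x * k' x) = - (LINT x|lborel. (d + prim v x) * k'' x)"
    by (simp add: mult.commute)
  have "(LINT x|lborel. indicator {0..R} x * (k'' x * (LINT s|lborel. indicator {0..x} s * (indicator {0..R} s * v s)))) =
      k' R * (LINT s|lborel. indicator {0..R} s * (indicator {0..R} s * v s)) - (LINT x|lborel. indicator {0..R} x * (k' x * (indicator {0..R} x * v x)))"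
    by (rule integral_by_parts_primitive[OF _ test_DERIV(2) test_cont(3) locally_integrable_Icc[OF v]]) (use R in simp)
  moreover have "k' R = 0" using R(2)[of R] R(1) by auto
  moreover have "(LINT x|lborel. indicator {0..R} x * (k'' x * (LINT s|lborel. indicator {0..x} s * (indicator {0..R} s * v s))))
      = (LINT x|lborel. indicator {0..R} x * (k'' x * prim v x))"
  proof (intro LINT_cong)
    fix x show "indicator {0..R} x * (k'' x * (LINT s|lborel. indicator {0..x} s * (indicator {0..R} s * v s))) = indicator {0..R} x * (k'' x * prim v x)"
    proof (cases "x \<in> {0..R}")
      case True
      have "(LINT s|lborel. indicator {0..x} s * (indicator {0..R} s * v s)) = (LINT s|lborel. indicator {0..x} s * v s)"
        using True by (intro LINT_cong) (auto simp: indicator_def)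
      then show ?thesis using prim_diff[OF v, of 0 x] True by simp
    qed simp
  qed
  moreover have "(LINT x|lborel. indicator {0..R} x * (k' x * (indicator {0..R} x * v x))) = (LINT x|lborel. v x * pos_part k' x)"
    by (rule LINT_cong_nonzero(2)) (use R(2) in \<open>auto simp: indicator_def pos_part_def\<close>)
  ultimately have 1: "(LINT x|lborel. v x * pos_part k' x) = - (LINT x|lborel. indicator {0..R} x * (k'' x * prim v x))" by simp
  have 2: "(LINT x|lborel. indicator {0..R} x * k'' x) = - k' 0"
    using FTC_Icc_lborel[OF _ test_DERIV(2) test_cont(3), of 0 R] R(1) \<open>k' R = 0\<close> by simp
  have "(LINT x|lborel. (d + prim v x) * pos_part k'' x) = (LINT x|lborel. d * (indicator {0..R} x * k'' x) + indicator {0..R} x * (k'' x * prim v x))"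
    by (rule LINT_cong_nonzero(2)) (use R(2) in \<open>auto simp: indicator_def pos_part_def algebra_simps\<close>)
  also have "\<dots> = d * (LINT x|lborel. indicator {0..R} x * k'' x) + (LINT x|lborel. indicator {0..R} x * (k'' x * prim v x))"
    by (subst LINT_add)
      (auto intro!: integrable_mult_right integrable_Icc_continuous continuous_on_mult test_cont continuous_on_subset[OF prim_continuous[OF v]])
  finally show pos: "(LINT x|lborel. v x * pos_part k' x) = - (LINT x|lborel. (d + prim v x) * pos_part k'' x) - d * k' 0"
    using 1 2 by simp
  show "(LINT x|lborel. v x * neg_part k' x) = - (LINT x|lborel. (d + prim v x) * neg_part k'' x) + d * k' 0"
    using integral_pos_neg_part(3)[OF integrable_times_test(2)[OF v]] integral_pos_neg_part(3)[OF integrable_times_test(1)[OF lp]] full pos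
    by simp
qed

end

text \<open>Used with three kinds of time factor: supported inside \<open>(0, 1)\<close> with any
  \<open>k\<close>, \<open>1 - t\<close> with a \<open>k\<close> on the right half line, and
  \<open>t\<close> with a \<open>k\<close> on the left. The two disjunctions cover these
  cases.\<close>

lemma test_pair_tensor:
  assumes E: "\<And>t. (E has_real_derivative E' t) (at t)" "continuous_on UNIV E'"
    and k: "continuous_on UNIV k" "\<And>x. x \<noteq> 0 \<Longrightarrow> (k has_real_derivative k' x) (at x)" "k' \<in> borel_measurable borel"
    and bd: "\<And>x. \<bar>k x\<bar> \<le> B" "\<And>x. \<bar>k' x\<bar> \<le> B" "\<And>x. \<bar>x\<bar> > R \<Longrightarrow> k x = 0" "\<And>x. \<bar>x\<bar> > R \<Longrightarrow> k' x = 0"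
    and init: "E 0 = 0 \<or> (\<forall>x\<le>0. k x = 0)" and fin: "E 1 = 0 \<or> (\<forall>x\<ge>0. k x = 0)"
  obtains C where "test_pair (\<lambda>t r. E t * k r) (\<lambda>t r. E' t * k r) (\<lambda>t r. E t * k' r) (\<lambda>_ _. 0) (\<lambda>_ _. 0) R C"
proof -
  have [measurable]: "E \<in> borel_measurable borel" "E' \<in> borel_measurable borel" "k \<in> borel_measurable borel" "k' \<in> borel_measurable borel"
    using E k by (auto intro: borel_measurable_continuous_onI borel_measurable_DERIV)
  obtain B1 where B1: "B1 \<ge> 0" "\<And>t. t \<in> {0..1} \<Longrightarrow> \<bar>E t\<bar> \<le> B1"
    using bounded_on_Icc[OF DERIV_imp_continuous_on[OF E(1)], of 0 1] by metis
  obtain B2 where B2: "B2 \<ge> 0" "\<And>t. t \<in> {0..1} \<Longrightarrow> \<bar>E' t\<bar> \<le> B2" using bounded_on_Icc[OF E(2), of 0 1] by metis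
  have B: "B \<ge> 0" using bd(1)[of 0] by simp
  have le: "\<bar>a * b\<bar> \<le> max B1 B2 * B" if "\<bar>a\<bar> \<le> B1 \<or> \<bar>a\<bar> \<le> B2" "\<bar>b\<bar> \<le> B" for a b
    unfolding abs_mult using that B B1(1) by (intro mult_mono) auto
  have "test_pair (\<lambda>t r. E t * k r) (\<lambda>t r. E' t * k r) (\<lambda>t r. E t * k' r) (\<lambda>_ _. 0) (\<lambda>_ _. 0) R (max B1 B2 * B)"
  proof
    show "plane_measurable (\<lambda>t r. E t * k r)" "plane_measurable (\<lambda>t r. E' t * k r)"
       "plane_measurable (\<lambda>t r. E t * k' r)" by measurable
    show "\<bar>E t * k r\<bar> \<le> max B1 B2 * B" "\<bar>E' t * k r\<bar> \<le> max B1 B2 * B" "\<bar>E t * k' r\<bar> \<le> max B1 B2 * B" if "t \<in> {0..1}" for t r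
      using B1(2)[OF that] B2(2)[OF that] bd(1,2)[of r] B B1(1) by (auto intro!: le)
    show "((\<lambda>r. E t * k r) has_real_derivative E t * k' r) (at r)" if "r \<noteq> 0" for t r
      using DERIV_cmult[OF k(2)[OF that], of "E t"] .
    show "((\<lambda>t. E t * k r) has_real_derivative E' t * k r) (at t)" for t r
      using DERIV_cmult_right[OF E(1)[of t], of "k r"] .
    show "continuous_on {0..1} (\<lambda>t. E t * k r)" for r
      by (intro continuous_on_mult continuous_on_const DERIV_imp_continuous_on[OF E(1)])
    show "E 0 * k r = 0" if "r \<le> 0" for r using init that by auto
    show "E 1 * k r = 0" if "0 \<le> r" for r using fin that by auto
  qed (use B B1(1) in \<open>auto simp: bd intro!: mult_nonneg_nonneg continuous_on_mult continuous_on_const k\<close>)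
  then show thesis by (rule that)
qed

text \<open>The second component \<open>v\<close> of a test pair is only required to be measurable
  and bounded in time, so an indicator in time is allowed. Such pairs express that \<open>V\<close>
  is the space derivative of \<open>W\<close>.\<close>

lemma test_pair_space_only:
  assumes u: "u \<in> Cc_infty UNIV" and A: "A \<in> sets borel"
  obtains R B where "test_pair (\<lambda>_ _. 0) (\<lambda>_ _. 0) (\<lambda>_ _. 0) (\<lambda>t r. indicator A t * u r) (\<lambda>t r. indicator A t * deriv u r) R B"
proof -
  interpret space_test u by standard (rule u)
  obtain R B where RB: "\<And>x. \<bar>x\<bar> \<ge> R \<Longrightarrow> u x = 0 \<and> k' x = 0 \<and> k'' x = 0" "B \<ge> 0"
    "\<And>x. \<bar>u x\<bar> \<le> B" "\<And>x. \<bar>k' x\<bar> \<le> B" using test_bounds by metis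
  have [measurable]: "indicator A \<in> borel_measurable borel" using A by simp
  have "test_pair (\<lambda>_ _. 0) (\<lambda>_ _. 0) (\<lambda>_ _. 0) (\<lambda>t r. indicator A t * u r) (\<lambda>t r. indicator A t * deriv u r) R B"
  proof
    show "plane_measurable (\<lambda>t r. indicator A t * u r)"
      "plane_measurable (\<lambda>t r. indicator A t * deriv u r)" by measurable
    show "\<bar>indicator A t * u r\<bar> \<le> B" "\<bar>indicator A t * deriv u r\<bar> \<le> B" for t r
      using RB(2-) by (auto simp: indicator_def)
    show "((\<lambda>r. indicator A t * u r) has_real_derivative indicator A t * deriv u r) (at r)" for t r
      using DERIV_cmult[OF test_DERIV(1), of "indicator A t"] .
  qed (use RB in \<open>auto intro!: continuous_on_mult continuous_on_const test_cont\<close>)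
  then show thesis by (rule that)
qed

lemma Cc_infty_deriv_within:
  assumes "f \<in> Cc_infty S" "x \<in> S"
  shows "((deriv_on S ^^ n) f has_vector_derivative (deriv_on S ^^ Suc n) f x) (at x within S)"
  using Cc_infty_differentiable[OF assms(1), of n] assms(2)
  by (simp add: differentiable_on_def vector_derivative_works deriv_on_def)

lemma Cc_infty_deriv_interior:
  assumes "f \<in> Cc_infty S" "x \<in> interior S"
  shows "((deriv_on S ^^ n) f has_real_derivative (deriv_on S ^^ Suc n) f x) (at x)"
proof -
  have "x \<in> S" using assms(2) interior_subset by blast
  from Cc_infty_deriv_within[OF assms(1) this, of n] show ?thesis
    unfolding at_within_interior[OF assms(2)] has_real_derivative_iff_has_vector_derivative .
qed

lemma Cc_infty_continuous_within:
  assumes "f \<in> Cc_infty S"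
  shows "continuous_on S ((deriv_on S ^^ n) f)"
  using Cc_infty_differentiable[OF assms, of n] by (rule differentiable_imp_continuous_on)

lemma Cc_infty_deriv_zero:
  assumes f: "f \<in> Cc_infty S"
  obtains R where "R > 0" "\<And>x n. x \<in> interior S \<Longrightarrow> R \<le> \<bar>x\<bar> \<Longrightarrow> (deriv_on S ^^ n) f x = 0"
proof -
  obtain K where K: "compact K" "\<And>x. x \<notin> K \<Longrightarrow> f x = 0" using Cc_inftyE[OF f] by metis
  obtain r where r: "\<And>x. x \<in> K \<Longrightarrow> \<bar>x\<bar> \<le> r" using compact_imp_bounded[OF K(1)] by (auto simp: bounded_iff)
  have z: "(deriv_on S ^^ n) f x = 0" if "x \<in> interior S" "\<bar>x\<bar> > r" for x n
    using that
  proof (induction n arbitrary: x)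
    case 0 then show ?case using K(2)[of x] r[of x] by force
  next
    case (Suc n)
    have o: "open (interior S \<inter> {x. \<bar>x\<bar> > r})" by (intro open_Int open_interior open_Collect_less continuous_intros)
    have "((deriv_on S ^^ n) f has_real_derivative 0) (at x)"
    proof (rule has_field_derivative_transform_within_open[OF DERIV_const o])
      show "x \<in> interior S \<inter> {x. \<bar>x\<bar> > r}" using Suc.prems by simp
      show "0 = (deriv_on S ^^ n) f y" if "y \<in> interior S \<inter> {x. \<bar>x\<bar> > r}" for y
        using Suc.IH[of y] that by simp
    qed
    with Cc_infty_deriv_interior[OF f Suc.prems(1), of n] show ?case by (rule DERIV_unique)
  qed
  show thesis by (rule that[of "\<bar>r\<bar> + 1"]) (use z in auto)
qed

lemma FTC_Icc_interior:
  fixes F :: "real \<Rightarrow> real"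
  assumes "a \<le> b" "continuous_on {a..b} F" "\<And>x. x \<in> {a<..<b} \<Longrightarrow> (F has_real_derivative F' x) (at x)" "continuous_on {a..b} F'"
  shows "(LINT x|lborel. indicator {a..b} x * F' x) = F b - F a"
proof -
  have "(F' has_integral F b - F a) {a..b}"
    using assms by (intro fundamental_theorem_of_calculus_interior) (auto simp: has_real_derivative_iff_has_vector_derivative)
  moreover have "set_integrable lborel {a..b} F'"
    unfolding set_integrable_def using integrable_Icc_continuous[OF assms(4)] by simp
  then have "(LINT x:{a..b}|lborel. F' x) = integral {a..b} F'" by (rule set_borel_integral_eq_integral(2))
  ultimately show ?thesis by (simp add: integral_unique set_lebesgue_integral_def)
qed

context space_test
begin

lemma data_by_parts:
  assumes f: "f \<in> Cc_infty S" and ab: "a \<le> b" "{a..b} \<subseteq> S" "{a<..<b} \<subseteq> interior S"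
    and h: "\<And>x. x \<noteq> 0 \<Longrightarrow> h x = indicator {a..b} x * k x" "\<And>x. x \<noteq> 0 \<Longrightarrow> h'' x = indicator {a..b} x * k'' x"
  shows "(LINT x|lborel. (deriv_on S ^^ 2) f x * h x) = (LINT x|lborel. f x * h'' x) +
      (((deriv_on S ^^ 1) f b * k b - f b * k' b) - ((deriv_on S ^^ 1) f a * k a - f a * k' a))"
    and "integrable lborel (\<lambda>x. (deriv_on S ^^ 2) f x * h x)" "integrable lborel (\<lambda>x. f x * h'' x)"
proof -
  let ?f1 = "(deriv_on S ^^ 1) f" and ?f2 = "(deriv_on S ^^ 2) f"
  have c: "continuous_on {a..b} f" "continuous_on {a..b} ?f1" "continuous_on {a..b} ?f2"
    using continuous_on_subset[OF Cc_infty_continuous_within[OF f, of 0]] continuous_on_subset[OF Cc_infty_continuous_within[OF f, of 1]]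
      continuous_on_subset[OF Cc_infty_continuous_within[OF f, of 2]] ab by auto
  have i: "integrable lborel (\<lambda>x. indicator {a..b} x * (?f2 x * k x))" "integrable lborel (\<lambda>x. indicator {a..b} x * (f x * k'' x))"
    by (intro integrable_Icc_continuous continuous_on_mult c test_cont)+
  have D: "(LINT x|lborel. indicator {a..b} x * (?f2 x * k x - f x * k'' x)) = (?f1 b * k b - f b * k' b) - (?f1 a * k a - f a * k' a)"
  proof (rule FTC_Icc_interior[OF ab(1)])
    fix x assume "x \<in> {a<..<b}"
    then have x: "x \<in> interior S" using ab by auto
    show "((\<lambda>x. ?f1 x * k x - f x * k' x) has_real_derivative (?f2 x * k x - f x * k'' x)) (at x)"
      using DERIV_diff[OF DERIV_mult[OF Cc_infty_deriv_interior[OF f x, of 1] test_DERIV(1)]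
        DERIV_mult[OF Cc_infty_deriv_interior[OF f x, of 0] test_DERIV(2)]]
      by (simp add: numeral_2_eq_2 algebra_simps)
  qed (use c in \<open>auto intro!: continuous_on_diff continuous_on_mult test_cont\<close>)
  have e: "?f2 x * h x = indicator {a..b} x * (?f2 x * k x)" "f x * h'' x = indicator {a..b} x * (f x * k'' x)" if "x \<noteq> 0" for x
    using h[OF that] by simp_all
  show "integrable lborel (\<lambda>x. ?f2 x * h x)" "integrable lborel (\<lambda>x. f x * h'' x)"
    by (rule LINT_cong_nonzero(1)[THEN iffD2, OF _ i(1)], rule e(1), assumption, rule LINT_cong_nonzero(1)[THEN iffD2, OF _ i(2)], rule e(2))
  have "(LINT x|lborel. ?f2 x * h x) = (LINT x|lborel. indicator {a..b} x * (?f2 x * k x))"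
    "(LINT x|lborel. f x * h'' x) = (LINT x|lborel. indicator {a..b} x * (f x * k'' x))"
    by (rule LINT_cong_nonzero(2), rule e, assumption)+
  then show "(LINT x|lborel. ?f2 x * h x) = (LINT x|lborel. f x * h'' x) + ((?f1 b * k b - f b * k' b) - (?f1 a * k a - f a * k' a))"
    unfolding D[symmetric] using i by (simp add: right_diff_distrib)
qed

text \<open>Since \<open>k 0 = 0\<close>, the one-sided derivative of the datum at 0 drops out and
  only its value there survives.\<close>

lemma left_data_by_parts:
  assumes f: "f \<in> Cc_infty {0..}" and 0: "k 0 = 0"
  shows "(LINT x|lborel. (deriv_on {0..} ^^ 2) f x * pos_part k x) = (LINT x|lborel. f x * pos_part k'' x) + f 0 * k' 0"
    and "integrable lborel (\<lambda>x. (deriv_on {0..} ^^ 2) f x * pos_part k x)" "integrable lborel (\<lambda>x. f x * pos_part k'' x)"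
proof -
  obtain R where R: "R > 0" "\<And>x. \<bar>x\<bar> \<ge> R \<Longrightarrow> k x = 0 \<and> k' x = 0 \<and> k'' x = 0" using test_bounds by metis
  have h: "pos_part k x = indicator {0..R} x * k x" "pos_part k'' x = indicator {0..R} x * k'' x" if "x \<noteq> 0" for x
    using R(2)[of x] that by (auto simp: indicator_def pos_part_def)
  note D = data_by_parts[OF f _ _ _ h]
  show "(LINT x|lborel. (deriv_on {0..} ^^ 2) f x * pos_part k x) = (LINT x|lborel. f x * pos_part k'' x) + f 0 * k' 0"
    "integrable lborel (\<lambda>x. (deriv_on {0..} ^^ 2) f x * pos_part k x)" "integrable lborel (\<lambda>x. f x * pos_part k'' x)"
    using D R(1) R(2)[of R] 0 by (auto simp: greaterThanLessThan_def)
qed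

lemma right_data_by_parts:
  assumes f: "f \<in> Cc_infty {..0}" and 0: "k 0 = 0"
  shows "(LINT x|lborel. (deriv_on {..0} ^^ 2) f x * neg_part k x) = (LINT x|lborel. f x * neg_part k'' x) - f 0 * k' 0"
    and "integrable lborel (\<lambda>x. (deriv_on {..0} ^^ 2) f x * neg_part k x)" "integrable lborel (\<lambda>x. f x * neg_part k'' x)"
proof -
  obtain R where R: "R > 0" "\<And>x. \<bar>x\<bar> \<ge> R \<Longrightarrow> k x = 0 \<and> k' x = 0 \<and> k'' x = 0" using test_bounds by metis
  have h: "neg_part k x = indicator {-R..0} x * k x" "neg_part k'' x = indicator {-R..0} x * k'' x" if "x \<noteq> 0" for x
    using R(2)[of x] that by (auto simp: indicator_def neg_part_def)
  note D = data_by_parts[OF f _ _ _ h]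
  show "(LINT x|lborel. (deriv_on {..0} ^^ 2) f x * neg_part k x) = (LINT x|lborel. f x * neg_part k'' x) - f 0 * k' 0"
    "integrable lborel (\<lambda>x. (deriv_on {..0} ^^ 2) f x * neg_part k x)" "integrable lborel (\<lambda>x. f x * neg_part k'' x)"
    using D R(1) R(2)[of "-R"] 0 by (auto simp: greaterThanLessThan_def)
qed

end

lemma time_trace_sqint:
  assumes "time_trace G s Gs" "s \<in> {0..1}"
  shows "sqint lborel Gs"
  using assms by (auto simp: time_trace_def C0_L2_def sqint_eq_square_integrable)

subsection \<open>The two scalar defects\<close>

text \<open>This is |x| times the lateral datum of \<open>W\<close>, whose denominator is
  \<open>x\<close>; hence the opposite sign on the left half line.\<close>

definition boundary_load :: "(real \<Rightarrow> real) \<Rightarrow> (real \<Rightarrow> real) \<Rightarrow> (real \<Rightarrow> real) \<Rightarrow> (real \<Rightarrow> real) \<Rightarrow> real \<Rightarrow> real" where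
  "boundary_load GL GR fL fR x = (if x > 0 then GL x + (deriv_on {0..} ^^ 2) fL x
     else if x < 0 then - (GR x + (deriv_on {..0} ^^ 2) fR x) else 0)"

text \<open>The value at \<open>t = 0\<close> of the reconstruction: prescribed on the right half
  line, and obtained on the left by integrating \<open>W\<close> back from
  \<open>t = 1\<close>.\<close>

definition initial_profile where
  "initial_profile c V fL fR x = (if x \<ge> 0 then fL x else fR x - profile_growth c V 1 x)"

text \<open>Right minus left limit of \<open>initial_profile\<close> at 0, since
  \<open>profile_growth c V 1 0\<close> is \<open>tint c 1\<close>.\<close>

definition jump :: "(real \<Rightarrow> real) \<Rightarrow> (real \<Rightarrow> real) \<Rightarrow> (real \<Rightarrow> real) \<Rightarrow> real" where
  "jump c fL fR = fL 0 - fR 0 + tint c 1"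

lemma bounded_support_sqint:
  fixes k :: "real \<Rightarrow> real"
  assumes "k \<in> borel_measurable borel" "\<And>x. \<bar>k x\<bar> \<le> B" "\<And>x. \<bar>x\<bar> > R \<Longrightarrow> k x = 0"
  shows "sqint lborel k" "sqint lborel (\<lambda>x. x * k x)"
proof -
  have B: "B \<ge> 0" using order_trans[OF abs_ge_zero assms(2)[of 0]] .
  note [measurable] = assms(1)
  have "integrable lborel (\<lambda>x. (k x)^2)"
    by (rule integrable_bounded_support[where C="B^2" and R=R])
      (use assms(2,3) B in \<open>auto simp: abs_le_square_iff[symmetric]\<close>)
  then show k: "sqint lborel k" by (simp add: sqint_def)
  have "sqint lborel (\<lambda>x. (if \<bar>x\<bar> \<le> R then x else 0) * k x)"
    by (rule sqint_mult_bounded[where C="\<bar>R\<bar>", OF k]) auto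
  also have "(\<lambda>x. (if \<bar>x\<bar> \<le> R then x else 0) * k x) = (\<lambda>x. x * k x)" using assms(3) by (auto simp: fun_eq_iff)
  finally show "sqint lborel (\<lambda>x. x * k x)" .
qed

lemma (in space_test) x_test_sqint: "sqint lborel (\<lambda>x. x * k x)"
proof -
  obtain R B where "\<And>x. \<bar>x\<bar> \<ge> R \<Longrightarrow> k x = 0 \<and> k' x = 0 \<and> k'' x = 0" "\<And>x. \<bar>k x\<bar> \<le> B" using test_bounds by metis
  then show ?thesis by (intro bounded_support_sqint(2)[of k B R]) auto
qed

locale weak_profile =
  fixes c :: "real \<Rightarrow> real" and V G g :: "field" and GL GR fL fR :: "real \<Rightarrow> real"
  assumes prof: "is_profile c V"
    and G: "sqint_strip G" and g: "sqint_strip g" and weak: "has_weak_time_deriv G g"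
    and trL: "time_trace G 0 GL" and trR: "time_trace G 1 GR"
    and dataL: "fL \<in> Cc_infty {0..}" and dataR: "fR \<in> Cc_infty {..0}"
    and eq: "\<And>f ft fr v vr R B. test_pair f ft fr v vr R B \<Longrightarrow>
       pairing (profile_velocity c V) V ft fr v vr = test_load g (boundary_load GL GR fL fR) f"
begin

abbreviation "W \<equiv> profile_velocity c V"
abbreviation "load \<equiv> boundary_load GL GR fL fR"

lemma W_sqint: "sqint_strip W"
  by (rule sqint_velocity[OF prof])

lemma V_sqint: "sqint_strip V"
  by (rule is_profileD(2)[OF prof])

lemma tensor_identity:
  assumes E: "\<And>t. (E has_real_derivative E' t) (at t)" "continuous_on UNIV E'"
    and k: "continuous_on UNIV k" "\<And>x. x \<noteq> 0 \<Longrightarrow> (k has_real_derivative k' x) (at x)" "k' \<in> borel_measurable borel"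
    and bd: "\<And>x. \<bar>k x\<bar> \<le> B" "\<And>x. \<bar>k' x\<bar> \<le> B" "\<And>x. \<bar>x\<bar> > R \<Longrightarrow> k x = 0" "\<And>x. \<bar>x\<bar> > R \<Longrightarrow> k' x = 0"
    and init: "E 0 = 0 \<or> (\<forall>x\<le>0. k x = 0)" and fin: "E 1 = 0 \<or> (\<forall>x\<ge>0. k x = 0)"
  shows "- (LINT t|time. E' t * slice W (\<lambda>x. x * k x) t) + (LINT t|time. E t * slice V k' t) =
     (LINT t|time. E t * slice g k t) + (E 0 + E 1) * (LINT x|lborel. load x * k x)"
proof -
  obtain C where tp: "test_pair (\<lambda>t r. E t * k r) (\<lambda>t r. E' t * k r) (\<lambda>t r. E t * k' r) (\<lambda>_ _. 0) (\<lambda>_ _. 0) R C"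
    using test_pair_tensor[OF E k bd init fin] by blast
  have km: "k \<in> borel_measurable borel" using k(1) by (rule borel_measurable_continuous_onI)
  note sq = bounded_support_sqint[where R=R and B=B, OF km bd(1) bd(3)] bounded_support_sqint(1)[where R=R and B=B, OF k(3) bd(2) bd(4)]
  have mE: "E \<in> borel_measurable borel" "E' \<in> borel_measurable borel"
    using E by (auto intro: borel_measurable_continuous_onI borel_measurable_DERIV)
  obtain B1 where B1: "\<And>t. t \<in> {0..1} \<Longrightarrow> \<bar>E t\<bar> \<le> B1" using bounded_on_Icc[OF DERIV_imp_continuous_on[OF E(1)], of 0 1] by metis
  obtain B2 where B2: "\<And>t. t \<in> {0..1} \<Longrightarrow> \<bar>E' t\<bar> \<le> B2" using bounded_on_Icc[OF E(2), of 0 1] by metis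
  note i1 = integrable_strip_time_slice[OF W_sqint sq(2) mE(2), where C=B2]
  note i2 = integrable_strip_time_slice[OF V_sqint sq(3) mE(1), where C=B1]
  note i3 = integrable_strip_time_slice[OF g sq(1) mE(1), where C=B1]
  have "(LINT (t, r)|strip. W t r * (- (r * (E' t * k r)) + 0) + V t r * (E t * k' r + 0)) =
     - (LINT (t, r)|strip. E' t * (W t r * (r * k r))) + (LINT (t, r)|strip. E t * (V t r * k' r))"
    using i1(1) i2(1) B1 B2 by (simp add: split_beta' mult_ac)
  also have "\<dots> = - (LINT t|time. E' t * slice W (\<lambda>x. x * k x) t) + (LINT t|time. E t * slice V k' t)"
    using i1(2) i2(2) B1 B2 by simp
  finally have l: "(LINT (t, r)|strip. W t r * (- (r * (E' t * k r)) + 0) + V t r * (E t * k' r + 0)) =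
     - (LINT t|time. E' t * slice W (\<lambda>x. x * k x) t) + (LINT t|time. E t * slice V k' t)" .
  have r1: "(LINT (t, r)|strip. g t r * (E t * k r)) = (LINT t|time. E t * slice g k t)"
    using i3(2) B1 by (simp add: split_beta' mult_ac)
  have r2: "(LINT r|lborel. load r * (E 0 * k r + E 1 * k r)) = (E 0 + E 1) * (LINT x|lborel. load x * k x)"
    unfolding Bochner_Integration.integral_mult_right_zero[symmetric]
    by (intro LINT_cong) (simp add: algebra_simps)
  show ?thesis using eq[OF tp] unfolding l r1 r2 .
qed

end

lemma Cc_infty_times_differentiable: "f \<in> Cc_infty UNIV \<Longrightarrow> times_differentiable n f"
proof (induction n arbitrary: f)
  case (Suc n)
  then show ?case using Cc_infty_open_DERIV[OF Suc.prems open_UNIV] Suc.IH[OF deriv_Cc_infty[OF Suc.prems open_UNIV]] by auto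
qed simp

lemma Cc_infty_UNIV_linear:
  assumes f: "f \<in> Cc_infty UNIV" and g: "g \<in> Cc_infty UNIV"
  shows "(\<lambda>x. f x + a * g x) \<in> Cc_infty UNIV"
proof -
  obtain K L where "compact K" "\<And>x. x \<notin> K \<Longrightarrow> f x = 0" "compact L" "\<And>x. x \<notin> L \<Longrightarrow> g x = 0"
    using Cc_inftyE[OF f] Cc_inftyE[OF g] by metis
  note K = this
  show ?thesis
  proof (rule Cc_inftyI[where K="K \<union> L"])
    show "times_differentiable n (\<lambda>x. f x + a * g x)" for n
      by (intro times_differentiable_add times_differentiable_mult times_differentiable_const Cc_infty_times_differentiable[OF f]
          Cc_infty_times_differentiable[OF g])
  qed (use K in auto)
qed

lemma deriv_linear:
  assumes f: "f \<in> Cc_infty UNIV" and g: "g \<in> Cc_infty UNIV"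
  shows "deriv (\<lambda>x. f x + a * g x) = (\<lambda>x. deriv f x + a * deriv g x)"
proof
  fix x
  have "((\<lambda>x. f x + a * g x) has_real_derivative deriv f x + a * deriv g x) (at x)"
    by (intro DERIV_add DERIV_cmult Cc_infty_open_DERIV[OF f] Cc_infty_open_DERIV[OF g]) auto
  then show "deriv (\<lambda>x. f x + a * g x) x = deriv f x + a * deriv g x" by (rule DERIV_imp_deriv)
qed

lemma exists_unit_test: obtains k0 where "k0 \<in> Cc_infty UNIV" "k0 0 = 1"
proof -
  have "bump (-1) 1 0 \<in> Cc_infty UNIV"
    by (rule Cc_inftyI[where K="{-1..1}"]) (auto intro: times_differentiable_bump bump_outside)
  from Cc_infty_UNIV_linear[OF this this, of "1 / bump (-1) 1 0 0 - 1"]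
  show thesis by (rule that) (use bump_pos[of "-1" 0 1 0] in \<open>auto simp: field_simps\<close>)
qed

lemma integral_time_const: "(LINT t|time. k) = (k::real)"
proof -
  have "measure time (space time) = 1" unfolding measure_def emeasure_time_space by simp
  then show ?thesis by simp
qed

lemma integral_slice_pos_neg:
  fixes F :: "field"
  assumes F: "sqint_strip F" and k: "sqint lborel k"
  shows "(LINT t|time. slice F (pos_part k) t) + (LINT t|time. slice F (neg_part k) t) = (LINT t|time. slice F k t)"
proof -
  have "(LINT t|time. slice F (pos_part k) t + slice F (neg_part k) t) = (LINT t|time. slice F k t)"
  proof (rule integral_cong_AE)
    show "AE t in time. slice F (pos_part k) t + slice F (neg_part k) t = slice F k t"
      using AE_sqint_slice[OF F]
    proof eventually_elim
      case (elim t)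
      show ?case unfolding slice_def using integral_pos_neg_part(3)[of "F t" k] integrable_inner_sqint[OF elim k] by simp
    qed
  qed (intro borel_measurable_integrable Bochner_Integration.integrable_add integrable_slice F k sqint_pos_part sqint_neg_part)+
  then show ?thesis
    using integrable_slice[OF F sqint_pos_part[OF k]] integrable_slice[OF F sqint_neg_part[OF k]] by simp
qed

lemma integral_t_times:
  assumes "integrable time f"
  shows "(LINT t|time. t * f t) = tint f 1 - (LINT t|time. tint f t)"
proof -
  have "integrable time (\<lambda>t. t * f t)" by (rule integrable_time_times[where C=1]) (use assms in auto)
  then have "(LINT t|time. (1 - t) * f t) = (LINT t|time. f t) - (LINT t|time. t * f t)"
    unfolding left_diff_distrib mult_1 using assms by (intro LINT_diff)
  then show ?thesis using integral_tint[OF assms] by (simp add: tint_1)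
qed

context space_test
begin

lemma pos_part_test:
  assumes 0: "k 0 = 0"
  shows "continuous_on UNIV (pos_part k)" "x \<noteq> 0 \<Longrightarrow> (pos_part k has_real_derivative pos_part k' x) (at x)"
    "continuous_on UNIV (neg_part k)" "x \<noteq> 0 \<Longrightarrow> (neg_part k has_real_derivative neg_part k' x) (at x)"
proof -
  have "pos_part k = (\<lambda>x. k (max x 0))" "neg_part k = (\<lambda>x. k (min x 0))"
    using 0 by (auto simp: fun_eq_iff pos_part_def neg_part_def max_def min_def not_less)
  then show "continuous_on UNIV (pos_part k)" "continuous_on UNIV (neg_part k)"
    by (auto intro!: continuous_on_compose2[OF test_cont(1)[of UNIV]] continuous_intros)
  have z: "((\<lambda>x. 0) has_real_derivative 0) (at x)" by simp
  show "(pos_part k has_real_derivative pos_part k' x) (at x)" if "x \<noteq> 0"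
  proof (cases "x > 0")
    case True
    then show ?thesis using has_field_derivative_transform_within_open[OF test_DERIV(1) open_greaterThan, of x 0 "pos_part k"]
      by (simp add: pos_part_def)
  next
    case False
    then show ?thesis using that has_field_derivative_transform_within_open[OF z open_lessThan, of 0 "pos_part k"]
      by (simp add: pos_part_def)
  qed
  show "(neg_part k has_real_derivative neg_part k' x) (at x)" if "x \<noteq> 0"
  proof (cases "x < 0")
    case True
    then show ?thesis using has_field_derivative_transform_within_open[OF test_DERIV(1) open_lessThan, of x 0 "neg_part k"]
      by (simp add: neg_part_def)
  next
    case False
    then show ?thesis using that has_field_derivative_transform_within_open[OF z open_greaterThan, of 0 "neg_part k"]
      by (simp add: neg_part_def)
  qed
qed

end

text \<open>The equation for the reconstruction tested with \<open>k\<close> in space, except that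
  the time-independent \<open>initial_profile\<close> is left out. If the reconstruction solves the
  equation, the defect equals the integral of \<open>initial_profile\<close> against the second
  derivative of \<open>k\<close>.\<close>

abbreviation profile_defect where
  "profile_defect c V G k t \<equiv>
     slice (profile_velocity c V) (\<lambda>x. x * k x) t - slice (profile_growth c V) (deriv (deriv k)) t - slice G k t"

locale weak_profile_test = weak_profile c V G g GL GR fL fR + space_test k
  for c V G g GL GR fL fR k
begin

abbreviation "growth \<equiv> profile_growth c V"

lemma V_slices:
  "slice V k' t = - slice W k'' t" "slice V (pos_part k') t = - slice W (pos_part k'') t - c t * k' 0"
  "slice V (neg_part k') t = - slice W (neg_part k'') t + c t * k' 0"
  unfolding slice_def profile_velocity_def using prim_by_parts[OF is_profileD(3)[OF prof], of t "c t"] by auto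

abbreviation "defect \<equiv> profile_defect c V G k"

text \<open>Time test functions supported in \<open>(0, 1)\<close> avoid the lateral terms, so the
  weak equation says that the first slice of the defect has time derivative
  \<open>slice W k'' t + slice g k t\<close>. The two subtracted slices together have the same
  derivative.\<close>

lemma defect_const: obtains h where "AE t in time. defect t = h"
proof -
  obtain R B where RB: "R > 0" "\<And>x. \<bar>x\<bar> \<ge> R \<Longrightarrow> k x = 0 \<and> k' x = 0 \<and> k'' x = 0" "\<And>x. \<bar>k x\<bar> \<le> B" "\<And>x. \<bar>k' x\<bar> \<le> B"
    using test_bounds by metis
  have iw: "integrable time (slice W k'')" "integrable time (slice g k)"
    by (intro integrable_slice W_sqint g test_sqint)+
  have "\<exists>c1. AE t in time. slice W (\<lambda>x. x * k x) t = c1 + tint (\<lambda>t. slice W k'' t + slice g k t) t"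
  proof (rule time_du_Bois_Reymond[OF integrable_slice[OF W_sqint x_test_sqint] Bochner_Integration.integrable_add[OF iw]])
    fix u :: "real \<Rightarrow> real" assume "u \<in> test_family {0<..<1}"
    then have u: "u \<in> Cc_infty {0<..<1}" using test_family_subset[of "{0<..<1}"] by (auto simp: is_interval_oo)
    obtain K where K: "K \<subseteq> {0<..<1}" "\<And>x. x \<notin> K \<Longrightarrow> u x = 0" using Cc_inftyE[OF u] by metis
    have z: "u 0 = 0" "u 1 = 0" using K by force+
    obtain C where C: "\<And>t. t \<in> {0..1} \<Longrightarrow> \<bar>u t\<bar> \<le> C" using Cc_infty_bounded[OF u open_unit, of 0 1] by metis
    have um: "u \<in> borel_measurable borel" by (rule Cc_infty_measurable[OF u open_unit])
    have "- (LINT t|time. deriv u t * slice W (\<lambda>x. x * k x) t) + (LINT t|time. u t * slice V k' t) =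
     (LINT t|time. u t * slice g k t) + (u 0 + u 1) * (LINT x|lborel. load x * k x)"
      by (rule tensor_identity[where B=B and R=R, OF Cc_infty_open_DERIV[OF u open_unit]
            Cc_infty_open_continuous[OF deriv_Cc_infty[OF u open_unit] open_unit] test_cont(1) test_DERIV(1) test_measurable(2)])
        (use RB z in auto)
    moreover have "(LINT t|time. u t * slice V k' t) = - (LINT t|time. u t * slice W k'' t)" by (simp add: V_slices)
    moreover have "(LINT t|time. u t * (slice W k'' t + slice g k t)) = (LINT t|time. u t * slice W k'' t) + (LINT t|time. u t * slice g k t)"
      unfolding distrib_left
      by (intro LINT_add integrable_time_times[where C=C] iw um) (use C in auto)
    ultimately show "(LINT t|time. deriv u t * slice W (\<lambda>x. x * k x) t) = - (LINT t|time. u t * (slice W k'' t + slice g k t))"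
      using z by simp
  qed blast
  then obtain c1 where c1: "AE t in time. slice W (\<lambda>x. x * k x) t = c1 + tint (\<lambda>t. slice W k'' t + slice g k t) t" by blast
  obtain c2 where c2: "AE t in time. slice G k t = c2 + tint (slice g k) t"
    by (rule slice_weak_time_deriv[OF G g weak test_sqint(1)])
  have "AE t in time. defect t = c1 - c2"
    using c1 c2 by eventually_elim (simp add: slice_growth(1)[OF prof test_sqint(3)] tint_add[OF iw])
  then show thesis by (rule that)
qed

lemma integrable_tint_time: "integrable time f \<Longrightarrow> integrable time (tint f)"
proof -
  assume f: "integrable time f"
  have "continuous_on UNIV (prim (\<lambda>s. indicator {0<..<1} s * f s))" by (intro prim_continuous locally_integrable_time f)
  then have m: "prim (\<lambda>s. indicator {0<..<1} s * f s) \<in> borel_measurable borel" by (rule borel_measurable_continuous_onI)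
  obtain C where C: "\<And>x. x \<in> {0..1} \<Longrightarrow> \<bar>prim (\<lambda>s. indicator {0<..<1} s * f s) x\<bar> \<le> C"
    using bounded_on_Icc[OF prim_continuous[OF locally_integrable_time[OF f]], of 0 1] by metis
  have "integrable time (\<lambda>t. prim (\<lambda>s. indicator {0<..<1} s * f s) t * 1)"
    by (rule integrable_time_times[where C=C]) (use m C in auto)
  then show ?thesis
    by (rule Bochner_Integration.integrable_cong[THEN iffD1, rotated 2]) (auto simp: tint_eq_prim)
qed

lemma growth_pos_neg:
  "(LINT t|time. tint (slice W (pos_part k'')) t) + (LINT t|time. tint (slice W (neg_part k'')) t) = (LINT t|time. slice growth k'' t)"
proof -
  have "tint (slice W (pos_part k'')) t + tint (slice W (neg_part k'')) t = slice growth k'' t" for t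
    using integral_pos_neg_part(3)[OF slice_growth(2)[OF prof test_sqint(3)]]
    unfolding slice_growth(1)[OF prof sqint_pos_part[OF test_sqint(3)], symmetric] slice_growth(1)[OF prof sqint_neg_part[OF test_sqint(3)], symmetric]
    by (simp add: slice_def)
  then have "(LINT t|time. slice growth k'' t) = (LINT t|time. tint (slice W (pos_part k'')) t + tint (slice W (neg_part k'')) t)" by simp
  then show ?thesis
    using integrable_tint_time[OF integrable_slice[OF W_sqint sqint_pos_part[OF test_sqint(3)]]]
      integrable_tint_time[OF integrable_slice[OF W_sqint sqint_neg_part[OF test_sqint(3)]]] by simp
qed

text \<open>Eliminates the unknown constant of \<open>slice_weak_time_deriv\<close> in favour of the
  trace at an end time, which will be 0 for the right and 1 for the left half line.\<close>

lemma source_trace: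
  assumes p: "sqint lborel p" and tr: "time_trace G s Gs" and s: "s \<in> {0..1}"
  shows "(LINT t|time. slice G p t) = (LINT x|lborel. Gs x * p x) - tint (slice g p) s + (LINT t|time. tint (slice g p) t)"
proof -
  obtain cg where cg: "AE t in time. slice G p t = cg + tint (slice g p) t"
    by (rule slice_weak_time_deriv[OF G g weak p])
  have iq: "integrable time (tint (slice g p))" by (intro integrable_tint_time integrable_slice g p)
  have "(LINT t|time. slice G p t) = (LINT t|time. cg + tint (slice g p) t)"
    using iq by (intro integral_cong_AE[OF _ _ cg] borel_measurable_integrable integrable_slice G p) auto
  also have "\<dots> = cg + (LINT t|time. tint (slice g p) t)" using iq by (simp add: integral_time_const del: lebesgue_integral_const)
  finally show ?thesis using time_trace_slice[OF G g p cg tr s] by simp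
qed

text \<open>The weak equation tested with \<open>(1 - t) * pos_part k\<close>, which is admissible
  because it vanishes at \<open>t = 1\<close> and for \<open>x <= 0\<close>. The left side is the
  time mean of the defect restricted to \<open>x > 0\<close>; the terms with \<open>k' 0\<close>
  come from integrating by parts up to the cut.\<close>

lemma pos_identity:
  assumes 0: "k 0 = 0"
  shows "(LINT t|time. slice W (pos_part (\<lambda>x. x * k x)) t) - (LINT t|time. tint (slice W (pos_part k'')) t) - (LINT t|time. slice G (pos_part k) t)
    = k' 0 * (LINT t|time. tint c t) + (LINT x|lborel. fL x * pos_part k'' x) + fL 0 * k' 0"
proof -
  obtain R B where RB: "R > 0" "B \<ge> 0" "\<And>x. \<bar>x\<bar> \<ge> R \<Longrightarrow> k x = 0 \<and> k' x = 0 \<and> k'' x = 0" "\<And>x. \<bar>k x\<bar> \<le> B" "\<And>x. \<bar>k' x\<bar> \<le> B"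
    using test_bounds by metis
  let ?p = "slice W (pos_part (\<lambda>x. x * k x))" and ?w = "slice W (pos_part k'')" and ?q = "slice g (pos_part k)"
  have xp: "(\<lambda>x. x * pos_part k x) = pos_part (\<lambda>x. x * k x)" by (auto simp: pos_part_def fun_eq_iff)
  have iw: "integrable time ?w" "integrable time ?q" "integrable time c"
    by (intro integrable_slice W_sqint g sqint_pos_part test_sqint is_profileD(1)[OF prof])+
  have "- (LINT t|time. -1 * slice W (\<lambda>x. x * pos_part k x) t) + (LINT t|time. (1 - t) * slice V (pos_part k') t) =
     (LINT t|time. (1 - t) * ?q t) + ((1 - 0) + (1 - 1)) * (LINT x|lborel. load x * pos_part k x)"
    by (rule tensor_identity[where B=B and R=R, OF _ _ pos_part_test(1,2)[OF 0] pos_part_measurable[OF test_measurable(2)]])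
      (use RB in \<open>auto simp: pos_part_def intro!: derivative_eq_intros\<close>)
  then have 1: "(LINT t|time. ?p t) + (LINT t|time. (1 - t) * slice V (pos_part k') t) = (LINT t|time. tint ?q t) + (LINT x|lborel. load x * pos_part k x)"
    unfolding xp by (simp add: integral_tint[OF iw(2)])
  have "(LINT t|time. (1 - t) * slice V (pos_part k') t) = (LINT t|time. - ((1 - t) * ?w t) - k' 0 * ((1 - t) * c t))"
    unfolding V_slices by (simp add: algebra_simps)
  also have "\<dots> = - (LINT t|time. (1 - t) * ?w t) - k' 0 * (LINT t|time. (1 - t) * c t)"
    using integrable_time_times[of ?w "\<lambda>t. 1 - t" 1] integrable_time_times[of c "\<lambda>t. 1 - t" 1] iw by simp
  finally have 2: "(LINT t|time. (1 - t) * slice V (pos_part k') t) = - (LINT t|time. tint ?w t) - k' 0 * (LINT t|time. tint c t)"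
    by (simp add: integral_tint iw)
  have 3: "(LINT t|time. slice G (pos_part k) t) = (LINT x|lborel. GL x * pos_part k x) + (LINT t|time. tint ?q t)"
    using source_trace[OF sqint_pos_part[OF test_sqint(1)] trL] by (simp add: tint_0)
  have "(LINT x|lborel. load x * pos_part k x) = (LINT x|lborel. GL x * pos_part k x + (deriv_on {0..} ^^ 2) fL x * pos_part k x)"
    by (intro LINT_cong) (simp add: boundary_load_def pos_part_def algebra_simps)
  also have "\<dots> = (LINT x|lborel. GL x * pos_part k x) + (LINT x|lborel. (deriv_on {0..} ^^ 2) fL x * pos_part k x)"
    using integrable_inner_sqint[OF time_trace_sqint[OF trL] sqint_pos_part[OF test_sqint(1)]] left_data_by_parts(2)[OF dataL 0]
    by (intro LINT_add) auto
  finally have 4: "(LINT x|lborel. load x * pos_part k x) = (LINT x|lborel. GL x * pos_part k x) + (LINT x|lborel. fL x * pos_part k'' x) + fL 0 * k' 0"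
    using left_data_by_parts(1)[OF dataL 0] by simp
  show ?thesis using 1 2 3 4 by simp
qed

text \<open>The mirror image, tested with \<open>t * neg_part k\<close>. The last term combines with
  that of \<open>fR\<close> into the integral of \<open>initial_profile\<close> over the left half
  line.\<close>

lemma neg_identity:
  assumes 0: "k 0 = 0"
  shows "(LINT t|time. slice W (neg_part (\<lambda>x. x * k x)) t) - (LINT t|time. tint (slice W (neg_part k'')) t) - (LINT t|time. slice G (neg_part k) t)
    = k' 0 * (tint c 1 - (LINT t|time. tint c t)) + (LINT x|lborel. fR x * neg_part k'' x) - fR 0 * k' 0 - tint (slice W (neg_part k'')) 1"
proof -
  obtain R B where RB: "R > 0" "B \<ge> 0" "\<And>x. \<bar>x\<bar> \<ge> R \<Longrightarrow> k x = 0 \<and> k' x = 0 \<and> k'' x = 0" "\<And>x. \<bar>k x\<bar> \<le> B" "\<And>x. \<bar>k' x\<bar> \<le> B"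
    using test_bounds by metis
  let ?p = "slice W (neg_part (\<lambda>x. x * k x))" and ?w = "slice W (neg_part k'')" and ?q = "slice g (neg_part k)"
  have xp: "(\<lambda>x. x * neg_part k x) = neg_part (\<lambda>x. x * k x)" by (auto simp: neg_part_def fun_eq_iff)
  have iw: "integrable time ?w" "integrable time ?q" "integrable time c"
    by (intro integrable_slice W_sqint g sqint_neg_part test_sqint is_profileD(1)[OF prof])+
  have "- (LINT t|time. 1 * slice W (\<lambda>x. x * neg_part k x) t) + (LINT t|time. t * slice V (neg_part k') t) =
     (LINT t|time. t * ?q t) + (0 + 1) * (LINT x|lborel. load x * neg_part k x)"
    by (rule tensor_identity[where B=B and R=R, OF _ _ pos_part_test(3,4)[OF 0] neg_part_measurable[OF test_measurable(2)]])
      (use RB in \<open>auto simp: neg_part_def intro!: derivative_eq_intros\<close>)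
  then have 1: "- (LINT t|time. ?p t) + (LINT t|time. t * slice V (neg_part k') t) = tint ?q 1 - (LINT t|time. tint ?q t) + (LINT x|lborel. load x * neg_part k x)"
    unfolding xp by (simp add: integral_t_times[OF iw(2)])
  have "(LINT t|time. t * slice V (neg_part k') t) = (LINT t|time. - (t * ?w t) + k' 0 * (t * c t))"
    unfolding V_slices by (simp add: algebra_simps)
  also have "\<dots> = - (LINT t|time. t * ?w t) + k' 0 * (LINT t|time. t * c t)"
    using integrable_time_times[of ?w "\<lambda>t. t" 1] integrable_time_times[of c "\<lambda>t. t" 1] iw by simp
  finally have 2: "(LINT t|time. t * slice V (neg_part k') t) = - (tint ?w 1 - (LINT t|time. tint ?w t)) + k' 0 * (tint c 1 - (LINT t|time. tint c t))"
    by (simp add: integral_t_times iw)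
  have 3: "(LINT t|time. slice G (neg_part k) t) = (LINT x|lborel. GR x * neg_part k x) - tint ?q 1 + (LINT t|time. tint ?q t)"
    using source_trace[OF sqint_neg_part[OF test_sqint(1)] trR] by simp
  have "(LINT x|lborel. load x * neg_part k x) = (LINT x|lborel. - (GR x * neg_part k x) - (deriv_on {..0} ^^ 2) fR x * neg_part k x)"
    by (intro LINT_cong) (simp add: boundary_load_def neg_part_def algebra_simps)
  also have "\<dots> = - (LINT x|lborel. GR x * neg_part k x) - (LINT x|lborel. (deriv_on {..0} ^^ 2) fR x * neg_part k x)"
    using integrable_inner_sqint[OF time_trace_sqint[OF trR] sqint_neg_part[OF test_sqint(1)]] right_data_by_parts(2)[OF dataR 0]
    by (subst LINT_diff) auto
  finally have 4: "(LINT x|lborel. load x * neg_part k x) = - (LINT x|lborel. GR x * neg_part k x) - ((LINT x|lborel. fR x * neg_part k'' x) - fR 0 * k' 0)"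
    using right_data_by_parts(1)[OF dataR 0] by simp
  show ?thesis using 1 2 3 4 by simp
qed

lemma initial_profile_integral:
  "(LINT x|lborel. initial_profile c V fL fR x * k'' x) =
     (LINT x|lborel. fL x * pos_part k'' x) + (LINT x|lborel. fR x * neg_part k'' x) - tint (slice W (neg_part k'')) 1"
  if 0: "k 0 = 0"
proof -
  note i = left_data_by_parts(3)[OF dataL 0] right_data_by_parts(3)[OF dataR 0] slice_growth(2)[OF prof sqint_neg_part[OF test_sqint(3)], of 1]
  have "(LINT x|lborel. initial_profile c V fL fR x * k'' x) = (LINT x|lborel. fL x * pos_part k'' x + fR x * neg_part k'' x - growth 1 x * neg_part k'' x)"
    by (rule LINT_cong_nonzero(2)) (auto simp: initial_profile_def pos_part_def neg_part_def algebra_simps)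
  also have "\<dots> = (LINT x|lborel. fL x * pos_part k'' x) + (LINT x|lborel. fR x * neg_part k'' x) - (LINT x|lborel. growth 1 x * neg_part k'' x)"
    using i by simp
  finally show ?thesis using slice_growth(1)[OF prof sqint_neg_part[OF test_sqint(3)], of 1] by (simp add: slice_def)
qed

text \<open>A constant defect equals its time mean, and the two half-line identities add up to it.
  The time means of \<open>tint c\<close> cancel, leaving \<open>tint c 1\<close>, which completes
  the jump.\<close>

lemma defect_vanishing:
  assumes 0: "k 0 = 0" and h: "AE t in time. defect t = h"
  shows "h = (LINT x|lborel. initial_profile c V fL fR x * k'' x) + jump c fL fR * k' 0"
proof -
  have ip: "integrable time (slice W (\<lambda>x. x * k x))" "integrable time (slice G k)"
    by (intro integrable_slice W_sqint G x_test_sqint test_sqint)+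
  have "slice growth k'' = tint (slice W k'')" by (intro ext slice_growth(1)[OF prof test_sqint(3)])
  then have ig: "integrable time (slice growth k'')"
    using integrable_tint_time[OF integrable_slice[OF W_sqint test_sqint(3)]] by simp
  have "(LINT t|time. defect t) = (LINT t|time. h)"
    using ip ig by (intro integral_cong_AE[OF _ _ h]) auto
  then have "h = (LINT t|time. slice W (\<lambda>x. x * k x) t) - (LINT t|time. slice growth k'' t) - (LINT t|time. slice G k t)"
    using ip ig by (simp add: integral_time_const del: lebesgue_integral_const)
  also have "\<dots> = ((LINT t|time. slice W (pos_part (\<lambda>x. x * k x)) t) - (LINT t|time. tint (slice W (pos_part k'')) t) - (LINT t|time. slice G (pos_part k) t))
     + ((LINT t|time. slice W (neg_part (\<lambda>x. x * k x)) t) - (LINT t|time. tint (slice W (neg_part k'')) t) - (LINT t|time. slice G (neg_part k) t))"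
    using integral_slice_pos_neg[OF W_sqint x_test_sqint] integral_slice_pos_neg[OF G test_sqint(1)] growth_pos_neg by simp
  also have "\<dots> = (LINT x|lborel. initial_profile c V fL fR x * k'' x) + jump c fL fR * k' 0"
    unfolding pos_identity[OF 0] neg_identity[OF 0] initial_profile_integral[OF 0] jump_def by (simp add: algebra_simps)
  finally show ?thesis .
qed

end

lemma continuous_growth_slice:
  assumes "is_profile c V" "t \<in> {0..1}"
  shows "continuous_on S (profile_growth c V t)"
proof -
  have "continuous_on UNIV (profile_growth c V t)"
    by (rule continuous_on_compose2[OF continuous_profile_growth[OF assms(1)], of UNIV "\<lambda>x. (t, x)", simplified])
      (use assms(2) in \<open>auto intro!: continuous_intros\<close>)
  then show ?thesis by (rule continuous_on_subset) simp
qed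

lemma locally_integrable_initial_profile:
  assumes prof: "is_profile c V" and L: "fL \<in> Cc_infty {0..}" and R: "fR \<in> Cc_infty {..0}"
  shows "locally_integrable (initial_profile c V fL fR)"
  unfolding locally_integrable_def
proof
  fix r :: real
  have cL: "continuous_on {0..\<bar>r\<bar>} fL" using continuous_on_subset[OF Cc_infty_continuous_within[OF L, of 0]] by auto
  have cR: "continuous_on {-\<bar>r\<bar>..0} fR" using continuous_on_subset[OF Cc_infty_continuous_within[OF R, of 0]] by auto
  have "integrable lborel (\<lambda>x. indicator {..<0} x *\<^sub>R (indicator {-\<bar>r\<bar>..0} x * (fR x - profile_growth c V 1 x)))"
    by (intro integrable_mult_indicator integrable_Icc_continuous continuous_on_diff cR continuous_growth_slice[OF prof]) auto
  from Bochner_Integration.integrable_add[OF integrable_Icc_continuous[OF cL] this]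
  have "integrable lborel (\<lambda>x. indicator {0..\<bar>r\<bar>} x * fL x + indicator {..<0} x *\<^sub>R (indicator {-\<bar>r\<bar>..0} x * (fR x - profile_growth c V 1 x)))" .
  then have "integrable lborel (\<lambda>x. indicator {-r..r} x *\<^sub>R (indicator {0..\<bar>r\<bar>} x * fL x + indicator {..<0} x *\<^sub>R (indicator {-\<bar>r\<bar>..0} x * (fR x - profile_growth c V 1 x))))"
    by (intro integrable_mult_indicator) auto
  moreover have "(\<lambda>x. indicator {-r..r} x *\<^sub>R (indicator {0..\<bar>r\<bar>} x * fL x + indicator {..<0} x *\<^sub>R (indicator {-\<bar>r\<bar>..0} x * (fR x - profile_growth c V 1 x)))) =
      (\<lambda>x. indicator {-r..r} x * initial_profile c V fL fR x)"
    by (auto simp: initial_profile_def indicator_def fun_eq_iff)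
  ultimately show "integrable lborel (\<lambda>x. indicator {-r..r} x * initial_profile c V fL fR x)" by simp
qed

text \<open>
  In the sense of distributions, \<open>\<Omega>' = initial_profile c V fL fR + profile_growth c V\<close> satisfies
  \<open>\<rho> \<partial>\<^sub>t\<Omega>' - \<partial>\<^sub>\<rho>\<^sup>2\<Omega>' = G + \<kappa> \<delta>\<^sub>0 - j \<delta>\<^sub>0'\<close>.
\<close>

definition solves_up_to where
  "solves_up_to c V G fL fR j \<kappa> \<longleftrightarrow> is_profile c V \<and> sqint_strip G \<and>
     locally_integrable (initial_profile c V fL fR) \<and> j = jump c fL fR \<and>
     (\<forall>k\<in>Cc_infty UNIV. AE t in time.
        profile_defect c V G k t =
        (LINT x|lborel. initial_profile c V fL fR x * deriv (deriv k) x) + \<kappa> * k 0 + j * deriv k 0)"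

lemma slice_linear:
  fixes F :: "field"
  assumes "integrable lborel (\<lambda>x. F t x * k x)" "integrable lborel (\<lambda>x. F t x * l x)"
  shows "slice F (\<lambda>x. k x + a * l x) t = slice F k t + a * slice F l t"
proof -
  have "slice F (\<lambda>x. k x + a * l x) t = (LINT x|lborel. F t x * k x + a * (F t x * l x))"
    unfolding slice_def by (intro LINT_cong) (simp add: algebra_simps)
  then show ?thesis using assms by (simp add: slice_def)
qed

text \<open>Write \<open>k\<close> as \<open>k1 + k 0 * k0\<close> with \<open>k1 0 = 0\<close>. For
  \<open>k1\<close> the defect is known, so the single number measured with \<open>k0\<close>
  determines it for all \<open>k\<close>.\<close>

lemma (in weak_profile) exists_solves_up_to:
  obtains \<kappa> where "solves_up_to c V G fL fR (jump c fL fR) \<kappa>"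
proof -
  let ?I = "initial_profile c V fL fR" and ?j = "jump c fL fR"
  obtain k0 where k0: "k0 \<in> Cc_infty UNIV" "k0 0 = 1" by (rule exists_unit_test)
  interpret z: weak_profile_test c V G g GL GR fL fR k0 by standard (rule k0)
  obtain h0 where h0: "AE t in time. profile_defect c V G k0 t = h0" by (rule z.defect_const)
  define \<kappa> where "\<kappa> = h0 - (LINT x|lborel. ?I x * deriv (deriv k0) x) - ?j * deriv k0 0"
  have lI: "locally_integrable ?I" by (rule locally_integrable_initial_profile[OF prof dataL dataR])
  have "AE t in time. profile_defect c V G k t =
        (LINT x|lborel. ?I x * deriv (deriv k) x) + \<kappa> * k 0 + ?j * deriv k 0" if k: "k \<in> Cc_infty UNIV" for k
  proof -
    define k1 where "k1 = (\<lambda>x. k x + (- k 0) * k0 x)"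
    have k1: "k1 \<in> Cc_infty UNIV" unfolding k1_def by (rule Cc_infty_UNIV_linear[OF k k0(1)])
    interpret y: weak_profile_test c V G g GL GR fL fR k1 by standard (rule k1)
    obtain h1 where h1: "AE t in time. profile_defect c V G k1 t = h1" by (rule y.defect_const)
    have h1_eq: "h1 = (LINT x|lborel. ?I x * deriv (deriv k1) x) + ?j * deriv k1 0"
      by (rule y.defect_vanishing[OF _ h1]) (simp add: k1_def k0)
    have e: "k = (\<lambda>x. k1 x + k 0 * k0 x)" by (auto simp: k1_def)
    have e1: "deriv k = (\<lambda>x. deriv k1 x + k 0 * deriv k0 x)" by (subst e) (rule deriv_linear[OF k1 k0(1)])
    have e2: "deriv (deriv k) = (\<lambda>x. deriv (deriv k1) x + k 0 * deriv (deriv k0) x)"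
      by (subst e1) (rule deriv_linear[OF deriv_Cc_infty[OF k1 open_UNIV] deriv_Cc_infty[OF k0(1) open_UNIV]])
    have ex: "(\<lambda>x. x * k x) = (\<lambda>x. x * k1 x + k 0 * (x * k0 x))" by (auto simp: k1_def fun_eq_iff algebra_simps)
    have rhs: "(LINT x|lborel. ?I x * deriv (deriv k) x) = (LINT x|lborel. ?I x * deriv (deriv k1) x) + k 0 * (LINT x|lborel. ?I x * deriv (deriv k0) x)"
      using slice_linear[of "\<lambda>_. ?I" 0 "deriv (deriv k1)" "deriv (deriv k0)" "k 0"] y.integrable_times_test(1)[OF lI] z.integrable_times_test(1)[OF lI]
      unfolding e2 by (simp add: slice_def)
    show ?thesis using h0 h1 AE_sqint_slice[OF W_sqint] AE_sqint_slice[OF G]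
    proof eventually_elim
      case (elim t)
      have "slice W (\<lambda>x. x * k x) t = slice W (\<lambda>x. x * k1 x) t + k 0 * slice W (\<lambda>x. x * k0 x) t"
        unfolding ex using integrable_inner_sqint[OF elim(3) y.x_test_sqint] integrable_inner_sqint[OF elim(3) z.x_test_sqint]
        by (intro slice_linear) auto
      moreover have "slice G k t = slice G k1 t + k 0 * slice G k0 t"
        by (subst e, rule slice_linear) (use integrable_inner_sqint[OF elim(4) y.test_sqint(1)] integrable_inner_sqint[OF elim(4) z.test_sqint(1)] in auto)
      moreover have "slice (profile_growth c V) (deriv (deriv k)) t = slice (profile_growth c V) (deriv (deriv k1)) t
           + k 0 * slice (profile_growth c V) (deriv (deriv k0)) t"
        unfolding e2 by (intro slice_linear slice_growth(2)[OF prof] y.test_sqint z.test_sqint)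
      moreover have "deriv k 0 = deriv k1 0 + k 0 * deriv k0 0" by (simp add: e1)
      ultimately show ?case
        using elim(1,2) unfolding rhs h1_eq \<kappa>_def by (simp add: algebra_simps)
    qed
  qed
  then have "solves_up_to c V G fL fR ?j \<kappa>"
    using prof G lI by (simp add: solves_up_to_def)
  then show thesis by (rule that)
qed

text \<open>Near 0 the square of \<open>g + D\<close> is at most twice that of \<open>g - c\<close>
  plus twice that of \<open>D + c\<close>; the first is integrable against 1/|x| by
  \<open>one_sided_value\<close>, the second is of order \<open>x^2\<close>. Away from 0 the weight
  1/|x| is bounded.\<close>

lemma half_load_integrable:
  fixes g D :: "real \<Rightarrow> real"
  assumes S: "S \<in> sets borel" "0 \<notin> S" and g: "sqint lborel g" and v: "one_sided_value S g c"
    and D: "sqint lborel (\<lambda>x. indicator S x * D x)" and near: "\<delta>' > 0" "\<And>x. x \<in> S \<Longrightarrow> \<bar>x\<bar> < \<delta>' \<Longrightarrow> \<bar>D x + c\<bar> \<le> M * \<bar>x\<bar>"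
  shows "integrable lborel (\<lambda>x. indicator S x * ((g x + D x)^2 / \<bar>x\<bar>))"
proof -
  obtain \<delta> where \<delta>: "\<delta> > 0" "(\<integral>\<^sup>+x\<in>S \<inter> {-\<delta><..<\<delta>}. ennreal ((g x - c)^2 / \<bar>x\<bar>) \<partial>lborel) < \<infinity>"
    using v by (auto simp: one_sided_value_def)
  have [measurable]: "g \<in> borel_measurable borel" "S \<in> sets borel" "(\<lambda>x. indicator S x * D x) \<in> borel_measurable borel"
    using sqint_measurable[OF g] sqint_measurable[OF D] S by auto
  define F where "F x = indicator (S \<inter> {-\<delta><..<\<delta>}) x * ((g x - c)^2 / \<bar>x\<bar>)" for x
  have Fi: "integrable lborel F"
  proof (rule integrableI_bounded)
    show "F \<in> borel_measurable lborel" unfolding F_def by measurable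
    have "(\<integral>\<^sup>+x. ennreal (norm (F x)) \<partial>lborel) = (\<integral>\<^sup>+x\<in>S \<inter> {-\<delta><..<\<delta>}. ennreal ((g x - c)^2 / \<bar>x\<bar>) \<partial>lborel)"
      by (intro nn_integral_cong) (auto simp: F_def indicator_def)
    with \<delta>(2) show "(\<integral>\<^sup>+x. ennreal (norm (F x)) \<partial>lborel) < \<infinity>" by simp
  qed
  define \<epsilon> where "\<epsilon> = min \<delta> \<delta>'"
  have \<epsilon>: "\<epsilon> > 0" using \<delta>(1) near(1) by (simp add: \<epsilon>_def)
  \<comment> \<open>One majorant for both regions: the first two terms serve for
    \<open>\<bar>x\<bar> < \<epsilon>\<close>, the last two elsewhere.\<close>
  define H where "H x = 2 * F x + 2 * M^2 * \<epsilon> * indicator {-\<epsilon>..\<epsilon>} x + 2 / \<epsilon> * (g x)^2 + 2 / \<epsilon> * (indicator S x * D x)^2" for x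
  have "integrable lborel (\<lambda>x. (g x)^2)" "integrable lborel (\<lambda>x. (indicator S x * D x)^2)"
    using sqint_integrable[OF g] sqint_integrable[OF D] by simp_all
  then have Hi: "integrable lborel H"
    unfolding H_def[abs_def] using Fi
    by (intro Bochner_Integration.integrable_add integrable_mult_right) (auto simp: emeasure_lborel_Icc_eq)
  have F0: "0 \<le> F x" for x by (simp add: F_def)
  have m: "(\<lambda>x. indicator S x * ((g x + D x)^2 / \<bar>x\<bar>)) \<in> borel_measurable lborel"
  proof -
    have "(\<lambda>x. indicator S x * ((g x + D x)^2 / \<bar>x\<bar>)) = (\<lambda>x. indicator S x * ((g x + indicator S x * D x)^2 / \<bar>x\<bar>))"
      by (auto simp: fun_eq_iff indicator_def)
    then show ?thesis by simp
  qed
  show ?thesis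
  proof (rule integrable_le[OF Hi m], rule AE_I2)
    fix x :: real
    have "indicator S x * ((g x + D x)^2 / \<bar>x\<bar>) \<le> H x"
    proof (cases "x \<in> S")
      case False
      then show ?thesis using F0[of x] \<epsilon> by (simp add: H_def)
    next
      case True
      then have r: "\<bar>x\<bar> > 0" using S by auto
      show ?thesis
      proof (cases "\<bar>x\<bar> < \<epsilon>")
        case small: True
        have "(g x + D x)^2 \<le> 2 * (g x - c)^2 + 2 * (D x + c)^2"
          using sum_squares_bound[of "g x - c" "D x + c"] by (simp add: power2_eq_square algebra_simps)
        moreover have "(D x + c)^2 \<le> (M * \<bar>x\<bar>)^2"
          using near(2)[OF True] small by (intro abs_le_square_iff[THEN iffD1]) (auto simp: \<epsilon>_def)
        ultimately have "(g x + D x)^2 \<le> 2 * (g x - c)^2 + 2 * (M * \<bar>x\<bar>)^2" by simp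
        then have "(g x + D x)^2 / \<bar>x\<bar> \<le> (2 * (g x - c)^2 + 2 * (M * \<bar>x\<bar>)^2) / \<bar>x\<bar>" using r by (simp add: divide_right_mono)
        also have "\<dots> = 2 * ((g x - c)^2 / \<bar>x\<bar>) + 2 * M^2 * \<bar>x\<bar>" using r by (simp add: power2_eq_square field_simps)
        also have "2 * M^2 * \<bar>x\<bar> \<le> 2 * M^2 * \<epsilon>" using small by (intro mult_left_mono) auto
        finally have *: "(g x + D x)^2 / \<bar>x\<bar> \<le> 2 * ((g x - c)^2 / \<bar>x\<bar>) + 2 * M^2 * \<epsilon>" by simp
        have "F x = (g x - c)^2 / \<bar>x\<bar>" "indicator {-\<epsilon>..\<epsilon>} x = (1::real)"
          using True small by (auto simp: F_def indicator_def \<epsilon>_def abs_less_iff)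
        then have "H x = 2 * ((g x - c)^2 / \<bar>x\<bar>) + 2 * M^2 * \<epsilon> + 2 / \<epsilon> * (g x)^2 + 2 / \<epsilon> * (D x)^2"
          using True unfolding H_def by simp
        moreover have "0 \<le> 2 / \<epsilon> * (g x)^2" "0 \<le> 2 / \<epsilon> * (D x)^2" using \<epsilon> by auto
        moreover have "indicator S x * ((g x + D x)^2 / \<bar>x\<bar>) = (g x + D x)^2 / \<bar>x\<bar>" using True by simp
        ultimately show ?thesis using * by argo
      next
        case False
        have "(g x + D x)^2 \<le> 2 * (g x)^2 + 2 * (D x)^2"
          using sum_squares_bound[of "g x" "D x"] by (simp add: power2_sum)
        then have "(g x + D x)^2 / \<bar>x\<bar> \<le> (2 * (g x)^2 + 2 * (D x)^2) / \<epsilon>"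
          using False \<epsilon> by (intro frac_le) auto
        also have "\<dots> = 2 / \<epsilon> * (g x)^2 + 2 / \<epsilon> * (D x)^2" by (simp add: add_divide_distrib)
        finally have *: "(g x + D x)^2 / \<bar>x\<bar> \<le> 2 / \<epsilon> * (g x)^2 + 2 / \<epsilon> * (D x)^2" .
        have "0 \<le> 2 * M^2 * \<epsilon> * indicator {-\<epsilon>..\<epsilon>} x" using \<epsilon> by simp
        then have "2 / \<epsilon> * (g x)^2 + 2 / \<epsilon> * (D x)^2 \<le> H x" using True F0[of x] unfolding H_def by simp
        with * have "(g x + D x)^2 / \<bar>x\<bar> \<le> H x" by (rule order_trans)
        then show ?thesis using True by simp
      qed
    qed
    then show "norm (indicator S x * ((g x + D x)^2 / \<bar>x\<bar>)) \<le> norm (H x)"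
      by (auto simp: indicator_def)
  qed
qed

lemma Cc_infty_near_end:
  assumes f: "f \<in> Cc_infty S" and "0 \<in> S"
  obtains M \<delta> where "\<delta> > 0" "\<And>x. x \<in> S \<Longrightarrow> \<bar>x\<bar> < \<delta> \<Longrightarrow> \<bar>(deriv_on S ^^ n) f x - (deriv_on S ^^ n) f 0\<bar> \<le> M * \<bar>x\<bar>"
proof -
  let ?F = "(deriv_on S ^^ n) f" and ?d = "(deriv_on S ^^ Suc n) f 0"
  have "(?F has_derivative (\<lambda>h. h *\<^sub>R ?d)) (at 0 within S)"
    using Cc_infty_deriv_within[OF assms, of n] by (simp add: has_vector_derivative_def)
  then obtain \<delta> where \<delta>: "\<delta> > 0" "\<And>y. y \<in> S \<Longrightarrow> \<bar>y\<bar> < \<delta> \<Longrightarrow> \<bar>?F y - ?F 0 - y * ?d\<bar> \<le> 1 * \<bar>y\<bar>"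
    unfolding has_derivative_within_alt by (force dest: spec[of _ 1])
  have "\<bar>?F x - ?F 0\<bar> \<le> (1 + \<bar>?d\<bar>) * \<bar>x\<bar>" if "x \<in> S" "\<bar>x\<bar> < \<delta>" for x
    using \<delta>(2)[OF that] abs_triangle_ineq[of "?F x - ?F 0 - x * ?d" "x * ?d"] by (simp add: abs_mult algebra_simps)
  with \<delta>(1) show thesis by (rule that)
qed

lemma Cc_infty_half_sqint:
  assumes f: "f \<in> Cc_infty S" and S: "closed S"
  shows "sqint lborel (\<lambda>x. indicator (interior S) x * (deriv_on S ^^ n) f x)"
proof -
  let ?F = "(deriv_on S ^^ n) f"
  obtain R where R: "R > 0" "\<And>x. x \<in> interior S \<Longrightarrow> R \<le> \<bar>x\<bar> \<Longrightarrow> ?F x = 0" using Cc_infty_deriv_zero[OF f] by metis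
  let ?K = "S \<inter> {-R..R}"
  have K: "compact ?K" using S by (rule closed_Int_compact) simp
  have cont: "continuous_on ?K ?F" using Cc_infty_continuous_within[OF f, of n] by (rule continuous_on_subset) auto
  have ind: "(indicator ?K x :: real)^2 = indicator ?K x" for x by (simp add: indicator_def)
  have *: "sqint lborel (\<lambda>x. indicator ?K x *\<^sub>R ?F x)"
    using borel_integrable_compact[OF K, of "\<lambda>x. (?F x)^2"] borel_measurable_continuous_on_indicator[OF _ cont] cont S
    by (auto simp: sqint_def power_mult_distrib ind continuous_on_power)
  have "(\<lambda>x. indicator (interior S) x * ?F x) = (\<lambda>x. indicator (interior S) x * (indicator ?K x *\<^sub>R ?F x))"
  proof
    fix x
    have "x \<in> ?K \<or> ?F x = 0" if "x \<in> interior S" using R(2)[OF that] interior_subset that by fastforce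
    then show "indicator (interior S) x * ?F x = indicator (interior S) x * (indicator ?K x *\<^sub>R ?F x)"
      by (auto simp: indicator_def)
  qed
  moreover have "sqint lborel (\<lambda>x. indicator (interior S) x * (indicator ?K x *\<^sub>R ?F x))"
    using * by (rule sqint_mult_bounded[where C=1]) (simp_all add: indicator_le_1)
  ultimately show ?thesis by simp
qed

lemma exists_solution_up_to:
  assumes G: "G \<in> H1_L2" and L: "fL \<in> Cc_infty {0..}" and R: "fR \<in> Cc_infty {..0}"
    and trL: "time_trace G 0 GL" "one_sided_value {0<..} GL GL0" "(deriv_on {0..} ^^ 2) fL 0 = - GL0"
    and trR: "time_trace G 1 GR" "one_sided_value {..<0} GR GR0" "(deriv_on {..0} ^^ 2) fR 0 = - GR0"
  obtains c V j \<kappa> where "solves_up_to c V G fL fR j \<kappa>"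
proof -
  obtain g where g: "g \<in> L2_L2" "has_weak_time_deriv G g" using G by (auto simp: H1_L2_def)
  have Gs: "sqint_strip G" "sqint_strip g"
    using G g by (auto simp: H1_L2_def L2_L2_def sqint_eq_square_integrable)
  let ?b = "boundary_load GL GR fL fR"
  let ?DL = "(deriv_on {0..} ^^ 2) fL" and ?DR = "(deriv_on {..0} ^^ 2) fR"
  have GLs: "sqint lborel GL" and GRs: "sqint lborel GR" using time_trace_sqint trL(1) trR(1) by auto
  have DL: "sqint lborel (\<lambda>x. indicator {0<..} x * ?DL x)" using Cc_infty_half_sqint[OF L, of 2] by simp
  have DR: "sqint lborel (\<lambda>x. indicator {..<0} x * ?DR x)" using Cc_infty_half_sqint[OF R, of 2] by simp
  obtain M \<delta> where nL: "\<delta> > 0" "\<And>x. x \<in> {0..} \<Longrightarrow> \<bar>x\<bar> < \<delta> \<Longrightarrow> \<bar>?DL x - ?DL 0\<bar> \<le> M * \<bar>x\<bar>"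
    by (rule Cc_infty_near_end[OF L, of 2]) auto
  obtain M' \<delta>' where nR: "\<delta>' > 0" "\<And>x. x \<in> {..0} \<Longrightarrow> \<bar>x\<bar> < \<delta>' \<Longrightarrow> \<bar>?DR x - ?DR 0\<bar> \<le> M' * \<bar>x\<bar>"
    by (rule Cc_infty_near_end[OF R, of 2]) auto
  have iL: "integrable lborel (\<lambda>y. indicator {0<..} y * ((GL y + ?DL y)^2 / \<bar>y\<bar>))"
    by (rule half_load_integrable[where M=M, OF _ _ GLs trL(2) DL nL(1)]) (use nL(2) trL(3) in auto)
  have iR: "integrable lborel (\<lambda>y. indicator {..<0} y * ((GR y + ?DR y)^2 / \<bar>y\<bar>))"
    by (rule half_load_integrable[where M=M', OF _ _ GRs trR(2) DR nR(1)]) (use nR(2) trR(3) in auto)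
  have "?b = (\<lambda>y. (indicator {0<..} y * GL y + indicator {0<..} y * ?DL y) - (indicator {..<0} y * GR y + indicator {..<0} y * ?DR y))"
    by (auto simp: boundary_load_def fun_eq_iff indicator_def)
  then have b: "?b \<in> borel_measurable borel"
    using sqint_measurable[OF GLs] sqint_measurable[OF GRs] sqint_measurable[OF DL] sqint_measurable[OF DR] by simp
  have bi: "integrable lborel (\<lambda>y. (?b y)^2 / \<bar>y\<bar>)"
    using Bochner_Integration.integrable_add[OF iL iR]
    by (rule Bochner_Integration.integrable_cong[THEN iffD1, rotated 2]) (auto simp: boundary_load_def indicator_def power2_commute power2_eq_square algebra_simps)
  obtain U V :: "field" where UV: "sqint_strip (\<lambda>t y. sqrt (jap y) * U t y)" "sqint_strip V"
    and eq: "\<And>f ft fr v vr R B. test_pair f ft fr v vr R B \<Longrightarrow>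
       pairing U V ft fr v vr = test_load g ?b f"
    by (rule exists_weak_pair[OF Gs(2) b bi]) (rule that, assumption, assumption, blast)
  have space: "(LINT (t, y)|strip. indicator A t * (U t y * deriv u y + V t y * u y)) = 0"
    if u: "u \<in> Cc_infty UNIV" and A: "A \<in> sets borel" for u A
  proof -
    obtain r B where "test_pair (\<lambda>_ _. 0) (\<lambda>_ _. 0) (\<lambda>_ _. 0) (\<lambda>t y. indicator A t * u y) (\<lambda>t y. indicator A t * deriv u y) r B"
      by (rule test_pair_space_only[OF u A])
    from eq[OF this] show ?thesis by (simp add: algebra_simps split_beta')
  qed
  obtain c V' where prof: "is_profile c V'" and ae: "AE (t, y) in strip. V t y = V' t y" "AE (t, y) in strip. U t y = profile_velocity c V' t y"
    by (rule exists_profile[OF UV space])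
  \<comment> \<open>The weak equation is an integral identity, so it passes from \<open>U\<close>
    and \<open>V\<close> to their representatives.\<close>
  interpret weak_profile c V' G g GL GR fL fR
  proof
    fix f ft fr v vr :: "field" and r B :: real
    assume "test_pair f ft fr v vr r B"
    then interpret tp: test_pair f ft fr v vr r B .
    have mW: "strip_measurable (\<lambda>t y. profile_velocity c V' t y)" by (rule sqint_measurable[OF sqint_velocity[OF prof]])
    have "pairing (profile_velocity c V') V' ft fr v vr = pairing U V ft fr v vr"
    proof (rule integral_cong_AE)
      have m: "strip_measurable (\<lambda>t y. F t y * (- (y * ft t y) + vr t y) + H t y * (fr t y + v t y))"
        if "strip_measurable F" "strip_measurable H" for F H :: "field"
      proof -
        have "strip_measurable ft" "strip_measurable vr"
          "strip_measurable fr" "strip_measurable v"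
          using tp.meas by (auto intro: measurable_strip_any)
        then show ?thesis using that unfolding split_beta' by measurable
      qed
      show "strip_measurable (\<lambda>t y. profile_velocity c V' t y * (- (y * ft t y) + vr t y) + V' t y * (fr t y + v t y))"
        by (rule m[OF mW sqint_measurable[OF is_profileD(2)[OF prof]]])
      show "strip_measurable (\<lambda>t y. U t y * (- (y * ft t y) + vr t y) + V t y * (fr t y + v t y))"
        by (rule m[OF sqint_measurable[OF sqint_strip_unweighted[OF UV(1)]] sqint_measurable[OF UV(2)]])
    qed (use ae in eventually_elim, auto)
    also note eq[OF tp.test_pair_axioms]
    finally show "pairing (profile_velocity c V') V' ft fr v vr = test_load g ?b f" .
  qed (use prof Gs g trL trR L R in auto)
  from exists_solves_up_to obtain \<kappa> where "solves_up_to c V' G fL fR (jump c fL fR) \<kappa>" .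
  then show thesis by (rule that)
qed

section \<open>Weak second derivatives of continuous functions\<close>

lemma continuous_locally_integrable: "continuous_on UNIV g \<Longrightarrow> locally_integrable g"
  unfolding locally_integrable_def by (auto intro!: integrable_Icc_continuous intro: continuous_on_subset)

lemma LINT_Icc_continuous:
  fixes f :: "real \<Rightarrow> real"
  assumes "continuous_on {a..b} f"
  shows "(LINT x|lborel. indicator {a..b} x * f x) = integral {a..b} f"
  using set_borel_integral_eq_integral(2)[of "{a..b}" f] integrable_Icc_continuous[OF assms]
  by (simp add: set_integrable_def set_lebesgue_integral_def)

lemma LINT_support_continuous:
  fixes f :: "real \<Rightarrow> real"
  assumes "continuous_on {a..b} f" "\<And>x. x \<notin> {a..b} \<Longrightarrow> f x = 0"
  shows "integrable lborel f" "(LINT x|lborel. f x) = integral {a..b} f"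
proof -
  have e: "(\<lambda>x. indicator {a..b} x * f x) = f" using assms(2) by (auto simp: fun_eq_iff indicator_def)
  from integrable_Icc_continuous[OF assms(1)] show "integrable lborel f" unfolding e .
  from LINT_Icc_continuous[OF assms(1)] show "(LINT x|lborel. f x) = integral {a..b} f" unfolding e .
qed

lemma continuous_AE_eq:
  fixes f g :: "real \<Rightarrow> real"
  assumes S: "open S" and "continuous_on S f" "continuous_on S g" "AE x in lborel. x \<in> S \<longrightarrow> f x = g x" "x \<in> S"
  shows "f x = g x"
proof -
  have "open (S \<inter> (\<lambda>x. f x - g x) -` (- {0}))"
    using assms by (intro continuous_open_preimage continuous_intros) auto
  then have "closed (- (S \<inter> (\<lambda>x. f x - g x) -` (- {0})))" by (simp only: closed_Compl)
  moreover have "AE x \<in> S in lebesgue. x \<in> - (S \<inter> (\<lambda>x. f x - g x) -` (- {0}))" using assms(4) by (simp add: AE_completion)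
  ultimately show ?thesis using mem_closed_if_AE_lebesgue_open[OF S] assms(5) by fastforce
qed

lemma prim_has_real_derivative:
  assumes g: "continuous_on UNIV g"
  shows "(prim g has_real_derivative g x) (at x)"
proof -
  let ?a = "x - 1"
  have c: "continuous_on S g" for S using g by (rule continuous_on_subset) simp
  have D: "((\<lambda>y. prim g ?a + integral {?a..y} g) has_real_derivative g x) (at x within {?a<..<x+1})"
    using DERIV_subset[OF integral_has_real_derivative[OF c[of "{?a..x+1}"], of x], of "{?a<..<x+1}"]
    by (auto intro!: derivative_eq_intros simp: greaterThanLessThan_subseteq_atLeastAtMost_iff)
  have "(prim g has_real_derivative g x) (at x within {?a<..<x+1})"
    by (rule has_field_derivative_transform_within[OF D zero_less_one])
      (auto simp: prim_diff[OF continuous_locally_integrable[OF g], of ?a, unfolded LINT_Icc_continuous[OF c], symmetric])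
  then show ?thesis using at_within_open[of x "{?a<..<x+1}"] by simp
qed

lemma Cc_infty_primitive:
  assumes z: "z \<in> Cc_infty UNIV" and 0: "(LINT x|lborel. z x) = 0"
  obtains v where "v \<in> Cc_infty UNIV" "deriv v = z"
proof -
  obtain R where R: "R > 0" "\<And>x. \<bar>x\<bar> \<ge> R \<Longrightarrow> z x = 0" using Cc_infty_UNIV_bounds[OF z] by metis
  have c: "continuous_on S z" for S by (rule Cc_infty_open_continuous[OF z open_UNIV])
  note li = continuous_locally_integrable[OF c]
  define v where "v x = prim z x - prim z (-R)" for x
  have D: "(v has_real_derivative z x) (at x)" for x
    unfolding v_def by (auto intro!: derivative_eq_intros prim_has_real_derivative c)
  have full: "(LINT x|lborel. indicator {p..q} x * z x) = 0" if "p \<le> -R" "R \<le> q" for p q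
  proof -
    have "indicator {p..q} x * z x = z x" for x using that R(2)[of x] by (cases "\<bar>x\<bar> \<ge> R") (auto simp: indicator_def)
    then show ?thesis using 0 by (simp only:)
  qed
  have left: "(LINT x|lborel. indicator {p..-R} x * z x) = 0" for p
  proof -
    have "indicator {p..-R} x * z x = 0" for x using R(2)[of x] by (auto simp: indicator_def)
    then show ?thesis by (simp only: Bochner_Integration.integral_zero)
  qed
  have "v x = 0" if "x \<notin> {-R..R}" for x
  proof (cases "x < -R")
    case True
    then show ?thesis using prim_diff[OF li, of x "-R"] left[of x] by (simp add: v_def)
  next
    case False
    with that have "x > R" by auto
    then show ?thesis using prim_diff[OF li, of "-R" x] full[of "-R" x] R(1) by (simp add: v_def)
  qed
  moreover have "times_differentiable n v" for n
  proof (cases n)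
    case (Suc m) then show ?thesis using D Cc_infty_times_differentiable[OF z, of m] by auto
  qed simp
  ultimately have "v \<in> Cc_infty UNIV" by (intro Cc_inftyI[where K="{-R..R}"]) auto
  moreover have "deriv v = z" using D by (auto intro: DERIV_imp_deriv)
  ultimately show thesis by (rule that)
qed

text \<open>Every test function differs from a multiple of the unit mass function \<eta> by the
  derivative of a test function. Hence \<open>f\<close> has weak derivative \<open>G - m\<close>,
  with \<open>G\<close> a primitive of \<open>g\<close> and \<open>m\<close> the constant seen by
  \<eta>; continuity makes both derivatives classical.\<close>

lemma weak_second_derivative:
  assumes f: "continuous_on UNIV f" and g: "continuous_on UNIV g"
    and weak: "\<And>v. v \<in> Cc_infty UNIV \<Longrightarrow> (LINT x|lborel. f x * deriv (deriv v) x) = (LINT x|lborel. g x * v x)"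
  obtains f' where "\<And>x. (f has_real_derivative f' x) (at x)" "\<And>x. (f' has_real_derivative g x) (at x)"
proof -
  obtain \<eta> where \<eta>: "\<eta> \<in> Cc_infty UNIV" "(LINT x|lborel. \<eta> x) = 1"
  proof -
    have b: "bump (-1) 1 0 \<in> Cc_infty UNIV"
      by (rule Cc_inftyI[where K="{-1..1}"]) (auto intro: times_differentiable_bump bump_outside)
    have i: "bump_integral (-1) 1 0 > 0" by (rule bump_integral_pos) simp
    define \<eta> where "\<eta> = (\<lambda>x. bump (-1) 1 0 x + (1 / bump_integral (-1) 1 0 - 1) * bump (-1) 1 0 x)"
    have "\<eta> \<in> Cc_infty UNIV" unfolding \<eta>_def by (rule Cc_infty_UNIV_linear[OF b b])
    moreover have "\<eta> = (\<lambda>x. 1 / bump_integral (-1) 1 0 * bump (-1) 1 0 x)" by (auto simp: \<eta>_def algebra_simps)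
    then have "(LINT x|lborel. \<eta> x) = 1" using i by (simp add: bump_integral_def)
    ultimately show thesis by (rule that)
  qed
  define G where "G = prim g"
  have G: "\<And>x. (G has_real_derivative g x) (at x)" "continuous_on S G" for S
    unfolding G_def using prim_has_real_derivative[OF g] by (auto intro: DERIV_imp_continuous_on)
  have fS: "continuous_on S f" and gS: "continuous_on S g" for S using f g continuous_on_subset by blast+
  define m where "m = (LINT x|lborel. f x * deriv \<eta> x) + (LINT x|lborel. G x * \<eta> x)"
  have li: "locally_integrable f" "locally_integrable (\<lambda>x. G x - m)"
    using fS G(2) by (auto intro!: continuous_locally_integrable continuous_intros)
  have ints: "integrable lborel (\<lambda>x. h x * u x)" if u: "u \<in> Cc_infty UNIV" and h: "\<And>S. continuous_on S h" for h u
  proof -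
    obtain R where R: "R > 0" "\<And>x. \<bar>x\<bar> \<ge> R \<Longrightarrow> u x = 0" using Cc_infty_UNIV_bounds[OF u] by metis
    show ?thesis
      by (rule LINT_support_continuous(1)[where a="-R" and b=R])
        (use R(2) h Cc_infty_open_continuous[OF u open_UNIV] in \<open>auto intro!: continuous_intros\<close>)
  qed
  have "(LINT x|lborel. deriv u x * f x) = - (LINT x|lborel. u x * (G x - m))" if "u \<in> test_family UNIV" for u
  proof -
    have u: "u \<in> Cc_infty UNIV" using that test_family_subset[of UNIV] by auto
    define k where "k = (LINT x|lborel. u x)"
    define z where "z = (\<lambda>x. u x + (-k) * \<eta> x)"
    have z: "z \<in> Cc_infty UNIV" unfolding z_def by (rule Cc_infty_UNIV_linear[OF u \<eta>(1)])
    have one: "integrable lborel (\<lambda>x. u x)" "integrable lborel (\<lambda>x. \<eta> x)" using ints[OF u, of "\<lambda>_. 1"] ints[OF \<eta>(1), of "\<lambda>_. 1"] by auto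
    have "(LINT x|lborel. z x) = 0" using one \<eta>(2) by (simp add: z_def k_def)
    then obtain v where v: "v \<in> Cc_infty UNIV" "deriv v = z" using Cc_infty_primitive[OF z] by metis
    obtain R where R: "R > 0" "\<And>x. \<bar>x\<bar> \<ge> R \<Longrightarrow> v x = 0" using Cc_infty_UNIV_bounds[OF v(1)] by metis
    have "(LINT x|lborel. deriv v x * (0 + prim g x)) = - (LINT x|lborel. v x * g x)"
      by (rule integral_deriv_mult_prim[where p="-R" and q=R])
        (use R Cc_infty_open_DERIV[OF v(1) open_UNIV] Cc_infty_open_continuous[OF deriv_Cc_infty[OF v(1) open_UNIV] open_UNIV] in
          \<open>auto intro!: continuous_locally_integrable gS\<close>)
    then have 1: "(LINT x|lborel. f x * deriv z x) = - (LINT x|lborel. G x * z x)"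
      using weak[OF v(1)] by (simp add: v(2) G_def mult.commute)
    have dz: "deriv z = (\<lambda>x. deriv u x + (-k) * deriv \<eta> x)" unfolding z_def by (rule deriv_linear[OF u \<eta>(1)])
    have "(LINT x|lborel. f x * deriv z x) = (LINT x|lborel. f x * deriv u x) - k * (LINT x|lborel. f x * deriv \<eta> x)"
      using slice_linear[of "\<lambda>_. f" 0 "deriv u" "deriv \<eta>" "-k"] ints[OF deriv_Cc_infty[OF u open_UNIV] fS] ints[OF deriv_Cc_infty[OF \<eta>(1) open_UNIV] fS]
      by (simp add: dz slice_def)
    moreover have "(LINT x|lborel. G x * z x) = (LINT x|lborel. G x * u x) - k * (LINT x|lborel. G x * \<eta> x)"
      using slice_linear[of "\<lambda>_. G" 0 "u" "\<eta>" "-k"] ints[OF u G(2)] ints[OF \<eta>(1) G(2)]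
      by (simp add: z_def slice_def)
    moreover have "(LINT x|lborel. u x * (G x - m)) = (LINT x|lborel. G x * u x) - k * m"
      using one(1) ints[OF u G(2)] by (simp add: k_def algebra_simps)
    ultimately show ?thesis using 1 by (simp add: m_def algebra_simps mult.commute[of _ "f _"])
  qed
  from du_Bois_Reymond[OF open_UNIV _ _ li this]
  obtain c where "AE x in lborel. x \<in> UNIV \<longrightarrow> f x = c + prim (\<lambda>x. G x - m) x" by auto
  then have ae: "AE x in lborel. x \<in> UNIV \<longrightarrow> f x = c + prim (\<lambda>x. G x - m) x" by simp
  have pD: "(prim (\<lambda>x. G x - m) has_real_derivative G x - m) (at x)" for x
    by (rule prim_has_real_derivative) (intro continuous_intros G(2))
  have "f x = c + prim (\<lambda>x. G x - m) x" for x
    by (rule continuous_AE_eq[OF open_UNIV f _ ae]) (auto intro!: continuous_intros DERIV_imp_continuous_on[OF pD])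
  then have e: "f = (\<lambda>x. c + prim (\<lambda>x. G x - m) x)" by (auto simp: fun_eq_iff)
  have "(f has_real_derivative G x - m) (at x)" for x unfolding e by (auto intro!: derivative_eq_intros pD)
  moreover have "((\<lambda>x. G x - m) has_real_derivative g x) (at x)" for x by (auto intro!: derivative_eq_intros G(1))
  ultimately show thesis by (rule that)
qed

lemma Cc_infty_open_mono:
  assumes f: "f \<in> Cc_infty S" and S: "open S" and T: "open T" "S \<subseteq> T"
  shows "f \<in> Cc_infty T"
proof -
  obtain K where K: "compact K" "K \<subseteq> S" "\<And>x. x \<notin> K \<Longrightarrow> f x = 0" using f by (rule Cc_inftyE) blast
  have "times_differentiable n f" for n
    using f
  proof (induction n arbitrary: f)
    case (Suc n)
    then show ?case using Cc_infty_open_DERIV[OF Suc.prems S] Suc.IH[OF deriv_Cc_infty[OF Suc.prems S]] by auto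
  qed simp
  then show ?thesis by (rule Cc_inftyI[OF _ T(1) K(1)]) (use K T in auto)
qed

lemma integral_scale_time:
  fixes f :: "real \<Rightarrow> real"
  assumes "h \<ge> 0" "continuous_on {t..t+h} f"
  shows "h * integral {0..1} (\<lambda>s. f (t + s * h)) = integral {t..t+h} f"
proof -
  have *: "t + s * h \<in> {t..t+h}" if "s \<in> {0..1}" for s
    using that assms(1) mult_right_mono[of s 1 h] by auto
  have "((\<lambda>s. h *\<^sub>R f (t + s * h)) has_integral integral {t + 0 * h..t + 1 * h} f) {0..1}"
    by (rule has_integral_substitution[where c=t and d="t+h"]) (use assms * in \<open>auto intro!: derivative_eq_intros\<close>)
  then show ?thesis by (simp add: has_integral_iff)
qed

lemma continuous_on_integral_param:
  fixes F :: "'a::topological_space \<Rightarrow> real \<Rightarrow> real"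
  assumes "continuous_on (U \<times> {a..b}) (\<lambda>(u, x). F u x)"
  shows "continuous_on U (\<lambda>u. integral {a..b} (F u))"
proof -
  have "continuous_on U (\<lambda>u. integral (cbox a b) (F u))"
    by (rule integral_continuous_on_param) (use assms in simp)
  then show ?thesis by simp
qed

subsection \<open>Uniqueness\<close>

text \<open>Used on \<open>[-R, R]\<close> only, where it vanishes to second order at both ends, so
  that no boundary terms arise; its second derivative there is at most
  \<open>8 / R^2\<close>.\<close>

definition cutoff :: "real \<Rightarrow> real \<Rightarrow> real" where
  "cutoff R x = (1 - x^2 / R^2)^2"

lemma cutoff_bounds:
  assumes "R > 0" "\<bar>x\<bar> \<le> R"
  shows "0 \<le> cutoff R x" "cutoff R x \<le> 1" "\<bar>x\<bar> \<le> R / 2 \<Longrightarrow> 1/2 \<le> cutoff R x"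
proof -
  have x: "x^2 \<le> R^2" using assms by (simp add: abs_le_square_iff[symmetric])
  then have "0 \<le> x^2 / R^2" "x^2 / R^2 \<le> 1" using assms(1) by auto
  then show "0 \<le> cutoff R x" "cutoff R x \<le> 1" unfolding cutoff_def by (auto intro!: power_le_one)
  assume "\<bar>x\<bar> \<le> R / 2"
  then have "x^2 \<le> (R / 2)^2" using assms(1) by (simp add: abs_le_square_iff[symmetric])
  then have "x^2 / R^2 \<le> 1/4" using assms(1) by (simp add: power_divide field_simps)
  then have "(3/4)^2 \<le> cutoff R x" unfolding cutoff_def by (intro power_mono) auto
  then show "1/2 \<le> cutoff R x" by (simp add: power2_eq_square)
qed

text \<open>Integrates the derivative of
  \<open>2 * cutoff R x * f x * f' x - k1 x * (f x)^2\<close>, where \<open>k1\<close> is the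
  derivative of the cutoff. The dissipation is kept only through a difference of values of
  \<open>f\<close>: the inequality then contains no derivative of \<open>f\<close> on its right side
  and survives the removal of the time averages.\<close>

lemma cutoff_energy:
  fixes f f' g :: "real \<Rightarrow> real"
  assumes f: "\<And>x. (f has_real_derivative f' x) (at x)" and f': "\<And>x. (f' has_real_derivative g x) (at x)"
    and g: "continuous_on UNIV g" and ab: "- (R / 2) \<le> a" "a < b" "b \<le> R / 2"
  shows "integral {-R..R} (\<lambda>x. 2 * cutoff R x * f x * g x) \<le> 8 / R^2 * integral {-R..R} (\<lambda>x. (f x)^2) - (f b - f a)^2 / (b - a)"
proof -
  have R: "R > 0" using ab by linarith
  have gS: "continuous_on S g" and fS: "continuous_on S f" and f'S: "continuous_on S f'" for S
    using g continuous_on_subset DERIV_imp_continuous_on[OF f] DERIV_imp_continuous_on[OF f'] by blast+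
  define k1 where "k1 x = - 4 * x / R^2 * (1 - x^2 / R^2)" for x
  define k2 where "k2 x = - 4 / R^2 + 12 * x^2 / R^4" for x
  have k: "(cutoff R has_real_derivative k1 x) (at x)" "(k1 has_real_derivative k2 x) (at x)" for x
    unfolding cutoff_def[abs_def] k1_def[abs_def] k2_def
    using R by (auto intro!: derivative_eq_intros simp: power2_eq_square power4_eq_xxxx field_simps)
  have cS: "continuous_on S (cutoff R)" "continuous_on S k2" for S
    using DERIV_imp_continuous_on[OF k(1)] R unfolding k2_def by (auto intro!: continuous_intros)
  have ends: "cutoff R R = 0" "cutoff R (-R) = 0" "k1 R = 0" "k1 (-R) = 0" using R by (auto simp: cutoff_def k1_def)
  have "((\<lambda>x. 2 * cutoff R x * (f' x)^2 + 2 * cutoff R x * f x * g x - k2 x * (f x)^2) has_integral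
      (2 * cutoff R R * f R * f' R - k1 R * (f R)^2) - (2 * cutoff R (-R) * f (-R) * f' (-R) - k1 (-R) * (f (-R))^2)) {-R..R}"
  proof (rule fundamental_theorem_of_calculus)
    fix x
    have "((\<lambda>x. 2 * cutoff R x * f x * f' x - k1 x * (f x)^2) has_real_derivative
        2 * cutoff R x * (f' x)^2 + 2 * cutoff R x * f x * g x - k2 x * (f x)^2) (at x)"
      by (auto intro!: derivative_eq_intros f f' k simp: power2_eq_square algebra_simps)
    then show "((\<lambda>x. 2 * cutoff R x * f x * f' x - k1 x * (f x)^2) has_vector_derivative
        2 * cutoff R x * (f' x)^2 + 2 * cutoff R x * f x * g x - k2 x * (f x)^2) (at x within {-R..R})"
      by (auto intro: has_vector_derivative_at_within simp: has_real_derivative_iff_has_vector_derivative)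
  qed (use R in simp)
  then have 0: "integral {-R..R} (\<lambda>x. 2 * cutoff R x * (f' x)^2 + 2 * cutoff R x * f x * g x - k2 x * (f x)^2) = 0"
    by (simp add: ends has_integral_iff)
  have split: "integral {-R..R} (\<lambda>x. 2 * cutoff R x * f x * g x) =
      integral {-R..R} (\<lambda>x. k2 x * (f x)^2) - integral {-R..R} (\<lambda>x. 2 * cutoff R x * (f' x)^2)"
  proof -
    have i: "(\<lambda>x. 2 * cutoff R x * (f' x)^2) integrable_on {-R..R}" "(\<lambda>x. 2 * cutoff R x * f x * g x) integrable_on {-R..R}"
      "(\<lambda>x. k2 x * (f x)^2) integrable_on {-R..R}"
      by (intro integrable_continuous_real continuous_intros cS fS f'S gS)+
    from 0 show ?thesis
      unfolding Henstock_Kurzweil_Integration.integral_diff[OF integrable_add[OF i(1,2)] i(3)]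
        Henstock_Kurzweil_Integration.integral_add[OF i(1,2)] by linarith
  qed
  have "k2 x * (f x)^2 \<le> 8 / R^2 * (f x)^2" if "x \<in> {-R..R}" for x
  proof -
    have "x^2 \<le> R^2" using that R by (intro abs_le_square_iff[THEN iffD1]) auto
    then have "k2 x \<le> 8 / R^2" using R by (simp add: k2_def power2_eq_square power4_eq_xxxx field_simps)
    then show ?thesis by (rule mult_right_mono) simp
  qed
  then have "integral {-R..R} (\<lambda>x. k2 x * (f x)^2) \<le> integral {-R..R} (\<lambda>x. 8 / R^2 * (f x)^2)"
    by (intro integral_le integrable_continuous_real continuous_intros cS fS)
  then have A: "integral {-R..R} (\<lambda>x. k2 x * (f x)^2) \<le> 8 / R^2 * integral {-R..R} (\<lambda>x. (f x)^2)" by simp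
  \<comment> \<open>The mean slope on \<open>[a, b]\<close>. The tangent line bound
    \<open>2 * m * f' x - m^2 <= (f' x)^2\<close> plays the role of Jensen's inequality.\<close>
  define m where "m = (f b - f a) / (b - a)"
  have sub: "{a..b} \<subseteq> {-R..R}" using ab R by auto
  have "(f' has_integral f b - f a) {a..b}"
    by (rule fundamental_theorem_of_calculus)
      (use ab in \<open>auto intro!: has_field_derivative_at_within f simp: has_real_derivative_iff_has_vector_derivative[symmetric]\<close>)
  then have "((\<lambda>x. 2 * m * f' x - m^2) has_integral 2 * m * (f b - f a) - (b - a) * m^2) {a..b}"
    using has_integral_diff[OF has_integral_mult_right[of f' _ _ "2 * m"] has_integral_const_real[of "m^2" a b]] ab(2) by simp
  moreover have "2 * m * (f b - f a) - (b - a) * m^2 = (f b - f a)^2 / (b - a)"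
  proof -
    have e: "f b - f a = m * (b - a)" using ab(2) by (simp add: m_def)
    show ?thesis using ab(2) unfolding e by (simp add: power2_eq_square)
  qed
  ultimately have "(f b - f a)^2 / (b - a) = integral {a..b} (\<lambda>x. 2 * m * f' x - m^2)" by (simp add: has_integral_iff)
  also have "\<dots> \<le> integral {a..b} (\<lambda>x. 2 * cutoff R x * (f' x)^2)"
  proof (intro integral_le integrable_continuous_real continuous_intros cS f'S)
    fix x assume "x \<in> {a..b}"
    then have "\<bar>x\<bar> \<le> R / 2" "\<bar>x\<bar> \<le> R" using ab R by auto
    then have "1 / 2 \<le> cutoff R x" by (intro cutoff_bounds(3)[OF R])
    then have "1 * (f' x)^2 \<le> (2 * cutoff R x) * (f' x)^2" by (intro mult_right_mono) auto
    moreover have "2 * m * f' x - m^2 \<le> (f' x)^2" using zero_le_power2[of "f' x - m"] by (simp add: power2_eq_square algebra_simps)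
    ultimately show "2 * m * f' x - m^2 \<le> 2 * cutoff R x * (f' x)^2" by simp
  qed
  also have "\<dots> \<le> integral {-R..R} (\<lambda>x. 2 * cutoff R x * (f' x)^2)"
    using cutoff_bounds(1)[OF R] by (intro integral_subset_le sub integrable_continuous_real continuous_intros cS f'S) auto
  finally show ?thesis using A split by linarith
qed

section \<open>The energy estimate for continuous solutions of the homogeneous equation\<close>

locale homogeneous_solution =
  fixes D :: "field"
  assumes cont: "continuous_on ({0<..<1} \<times> UNIV) (\<lambda>(t, r). D t r)"
    and weak: "\<And>f v. f \<in> Cc_infty {0<..<1} \<Longrightarrow> v \<in> Cc_infty UNIV \<Longrightarrow>
      (LINT t|time. deriv f t * slice D (\<lambda>x. x * v x) t) = - (LINT t|time. f t * slice D (deriv (deriv v)) t)"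
begin

lemma continuous_D:
  assumes "continuous_on U f" "continuous_on U k" "\<And>u. u \<in> U \<Longrightarrow> f u \<in> {0<..<1}"
  shows "continuous_on U (\<lambda>u. D (f u) (k u))"
proof -
  have "continuous_on U (\<lambda>u. case (f u, k u) of (t, x) \<Rightarrow> D t x)"
    by (rule continuous_on_compose2[OF cont]) (use assms in \<open>auto intro!: continuous_on_Pair\<close>)
  then show ?thesis by simp
qed

lemma slice_support:
  assumes "t \<in> {0<..<1}" "\<And>S. continuous_on S k" "\<And>x. x \<notin> {-R..R} \<Longrightarrow> k x = 0"
  shows "slice D k t = integral {-R..R} (\<lambda>x. D t x * k x)" "integrable lborel (\<lambda>x. D t x * k x)"
proof -
  have "continuous_on {-R..R} (\<lambda>x. D t x * k x)" by (intro continuous_intros continuous_D assms(2)) (use assms(1) in auto)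
  note * = LINT_support_continuous[OF this, unfolded mult_eq_0_iff]
  show "slice D k t = integral {-R..R} (\<lambda>x. D t x * k x)" "integrable lborel (\<lambda>x. D t x * k x)"
    unfolding slice_def using * assms(3) by auto
qed

lemma continuous_slice:
  assumes k: "\<And>S. continuous_on S k" "\<And>x. x \<notin> {-R..R} \<Longrightarrow> k x = 0"
  shows "continuous_on {0<..<1} (slice D k)"
proof -
  have "continuous_on {0<..<1} (\<lambda>t. integral {-R..R} (\<lambda>x. D t x * k x))"
    by (rule continuous_on_integral_param)
      (auto simp: split_beta' intro!: continuous_intros continuous_D continuous_on_compose2[OF k(1)])
  then show ?thesis by (rule continuous_on_cong[THEN iffD1, rotated 2]) (use slice_support(1)[OF _ k] in auto)
qed

text \<open>The integrated form of the equation between two interior times, obtained from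
  \<open>weak\<close> by du Bois-Reymond in time and the continuity of the slices.\<close>

lemma slice_increment:
  assumes v: "v \<in> Cc_infty UNIV" and t: "0 < t0" "t0 \<le> t1" "t1 < 1"
  shows "slice D (\<lambda>x. x * v x) t1 - slice D (\<lambda>x. x * v x) t0 = integral {t0..t1} (slice D (deriv (deriv v)))"
proof -
  obtain R where R: "R > 0" "\<And>x. \<bar>x\<bar> \<ge> R \<Longrightarrow> v x = 0" using Cc_infty_UNIV_bounds[OF v] by metis
  have d2: "deriv (deriv v) \<in> Cc_infty UNIV" by (intro deriv_Cc_infty v open_UNIV)
  obtain R' where R': "R' > 0" "\<And>x. \<bar>x\<bar> \<ge> R' \<Longrightarrow> deriv (deriv v) x = 0" using Cc_infty_UNIV_bounds[OF d2] by metis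
  let ?a = "slice D (\<lambda>x. x * v x)" and ?b = "slice D (deriv (deriv v))"
  have ca: "continuous_on {0<..<1} ?a"
    by (rule continuous_slice[where R=R]) (use R in \<open>auto intro!: continuous_intros Cc_infty_open_continuous[OF v]\<close>)
  have cb: "continuous_on {0<..<1} ?b"
    by (rule continuous_slice[where R=R']) (use R' in \<open>auto intro!: Cc_infty_open_continuous[OF d2]\<close>)
  \<comment> \<open>A margin inside \<open>(0, 1)\<close>, since the slices need not be bounded near
    the end times.\<close>
  define p q where "p = t0 / 2" and "q = (1 + t1) / 2"
  have pq: "0 < p" "p < t0" "t1 < q" "q < 1" using t by (auto simp: p_def q_def)
  let ?f = "\<lambda>t. indicator {p..q} t * ?a t" and ?g = "\<lambda>t. indicator {p..q} t * ?b t"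
  have sub: "{p..q} \<subseteq> {0<..<1}" using pq by auto
  have caS: "continuous_on {p..q} ?a" "continuous_on {p..q} ?b" using ca cb sub continuous_on_subset by blast+
  have loc: "locally_integrable (\<lambda>t. indicator {p..q} t * k t)" if "continuous_on {p..q} k" for k :: "real \<Rightarrow> real"
    unfolding locally_integrable_def
  proof
    fix r :: real
    have "integrable lborel (\<lambda>x. indicator {-r..r} x *\<^sub>R (indicator {p..q} x * k x))"
      by (intro integrable_mult_indicator integrable_Icc_continuous that) simp
    then show "integrable lborel (\<lambda>x. indicator {-r..r} x * (indicator {p..q} x * k x))" by simp
  qed
  have test: "(LINT x|lborel. deriv u x * ?f x) = - (LINT x|lborel. u x * ?g x)" if "u \<in> test_family {p<..<q}" for u
  proof -
    have u: "u \<in> Cc_infty {p<..<q}" using that test_family_subset[of "{p<..<q}"] by (auto simp: is_interval_oo)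
    have u1: "u \<in> Cc_infty {0<..<1}" by (rule Cc_infty_open_mono[OF u]) (use pq in auto)
    have e: "(LINT t|time. z t * k t) = (LINT t|lborel. z t * (indicator {p..q} t * k t))"
      if z: "z \<in> Cc_infty {p<..<q}" for z k :: "real \<Rightarrow> real"
    proof -
      obtain K where "K \<subseteq> {p<..<q}" "\<And>x. x \<notin> K \<Longrightarrow> z x = 0" using Cc_inftyE[OF z] by metis
      then have "z x = 0" if "x \<notin> {p..q}" for x using that by force
      then show ?thesis unfolding integral_time
        by (intro LINT_cong) (use sub in \<open>auto simp: indicator_def\<close>)
    qed
    show ?thesis using weak[OF u1 v] e[OF u, of ?b] e[OF deriv_Cc_infty[OF u], of ?a] by simp
  qed
  have I: "open {p<..<q}" "is_interval {p<..<q}" "{p<..<q} \<noteq> {}" using pq t by (auto simp: is_interval_oo)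
  obtain c where c: "AE x in lborel. x \<in> {p<..<q} \<longrightarrow> ?f x = c + prim ?g x"
    by (rule du_Bois_Reymond[OF I loc[OF caS(1)] loc[OF caS(2)] test])
  have ae: "AE x in lborel. x \<in> {p<..<q} \<longrightarrow> ?a x = c + prim ?g x" using c by eventually_elim (auto simp: indicator_def)
  have e: "?a x = c + prim ?g x" if "x \<in> {p<..<q}" for x
    by (rule continuous_AE_eq[OF open_greaterThanLessThan _ _ ae that])
      (auto intro!: continuous_intros continuous_on_subset[OF caS(1)] continuous_on_subset[OF prim_continuous[OF loc[OF caS(2)]]])
  have "?a t1 - ?a t0 = (LINT r|lborel. indicator {t0..t1} r * ?g r)"
    using e[of t1] e[of t0] pq t prim_diff[OF loc[OF caS(2)] t(2)] by auto
  also have "\<dots> = (LINT r|lborel. indicator {t0..t1} r * ?b r)"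
    by (intro LINT_cong) (use pq in \<open>auto simp: indicator_def\<close>)
  also have "\<dots> = integral {t0..t1} ?b"
    by (rule LINT_Icc_continuous, rule continuous_on_subset[OF caS(2)]) (use pq in auto)
  finally show ?thesis .
qed

text \<open>For \<open>h > 0\<close> this is the mean of \<open>D\<close> over \<open>[t, t + h]\<close>; this form is continuous up to \<open>h = 0\<close>.\<close>

definition mean :: "real \<Rightarrow> real \<Rightarrow> real \<Rightarrow> real" where
  "mean h t x = integral {0..1} (\<lambda>s. D (t + s * h) x)"

lemma mean_0: "mean 0 t x = D t x"
  by (simp add: mean_def)

lemma mean_time:
  fixes h t s :: real
  assumes "0 \<le> h" "0 < t" "t + h < 1" "s \<in> {0..1}"
  shows "t + s * h \<in> {0<..<1}"
proof -
  have "0 \<le> s * h" "s * h \<le> h" using assms mult_right_mono[of s 1 h] by auto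
  then show ?thesis using assms(2,3) by simp
qed

lemma continuous_mean:
  assumes "continuous_on U h" "continuous_on U f" "continuous_on U k" "\<And>u. u \<in> U \<Longrightarrow> 0 \<le> h u \<and> 0 < f u \<and> f u + h u < 1"
  shows "continuous_on U (\<lambda>u. mean (h u) (f u) (k u))"
  unfolding mean_def
proof (rule continuous_on_integral_param, unfold split_beta', rule continuous_D)
  show "continuous_on (U \<times> {0..1}) (\<lambda>p. f (fst p) + snd p * h (fst p))" "continuous_on (U \<times> {0..1}) (\<lambda>p. k (fst p))"
    by (auto intro!: continuous_intros continuous_on_compose2[OF assms(1)] continuous_on_compose2[OF assms(2)] continuous_on_compose2[OF assms(3)])
  show "\<And>u. u \<in> U \<times> {0..1} \<Longrightarrow> f (fst u) + snd u * h (fst u) \<in> {0<..<1}" using mean_time assms(4) by fastforce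
qed

text \<open>Averaging over \<open>[t, t + h]\<close> turns the time derivative in the equation into
  a difference quotient, which is continuous in \<open>x\<close>. Hence the average is classically
  twice differentiable in space, which is not known for \<open>D\<close> itself.\<close>

lemma mean_space_derivatives:
  assumes h: "0 < h" "0 < t" "t + h < 1"
  obtains f' where "\<And>x. (mean h t has_real_derivative f' x) (at x)"
    "\<And>x. (f' has_real_derivative x * ((D (t + h) x - D t x) / h)) (at x)"
proof -
  have cD: "continuous_on S (D s)" if "s \<in> {0<..<1}" for s S by (rule continuous_D) (use that in auto)
  have f: "continuous_on UNIV (mean h t)" using continuous_mean[of UNIV "\<lambda>_. h" "\<lambda>_. t" "\<lambda>x. x"] h by auto
  have g: "continuous_on UNIV (\<lambda>x. x * ((D (t + h) x - D t x) / h))" using h by (intro continuous_intros cD) auto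
  have weak2: "(LINT x|lborel. mean h t x * deriv (deriv v) x) = (LINT x|lborel. x * ((D (t + h) x - D t x) / h) * v x)"
    if v: "v \<in> Cc_infty UNIV" for v
  proof -
    have d2: "deriv (deriv v) \<in> Cc_infty UNIV" by (intro deriv_Cc_infty v open_UNIV)
    let ?d = "deriv (deriv v)" and ?b = "slice D (deriv (deriv v))"
    obtain R where R: "R > 0" "\<And>x. \<bar>x\<bar> \<ge> R \<Longrightarrow> v x = 0" using Cc_infty_UNIV_bounds[OF v] by metis
    obtain R' where R': "R' > 0" "\<And>x. \<bar>x\<bar> \<ge> R' \<Longrightarrow> ?d x = 0" using Cc_infty_UNIV_bounds[OF d2] by metis
    have cd: "continuous_on S ?d" for S by (rule Cc_infty_open_continuous[OF d2 open_UNIV])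
    have sb: "?b s = integral {-R'..R'} (\<lambda>x. D s x * ?d x)" if "s \<in> {0<..<1}" for s
      by (rule slice_support(1)[OF that cd]) (use R' in auto)
    have cb: "continuous_on {t..t+h} ?b"
      by (rule continuous_on_subset[OF continuous_slice[where R=R', OF cd]]) (use R' h in auto)
    have "(LINT x|lborel. mean h t x * ?d x) = integral {-R'..R'} (\<lambda>x. mean h t x * ?d x)"
      by (rule LINT_support_continuous) (use R' in \<open>auto intro!: continuous_intros cd continuous_on_subset[OF f]\<close>)
    also have "\<dots> = integral {-R'..R'} (\<lambda>x. integral {0..1} (\<lambda>s. D (t + s * h) x * ?d x))"
      by (simp add: mean_def)
    also have "\<dots> = integral {0..1} (\<lambda>s. integral {-R'..R'} (\<lambda>x. D (t + s * h) x * ?d x))"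
    proof -
      have "continuous_on (cbox (-R', 0) (R', 1)) (\<lambda>(x, s). D (t + s * h) x * ?d x)"
        unfolding split_beta'
        by (intro continuous_intros continuous_D continuous_on_compose2[OF cd[of UNIV]])
          (use mean_time[of h t] h in \<open>auto simp: mem_Times_iff cbox_Pair_eq\<close>)
      from integral_swap_continuous[OF this] show ?thesis by simp
    qed
    also have "\<dots> = integral {0..1} (\<lambda>s. ?b (t + s * h))"
      by (rule Henstock_Kurzweil_Integration.integral_cong) (use sb mean_time[of h t] h in auto)
    also have "\<dots> = integral {t..t+h} ?b / h"
      using integral_scale_time[OF _ cb] h by (simp add: field_simps)
    also have "\<dots> = (slice D (\<lambda>x. x * v x) (t + h) - slice D (\<lambda>x. x * v x) t) / h"
      using slice_increment[OF v, of t "t + h"] h by simp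
    also have "\<dots> = (LINT x|lborel. x * ((D (t + h) x - D t x) / h) * v x)"
    proof -
      have i: "integrable lborel (\<lambda>x. D s x * (x * v x))" if "s \<in> {0<..<1}" for s
        by (rule slice_support(2)[OF that, of _ R]) (use R in \<open>auto intro!: continuous_intros Cc_infty_open_continuous[OF v]\<close>)
      have *: "slice D (\<lambda>x. x * v x) (t + h) - slice D (\<lambda>x. x * v x) t = (LINT x|lborel. D (t + h) x * (x * v x) - D t x * (x * v x))"
        unfolding slice_def using i[of "t + h"] i[of t] h by simp
      have "(slice D (\<lambda>x. x * v x) (t + h) - slice D (\<lambda>x. x * v x) t) / h =
          (LINT x|lborel. (D (t + h) x * (x * v x) - D t x * (x * v x)) / h)" unfolding * by simp
      also have "\<dots> = (LINT x|lborel. x * ((D (t + h) x - D t x) / h) * v x)"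
      proof (intro LINT_cong)
        fix x
        have "D (t + h) x * (x * v x) - D t x * (x * v x) = x * (D (t + h) x - D t x) * v x" by (simp only: algebra_simps)
        then show "(D (t + h) x * (x * v x) - D t x * (x * v x)) / h = x * ((D (t + h) x - D t x) / h) * v x" by simp
      qed
      finally show ?thesis .
    qed
    finally show ?thesis .
  qed
  show thesis by (rule weak_second_derivative[OF f g weak2], assumption) (rule that)
qed

lemma mean_time_derivative:
  assumes h: "0 < h" "0 < t" "t + h < 1"
  shows "((\<lambda>t. mean h t x) has_real_derivative (D (t + h) x - D t x) / h) (at t)"
proof -
  define p q where "p = t / 2" and "q = (1 + (t + h)) / 2"
  have pq: "0 < p" "p < t" "t + h < q" "q < 1" using h by (auto simp: p_def q_def)
  have cD: "continuous_on S (\<lambda>s. D s x)" if "S \<subseteq> {0<..<1}" for S by (rule continuous_D) (use that in auto)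
  define P where "P s = integral {p..s} (\<lambda>s. D s x)" for s
  have P: "(P has_real_derivative D s x) (at s)" if "p < s" "s < q" for s
    unfolding P_def using integral_has_real_derivative[OF cD, of p q s] that pq at_within_interior[of s "{p..q}"]
    by (auto simp: subset_iff)
  have "((\<lambda>s. P (s + h)) has_real_derivative D (t + h) x) (at t)"
    using P[of "t + h"] pq h by (simp add: DERIV_shift)
  moreover have "(P has_real_derivative D t x) (at t)" using P[of t] pq h by simp
  ultimately have D: "((\<lambda>s. (P (s + h) - P s) / h) has_real_derivative (D (t + h) x - D t x) / h) (at t)"
    by (intro DERIV_cdivide DERIV_diff)
  have e: "(P (s + h) - P s) / h = mean h s x" if "s \<in> {p<..<q-h}" for s
  proof -
    have "(\<lambda>s. D s x) integrable_on {p..s + h}" by (intro integrable_continuous_real cD) (use that pq in auto)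
    then have "P s + integral {s..s + h} (\<lambda>s. D s x) = P (s + h)"
      unfolding P_def by (intro Henstock_Kurzweil_Integration.integral_combine) (use that h in auto)
    moreover have "h * mean h s x = integral {s..s + h} (\<lambda>s. D s x)"
      unfolding mean_def by (rule integral_scale_time) (use that h pq in \<open>auto intro!: cD\<close>)
    ultimately show ?thesis using h by (simp add: field_simps)
  qed
  show ?thesis
    by (rule has_field_derivative_transform_within_open[OF D, of "{p<..<q-h}"]) (use e pq in auto)
qed

text \<open>For the average, \<open>x\<close> times its time derivative is its second space
  derivative, so the time derivative of the weighted energy is bounded by
  \<open>cutoff_energy\<close> at each time.\<close>

lemma mean_energy:
  assumes h: "0 < h" and t: "0 < t1" "t1 \<le> t2" "t2 + h < 1" and ab: "- (R / 2) \<le> a" "a < b" "b \<le> R / 2"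
  shows "integral {-R..R} (\<lambda>x. cutoff R x * x * (mean h t2 x)^2) - integral {-R..R} (\<lambda>x. cutoff R x * x * (mean h t1 x)^2)
    \<le> integral {t1..t2} (\<lambda>t. 8 / R^2 * integral {-R..R} (\<lambda>x. (mean h t x)^2) - (mean h t b - mean h t a)^2 / (b - a))"
proof -
  have R: "R > 0" using ab by linarith
  have cc: "continuous_on S (cutoff R)" for S unfolding cutoff_def[abs_def] using R by (auto intro!: continuous_intros)
  define q where "q t x = (D (t + h) x - D t x) / h" for t x
  define F where "F t x = cutoff R x * x * (2 * mean h t x * q t x)" for t x
  have cm: "continuous_on S (\<lambda>u. mean h (f u) (k u))" if "continuous_on S f" "continuous_on S k" "\<And>u. u \<in> S \<Longrightarrow> f u \<in> {t1..t2}"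
    for S :: "'x::topological_space set" and f k
    by (rule continuous_mean) (use that h t in \<open>force intro: continuous_intros\<close>)+
  have cq: "continuous_on S (\<lambda>u. q (f u) (k u))" if "continuous_on S f" "continuous_on S k" "\<And>u. u \<in> S \<Longrightarrow> f u \<in> {t1..t2}"
    for S :: "'x::topological_space set" and f k
    unfolding q_def by (intro continuous_intros continuous_D that) (use that(3) h t in force)+
  have cF: "continuous_on S (\<lambda>u. F (f u) (k u))" if "continuous_on S f" "continuous_on S k" "\<And>u. u \<in> S \<Longrightarrow> f u \<in> {t1..t2}"
    for S :: "'x::topological_space set" and f k
    unfolding F_def by (intro continuous_intros cq cm that continuous_on_compose2[OF cc[of UNIV]]) auto
  have incr: "cutoff R x * x * (mean h t2 x)^2 - cutoff R x * x * (mean h t1 x)^2 = integral {t1..t2} (\<lambda>t. F t x)" for x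
  proof -
    have "((\<lambda>t. F t x) has_integral cutoff R x * x * (mean h t2 x)^2 - cutoff R x * x * (mean h t1 x)^2) {t1..t2}"
    proof (rule fundamental_theorem_of_calculus[OF t(2)])
      fix t assume "t \<in> {t1..t2}"
      then have "((\<lambda>t. mean h t x) has_real_derivative q t x) (at t)"
        unfolding q_def using h t by (intro mean_time_derivative) auto
      then have "((\<lambda>t. cutoff R x * x * (mean h t x)^2) has_real_derivative F t x) (at t)"
        by (auto intro!: derivative_eq_intros simp: F_def)
      then show "((\<lambda>t. cutoff R x * x * (mean h t x)^2) has_vector_derivative F t x) (at t within {t1..t2})"
        by (auto intro: has_vector_derivative_at_within simp: has_real_derivative_iff_has_vector_derivative)
    qed
    then show ?thesis by (simp add: has_integral_iff)
  qed
  have i: "(\<lambda>x. cutoff R x * x * (mean h t x)^2) integrable_on {-R..R}" if "t \<in> {t1..t2}" for t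
    by (intro integrable_continuous_real continuous_intros cc cm) (use that in auto)
  have "integral {-R..R} (\<lambda>x. cutoff R x * x * (mean h t2 x)^2) - integral {-R..R} (\<lambda>x. cutoff R x * x * (mean h t1 x)^2) =
     integral {-R..R} (\<lambda>x. cutoff R x * x * (mean h t2 x)^2 - cutoff R x * x * (mean h t1 x)^2)"
    by (intro Henstock_Kurzweil_Integration.integral_diff[symmetric] i) (use t in auto)
  also have "\<dots> = integral {-R..R} (\<lambda>x. integral {t1..t2} (\<lambda>t. F t x))" by (simp only: incr)
  also have "\<dots> = integral {t1..t2} (\<lambda>t. integral {-R..R} (F t))"
  proof -
    have "continuous_on (cbox (-R, t1) (R, t2)) (\<lambda>(x, t). F t x)"
      unfolding split_beta' by (intro cF continuous_intros) (auto simp: cbox_Pair_eq mem_Times_iff)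
    from integral_swap_continuous[OF this] show ?thesis by simp
  qed
  also have "\<dots> \<le> integral {t1..t2} (\<lambda>t. 8 / R^2 * integral {-R..R} (\<lambda>x. (mean h t x)^2) - (mean h t b - mean h t a)^2 / (b - a))"
  proof (rule integral_le)
    show "(\<lambda>t. integral {-R..R} (F t)) integrable_on {t1..t2}"
      by (intro integrable_continuous_real continuous_on_integral_param)
        (auto simp: split_beta' intro!: cF continuous_intros)
    show "(\<lambda>t. 8 / R^2 * integral {-R..R} (\<lambda>x. (mean h t x)^2) - (mean h t b - mean h t a)^2 / (b - a)) integrable_on {t1..t2}"
      by (intro integrable_continuous_real continuous_intros continuous_on_integral_param cm)
        (use ab R in \<open>auto simp: split_beta' intro!: cm continuous_intros\<close>)
    fix t assume tt: "t \<in> {t1..t2}"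
    obtain f' where f': "\<And>x. (mean h t has_real_derivative f' x) (at x)" "\<And>x. (f' has_real_derivative x * ((D (t + h) x - D t x) / h)) (at x)"
      by (rule mean_space_derivatives[of h t]) (use h t tt in auto)
    have "continuous_on UNIV (\<lambda>x. x * ((D (t + h) x - D t x) / h))"
      unfolding q_def[symmetric] by (intro continuous_intros cq) (use tt in auto)
    from cutoff_energy[OF f' this ab]
    show "integral {-R..R} (F t) \<le> 8 / R^2 * integral {-R..R} (\<lambda>x. (mean h t x)^2) - (mean h t b - mean h t a)^2 / (b - a)"
      by (simp add: F_def[abs_def] q_def mult_ac)
  qed
  finally show ?thesis .
qed

text \<open>Both sides of \<open>mean_energy\<close> are continuous in \<open>h\<close> up to
  \<open>h = 0\<close>, where the average is \<open>D\<close>. As no derivatives occur, the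
  inequality passes to the limit.\<close>

lemma energy:
  assumes t: "0 < t1" "t1 \<le> t2" "t2 < 1" and ab: "- (R / 2) \<le> a" "a < b" "b \<le> R / 2"
  shows "integral {-R..R} (\<lambda>x. cutoff R x * x * (D t2 x)^2) - integral {-R..R} (\<lambda>x. cutoff R x * x * (D t1 x)^2)
    \<le> integral {t1..t2} (\<lambda>t. 8 / R^2 * integral {-R..R} (\<lambda>x. (D t x)^2) - (D t b - D t a)^2 / (b - a))"
proof -
  have R: "R > 0" using ab by linarith
  have cc: "continuous_on S (cutoff R)" for S unfolding cutoff_def[abs_def] using R by (auto intro!: continuous_intros)
  define \<delta> where "\<delta> = (1 - t2) / 2"
  have \<delta>: "\<delta> > 0" "t2 + \<delta> < 1" using t by (auto simp: \<delta>_def field_simps)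
  define L where "L h = integral {-R..R} (\<lambda>x. cutoff R x * x * (mean h t2 x)^2) - integral {-R..R} (\<lambda>x. cutoff R x * x * (mean h t1 x)^2)
    - integral {t1..t2} (\<lambda>t. 8 / R^2 * integral {-R..R} (\<lambda>x. (mean h t x)^2) - (mean h t b - mean h t a)^2 / (b - a))" for h
  have cl: "closure {0<..\<delta>} = {0..\<delta>}" using \<delta> by (intro closure_greaterThanAtMost) auto
  have cm: "continuous_on S (\<lambda>u. mean (g u) (f u) (k u))" if "continuous_on S g" "continuous_on S f" "continuous_on S k" "\<And>u. u \<in> S \<Longrightarrow> f u \<in> {t1..t2} \<and> g u \<in> {0..\<delta>}"
    for S :: "'x::topological_space set" and f g k
    by (rule continuous_mean) (use that \<delta> t in \<open>force intro: continuous_intros\<close>)+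
  have "L 0 \<le> 0"
  proof (rule continuous_le_on_closure[of "{0<..\<delta>}" L])
    show "continuous_on (closure {0<..\<delta>}) L"
      unfolding cl L_def using ab t
      by (intro continuous_intros continuous_on_integral_param cm; unfold split_beta')
        (auto intro!: continuous_intros continuous_on_integral_param cm continuous_on_compose2[OF cc[of UNIV]] simp: split_beta')
    fix h assume "h \<in> {0<..\<delta>}"
    then show "L h \<le> 0" unfolding L_def using mean_energy[of h t1 t2 R a b] t ab \<delta> by simp
  qed (use \<delta> cl in auto)
  then show ?thesis by (simp add: L_def mean_0)
qed

text \<open>The weight \<open>x\<close> changes sign. Multiplied by \<open>s\<close> it is
  nonpositive off \<open>S\<close>, so only the part over \<open>S\<close>, where a trace condition
  is available, contributes to an upper bound.\<close>

lemma half_energy_bound: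
  assumes S: "S \<in> sets borel" and t: "t \<in> {0<..<1}" and R: "R > 0" and e: "0 \<le> e"
    and n: "lateral S (D t) \<le> ennreal e"
    and s: "s = 1 \<or> s = -1" "\<And>x. x \<notin> S \<Longrightarrow> s * x \<le> 0"
  shows "integral {-R..R} (\<lambda>x. s * (cutoff R x * x * (D t x)^2)) \<le> e"
proof -
  have cD: "continuous_on T (D t)" for T by (rule continuous_D) (use t in auto)
  have cc: "continuous_on T (cutoff R)" for T unfolding cutoff_def[abs_def] using R by (auto intro!: continuous_intros)
  have [measurable]: "D t \<in> borel_measurable borel" "S \<in> sets borel" using cD S by (auto intro: borel_measurable_continuous_onI)
  let ?k = "\<lambda>x. s * (cutoff R x * x * (D t x)^2)" and ?w = "\<lambda>x. indicator S x * (\<bar>x\<bar> * (D t x)^2)"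
  have e2: "lateral S (D t) = (\<integral>\<^sup>+x. ennreal (?w x) \<partial>lborel)"
    by (intro nn_integral_cong) (auto simp: indicator_def)
  have fin: "(\<integral>\<^sup>+x. ennreal (?w x) \<partial>lborel) < \<infinity>" using n[unfolded e2] by (rule le_less_trans) simp
  have wi: "integrable lborel ?w" by (rule integrableI_nonneg) (use fin in auto)
  have "ennreal (LINT x|lborel. ?w x) \<le> ennreal e"
    using n[unfolded e2] nn_integral_eq_integral[OF wi] by simp
  then have we: "(LINT x|lborel. ?w x) \<le> e" using e by (simp add: ennreal_le_iff)
  have ck: "continuous_on {-R..R} ?k" by (intro continuous_intros cc cD)
  have "integral {-R..R} ?k = (LINT x|lborel. indicator {-R..R} x * ?k x)" by (rule LINT_Icc_continuous[OF ck, symmetric])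
  also have "\<dots> \<le> (LINT x|lborel. ?w x)"
  proof (rule integral_mono[OF integrable_Icc_continuous[OF ck] wi])
    fix x
    show "indicator {-R..R} x * ?k x \<le> ?w x"
    proof (cases "x \<in> {-R..R}")
      case True
      then have c: "0 \<le> cutoff R x" "cutoff R x \<le> 1" using cutoff_bounds(1,2)[OF R, of x] by auto
      have k: "?k x = (cutoff R x * (D t x)^2) * (s * x)" by simp
      show ?thesis
      proof (cases "x \<in> S")
        case False
        then have "s * x \<le> 0" by (rule s(2))
        then have "?k x \<le> 0" unfolding k using c by (intro mult_nonneg_nonpos[of _ "s * x"]) auto
        then show ?thesis using True False by simp
      next
        case xS: True
        have "s * x \<le> \<bar>x\<bar>" using s(1) by auto
        then have "?k x \<le> (cutoff R x * (D t x)^2) * \<bar>x\<bar>" unfolding k using c by (intro mult_left_mono) auto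
        also have "\<dots> \<le> (1 * (D t x)^2) * \<bar>x\<bar>" using c by (intro mult_right_mono) auto
        finally show ?thesis using True xS by (simp add: mult_ac)
      qed
    qed simp
  qed
  finally show ?thesis using we by linarith
qed

text \<open>In the energy inequality the cutoff error is of order \<open>1 / R^2\<close> and
  disappears as \<open>R\<close> grows. The energies at \<open>t1\<close> and \<open>t2\<close> are
  bounded on the favourable sides by the traces, which vanish as the times approach 0 and 1. Nothing
  is left to balance the squared spatial difference.\<close>

lemma space_constant:
  assumes bounded: "\<And>p q. 0 < p \<Longrightarrow> q < 1 \<Longrightarrow> \<exists>B. \<forall>t\<in>{p..q}. \<forall>R. integral {-R..R} (\<lambda>x. (D t x)^2) \<le> B"
    and tr0: "((\<lambda>t. lateral {0<..} (D t)) \<longlongrightarrow> 0) (at_right 0)"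
    and tr1: "((\<lambda>t. lateral {..<0} (D t)) \<longlongrightarrow> 0) (at_left 1)"
    and t: "t \<in> {0<..<1}" and ab: "a < b"
  shows "D t a = D t b"
proof -
  define p q where "p = t / 2" and "q = (1 + t) / 2"
  have pq: "0 < p" "p < t" "t < q" "q < 1" using t by (auto simp: p_def q_def)
  let ?J = "\<lambda>t. (D t b - D t a)^2 / (b - a)"
  have cJ: "continuous_on T ?J" if "T \<subseteq> {0<..<1}" for T using ab by (intro continuous_intros continuous_D) (use that in auto)
  have J0: "?J t \<ge> 0" for t using ab by simp
  have Jpq: "continuous_on {p..q} ?J" by (rule cJ) (use pq in auto)
  then have Jpqi: "?J integrable_on {p..q}" by (rule integrable_continuous_real)
  have small: "integral {p..q} ?J \<le> 2 * e" if e: "e > 0" for e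
  proof -
    have "\<forall>\<^sub>F t in at_right 0. lateral {0<..} (D t) < ennreal e"
      using order_tendstoD(2)[OF tr0, of "ennreal e"] e by simp
    then obtain r0 where r0: "0 < r0" "\<And>t. 0 < t \<Longrightarrow> t < r0 \<Longrightarrow> lateral {0<..} (D t) < ennreal e"
      unfolding eventually_at_right_field by auto
    have "\<forall>\<^sub>F t in at_left 1. lateral {..<0} (D t) < ennreal e"
      using order_tendstoD(2)[OF tr1, of "ennreal e"] e by simp
    then obtain r1 where r1: "r1 < 1" "\<And>t. r1 < t \<Longrightarrow> t < 1 \<Longrightarrow> lateral {..<0} (D t) < ennreal e"
      unfolding eventually_at_left_field by auto
    \<comment> \<open>Times so close to the ends that both traces are below \<open>e\<close>, with
      \<open>[p, q]\<close> in between.\<close>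
    define t1 t2 where "t1 = min p (r0 / 2)" and "t2 = max q ((1 + r1) / 2)"
    have tt: "0 < t1" "t1 \<le> p" "t1 < r0" "q \<le> t2" "t2 < 1" "r1 < t2" using pq r0(1) r1(1) by (auto simp: t1_def t2_def min_def max_def)
    obtain B where B: "\<And>t R. t \<in> {t1..t2} \<Longrightarrow> integral {-R..R} (\<lambda>x. (D t x)^2) \<le> B" using bounded[OF tt(1,5)] by blast
    have sub: "{t1..t2} \<subseteq> {0<..<1}" using tt by auto
    have Ji: "?J integrable_on {t1..t2}" by (intro integrable_continuous_real cJ sub)
    have ineq: "integral {t1..t2} ?J \<le> 8 * B * (t2 - t1) / R^2 + 2 * e" if R: "R \<ge> 2 * (\<bar>a\<bar> + \<bar>b\<bar> + 1)" for R :: real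
    proof -
      have R0: "R > 0" using R abs_ge_zero[of a] abs_ge_zero[of b] by argo
      have abR: "- (R / 2) \<le> a" "b \<le> R / 2" using R by argo+
      let ?n = "\<lambda>t. integral {-R..R} (\<lambda>x. (D t x)^2)"
      have cn: "continuous_on {t1..t2} ?n"
        by (intro continuous_on_integral_param) (use sub in \<open>auto simp: split_beta' intro!: continuous_intros continuous_D\<close>)
      have ni: "(\<lambda>t. 8 / R^2 * ?n t) integrable_on {t1..t2}" using cn R0 by (intro integrable_continuous_real continuous_intros)
      have "integral {-R..R} (\<lambda>x. 1 * (cutoff R x * x * (D t1 x)^2)) \<le> e"
        by (rule half_energy_bound[of "{0<..}"]) (use tt R0 e r0(2)[of t1] pq in \<open>auto intro: less_imp_le\<close>)
      then have E1: "integral {-R..R} (\<lambda>x. cutoff R x * x * (D t1 x)^2) \<le> e" by simp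
      have "integral {-R..R} (\<lambda>x. -1 * (cutoff R x * x * (D t2 x)^2)) \<le> e"
        by (rule half_energy_bound[of "{..<0}"]) (use tt R0 e r1(2)[of t2] pq in \<open>auto intro: less_imp_le\<close>)
      then have E2: "- integral {-R..R} (\<lambda>x. cutoff R x * x * (D t2 x)^2) \<le> e" by simp
      have "- e - e \<le> integral {-R..R} (\<lambda>x. cutoff R x * x * (D t2 x)^2) - integral {-R..R} (\<lambda>x. cutoff R x * x * (D t1 x)^2)"
        using E1 E2 by linarith
      also have "\<dots> \<le> integral {t1..t2} (\<lambda>t. 8 / R^2 * ?n t - ?J t)"
        by (rule energy[OF _ _ _ abR(1) ab abR(2)]) (use tt pq in auto)
      also have "\<dots> = integral {t1..t2} (\<lambda>t. 8 / R^2 * ?n t) - integral {t1..t2} ?J"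
        by (intro Henstock_Kurzweil_Integration.integral_diff ni Ji)
      finally have 1: "integral {t1..t2} ?J \<le> integral {t1..t2} (\<lambda>t. 8 / R^2 * ?n t) + 2 * e" by linarith
      have "integral {t1..t2} (\<lambda>t. 8 / R^2 * ?n t) \<le> integral {t1..t2} (\<lambda>t. 8 / R^2 * B)"
        by (intro integral_le ni mult_left_mono B) auto
      also have "\<dots> = 8 * B * (t2 - t1) / R^2" using tt pq by simp
      finally show ?thesis using 1 by linarith
    qed
    have "integral {p..q} ?J \<le> integral {t1..t2} ?J"
      by (rule integral_subset_le[OF _ Jpqi Ji]) (use tt J0 in auto)
    also have "\<dots> \<le> 2 * e"
    proof (rule tendsto_lowerbound)
      have "((\<lambda>R. 8 * B * (t2 - t1) / R^2 + 2 * e) \<longlongrightarrow> 0 + 2 * e) at_top"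
        by (intro tendsto_add tendsto_const tendsto_divide_0[OF tendsto_const] filterlim_at_top_imp_at_infinity filterlim_pow_at_top filterlim_ident) simp
      then show "((\<lambda>R. 8 * B * (t2 - t1) / R^2 + 2 * e) \<longlongrightarrow> 2 * e) at_top" by simp
      show "\<forall>\<^sub>F R in at_top. integral {t1..t2} ?J \<le> 8 * B * (t2 - t1) / R^2 + 2 * e"
        using eventually_ge_at_top[of "2 * (\<bar>a\<bar> + \<bar>b\<bar> + 1)"] by eventually_elim (rule ineq)
    qed simp
    finally show ?thesis .
  qed
  have "integral {p..q} ?J \<le> 0"
  proof (rule field_le_epsilon)
    fix e :: real assume "0 < e"
    then show "integral {p..q} ?J \<le> 0 + e" using small[of "e / 2"] by simp
  qed
  moreover have "integral {p..q} ?J \<ge> 0" by (intro Henstock_Kurzweil_Integration.integral_nonneg Jpqi J0)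
  ultimately have "integral {p..q} ?J = 0" by simp
  moreover have "integral {p..q} ?J = 0 \<longleftrightarrow> (\<forall>t\<in>{p..q}. ?J t = 0)"
    by (rule integral_eq_0_iff[OF Jpq _ J0]) (use pq in auto)
  ultimately have "?J t = 0" using pq by auto
  then show ?thesis using ab by simp
qed

text \<open>By \<open>space_constant\<close> each slice is a constant, and a nonzero constant has
  unbounded L2 norm over growing intervals.\<close>

lemma unique:
  assumes bounded: "\<And>p q. 0 < p \<Longrightarrow> q < 1 \<Longrightarrow> \<exists>B. \<forall>t\<in>{p..q}. \<forall>R. integral {-R..R} (\<lambda>x. (D t x)^2) \<le> B"
    and tr0: "((\<lambda>t. lateral {0<..} (D t)) \<longlongrightarrow> 0) (at_right 0)"
    and tr1: "((\<lambda>t. lateral {..<0} (D t)) \<longlongrightarrow> 0) (at_left 1)"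
    and t: "t \<in> {0<..<1}"
  shows "D t x = 0"
proof -
  define c where "c = D t x"
  have e: "D t y = c" for y
    unfolding c_def using space_constant[OF bounded tr0 tr1 t, of x y] space_constant[OF bounded tr0 tr1 t, of y x] by (cases y x rule: linorder_cases) auto
  obtain B where B: "\<And>R. integral {-R..R} (\<lambda>x. (D t x)^2) \<le> B" using bounded[of t t] t by auto
  have "2 * R * (c)^2 \<le> B" if "R > 0" for R
    using B[of R] that by (simp add: e)
  note B' = this
  show ?thesis
  proof (rule ccontr)
    assume "D t x \<noteq> 0"
    then have pos: "c^2 > 0" by (simp add: c_def)
    \<comment> \<open>With this radius the bound would read
      \<open>2 * (\<bar>B\<bar> + 1) <= B\<close>.\<close>
    have "2 * ((\<bar>B\<bar> + 1) / (c)^2) * (c)^2 \<le> B" using pos by (intro B') auto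
    then show False using pos by simp
  qed
qed

end

section \<open>Continuity of weak solutions and comparison of equations\<close>

lemma weak_deriv_increment:
  assumes f: "continuous_on UNIV f" and w: "sqint lborel w" and d: "has_weak_deriv f w" and xy: "x \<le> y"
  shows "f y - f x = (LINT r|lborel. indicator {x..y} r * w r)"
proof -
  note lw = sqint_locally_integrable[OF w]
  have test: "(LINT x|lborel. deriv u x * f x) = - (LINT x|lborel. u x * w x)" if "u \<in> test_family UNIV" for u
    using d test_family_subset[of UNIV] that by (auto simp: has_weak_deriv_def mult.commute)
  obtain c where c: "AE x in lborel. x \<in> UNIV \<longrightarrow> f x = c + prim w x"
    by (rule du_Bois_Reymond[OF open_UNIV is_interval_univ UNIV_not_empty continuous_locally_integrable[OF f] lw test])
  have "f z = c + prim w z" for z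
    by (rule continuous_AE_eq[OF open_UNIV f _ c]) (auto intro!: continuous_intros prim_continuous lw)
  then show ?thesis using prim_diff[OF lw xy] by simp
qed

text \<open>The Sobolev embedding of H1 into bounded functions: compare \<open>f x\<close> with
  \<open>f y\<close> for \<open>y\<close> in \<open>[x, x + 1]\<close> by Cauchy-Schwarz and average
  over \<open>y\<close>.\<close>

lemma weak_deriv_sup_bound:
  assumes f: "continuous_on UNIV f" "sqint lborel f" and w: "sqint lborel w" and d: "has_weak_deriv f w"
  shows "(f x)^2 \<le> 2 * (LINT r|lborel. (f r)^2) + 2 * (LINT r|lborel. (w r)^2)"
proof -
  let ?N = "LINT r|lborel. (w r)^2"
  have fi: "integrable lborel (\<lambda>r. (f r)^2)" using sqint_integrable[OF f(2)] by simp
  have fS: "continuous_on S f" for S using f(1) by (rule continuous_on_subset) simp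
  have N: "?N \<ge> 0" by simp
  have "(f x)^2 \<le> 2 * (f y)^2 + 2 * ?N" if y: "y \<in> {x..x+1}" for y
  proof -
    have i: "(LINT r|lborel. (indicator {x..y} r)^2) = y - x" using y by (simp add: power2_eq_square indicator_inter_arith[symmetric])
    have "(LINT r|lborel. indicator {x..y} r * w r)^2 \<le> (y - x) * ?N"
      using integral_Cauchy_Schwarz[OF sqint_indicator_Icc w, of x y] by (simp add: i)
    also have "\<dots> \<le> 1 * ?N" using y N by (intro mult_right_mono) auto
    finally have "(f y - f x)^2 \<le> ?N" using weak_deriv_increment[OF f(1) w d, of x y] y by simp
    moreover have "(f x)^2 \<le> 2 * (f y)^2 + 2 * (f y - f x)^2"
      using zero_le_power2[of "2 * f y - f x"] by (simp add: power2_eq_square algebra_simps)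
    ultimately show ?thesis by linarith
  qed
  then have "integral {x..x+1} (\<lambda>_. (f x)^2) \<le> integral {x..x+1} (\<lambda>y. 2 * (f y)^2 + 2 * ?N)"
    by (intro integral_le integrable_continuous_real continuous_intros fS) auto
  also have "\<dots> = integral {x..x+1} (\<lambda>y. 2 * (f y)^2) + integral {x..x+1} (\<lambda>y. 2 * ?N)"
    by (intro Henstock_Kurzweil_Integration.integral_add integrable_continuous_real continuous_intros fS)
  also have "\<dots> = 2 * (LINT y|lborel. indicator {x..x+1} y * (f y)^2) + 2 * ?N"
    by (subst LINT_Icc_continuous) (auto intro!: continuous_intros fS)
  also have "(LINT y|lborel. indicator {x..x+1} y * (f y)^2) \<le> (LINT r|lborel. (f r)^2)"
    by (intro integral_mono fi integrable_Icc_continuous continuous_intros fS) (auto simp: indicator_def)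
  finally show ?thesis by simp
qed

text \<open>The sup bound applied to the difference of two slices makes the continuity in time
  uniform in space; each slice is continuous by hypothesis.\<close>

lemma C0_H1_jointly_continuous:
  assumes u: "u \<in> C0_H1 I" and c: "\<And>t. t \<in> I \<Longrightarrow> continuous_on UNIV (u t)"
  shows "continuous_on (I \<times> UNIV) (\<lambda>(t, x). u t x)"
proof -
  obtain w where w: "w \<in> C0_L2 I" "\<And>t. t \<in> I \<Longrightarrow> has_weak_deriv (u t) (w t)" and uL: "u \<in> C0_L2 I" using u by (auto simp: C0_H1_def)
  have sq: "sqint lborel (u t)" "sqint lborel (w t)" if "t \<in> I" for t
    using uL w(1) that by (auto simp: C0_L2_def sqint_eq_square_integrable)
  show ?thesis unfolding continuous_on_def
  proof (rule ballI)
    fix p assume p: "p \<in> I \<times> (UNIV :: real set)"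
    obtain s \<sigma> where ps: "p = (s, \<sigma>)" by force
    have s: "s \<in> I" using p ps by auto
    define n where "n t = (LINT r|lborel. (u t r - u s r)^2)" for t
    define m where "m t = (LINT r|lborel. (w t r - w s r)^2)" for t
    have n0: "n s = 0" "m s = 0" by (simp_all add: n_def m_def)
    have "continuous (at s within I) n" "continuous (at s within I) m"
      using uL w(1) s by (auto simp: C0_L2_def continuous_within n_def[abs_def] m_def[abs_def])
    then have nm: "((\<lambda>q. n (fst q)) \<longlongrightarrow> 0) (at p within I \<times> UNIV)" "((\<lambda>q. m (fst q)) \<longlongrightarrow> 0) (at p within I \<times> UNIV)"
      using continuous_within_compose2[of p "I \<times> UNIV" fst n] continuous_within_compose2[of p "I \<times> UNIV" fst m] ps n0
        tendsto_fst[OF tendsto_ident_at, of p "I \<times> UNIV"]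
      by (auto simp: continuous_within)
    have diff: "has_weak_deriv (\<lambda>r. u t r - u s r) (\<lambda>r. w t r - w s r)" if t: "t \<in> I" for t
      unfolding has_weak_deriv_def
    proof
      fix v assume v: "v \<in> Cc_infty UNIV"
      have i: "integrable lborel (\<lambda>r. f r * k r)" if "sqint lborel f" "k \<in> Cc_infty UNIV" for f k
        using integrable_inner_sqint[OF that(1) Cc_infty_sqint[OF that(2)]] by simp
      have d: "deriv v \<in> Cc_infty UNIV" by (rule deriv_Cc_infty[OF v open_UNIV])
      show "(LINT r|lborel. (u t r - u s r) * deriv v r) = - (LINT r|lborel. (w t r - w s r) * v r)"
        using w(2)[OF t] w(2)[OF s] i[OF sq(1)[OF t] d] i[OF sq(1)[OF s] d] i[OF sq(2)[OF t] v] i[OF sq(2)[OF s] v] v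
        by (simp add: has_weak_deriv_def left_diff_distrib)
    qed
    have bound: "\<bar>u t r - u s r\<bar> \<le> sqrt (2 * n t + 2 * m t)" if t: "t \<in> I" for t r
    proof (rule real_le_rsqrt)
      show "\<bar>u t r - u s r\<bar>\<^sup>2 \<le> 2 * n t + 2 * m t"
        using weak_deriv_sup_bound[OF _ _ _ diff[OF t], of r] sq t s c
        by (auto simp: n_def m_def intro!: continuous_intros sqint_diff)
    qed
    have "isCont (u s) \<sigma>" using c[OF s] by (simp add: continuous_on_eq_continuous_at)
    then have us: "((\<lambda>q. u s (snd q)) \<longlongrightarrow> u s \<sigma>) (at p within I \<times> UNIV)"
      by (rule isCont_tendsto_compose) (use ps in \<open>auto intro!: tendsto_eq_intros\<close>)
    have "((\<lambda>q. u (fst q) (snd q) - u s (snd q)) \<longlongrightarrow> 0) (at p within I \<times> UNIV)"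
    proof (rule Lim_null_comparison)
      show "\<forall>\<^sub>F q in at p within I \<times> UNIV. norm (u (fst q) (snd q) - u s (snd q)) \<le> sqrt (2 * n (fst q) + 2 * m (fst q))"
        unfolding eventually_at_filter using bound by (auto intro!: always_eventually)
      show "((\<lambda>q. sqrt (2 * n (fst q) + 2 * m (fst q))) \<longlongrightarrow> 0) (at p within I \<times> UNIV)"
        using nm by (auto intro!: tendsto_eq_intros)
    qed
    from tendsto_add[OF this us]
    show "((\<lambda>(t, x). u t x) \<longlongrightarrow> (case p of (t, x) \<Rightarrow> u t x)) (at p within I \<times> UNIV)"
      by (simp add: split_beta' ps)
  qed
qed

lemma C0_L2_norm_continuous:
  assumes u: "u \<in> C0_L2 I"
  shows "continuous_on I (\<lambda>t. LINT r|lborel. (u t r)^2)"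
  unfolding continuous_on_def
proof (rule ballI)
  fix s assume s: "s \<in> I"
  have sq: "sqint lborel (u t)" if "t \<in> I" for t using u that by (auto simp: C0_L2_def sqint_eq_square_integrable)
  let ?d = "\<lambda>t. LINT r|lborel. (u t r - u s r)^2" and ?n = "\<lambda>t. LINT r|lborel. (u t r)^2"
  have e: "?n t = ?d t - ?n s + 2 * slice u (u s) t" if t: "t \<in> I" for t
  proof -
    have i: "integrable lborel (\<lambda>r. (u t r)^2)" "integrable lborel (\<lambda>r. (u s r)^2)" "integrable lborel (\<lambda>r. u t r * u s r)"
      using sqint_integrable[OF sq[OF t]] sqint_integrable[OF sq[OF s]] integrable_inner_sqint[OF sq[OF t] sq[OF s]] by auto
    have "?d t = (LINT r|lborel. (u t r)^2 + (u s r)^2 - 2 * (u t r * u s r))"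
      by (simp add: power2_diff mult.assoc)
    also have "\<dots> = ?n t + ?n s - 2 * slice u (u s) t" unfolding slice_def using i by simp
    finally show ?thesis by simp
  qed
  have "((\<lambda>t. ?d t - ?n s + 2 * slice u (u s) t) \<longlongrightarrow> 0 - ?n s + 2 * slice u (u s) s) (at s within I)"
    using u s C0_L2_slice_continuous[OF u sq[OF s]] by (intro tendsto_intros) (auto simp: C0_L2_def continuous_on_def)
  then have "((\<lambda>t. ?d t - ?n s + 2 * slice u (u s) t) \<longlongrightarrow> ?n s) (at s within I)" by (simp add: slice_def power2_eq_square)
  then show "(?n \<longlongrightarrow> ?n s) (at s within I)"
    by (rule Lim_transform_within[OF _ zero_less_one]) (use e in auto)
qed

lemma continuous_strip_measurable:
  fixes F :: "field"
  assumes "continuous_on ({0<..<1} \<times> UNIV) (\<lambda>(t, x). F t x)"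
  shows "plane_measurable (\<lambda>t x. indicator {0<..<1} t * F t x)"
    "strip_measurable F"
proof -
  have "open ({0<..<1} \<times> UNIV :: (real \<times> real) set)" by (intro open_Times) auto
  then have "(\<lambda>p. indicator ({0<..<1} \<times> UNIV) p *\<^sub>R (case p of (t, x) \<Rightarrow> F t x)) \<in> borel_measurable borel"
    by (intro borel_measurable_continuous_on_indicator assms) auto
  then show 1: "plane_measurable (\<lambda>t x. indicator {0<..<1} t * F t x)"
    by (simp add: borel_prod split_beta' indicator_times)
  show "strip_measurable F"
    by (rule measurable_cong[THEN iffD1, OF _ measurable_strip_any[OF 1]]) (auto simp: space_pair_measure)
qed

text \<open>\<open>F\<close> may be unbounded near the end times, but \<open>f\<close> confines
  everything to a compact set of times inside \<open>(0, 1)\<close>.\<close>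

lemma integral_tensor_strip:
  fixes F :: "field"
  assumes F: "continuous_on ({0<..<1} \<times> UNIV) (\<lambda>(t, r). F t r)" and f: "f \<in> Cc_infty {0<..<1}"
    and k: "\<And>S. continuous_on S k" "\<And>x. x \<notin> {-R..R} \<Longrightarrow> k x = 0"
  shows "integrable strip (\<lambda>(t, r). f t * (F t r * k r))"
    "(LINT (t, r)|strip. f t * (F t r * k r)) = (LINT t|time. f t * slice F k t)"
    "integrable time (\<lambda>t. f t * slice F k t)"
proof -
  obtain K where K: "compact K" "K \<subseteq> {0<..<1}" "\<And>x. x \<notin> K \<Longrightarrow> f x = 0" using Cc_inftyE[OF f] by metis
  have cf: "continuous_on S f" for S by (rule Cc_infty_open_continuous[OF f open_unit])
  have [measurable]: "f \<in> borel_measurable borel" "k \<in> borel_measurable borel" using cf k(1) by (auto intro: borel_measurable_continuous_onI)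
  have "continuous_on (K \<times> {-R..R}) (\<lambda>p. f (fst p) * ((case p of (t, r) \<Rightarrow> F t r) * k (snd p)))"
    by (intro continuous_intros continuous_on_subset[OF F] continuous_on_compose2[OF cf[of UNIV]] continuous_on_compose2[OF k(1)[of UNIV]])
      (use K(2) in auto)
  then have "bounded ((\<lambda>p. f (fst p) * ((case p of (t, r) \<Rightarrow> F t r) * k (snd p))) ` (K \<times> {-R..R}))"
    by (intro compact_imp_bounded compact_continuous_image compact_Times K) auto
  then obtain C where C: "\<And>t r. t \<in> K \<Longrightarrow> r \<in> {-R..R} \<Longrightarrow> \<bar>f t * (F t r * k r)\<bar> \<le> C"
    unfolding bounded_iff by fastforce
  have "integrable strip (\<lambda>(t, r). f t * ((indicator {0<..<1} t * F t r) * k r))"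
  proof (rule integrable_strip_bounded_support[where C="\<bar>C\<bar>" and R=R])
    show "plane_measurable (\<lambda>t r. f t * ((indicator {0<..<1} t * F t r) * k r))"
      using continuous_strip_measurable(1)[OF F] by (simp add: split_beta')
    fix t r :: real assume t: "t \<in> {0<..<1}"
    show "\<bar>f t * ((indicator {0<..<1} t * F t r) * k r)\<bar> \<le> \<bar>C\<bar>"
      using C[of t r] K(3)[of t] k(2)[of r] t by (cases "t \<in> K \<and> r \<in> {-R..R}") auto
    show "\<bar>r\<bar> > R \<Longrightarrow> f t * ((indicator {0<..<1} t * F t r) * k r) = 0" using k(2)[of r] by fastforce
  qed
  also have "integrable strip (\<lambda>(t, r). f t * ((indicator {0<..<1} t * F t r) * k r)) = integrable strip (\<lambda>(t, r). f t * (F t r * k r))"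
    by (intro Bochner_Integration.integrable_cong refl) (auto simp: space_pair_measure)
  finally show i: "integrable strip (\<lambda>(t, r). f t * (F t r * k r))" .
  show "(LINT (t, r)|strip. f t * (F t r * k r)) = (LINT t|time. f t * slice F k t)"
    unfolding strip_integral_eq_t_rho[OF i] slice_def by simp
  show "integrable time (\<lambda>t. f t * slice F k t)"
    using strip.integrable_fst'[OF i] by (simp add: slice_def)
qed

text \<open>The distributional equation after integrating in space first. The solution and the
  reconstruction are compared in this form.\<close>

definition slice_equation :: "field \<Rightarrow> field \<Rightarrow> bool" where
  "slice_equation G F \<longleftrightarrow> (\<forall>f\<in>Cc_infty {0<..<1}. \<forall>v\<in>Cc_infty UNIV.
     (LINT t|time. deriv f t * slice F (\<lambda>x. x * v x) t) =
     - (LINT t|time. f t * slice F (deriv (deriv v)) t) - (LINT t|time. f t * slice G v t))"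

lemma homogeneous_solution_diff:
  assumes F: "continuous_on ({0<..<1} \<times> UNIV) (\<lambda>(t, r). F t r)" "slice_equation G F"
    and H: "continuous_on ({0<..<1} \<times> UNIV) (\<lambda>(t, r). H t r)" "slice_equation G H"
  shows "homogeneous_solution (\<lambda>t r. F t r - H t r)"
proof
  show "continuous_on ({0<..<1} \<times> UNIV) (\<lambda>(t, r). F t r - H t r)"
    using continuous_on_diff[OF F(1) H(1)] by (simp add: split_beta')
  fix f v assume f: "f \<in> Cc_infty {0<..<1}" and v: "v \<in> Cc_infty UNIV"
  have sl: "(LINT t|time. \<eta> t * slice (\<lambda>t r. F t r - H t r) k t) = (LINT t|time. \<eta> t * slice F k t) - (LINT t|time. \<eta> t * slice H k t)"
    if \<eta>: "\<eta> \<in> Cc_infty {0<..<1}" and k: "\<And>S. continuous_on S k" "\<And>x. x \<notin> {-R..R} \<Longrightarrow> k x = 0" for \<eta> k R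
  proof -
    have i: "integrable lborel (\<lambda>r. L t r * k r)"
      if L: "continuous_on ({0<..<1} \<times> UNIV) (\<lambda>(t, r). L t r)" and t: "t \<in> {0<..<1}" for L :: "field" and t
    proof -
      have "continuous_on {-R..R} (\<lambda>r. case (t, r) of (t, r) \<Rightarrow> L t r)"
        by (rule continuous_on_compose2[OF L]) (use t in \<open>auto intro!: continuous_intros\<close>)
      then show ?thesis by (intro LINT_support_continuous(1)[where a="-R" and b=R]) (use k in \<open>auto intro!: continuous_intros\<close>)
    qed
    have "(LINT t|time. \<eta> t * slice (\<lambda>t r. F t r - H t r) k t) = (LINT t|time. \<eta> t * slice F k t - \<eta> t * slice H k t)"
      by (intro LINT_cong)
        (use i[OF F(1)] i[OF H(1)] in \<open>auto simp: slice_def left_diff_distrib right_diff_distrib[symmetric]\<close>)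
    then show ?thesis using integral_tensor_strip(3)[OF F(1) \<eta> k] integral_tensor_strip(3)[OF H(1) \<eta> k] by simp
  qed
  obtain R where R: "R > 0" "\<And>x. \<bar>x\<bar> \<ge> R \<Longrightarrow> v x = 0" using Cc_infty_UNIV_bounds[OF v] by metis
  have d2: "deriv (deriv v) \<in> Cc_infty UNIV" by (intro deriv_Cc_infty v open_UNIV)
  obtain R' where R': "R' > 0" "\<And>x. \<bar>x\<bar> \<ge> R' \<Longrightarrow> deriv (deriv v) x = 0" using Cc_infty_UNIV_bounds[OF d2] by metis
  have "(LINT t|time. deriv f t * slice (\<lambda>t r. F t r - H t r) (\<lambda>x. x * v x) t) =
     (LINT t|time. deriv f t * slice F (\<lambda>x. x * v x) t) - (LINT t|time. deriv f t * slice H (\<lambda>x. x * v x) t)"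
    by (rule sl[of _ _ R]) (use R in \<open>auto intro!: deriv_Cc_infty f continuous_intros Cc_infty_open_continuous[OF v]\<close>)
  moreover have "(LINT t|time. f t * slice (\<lambda>t r. F t r - H t r) (deriv (deriv v)) t) =
     (LINT t|time. f t * slice F (deriv (deriv v)) t) - (LINT t|time. f t * slice H (deriv (deriv v)) t)"
    by (rule sl[of _ _ R']) (use R' in \<open>auto intro!: f Cc_infty_open_continuous[OF d2]\<close>)
  ultimately show "(LINT t|time. deriv f t * slice (\<lambda>t r. F t r - H t r) (\<lambda>x. x * v x) t) =
      - (LINT t|time. f t * slice (\<lambda>t r. F t r - H t r) (deriv (deriv v)) t)"
    using F(2) H(2) f v unfolding slice_equation_def by auto
qed

lemma weak_solution_slice_equation:
  assumes sol: "weak_solution G fL fR \<Omega>" and G: "sqint_strip G"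
  shows "continuous_on ({0<..<1} \<times> UNIV) (\<lambda>(t, r). \<Omega> t r)" "slice_equation G \<Omega>"
proof -
  show c: "continuous_on ({0<..<1} \<times> UNIV) (\<lambda>(t, r). \<Omega> t r)"
    using sol by (intro C0_H1_jointly_continuous) (auto simp: weak_solution_def)
  show "slice_equation G \<Omega>" unfolding slice_equation_def
  proof (intro ballI)
    fix f v assume f: "f \<in> Cc_infty {0<..<1}" and v: "v \<in> Cc_infty UNIV"
    obtain R where R: "R > 0" "\<And>x. \<bar>x\<bar> \<ge> R \<Longrightarrow> v x = 0" using Cc_infty_UNIV_bounds[OF v] by metis
    have d2: "deriv (deriv v) \<in> Cc_infty UNIV" by (intro deriv_Cc_infty v open_UNIV)
    obtain R' where R': "R' > 0" "\<And>x. \<bar>x\<bar> \<ge> R' \<Longrightarrow> deriv (deriv v) x = 0" using Cc_infty_UNIV_bounds[OF d2] by metis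
    have df: "deriv f \<in> Cc_infty {0<..<1}" by (intro deriv_Cc_infty f open_unit)
    have k1: "\<And>S. continuous_on S (\<lambda>x. x * v x)" "\<And>x. x \<notin> {-R..R} \<Longrightarrow> x * v x = 0"
      using R by (auto intro!: continuous_intros Cc_infty_open_continuous[OF v])
    have k2: "\<And>S. continuous_on S (deriv (deriv v))" "\<And>x. x \<notin> {-R'..R'} \<Longrightarrow> deriv (deriv v) x = 0"
      using R' by (auto intro!: Cc_infty_open_continuous[OF d2])
    note 1 = integral_tensor_strip[where R=R, OF c df k1, simplified] and 2 = integral_tensor_strip[where R=R', OF c f k2, simplified]
    obtain C where C: "\<And>t. t \<in> {0..1} \<Longrightarrow> \<bar>f t\<bar> \<le> C" using Cc_infty_bounded[OF f open_unit, of 0 1] by metis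
    have 3: "(LINT (t, r)|strip. f t * (G t r * v r)) = (LINT t|time. f t * slice G v t)"
      by (rule integrable_strip_time_slice(2)[where C=C, OF G Cc_infty_sqint[OF v] Cc_infty_measurable[OF f open_unit]]) (use C in auto)
    have "(LINT (t, r)|strip. - (r * \<Omega> t r * deriv f t * v r) - \<Omega> t r * f t * deriv (deriv v) r) =
        (LINT (t, r)|strip. G t r * f t * v r)"
      using sol f v unfolding weak_solution_def by blast
    also have "(\<lambda>(t, r). G t r * f t * v r) = (\<lambda>(t, r). f t * (G t r * v r))" by (auto simp: fun_eq_iff)
    also have "(\<lambda>(t, r). - (r * \<Omega> t r * deriv f t * v r) - \<Omega> t r * f t * deriv (deriv v) r) =
       (\<lambda>p. - (case p of (t, r) \<Rightarrow> deriv f t * (\<Omega> t r * (r * v r))) - (case p of (t, r) \<Rightarrow> f t * (\<Omega> t r * deriv (deriv v) r)))"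
      by (auto simp: fun_eq_iff)
    also have "(LINT p|strip. - (case p of (t, r) \<Rightarrow> deriv f t * (\<Omega> t r * (r * v r))) - (case p of (t, r) \<Rightarrow> f t * (\<Omega> t r * deriv (deriv v) r))) =
      - (LINT t|time. deriv f t * slice \<Omega> (\<lambda>x. x * v x) t) - (LINT t|time. f t * slice \<Omega> (deriv (deriv v)) t)"
      using 1(1) 2(1) unfolding 1(2)[symmetric] 2(2)[symmetric] by simp
    finally show "(LINT t|time. deriv f t * slice \<Omega> (\<lambda>x. x * v x) t) =
       - (LINT t|time. f t * slice \<Omega> (deriv (deriv v)) t) - (LINT t|time. f t * slice G v t)"
      unfolding 3 by linarith
  qed
qed

lemma integral_deriv_tint:
  assumes f: "f \<in> Cc_infty {0<..<1}" and g: "integrable time g"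
  shows "(LINT t|time. deriv f t * (k + tint g t)) = - (LINT t|time. f t * g t)"
proof -
  obtain K where K: "K \<subseteq> {0<..<1}" "\<And>x. x \<notin> K \<Longrightarrow> f x = 0" using Cc_inftyE[OF f] by metis
  obtain K' where K': "K' \<subseteq> {0<..<1}" "\<And>x. x \<notin> K' \<Longrightarrow> deriv f x = 0" using Cc_inftyE[OF deriv_Cc_infty[OF f open_unit]] by metis
  have z: "f x = 0" "deriv f x = 0" if "x \<notin> {0<..<1}" for x
    using K(2)[of x] K'(2)[of x] K(1) K'(1) that by blast+
  let ?g = "\<lambda>s. indicator {0<..<1} s * g s"
  have "(LINT t|time. deriv f t * (k + tint g t)) = (LINT t|lborel. deriv f t * (k + prim ?g t))"
    unfolding integral_time by (intro LINT_cong) (auto simp: indicator_def z tint_eq_prim)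
  also have "\<dots> = - (LINT t|lborel. f t * ?g t)"
    by (rule integral_deriv_mult_prim[where p=0 and q=1])
      (use z in \<open>auto intro: Cc_infty_open_DERIV[OF f] Cc_infty_open_continuous[OF deriv_Cc_infty[OF f]] locally_integrable_time g\<close>)
  also have "(LINT t|lborel. f t * ?g t) = (LINT t|time. f t * g t)"
    unfolding integral_time by (intro LINT_cong) auto
  finally show ?thesis .
qed

lemma square_add_le: "(x + y)^2 \<le> 2 * x^2 + 2 * y^2" for x y :: real
  using zero_le_power2[of "x - y"] by (simp add: power2_eq_square algebra_simps)

section \<open>Time integrals of fields and their traces\<close>

lemma tint_strip_measurable:
  assumes "strip_measurable F"
  shows "strip_measurable (\<lambda>t r. tint (\<lambda>s. F s r) t)"
    "(\<lambda>r. tint (\<lambda>s. F s r) t) \<in> borel_measurable lborel"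
proof -
  have "(\<lambda>x. (snd x, snd (fst x))) \<in> strip \<Otimes>\<^sub>M time \<rightarrow>\<^sub>M strip" by measurable
  from measurable_compose[OF this assms]
  have [measurable]: "(\<lambda>x. F (snd x) (snd (fst x))) \<in> borel_measurable (strip \<Otimes>\<^sub>M time)" by simp
  have "(\<lambda>x. (fst (fst x), snd x)) \<in> strip \<Otimes>\<^sub>M time \<rightarrow>\<^sub>M (borel \<Otimes>\<^sub>M borel :: (real \<times> real) measure)"
    by (intro measurable_Pair measurable_compose[OF measurable_fst measurable_compose[OF measurable_fst measurable_time_ident]]
        measurable_compose[OF measurable_snd measurable_time_ident])
  then have "(\<lambda>x. indicator {p. snd p \<le> fst p} (fst (fst x), snd x) :: real) \<in> borel_measurable (strip \<Otimes>\<^sub>M time)"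
    by (rule measurable_compose) measurable
  then have "(\<lambda>x. indicator {p. snd p \<le> fst p} (fst (fst x), snd x) * F (snd x) (snd (fst x))) \<in> borel_measurable (strip \<Otimes>\<^sub>M time)"
    by measurable
  then have "(\<lambda>(x, s). indicator {..fst x} s * F s (snd x)) \<in> borel_measurable (strip \<Otimes>\<^sub>M time)"
    by (simp add: split_beta' indicator_def)
  from time.borel_measurable_lebesgue_integral[OF this]
  show "strip_measurable (\<lambda>t r. tint (\<lambda>s. F s r) t)" by (simp add: tint_def split_beta')
  have "(\<lambda>x. (snd x, fst x)) \<in> lborel \<Otimes>\<^sub>M time \<rightarrow>\<^sub>M strip" by measurable
  from measurable_compose[OF this assms]
  have "(\<lambda>x. F (snd x) (fst x)) \<in> borel_measurable (lborel \<Otimes>\<^sub>M time)" by simp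
  moreover have "(\<lambda>x. indicator {..t} (snd x) :: real) \<in> borel_measurable (lborel \<Otimes>\<^sub>M time)"
    by (rule measurable_compose[OF measurable_snd measurable_time]) simp
  ultimately have "(\<lambda>x. indicator {..t} (snd x) * F (snd x) (fst x)) \<in> borel_measurable (lborel \<Otimes>\<^sub>M time)"
    by (rule borel_measurable_times[rotated])
  then have "(\<lambda>(r, s). indicator {..t} s * F s r) \<in> borel_measurable (lborel \<Otimes>\<^sub>M time)" by (simp only: split_beta')
  from time.borel_measurable_lebesgue_integral[OF this]
  show "(\<lambda>r. tint (\<lambda>s. F s r) t) \<in> borel_measurable lborel" by (simp add: tint_def)
qed

context
  fixes F :: "field"
  assumes F: "sqint_strip F"
begin

lemma integrable_time_square:
  "integrable lborel (\<lambda>x. LINT s|time. (F s x)^2)" "AE x in lborel. sqint time (\<lambda>s. F s x)"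
proof -
  have 1: "integrable strip (\<lambda>(t, x). (F t x)^2)" using sqint_integrable[OF F] by (simp add: split_beta')
  show "integrable lborel (\<lambda>x. LINT s|time. (F s x)^2)" using strip.integrable_snd[OF 1] .
  have "(\<lambda>s. F s x) \<in> borel_measurable time" for x using measurable_Pair2'[of x lborel time] sqint_measurable[OF F]
    by (auto dest: measurable_compose[rotated])
  with strip.AE_integrable_snd[OF 1] show "AE x in lborel. sqint time (\<lambda>s. F s x)" by (simp add: sqint_def)
qed

text \<open>Cauchy-Schwarz on \<open>(s, t]\<close>. The exceptional \<open>y\<close> are those at
  which \<open>F\<close> fails to be square integrable in time, so they do not depend on
  \<open>s\<close> and \<open>t\<close>.\<close>

lemma tint_increment_square:
  "AE y in lborel. \<forall>s t. 0 \<le> s \<longrightarrow> s \<le> t \<longrightarrow>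
     (tint (\<lambda>r. F r y) t - tint (\<lambda>r. F r y) s)^2 \<le> (t - s) * (LINT r|time. (F r y)^2)"
  using integrable_time_square(2)
proof eventually_elim
  case (elim y)
  let ?W = "\<lambda>r. F r y"
  show ?case
  proof (intro allI impI)
    fix s t :: real assume st: "0 \<le> s" "s \<le> t"
    have sq: "(indicator A r :: real)^2 = indicator A r" for A :: "real set" and r by (simp add: indicator_def)
    have ind: "sqint time (indicator A :: real \<Rightarrow> real)" if "A \<in> sets borel" for A
    proof -
      have "(indicator A :: real \<Rightarrow> real) \<in> borel_measurable time" by (intro measurable_time borel_measurable_indicator that)
      then show ?thesis by (auto simp: sqint_def sq indicator_le_1 intro!: time.integrable_const_bound[where B=1])
    qed
    have i: "integrable time (\<lambda>r. indicator {..x} r * ?W r)" for x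
      using integrable_inner_sqint[OF ind elim, of "{..x}"] by simp
    have "(LINT r|time. indicator {s<..t} r :: real) = (LINT r|lborel. indicator {0<..<1} r * indicator {s<..t} r)"
      by (rule integral_time)
    also have "\<dots> \<le> (LINT r|lborel. indicator {s..t} r)"
    proof (rule integral_mono)
      show "integrable lborel (\<lambda>r. indicator {0<..<1} r * indicator {s<..t} r :: real)"
        unfolding indicator_inter_arith[symmetric] by (simp add: integrable_indicator_iff greaterThanLessThan_def)
          (rule le_less_trans[OF emeasure_mono[of _ "{s..t}"]]; auto simp: emeasure_lborel_Icc_eq)
      show "integrable lborel (indicator {s..t} :: real \<Rightarrow> real)" by (auto simp: emeasure_lborel_Icc_eq)
    qed (auto simp: indicator_def)
    also have "\<dots> = t - s" using st by simp
    finally have len: "(LINT r|time. indicator {s<..t} r) \<le> t - s" .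
    have "tint ?W t - tint ?W s = (LINT r|time. indicator {..t} r * ?W r - indicator {..s} r * ?W r)"
      unfolding tint_def by (intro LINT_diff[symmetric] i)
    also have "\<dots> = (LINT r|time. indicator {s<..t} r * ?W r)"
      by (intro LINT_cong) (use st in \<open>auto simp: indicator_def\<close>)
    finally have "(tint ?W t - tint ?W s)^2 \<le> (LINT r|time. indicator {s<..t} r) * (LINT r|time. (?W r)^2)"
      using integral_Cauchy_Schwarz[OF ind[of "{s<..t}"] elim] by (simp add: sq)
    also have "\<dots> \<le> (t - s) * (LINT r|time. (?W r)^2)" by (intro mult_right_mono len) auto
    finally show "(tint ?W t - tint ?W s)^2 \<le> (t - s) * (LINT r|time. (?W r)^2)" .
  qed
qed

lemma sqint_tint:
  assumes t: "t \<in> {0..1}"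
  shows "sqint lborel (\<lambda>x. tint (\<lambda>s. F s x) t)"
    "(LINT x|lborel. (tint (\<lambda>s. F s x) t)^2) \<le> (LINT x|lborel. LINT s|time. (F s x)^2)"
proof -
  let ?N = "\<lambda>x. LINT s|time. (F s x)^2"
  note m = tint_strip_measurable(2)[OF sqint_measurable[OF F], of t]
  have ae: "AE x in lborel. (tint (\<lambda>s. F s x) t)^2 \<le> ?N x"
    using tint_increment_square
  proof eventually_elim
    case (elim x)
    have "(tint (\<lambda>s. F s x) t)^2 \<le> t * ?N x"
      using elim[rule_format, of 0 t] t by (simp add: tint_0)
    also have "\<dots> \<le> 1 * ?N x" using t by (intro mult_right_mono) auto
    finally show ?case by simp
  qed
  have i: "integrable lborel (\<lambda>x. (tint (\<lambda>s. F s x) t)^2)"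
    by (rule integrable_le[OF integrable_time_square(1)]) (use m ae in auto)
  then show "sqint lborel (\<lambda>x. tint (\<lambda>s. F s x) t)" using m by (simp add: sqint_def)
  show "(LINT x|lborel. (tint (\<lambda>s. F s x) t)^2) \<le> (LINT x|lborel. ?N x)"
    by (rule integral_mono_AE[OF i integrable_time_square(1) ae])
qed

end

context
  fixes c V assumes prof: "is_profile c V"
begin

lemma growth_increment_square:
  "AE x in lborel. \<forall>s t. 0 \<le> s \<longrightarrow> s \<le> t \<longrightarrow>
     (profile_growth c V t x - profile_growth c V s x)^2 \<le> (t - s) * (LINT r|time. (profile_velocity c V r x)^2)"
  using tint_increment_square[OF sqint_velocity[OF prof]] by (simp add: profile_growth_def)

lemma integrable_velocity_square_jap:
  "integrable lborel (\<lambda>x. jap x * (LINT s|time. (profile_velocity c V s x)^2))"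
  using integrable_time_square(1)[OF is_profileD(4)[OF prof]] jap_pos by (simp add: power_mult_distrib less_imp_le)

lemma sqint_growth:
  assumes "t \<in> {0..1}"
  shows "sqint lborel (profile_growth c V t)"
    "(LINT x|lborel. (profile_growth c V t x)^2) \<le> (LINT x|lborel. LINT s|time. (profile_velocity c V s x)^2)"
  using sqint_tint[OF sqint_velocity[OF prof] assms] by (simp_all add: profile_growth_def[abs_def])

text \<open>The weight |x| is dominated by \<open>jap x\<close>, for which \<open>W\<close> is
  square integrable on the strip. Hence the reconstruction attains its data in the weighted trace
  norm, with a linear rate for the squared norm.\<close>

lemma growth_trace:
  assumes "0 \<le> s" "s \<le> t"
  shows "(\<integral>\<^sup>+x. ennreal (\<bar>x\<bar> * (profile_growth c V t x - profile_growth c V s x)^2) \<partial>lborel)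
    \<le> ennreal ((t - s) * (LINT x|lborel. jap x * (LINT s|time. (profile_velocity c V s x)^2)))"
proof -
  let ?N = "\<lambda>x. LINT s|time. (profile_velocity c V s x)^2"
  have "(\<integral>\<^sup>+x. ennreal (\<bar>x\<bar> * (profile_growth c V t x - profile_growth c V s x)^2) \<partial>lborel)
     \<le> (\<integral>\<^sup>+x. ennreal ((t - s) * (jap x * ?N x)) \<partial>lborel)"
  proof (rule nn_integral_mono_AE)
    show "AE x in lborel. ennreal (\<bar>x\<bar> * (profile_growth c V t x - profile_growth c V s x)^2) \<le> ennreal ((t - s) * (jap x * ?N x))"
      using growth_increment_square
    proof eventually_elim
      case (elim x)
      have "\<bar>x\<bar> * (profile_growth c V t x - profile_growth c V s x)^2 \<le> jap x * ((t - s) * ?N x)"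
        using elim[rule_format, OF assms] abs_le_jap[of x] jap_pos[of x] by (intro mult_mono) auto
      then show ?case by (intro ennreal_leI) (simp add: mult_ac)
    qed
  qed
  also have "\<dots> = ennreal (LINT x|lborel. (t - s) * (jap x * ?N x))"
    using integrable_velocity_square_jap assms jap_pos by (intro nn_integral_eq_integral) (auto simp: less_imp_le)
  finally show ?thesis by simp
qed

end

subsection \<open>Regularity in the absence of defects\<close>

definition candidate :: "(real \<Rightarrow> real) \<Rightarrow> field \<Rightarrow> (real \<Rightarrow> real) \<Rightarrow> (real \<Rightarrow> real) \<Rightarrow> field" where
  "candidate c V fL fR t x = initial_profile c V fL fR x + profile_growth c V t x"

locale matched_solution =
  fixes c :: "real \<Rightarrow> real" and V G :: "field" and fL fR :: "real \<Rightarrow> real"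
  assumes L: "fL \<in> Cc_infty {0..}" and R: "fR \<in> Cc_infty {..0}" and sol: "solves_up_to c V G fL fR 0 0"
begin

abbreviation "W \<equiv> profile_velocity c V"
abbreviation "\<Theta> \<equiv> profile_growth c V"
abbreviation "I \<equiv> initial_profile c V fL fR"
abbreviation "\<Omega>' \<equiv> candidate c V fL fR"

lemma prof: "is_profile c V" and G: "sqint_strip G" and match: "jump c fL fR = 0"
  using sol by (auto simp: solves_up_to_def)

text \<open>The vanishing jump is what makes the two halves agree at 0.\<close>

lemma continuous_initial: "continuous_on S I"
proof -
  have 1: "continuous_on {0..} I"
    by (rule continuous_on_eq[OF Cc_infty_continuous_within[OF L, of 0, simplified]]) (simp add: initial_profile_def)
  have 2: "continuous_on {..0} I"
  proof (rule continuous_on_eq)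
    show "continuous_on {..0} (\<lambda>r. fR r - \<Theta> 1 r)"
      by (intro continuous_intros Cc_infty_continuous_within[OF R, of 0, simplified] continuous_growth_slice[OF prof]) simp
    show "\<And>x. x \<in> {..0} \<Longrightarrow> fR x - \<Theta> 1 x = I x"
      using match by (auto simp: initial_profile_def jump_def profile_growth_at_0[OF prof])
  qed
  have "continuous_on ({0..} \<union> {..0}) I" by (rule continuous_on_closed_Un[OF _ _ 1 2]) auto
  then show ?thesis by (rule continuous_on_subset) auto
qed

lemma sqint_initial: "sqint lborel I"
proof -
  have "sqint lborel (\<lambda>x. indicator {0<..} x * fL x + (indicator {..<0} x * fR x - indicator {..<0} x * \<Theta> 1 x))"
  proof (intro sqint_add sqint_diff)
    show "sqint lborel (\<lambda>x. indicator {0<..} x * fL x)" "sqint lborel (\<lambda>x. indicator {..<0} x * fR x)"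
      using Cc_infty_half_sqint[OF L, of 0] Cc_infty_half_sqint[OF R, of 0] by simp_all
    show "sqint lborel (\<lambda>x. indicator {..<0} x * \<Theta> 1 x)"
      by (rule sqint_mult_bounded[where C=1, OF sqint_growth(1)[OF prof]]) (simp_all add: indicator_le_1)
  qed
  then show ?thesis
  proof (rule sqint_cong_AE)
    show "AE x in lborel. indicator {0<..} x * fL x + (indicator {..<0} x * fR x - indicator {..<0} x * \<Theta> 1 x) = I x"
      using AE_nonzero by eventually_elim (auto simp: initial_profile_def)
    show "I \<in> borel_measurable lborel" using continuous_initial[of UNIV] by (simp add: borel_measurable_continuous_onI)
  qed
qed

lemma continuous_candidate: "continuous_on ({0..1} \<times> UNIV) (\<lambda>(t, x). \<Omega>' t x)"
proof -
  have "continuous_on ({0..1} \<times> UNIV) (\<lambda>p. I (snd p) + (case p of (t, x) \<Rightarrow> \<Theta> t x))"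
    by (intro continuous_intros continuous_profile_growth[OF prof] continuous_on_compose2[OF continuous_initial[of UNIV]]) auto
  then show ?thesis by (simp add: candidate_def split_beta')
qed

lemma sqint_candidate:
  assumes "t \<in> {0..1}"
  shows "sqint lborel (\<Omega>' t)"
    "(LINT x|lborel. (\<Omega>' t x)^2) \<le> 2 * (LINT x|lborel. (I x)^2) + 2 * (LINT x|lborel. LINT s|time. (W s x)^2)"
proof -
  show s: "sqint lborel (\<Omega>' t)"
    unfolding candidate_def[abs_def] by (intro sqint_add sqint_initial sqint_growth[OF prof] assms)
  have i: "integrable lborel (\<lambda>x. (\<Omega>' t x)^2)" "integrable lborel (\<lambda>x. (I x)^2)" "integrable lborel (\<lambda>x. (\<Theta> t x)^2)"
    using sqint_integrable[OF s] sqint_integrable[OF sqint_initial] sqint_integrable[OF sqint_growth(1)[OF prof assms]] by simp_all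
  have "(LINT x|lborel. (\<Omega>' t x)^2) \<le> (LINT x|lborel. 2 * (I x)^2 + 2 * (\<Theta> t x)^2)"
    by (intro integral_mono i Bochner_Integration.integrable_add integrable_mult_right) (simp add: candidate_def square_add_le)
  also have "\<dots> = 2 * (LINT x|lborel. (I x)^2) + 2 * (LINT x|lborel. (\<Theta> t x)^2)" using i by simp
  finally show "(LINT x|lborel. (\<Omega>' t x)^2) \<le> 2 * (LINT x|lborel. (I x)^2) + 2 * (LINT x|lborel. LINT s|time. (W s x)^2)"
    using sqint_growth(2)[OF prof assms] by linarith
qed

lemma slice_candidate:
  assumes "sqint lborel k" "t \<in> {0..1}"
  shows "slice \<Omega>' k t = (LINT x|lborel. I x * k x) + tint (slice W k) t"
proof -
  have "slice \<Omega>' k t = (LINT x|lborel. I x * k x + \<Theta> t x * k x)" by (simp add: slice_def candidate_def distrib_right)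
  also have "\<dots> = (LINT x|lborel. I x * k x) + slice \<Theta> k t"
    using integrable_inner_sqint[OF sqint_initial assms(1)] slice_growth(2)[OF prof assms(1), of t] by (simp add: slice_def)
  finally show ?thesis by (simp add: slice_growth(1)[OF prof assms(1)])
qed

text \<open>With both numbers zero, \<open>solves_up_to\<close> supplies precisely the integral of
  \<open>I\<close> against the second derivative that \<open>profile_defect\<close> leaves
  out.\<close>

lemma candidate_slice_equation: "slice_equation G \<Omega>'"
  unfolding slice_equation_def
proof (intro ballI)
  fix f v assume f: "f \<in> Cc_infty {0<..<1}" and v: "v \<in> Cc_infty UNIV"
  interpret space_test v by standard (rule v)
  obtain C where C: "\<And>t. t \<in> {0..1} \<Longrightarrow> \<bar>f t\<bar> \<le> C" using Cc_infty_bounded[OF f open_unit, of 0 1] by metis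
  have fm: "f \<in> borel_measurable borel" by (rule Cc_infty_measurable[OF f open_unit])
  have WI: "integrable time (slice W (\<lambda>x. x * v x))" and GI: "integrable time (slice G v)"
    by (intro integrable_slice sqint_velocity[OF prof] x_test_sqint G test_sqint)+
  have WI': "integrable time (\<lambda>t. f t * slice W (\<lambda>x. x * v x) t)" and GI': "integrable time (\<lambda>t. f t * slice G v t)"
    by (rule integrable_time_times[where C=C]; use WI GI fm C in auto)+
  have "(LINT t|time. deriv f t * slice \<Omega>' (\<lambda>x. x * v x) t) =
      (LINT t|time. deriv f t * ((LINT r|lborel. I r * (r * v r)) + tint (slice W (\<lambda>x. x * v x)) t))"
    by (intro LINT_cong) (simp add: slice_candidate[OF x_test_sqint])
  also have "\<dots> = - (LINT t|time. f t * slice W (\<lambda>x. x * v x) t)" by (rule integral_deriv_tint[OF f WI])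
  finally have 1: "(LINT t|time. deriv f t * slice \<Omega>' (\<lambda>x. x * v x) t) = - (LINT t|time. f t * slice W (\<lambda>x. x * v x) t)" .
  have ae: "AE t in time. slice \<Omega>' (deriv (deriv v)) t = slice W (\<lambda>x. x * v x) t - slice G v t"
  proof -
    have "AE t in time. slice W (\<lambda>x. x * v x) t - slice \<Theta> (deriv (deriv v)) t - slice G v t = (LINT x|lborel. I x * deriv (deriv v) x)"
      using sol v unfolding solves_up_to_def by auto
    with AE_space show ?thesis
      by eventually_elim (simp add: slice_candidate[OF test_sqint(3)] slice_growth(1)[OF prof test_sqint(3)])
  qed
  obtain Q where Q: "Q > 0" "\<And>x. \<bar>x\<bar> \<ge> Q \<Longrightarrow> v x = 0 \<and> deriv v x = 0 \<and> deriv (deriv v) x = 0" using test_bounds by metis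
  have cc: "continuous_on ({0<..<1} \<times> UNIV) (\<lambda>(t, r). \<Omega>' t r)" by (rule continuous_on_subset[OF continuous_candidate]) auto
  have m: "integrable time (\<lambda>t. f t * slice \<Omega>' (deriv (deriv v)) t)"
    by (rule integral_tensor_strip(3)[where R=Q, OF cc f]) (use Q Cc_infty_open_continuous[OF test_mem(2)] in auto)
  have "(LINT t|time. f t * slice \<Omega>' (deriv (deriv v)) t) = (LINT t|time. f t * slice W (\<lambda>x. x * v x) t - f t * slice G v t)"
    by (rule integral_cong_AE) (use ae WI' GI' m in \<open>auto simp: right_diff_distrib elim!: AE_mp\<close>)
  also have "\<dots> = (LINT t|time. f t * slice W (\<lambda>x. x * v x) t) - (LINT t|time. f t * slice G v t)"
    by (rule LINT_diff[OF WI' GI'])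
  finally show "(LINT t|time. deriv f t * slice \<Omega>' (\<lambda>x. x * v x) t) =
      - (LINT t|time. f t * slice \<Omega>' (deriv (deriv v)) t) - (LINT t|time. f t * slice G v t)"
    using 1 by linarith
qed

text \<open>The difference \<open>D\<close> satisfies the homogeneous equation, and
  \<open>unique\<close> asks for local bounds of the L2 norm and vanishing weighted traces. Near
  each end \<open>D\<close> splits into the error of \<open>\<Omega>\<close> against its datum and
  an increment of the growth, which \<open>growth_trace\<close> controls.\<close>

lemma solution_eq_candidate:
  assumes \<Omega>: "weak_solution G fL fR \<Omega>" and t: "t \<in> {0<..<1}"
  shows "\<Omega> t y = \<Omega>' t y"
proof -
  have cc: "continuous_on ({0<..<1} \<times> UNIV) (\<lambda>(t, y). \<Omega>' t y)" by (rule continuous_on_subset[OF continuous_candidate]) auto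
  define D where "D t y = \<Omega> t y - \<Omega>' t y" for t y
  interpret homogeneous_solution D
    unfolding D_def[abs_def]
    by (rule homogeneous_solution_diff[OF weak_solution_slice_equation[OF \<Omega> G] cc candidate_slice_equation])
  have uL: "\<Omega> \<in> C0_L2 {0<..<1}" using \<Omega> by (auto simp: weak_solution_def C0_H1_def)
  have u2: "sqint lborel (\<Omega> t)" if "t \<in> {0<..<1}" for t using uL that by (auto simp: C0_L2_def sqint_eq_square_integrable)
  let ?E = "\<lambda>t. LINT y|lborel. (\<Omega> t y)^2" and ?B = "2 * (LINT y|lborel. (I y)^2) + 2 * (LINT y|lborel. LINT s|time. (W s y)^2)"
  let ?C = "LINT y|lborel. jap y * (LINT s|time. (W s y)^2)"
  have "D t y = 0"
  proof (rule unique[OF _ _ _ t])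
    fix p q :: real assume pq: "0 < p" "q < 1"
    have "compact (?E ` {p..q})"
      by (intro compact_continuous_image continuous_on_subset[OF C0_L2_norm_continuous[OF uL]]) (use pq in auto)
    from compact_imp_bounded[OF this] obtain M where M: "\<And>t. t \<in> {p..q} \<Longrightarrow> ?E t \<le> M"
      unfolding bounded_iff by force
    have "integral {-r..r} (\<lambda>x. (D t x)^2) \<le> 2 * M + 2 * ?B" if t: "t \<in> {p..q}" for t r
    proof -
      have t': "t \<in> {0<..<1}" "t \<in> {0..1}" using t pq by auto
      have s: "sqint lborel (D t)" unfolding D_def[abs_def] by (intro sqint_diff u2 sqint_candidate t')
      have i: "integrable lborel (\<lambda>x. (D t x)^2)" "integrable lborel (\<lambda>x. (\<Omega> t x)^2)" "integrable lborel (\<lambda>x. (\<Omega>' t x)^2)"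
        using sqint_integrable[OF s] sqint_integrable[OF u2[OF t'(1)]] sqint_integrable[OF sqint_candidate(1)[OF t'(2)]] by simp_all
      have cD: "continuous_on {-r..r} (\<lambda>x. (D t x)^2)" by (intro continuous_intros continuous_D) (use t' in auto)
      have "integral {-r..r} (\<lambda>x. (D t x)^2) = (LINT x|lborel. indicator {-r..r} x * (D t x)^2)" by (rule LINT_Icc_continuous[OF cD, symmetric])
      also have "\<dots> \<le> (LINT x|lborel. 2 * (\<Omega> t x)^2 + 2 * (\<Omega>' t x)^2)"
      proof (intro integral_mono integrable_Icc_continuous cD Bochner_Integration.integrable_add integrable_mult_right i)
        fix x show "indicator {-r..r} x * (D t x)^2 \<le> 2 * (\<Omega> t x)^2 + 2 * (\<Omega>' t x)^2"
          using square_add_le[of "\<Omega> t x" "- \<Omega>' t x"] by (auto simp: D_def indicator_def)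
      qed
      also have "\<dots> = 2 * ?E t + 2 * (LINT x|lborel. (\<Omega>' t x)^2)" using i by simp
      also have "\<dots> \<le> 2 * M + 2 * ?B" using M[OF t] sqint_candidate(2)[OF t'(2)] by simp
      finally show ?thesis .
    qed
    then show "\<exists>B. \<forall>t\<in>{p..q}. \<forall>R. integral {-R..R} (\<lambda>x. (D t x)^2) \<le> B" by blast
  next
    \<comment> \<open>\<open>X\<close> is the datum prescribed on \<open>S\<close>; \<open>a\<close>
      and \<open>b\<close> are the current time and the nearby end time in increasing order.\<close>
    have trace: "lateral S (D t) \<le>
        (lateral S (\<lambda>y. \<Omega> t y - X y) + lateral S (\<lambda>y. \<Omega> t y - X y)) + ennreal (2 * ((b - a) * ?C))"
      if S: "S \<in> sets borel" and t: "t \<in> {0<..<1}" and X: "\<And>y. y \<in> S \<Longrightarrow> (D t y)\<^sup>2 \<le> 2 * (\<Omega> t y - X y)^2 + 2 * (\<Theta> b y - \<Theta> a y)^2"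
        and Xm: "(\<lambda>y. indicator S y * X y) \<in> borel_measurable borel" and ab: "0 \<le> a" "a \<le> b" "b \<le> 1" for S t X a b
    proof -
      have [measurable]: "\<Omega> t \<in> borel_measurable borel" "\<Theta> a \<in> borel_measurable borel" "\<Theta> b \<in> borel_measurable borel" "S \<in> sets borel"
        using sqint_measurable[OF u2[OF t]] sqint_measurable[OF sqint_growth(1)[OF prof, of a]] sqint_measurable[OF sqint_growth(1)[OF prof, of b]] ab S by auto
      let ?f = "\<lambda>y. ennreal (\<bar>y\<bar> * (\<Omega> t y - X y)^2) * indicator S y" and ?g = "\<lambda>y. ennreal (\<bar>y\<bar> * (\<Theta> b y - \<Theta> a y)^2)"
      have "?f = (\<lambda>y. ennreal (\<bar>y\<bar> * (\<Omega> t y - indicator S y * X y)^2) * indicator S y)" by (auto simp: indicator_def fun_eq_iff)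
      then have [measurable]: "?f \<in> borel_measurable borel" using Xm by simp
      have "lateral S (D t) \<le> (\<integral>\<^sup>+y. (?f y + ?f y) + (?g y + ?g y) \<partial>lborel)"
      proof (rule nn_integral_mono)
        fix y show "ennreal (\<bar>y\<bar> * (D t y)^2) * indicator S y \<le> (?f y + ?f y) + (?g y + ?g y)"
        proof (cases "y \<in> S")
          case True
          have "\<bar>y\<bar> * (D t y)^2 \<le> \<bar>y\<bar> * (2 * (\<Omega> t y - X y)^2 + 2 * (\<Theta> b y - \<Theta> a y)^2)" by (intro mult_left_mono X True) simp
          then have "ennreal (\<bar>y\<bar> * (D t y)^2) \<le> ennreal ((\<bar>y\<bar> * (\<Omega> t y - X y)^2 + \<bar>y\<bar> * (\<Omega> t y - X y)^2) + (\<bar>y\<bar> * (\<Theta> b y - \<Theta> a y)^2 + \<bar>y\<bar> * (\<Theta> b y - \<Theta> a y)^2))"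
            by (intro ennreal_leI) (simp add: algebra_simps)
          also have "\<dots> = (ennreal (\<bar>y\<bar> * (\<Omega> t y - X y)^2) + ennreal (\<bar>y\<bar> * (\<Omega> t y - X y)^2)) + (?g y + ?g y)"
            by (simp only: ennreal_plus add_nonneg_nonneg mult_nonneg_nonneg abs_ge_zero zero_le_power2)
          finally show ?thesis using True by (simp only: indicator_simps mult_1_right)
        qed simp
      qed
      also have "\<dots> = ((\<integral>\<^sup>+y. ?f y \<partial>lborel) + (\<integral>\<^sup>+y. ?f y \<partial>lborel)) + ((\<integral>\<^sup>+y. ?g y \<partial>lborel) + (\<integral>\<^sup>+y. ?g y \<partial>lborel))"
        by (simp add: nn_integral_add)
      also have "\<dots> \<le> ((\<integral>\<^sup>+y. ?f y \<partial>lborel) + (\<integral>\<^sup>+y. ?f y \<partial>lborel)) + (ennreal ((b - a) * ?C) + ennreal ((b - a) * ?C))"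
        by (intro add_left_mono add_mono growth_trace[OF prof] ab)
      also have "ennreal ((b - a) * ?C) + ennreal ((b - a) * ?C) = ennreal (2 * ((b - a) * ?C))"
        using ab jap_pos by (subst ennreal_plus[symmetric]) (auto intro!: mult_nonneg_nonneg integral_nonneg_AE simp: less_imp_le)
      finally show ?thesis .
    qed
    have lim: "((\<lambda>t. (A t + A t) + ennreal (2 * (h t * ?C))) \<longlongrightarrow> 0) F"
      if "(A \<longlongrightarrow> 0) F" "(h \<longlongrightarrow> 0) F" for A :: "real \<Rightarrow> ennreal" and h :: "real \<Rightarrow> real" and F
    proof -
      have "((\<lambda>t. (A t + A t) + ennreal (2 * (h t * ?C))) \<longlongrightarrow> (0 + 0) + ennreal (2 * (0 * ?C))) F"
        by (intro tendsto_add tendsto_ennrealI tendsto_mult tendsto_const that)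
      then show ?thesis by simp
    qed
    have Lm: "(\<lambda>y. indicator {0<..} y * fL y) \<in> borel_measurable borel"
      using sqint_measurable[OF Cc_infty_half_sqint[OF L, of 0]] by simp
    have Rm: "(\<lambda>y. indicator {..<0} y * fR y) \<in> borel_measurable borel"
      using sqint_measurable[OF Cc_infty_half_sqint[OF R, of 0]] by simp
    show "((\<lambda>t. lateral {0<..} (D t)) \<longlongrightarrow> 0) (at_right 0)"
    proof (rule tendsto_sandwich[OF _ _ tendsto_const lim])
      show "\<forall>\<^sub>F t in at_right 0. lateral {0<..} (D t) \<le>
        (lateral {0<..} (\<lambda>y. \<Omega> t y - fL y) + lateral {0<..} (\<lambda>y. \<Omega> t y - fL y)) + ennreal (2 * ((t - 0) * ?C))"
        unfolding eventually_at_right_field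
      proof (intro exI[of _ 1] conjI allI impI trace Lm)
        fix t y :: real assume "y \<in> {0<..}"
        then have "D t y = (\<Omega> t y - fL y) + - (\<Theta> t y - \<Theta> 0 y)" by (simp add: D_def candidate_def initial_profile_def profile_growth_time_0[OF prof])
        then show "(D t y)^2 \<le> 2 * (\<Omega> t y - fL y)^2 + 2 * (\<Theta> t y - \<Theta> 0 y)^2"
          using square_add_le[of "\<Omega> t y - fL y" "- (\<Theta> t y - \<Theta> 0 y)"] by (simp add: power2_commute[of "\<Theta> t y"])
      qed auto
    qed (use \<Omega> in \<open>auto simp: weak_solution_def intro!: tendsto_eq_intros\<close>)
    show "((\<lambda>t. lateral {..<0} (D t)) \<longlongrightarrow> 0) (at_left 1)"
    proof (rule tendsto_sandwich[OF _ _ tendsto_const lim])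
      show "\<forall>\<^sub>F t in at_left 1. lateral {..<0} (D t) \<le>
        (lateral {..<0} (\<lambda>y. \<Omega> t y - fR y) + lateral {..<0} (\<lambda>y. \<Omega> t y - fR y)) + ennreal (2 * ((1 - t) * ?C))"
        unfolding eventually_at_left_field
      proof (intro exI[of _ 0] conjI allI impI trace Rm)
        fix t y :: real assume "y \<in> {..<0}"
        then have "D t y = (\<Omega> t y - fR y) + (\<Theta> 1 y - \<Theta> t y)" by (simp add: D_def candidate_def initial_profile_def)
        then show "(D t y)^2 \<le> 2 * (\<Omega> t y - fR y)^2 + 2 * (\<Theta> 1 y - \<Theta> t y)^2"
          using square_add_le[of "\<Omega> t y - fR y" "\<Theta> 1 y - \<Theta> t y"] by simp
      qed auto
    qed (use \<Omega> in \<open>auto simp: weak_solution_def intro!: tendsto_eq_intros\<close>)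
  qed
  then show ?thesis by (simp add: D_def)
qed

end

lemma sqint_strip_bounded:
  fixes F :: "field"
  assumes m: "strip_measurable F"
    and F: "\<And>t. t \<in> {0<..<1} \<Longrightarrow> sqint lborel (F t)" "\<And>t. t \<in> {0<..<1} \<Longrightarrow> (LINT x|lborel. (F t x)^2) \<le> B"
  shows "sqint_strip F"
proof -
  have m2: "(\<lambda>p. (case p of (t, x) \<Rightarrow> F t x)^2) \<in> borel_measurable strip" using m by measurable
  have "integrable strip (\<lambda>p. (case p of (t, x) \<Rightarrow> F t x)^2)"
  proof (rule strip.Fubini_integrable[OF m2])
    have "(\<lambda>t. LINT x|lborel. (F t x)^2) \<in> borel_measurable time"
      using lborel.borel_measurable_lebesgue_integral[of "\<lambda>t x. (F t x)^2" time] m2 by (simp add: split_beta')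
    then have "integrable time (\<lambda>t. LINT x|lborel. (F t x)^2)"
      by (intro time.integrable_const_bound[where B=B]) (use F(2) in auto)
    then show "integrable time (\<lambda>t. LINT x|lborel. norm ((case (t, x) of (t, x) \<Rightarrow> F t x)^2))" by simp
    show "AE t in time. integrable lborel (\<lambda>x. (case (t, x) of (t, x) \<Rightarrow> F t x)^2)"
      using AE_space by eventually_elim (use F(1) in \<open>auto simp: sqint_def\<close>)
  qed
  then show ?thesis using m by (simp add: sqint_def)
qed

lemma prim_add:
  assumes "locally_integrable f" "locally_integrable g"
  shows "prim (\<lambda>x. f x + g x) y = prim f y + prim g y"
  unfolding prim_def distrib_left by (intro LINT_add prim_integrable assms)

lemma has_weak_deriv_prim:
  assumes "locally_integrable w" "\<And>x. f x = d + prim w x"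
  shows "has_weak_deriv f w"
  unfolding has_weak_deriv_def
proof
  fix v assume v: "v \<in> Cc_infty UNIV"
  obtain R where R: "R > 0" "\<And>x. \<bar>x\<bar> \<ge> R \<Longrightarrow> v x = 0" using Cc_infty_UNIV_bounds[OF v] by metis
  have "(LINT x|lborel. deriv v x * (d + prim w x)) = - (LINT x|lborel. v x * w x)"
    by (rule integral_deriv_mult_prim[where p="-R" and q=R])
      (use R assms(1) in \<open>auto intro: Cc_infty_open_DERIV[OF v] Cc_infty_open_continuous[OF deriv_Cc_infty[OF v]]\<close>)
  then show "(LINT r|lborel. f r * deriv v r) = - (LINT r|lborel. w r * v r)"
    by (simp add: assms(2) mult.commute)
qed

context matched_solution
begin

text \<open>\<open>K t\<close> and \<open>dI\<close> are the weak space derivatives of the growth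
  and of the initial profile. On the left half line \<open>dI\<close> contains \<open>- K 1\<close>
  because the profile there subtracts the growth up to time 1.\<close>

definition "K t x = tint (\<lambda>s. V s x) t"
definition "dI x = indicator {0<..} x * (deriv_on {0..} ^^ 1) fL x + (indicator {..<0} x * (deriv_on {..0} ^^ 1) fR x - indicator {..<0} x * K 1 x)"

lemma V: "sqint_strip V"
  by (rule is_profileD(2)[OF prof])

lemma sqint_K: "t \<in> {0..1} \<Longrightarrow> sqint lborel (K t)"
  unfolding K_def[abs_def] by (rule sqint_tint[OF V])

lemma sqint_half_data: "sqint lborel (\<lambda>x. indicator {0<..} x * (deriv_on {0..} ^^ 1) fL x)"
  "sqint lborel (\<lambda>x. indicator {..<0} x * (deriv_on {..0} ^^ 1) fR x)"
  using Cc_infty_half_sqint[OF L, of 1] Cc_infty_half_sqint[OF R, of 1] by simp_all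

lemma sqint_dI: "sqint lborel dI"
  unfolding dI_def[abs_def]
  by (intro sqint_add sqint_diff sqint_half_data)
    (rule sqint_mult_bounded[where C=1, OF sqint_K]; simp add: indicator_le_1)

lemma growth_eq_prim:
  assumes "t \<in> {0..1}"
  shows "\<Theta> t x = tint c t + prim (K t) x"
proof -
  have "prim (K t) x = (LINT r|lborel. tint (\<lambda>s. V s r) t * interval_sign x r)" by (simp add: prim_def K_def mult.commute)
  also have "\<dots> = tint (\<lambda>s. prim (V s) x) t" unfolding slice_tint(1)[OF V sqint_interval_sign] by (simp add: prim_eq_slice)
  finally show ?thesis by (simp add: profile_growth_eq[OF prof])
qed

text \<open>For negative \<open>x\<close> the constant is \<open>fR 0 - tint c 1\<close>, which
  equals \<open>fL 0\<close> because the jump is zero; a jump would put a Dirac mass into the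
  derivative.\<close>

lemma initial_eq_prim: "I x = fL 0 + prim dI x"
proof (cases "x \<ge> 0")
  case True
  have "prim dI x - prim dI 0 = (LINT r|lborel. indicator {0..x} r * dI r)"
    by (rule prim_diff[OF sqint_locally_integrable[OF sqint_dI] True])
  also have "\<dots> = (LINT r|lborel. indicator {0..x} r * (deriv_on {0..} ^^ 1) fL r)"
    by (rule LINT_cong_nonzero(2)) (auto simp: dI_def indicator_def)
  also have "\<dots> = fL x - fL 0"
    by (rule FTC_Icc_interior[OF True])
      (use Cc_infty_deriv_interior[OF L, of _ 0] continuous_on_subset[OF Cc_infty_continuous_within[OF L, of 0], of "{0..x}"]
        continuous_on_subset[OF Cc_infty_continuous_within[OF L, of 1], of "{0..x}"] in auto)
  finally show ?thesis using True by (simp add: initial_profile_def)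
next
  case False
  then have neg: "x \<le> 0" by simp
  note i = sqint_locally_integrable[OF sqint_half_data(2)] sqint_locally_integrable[OF sqint_K[of 1]]
  have "prim dI 0 - prim dI x = (LINT r|lborel. indicator {x..0} r * dI r)"
    by (rule prim_diff[OF sqint_locally_integrable[OF sqint_dI] neg])
  also have "\<dots> = (LINT r|lborel. indicator {x..0} r * (deriv_on {..0} ^^ 1) fR r - indicator {x..0} r * K 1 r)"
    by (rule LINT_cong_nonzero(2)) (auto simp: dI_def indicator_def)
  also have "\<dots> = (LINT r|lborel. indicator {x..0} r * (deriv_on {..0} ^^ 1) fR r) - (LINT r|lborel. indicator {x..0} r * K 1 r)"
    by (intro LINT_diff integrable_Icc_continuous locally_integrable_Icc i continuous_on_subset[OF Cc_infty_continuous_within[OF R]]) auto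
  also have "(LINT r|lborel. indicator {x..0} r * (deriv_on {..0} ^^ 1) fR r) = fR 0 - fR x"
    by (rule FTC_Icc_interior[OF neg])
      (use Cc_infty_deriv_interior[OF R, of _ 0] continuous_on_subset[OF Cc_infty_continuous_within[OF R, of 0], of "{x..0}"]
        continuous_on_subset[OF Cc_infty_continuous_within[OF R, of 1], of "{x..0}"] in auto)
  also have "(LINT r|lborel. indicator {x..0} r * K 1 r) = prim (K 1) 0 - prim (K 1) x"
    by (rule prim_diff[OF i(2) neg, symmetric]) simp
  finally show ?thesis using False match by (simp add: initial_profile_def growth_eq_prim jump_def)
qed

lemma candidate_eq_prim:
  assumes "t \<in> {0..1}"
  shows "\<Omega>' t x = (fL 0 + tint c t) + prim (\<lambda>r. dI r + K t r) x"
  using sqint_locally_integrable[OF sqint_dI] sqint_locally_integrable[OF sqint_K[OF assms]]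
  by (simp add: candidate_def initial_eq_prim growth_eq_prim[OF assms] prim_add)

text \<open>The reconstruction is explicit: its space derivative at time \<open>t\<close> is
  \<open>dI + K t\<close>, its time derivative is \<open>W\<close>, and the space derivative of
  \<open>W\<close> is \<open>V\<close>, all square integrable on the strip.\<close>

lemma candidate_H1_H1:
  assumes \<Omega>: "\<And>t x. t \<in> {0<..<1} \<Longrightarrow> \<Omega> t x = \<Omega>' t x"
  shows "\<Omega> \<in> H1_H1"
proof -
  have "continuous_on ({0<..<1} \<times> UNIV) (\<lambda>(t, x). \<Omega>' t x)" by (rule continuous_on_subset[OF continuous_candidate]) auto
  then have c: "sqint_strip (\<lambda>t x. \<Omega>' t x)"
    by (intro sqint_strip_bounded[OF _ _ sqint_candidate(2)] continuous_strip_measurable(2) sqint_candidate(1)) auto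
  have "strip_measurable (\<lambda>t x. \<Omega>' t x) \<longleftrightarrow> strip_measurable (\<lambda>t x. \<Omega> t x)"
    by (rule measurable_cong) (auto simp: space_pair_measure \<Omega>)
  then have m: "strip_measurable (\<lambda>t x. \<Omega> t x)" using sqint_measurable[OF c] by blast
  have 1: "sqint_strip (\<lambda>t x. \<Omega> t x)"
    by (rule sqint_cong_AE[OF c AE_I2 m]) (auto simp: space_pair_measure \<Omega>)
  have "sqint_strip K"
    unfolding K_def by (intro sqint_strip_bounded[OF _ _ sqint_tint(2)[OF V]] tint_strip_measurable(1) sqint_measurable[OF V] sqint_tint(1)[OF V]) auto
  then have 2: "sqint_strip (\<lambda>t x. dI x + K t x)"
    using sqint_add[OF sqint_strip_space[OF sqint_dI]] by (simp add: split_beta')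
  have 3: "has_weak_deriv (\<Omega> t) (\<lambda>x. dI x + K t x)" if "t \<in> {0<..<1}" for t
    by (rule has_weak_deriv_prim[of _ _ "fL 0 + tint c t"])
      (use that in \<open>auto intro!: sqint_locally_integrable sqint_add sqint_dI sqint_K simp: \<Omega>[OF that] candidate_eq_prim\<close>)
  have "\<Omega> \<in> L2_H1" unfolding L2_H1_def L2_L2_def
    using 1 2 by (auto simp: sqint_eq_square_integrable intro!: bexI[of _ "\<lambda>t x. dI x + K t x"] AE_I2 3)
  moreover have "W \<in> L2_H1"
  proof -
    have "has_weak_deriv (W t) (V t)" for t
      by (rule has_weak_deriv_prim[of _ _ "c t"]) (auto simp: profile_velocity_def intro: is_profileD[OF prof])
    then show ?thesis unfolding L2_H1_def L2_L2_def
      using sqint_velocity[OF prof] V by (auto simp: sqint_eq_square_integrable intro!: bexI[of _ V])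
  qed
  moreover have "has_weak_time_deriv \<Omega> W" unfolding has_weak_time_deriv_def
  proof (intro ballI AE_I2)
    fix f x assume f: "f \<in> Cc_infty {0<..<1}"
    have "(LINT t|time. deriv f t * \<Omega> t x) = (LINT t|time. deriv f t * (I x + tint (\<lambda>s. W s x) t))"
      by (intro LINT_cong) (simp add: \<Omega> candidate_def profile_growth_def)
    then show "(LINT t|time. deriv f t * \<Omega> t x) = - (LINT t|time. f t * W t x)"
      unfolding integral_deriv_tint[OF f integrable_velocity_time[OF prof]] .
  qed
  ultimately show ?thesis unfolding H1_H1_def by blast
qed

theorem solution_H1_H1: "weak_solution G fL fR \<Omega> \<Longrightarrow> \<Omega> \<in> H1_H1"
  by (intro candidate_H1_H1 solution_eq_candidate)

end

subsection \<open>Linear choice of the defects\<close>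

text \<open>In the application \<open>p\<close> forgets the two numbers and \<open>R\<close> is the
  relation. A linear right inverse \<open>g\<close> of \<open>p\<close> on \<open>R\<close> exists
  by bases; a linear projection \<open>q\<close> onto \<open>K\<close> corrects it so that it
  becomes the identity on \<open>K\<close>.\<close>

lemma linear_selection:
  fixes s :: "'k::field \<Rightarrow> 'v::ab_group_add \<Rightarrow> 'v"
  assumes vs: "vector_space s" and p: "\<And>x y. p (x + y) = p x + p y" "\<And>a x. p (s a x) = s a (p x)"
    and R: "module.subspace s R" and K: "module.subspace s K" "K \<subseteq> R" "\<And>v. v \<in> K \<Longrightarrow> p v = v"
  shows "\<exists>S. (\<forall>x y. S (x + y) = S x + S y) \<and> (\<forall>a x. S (s a x) = s a (S x)) \<and>
    (\<forall>v. S v \<in> R) \<and> (\<forall>v\<in>p ` R. p (S v) = v) \<and> (\<forall>v\<in>K. S v = v)"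
proof -
  interpret vector_space s by (rule vs)
  have vp: "vector_space_pair s s" using vs by (simp add: vector_space_pair_def)
  have lin: "Vector_Spaces.linear s s f \<longleftrightarrow> (\<forall>x y. f (x + y) = f x + f y) \<and> (\<forall>a x. f (s a x) = s a (f x))" for f
    using vs by (simp add: Vector_Spaces.linear_iff)
  have "Vector_Spaces.linear s s (\<lambda>v. v)" by (simp add: lin)
  from vector_space_pair.linear_exists_left_inverse_on[OF vp this K(1)] obtain q where
    q: "range q \<subseteq> K" "Vector_Spaces.linear s s q" "\<And>v. v \<in> K \<Longrightarrow> q v = v" by (auto simp: inj_on_def)
  have "Vector_Spaces.linear s s p" by (simp add: lin p)
  from vector_space_pair.linear_exists_right_inverse_on[OF vp this R] obtain g where
    g: "range g \<subseteq> R" "Vector_Spaces.linear s s g" "\<And>v. v \<in> p ` R \<Longrightarrow> p (g v) = v" by auto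
  have ql: "q (x + y) = q x + q y" "q (s a x) = s a (q x)" and gl: "g (x + y) = g x + g y" "g (s a x) = s a (g x)" for x y a
    using q(2) g(2) by (auto simp: lin)
  have diff: "f (x - y) = f x - f y" if "\<And>x y. f (x + y) = f x + f y" for f :: "'v \<Rightarrow> 'v" and x y
    using that[of "x - y" y] by simp
  define S where "S v = g (v - q v) + q v" for v
  have qv: "q v \<in> R" "q v \<in> K" for v using q(1) K(2) by auto
  show ?thesis
  proof (intro exI[of _ S] conjI allI ballI)
    show "S (x + y) = S x + S y" for x y by (simp add: S_def ql gl diff[OF ql(1)] diff[OF gl(1)])
    show "S (s a x) = s a (S x)" for a x
      by (simp add: S_def ql scale_right_distrib scale_right_diff_distrib diff[of g, OF gl(1)] gl)
    show "S v \<in> R" for v unfolding S_def using g(1) qv(1) by (intro subspace_add R) auto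
    show "p (S v) = v" if v: "v \<in> p ` R" for v
    proof -
      obtain r where r: "r \<in> R" "v = p r" using v by auto
      have "v - q v = p (r - q v)" using r K(3)[OF qv(2)] by (simp add: diff[OF p(1)])
      moreover have "r - q v \<in> R" by (intro subspace_diff R r qv)
      ultimately have "p (g (v - q v)) = v - q v" by (intro g(3)) auto
      then show ?thesis using K(3)[OF qv(2)] by (simp add: S_def p(1))
    qed
    show "S v = v" if "v \<in> K" for v
      using q(3)[OF that] diff[of g v v, OF gl(1)] by (simp add: S_def)
  qed
qed

type_synonym entry = "field \<times> (real \<Rightarrow> real) \<times> (real \<Rightarrow> real) \<times> real \<times> real"

definition entry_scale :: "real \<Rightarrow> entry \<Rightarrow> entry" where
  "entry_scale a = (\<lambda>(G, f, g, x, y). (\<lambda>t r. a * G t r, \<lambda>r. a * f r, \<lambda>r. a * g r, a * x, a * y))"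

interpretation entry: vector_space entry_scale
  by standard (auto simp: entry_scale_def plus_prod_def fun_eq_iff algebra_simps)

definition null_source :: "field \<Rightarrow> bool" where
  "null_source N \<longleftrightarrow> strip_measurable N \<and> (AE (t, x) in strip. N t x = 0)"

definition entry_linear :: "(field \<Rightarrow> (real \<Rightarrow> real) \<Rightarrow> (real \<Rightarrow> real) \<Rightarrow> real) \<Rightarrow> bool" where
  "entry_linear X \<longleftrightarrow> (\<forall>G f g G' f' g' a b.
     X (\<lambda>t x. a * G t x + b * G' t x) (\<lambda>x. a * f x + b * f' x) (\<lambda>x. a * g x + b * g' x) = a * X G f g + b * X G' f' g')"

text \<open>The clause on null sources makes the chosen values depend on the source only up to null sets.\<close>

lemma linear_relation_selection:
  fixes rel :: "field \<Rightarrow> (real \<Rightarrow> real) \<Rightarrow> (real \<Rightarrow> real) \<Rightarrow> real \<Rightarrow> real \<Rightarrow> bool"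
  assumes lin: "\<And>G f g x y G' f' g' x' y' a. rel G f g x y \<Longrightarrow> rel G' f' g' x' y' \<Longrightarrow>
      rel (\<lambda>t z. G t z + a * G' t z) (\<lambda>z. f z + a * f' z) (\<lambda>z. g z + a * g' z) (x + a * x') (y + a * y')"
    and null: "\<And>N. null_source N \<Longrightarrow> rel N (\<lambda>_. 0) (\<lambda>_. 0) 0 0"
  shows "\<exists>X Y.
    entry_linear X \<and> entry_linear Y \<and>
    (\<forall>G f g x y. rel G f g x y \<longrightarrow> rel G f g (X G f g) (Y G f g)) \<and>
    (\<forall>N. null_source N \<longrightarrow> X N (\<lambda>_. 0) (\<lambda>_. 0) = 0 \<and> Y N (\<lambda>_. 0) (\<lambda>_. 0) = (0::real))"
proof -
  define p :: "entry \<Rightarrow> entry" where "p = (\<lambda>(G, f, g, x, y). (G, f, g, 0, 0))"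
  define R where "R = {(G, f, g, x, y). rel G f g x y}"
  define K :: "entry set" where "K = {(N, f, g, x, y). null_source N \<and> f = 0 \<and> g = 0 \<and> x = 0 \<and> y = 0}"
  have "null_source (\<lambda>_ _. 0)" by (simp add: null_source_def)
  from null[OF this] have 0: "rel (\<lambda>_ _. 0) (\<lambda>_. 0) (\<lambda>_. 0) 0 0" .
  have p: "p (v + w) = p v + p w" "p (entry_scale a v) = entry_scale a (p v)" for v w a
    by (auto simp: p_def entry_scale_def plus_prod_def split_beta')
  have R: "entry.subspace R"
  proof (rule entry.subspaceI)
    show "0 \<in> R" using 0 by (simp add: R_def zero_prod_def zero_fun_def)
    show "v + w \<in> R" if "v \<in> R" "w \<in> R" for v w
      using that lin[where a=1] by (auto simp: R_def plus_prod_def plus_fun_def)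
    show "entry_scale a v \<in> R" if "v \<in> R" for a v
      using that lin[OF 0, where a=a] by (auto simp: R_def entry_scale_def)
  qed
  have nl: "null_source (\<lambda>t z. N t z + a * N' t z)" if "null_source N" "null_source N'" for N N' a
  proof -
    have [measurable]: "(\<lambda>p. N (fst p) (snd p)) \<in> borel_measurable strip" "(\<lambda>p. N' (fst p) (snd p)) \<in> borel_measurable strip"
      using that by (auto simp: null_source_def split_beta')
    have "AE p in strip. N (fst p) (snd p) = 0" "AE p in strip. N' (fst p) (snd p) = 0"
      using that by (auto simp: null_source_def split_beta')
    then have "AE p in strip. N (fst p) (snd p) + a * N' (fst p) (snd p) = 0" by eventually_elim simp
    then show ?thesis unfolding null_source_def split_beta' by simp
  qed
  have K: "entry.subspace K"
  proof (rule entry.subspaceI)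
    show "0 \<in> K" by (simp add: K_def null_source_def zero_prod_def zero_fun_def)
    show "v + w \<in> K" if v: "v \<in> K" and w: "w \<in> K" for v w
    proof -
      obtain N N' where N: "null_source N" "v = (N, 0, 0, 0, 0)" "null_source N'" "w = (N', 0, 0, 0, 0)" using v w by (auto simp: K_def)
      from nl[OF N(1,3), of 1] show ?thesis unfolding N(2,4) by (simp add: K_def plus_prod_def plus_fun_def zero_fun_def)
    qed
    show "entry_scale a v \<in> K" if v: "v \<in> K" for a v
    proof -
      obtain N where N: "null_source N" "v = (N, 0, 0, 0, 0)" using v by (auto simp: K_def)
      from nl[OF \<open>null_source (\<lambda>_ _. 0)\<close> N(1), of a] show ?thesis unfolding N(2) by (simp add: K_def entry_scale_def zero_fun_def)
    qed
  qed
  have KR: "K \<subseteq> R" using null by (auto simp: K_def R_def zero_fun_def)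
  have Kp: "p v = v" if "v \<in> K" for v using that by (auto simp: K_def p_def)
  have "\<exists>S. (\<forall>v w. S (v + w) = S v + S w) \<and> (\<forall>a v. S (entry_scale a v) = entry_scale a (S v)) \<and>
    (\<forall>v. S v \<in> R) \<and> (\<forall>v\<in>p ` R. p (S v) = v) \<and> (\<forall>v\<in>K. S v = v)"
    by (rule linear_selection[OF entry.vector_space_axioms p R K KR Kp])
  then obtain S where Sl: "\<And>v w. S (v + w) = S v + S w" "\<And>a v. S (entry_scale a v) = entry_scale a (S v)"
    and S: "\<And>v. S v \<in> R" "\<And>v. v \<in> p ` R \<Longrightarrow> p (S v) = v" "\<And>v. v \<in> K \<Longrightarrow> S v = v"
    by metis
  \<comment> \<open>\<open>S\<close> is linear on all entries, so \<open>X\<close> and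
    \<open>Y\<close> have values also at sources and data that are related to no numbers; there the
    values only serve linearity.\<close>
  define X where "X G f g = (case S (G, f, g, 0, 0) of (_, _, _, x, _) \<Rightarrow> x)" for G f g
  define Y where "Y G f g = (case S (G, f, g, 0, 0) of (_, _, _, _, y) \<Rightarrow> y)" for G f g
  have e: "(\<lambda>t z. a * G t z + b * G' t z, \<lambda>z. a * f z + b * f' z, \<lambda>z. a * g z + b * g' z, 0, 0) =
      entry_scale a (G, f, g, 0, 0) + entry_scale b (G', f', g', 0, 0)" for a b G G' f f' g g'
    by (simp add: entry_scale_def plus_prod_def plus_fun_def)
  show ?thesis
  proof (rule exI[of _ X], rule exI[of _ Y], intro conjI allI impI)
    show "entry_linear X" "entry_linear Y"
      unfolding entry_linear_def X_def Y_def e Sl by (simp_all add: entry_scale_def plus_prod_def split_beta')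
    show "rel G f g (X G f g) (Y G f g)" if r: "rel G f g x y" for G f g x y
    proof -
      have "(G, f, g, 0, 0) \<in> p ` R" using r by (force simp: R_def p_def)
      from S(2)[OF this] S(1)[of "(G, f, g, 0, 0)"] show ?thesis
        by (auto simp: R_def p_def X_def Y_def split: prod.splits)
    qed
    show "X N (\<lambda>_. 0) (\<lambda>_. 0) = 0" "Y N (\<lambda>_. 0) (\<lambda>_. 0) = 0" if "null_source N" for N
      using S(3)[of "(N, \<lambda>_. 0, \<lambda>_. 0, 0, 0)"] that by (simp_all add: K_def X_def Y_def zero_fun_def)
  qed
qed

text \<open>Each term of the defect is linear in the witnesses \<open>c\<close> and
  \<open>V\<close>, so the combined witnesses serve the combined entry.\<close>

lemma solves_up_to_linear:
  assumes 1: "solves_up_to c V G f g j \<kappa>" and 2: "solves_up_to c' V' G' f' g' j' \<kappa>'"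
  shows "solves_up_to (\<lambda>t. c t + a * c' t) (\<lambda>t r. V t r + a * V' t r) (\<lambda>t r. G t r + a * G' t r)
    (\<lambda>r. f r + a * f' r) (\<lambda>r. g r + a * g' r) (j + a * j') (\<kappa> + a * \<kappa>')"
proof -
  let ?c = "\<lambda>t. c t + a * c' t" and ?V = "\<lambda>t r. V t r + a * V' t r" and ?G = "\<lambda>t r. G t r + a * G' t r"
    and ?f = "\<lambda>r. f r + a * f' r" and ?g = "\<lambda>r. g r + a * g' r"
  have p1: "is_profile c V" and p2: "is_profile c' V'" using 1 2 by (auto simp: solves_up_to_def)
  have li1: "locally_integrable (initial_profile c V f g)" and li2: "locally_integrable (initial_profile c' V' f' g')"
    using 1 2 by (auto simp: solves_up_to_def)
  have sq: "sqint_strip (\<lambda>t r. F t r + a * F' t r)" if "sqint_strip F" "sqint_strip F'"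
    for F F' :: "field"
    using sqint_add[OF that(1) sqint_scaleR[OF that(2), of a]] by (simp add: split_beta')
  have li: "locally_integrable (\<lambda>x. u x + a * v x)" if "locally_integrable u" "locally_integrable v" for u v
    using that integrable_mult_right[of a lborel] unfolding locally_integrable_def by (simp add: distrib_left mult.left_commute[of _ a])
  have prm: "prim (\<lambda>x. V t x + a * V' t x) y = prim (V t) y + a * prim (V' t) y" for t y
  proof -
    have "prim (\<lambda>x. a * V' t x) y = a * prim (V' t) y" by (simp add: prim_def mult.left_commute[of _ a])
    then show ?thesis using prim_add[OF is_profileD(3)[OF p1] li[of "\<lambda>_. 0" "V' t"]] is_profileD(3)[OF p2]
      by (simp add: locally_integrable_def)
  qed
  have W: "profile_velocity ?c ?V t r = profile_velocity c V t r + a * profile_velocity c' V' t r" for t r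
    by (simp add: profile_velocity_def prm algebra_simps)
  have ti: "tint (\<lambda>s. u s + a * v s) t = tint u t + a * tint v t" if "integrable time u" "integrable time v" for u v t
    using tint_add[OF that(1) integrable_mult_right[of a, OF that(2)]] by (simp add: tint_mult)
  have T: "profile_growth ?c ?V t r = profile_growth c V t r + a * profile_growth c' V' t r" for t r
    unfolding profile_growth_def W by (rule ti[OF integrable_velocity_time[OF p1] integrable_velocity_time[OF p2]])
  have "is_profile ?c ?V" unfolding is_profile_def W
  proof (intro conjI allI)
    show "integrable time ?c" using is_profileD(1)[OF p1] is_profileD(1)[OF p2] by simp
    show "sqint_strip (\<lambda>t r. ?V t r)" by (rule sq[OF is_profileD(2)[OF p1] is_profileD(2)[OF p2]])
    show "locally_integrable (?V t)" for t by (intro li is_profileD(3)[OF p1] is_profileD(3)[OF p2])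
    show "sqint_strip (\<lambda>t r. sqrt (jap r) * (profile_velocity c V t r + a * profile_velocity c' V' t r))"
      using sq[OF is_profileD(4)[OF p1] is_profileD(4)[OF p2]] by (simp add: algebra_simps)
  qed
  moreover have Gs: "sqint_strip G" "sqint_strip G'" using 1 2 by (auto simp: solves_up_to_def)
  then have "sqint_strip (\<lambda>t r. ?G t r)" by (rule sq)
  moreover have I: "initial_profile ?c ?V ?f ?g = (\<lambda>x. initial_profile c V f g x + a * initial_profile c' V' f' g' x)"
    by (auto simp: initial_profile_def T fun_eq_iff algebra_simps)
  then have "locally_integrable (initial_profile ?c ?V ?f ?g)" using li[OF li1 li2] by simp
  moreover have "j + a * j' = jump ?c ?f ?g"
  proof -
    have "j = jump c f g" "j' = jump c' f' g'" using 1 2 by (auto simp: solves_up_to_def)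
    then show ?thesis unfolding jump_def ti[OF is_profileD(1)[OF p1] is_profileD(1)[OF p2]] by algebra
  qed
  moreover have "AE t in time. profile_defect ?c ?V ?G \<xi> t =
        (LINT x|lborel. initial_profile ?c ?V ?f ?g x * deriv (deriv \<xi>) x) + (\<kappa> + a * \<kappa>') * \<xi> 0 + (j + a * j') * deriv \<xi> 0"
    if \<xi>: "\<xi> \<in> Cc_infty UNIV" for \<xi>
  proof -
    interpret space_test \<xi> by standard (rule \<xi>)
    have sl: "(LINT x|lborel. (u x + a * v x) * k x) = (LINT x|lborel. u x * k x) + a * (LINT x|lborel. v x * k x)"
      if "integrable lborel (\<lambda>x. u x * k x)" "integrable lborel (\<lambda>x. v x * k x)" for u v k :: "real \<Rightarrow> real"
      using that by (simp add: distrib_right mult.assoc)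
    have e1: "AE t in time. profile_defect c V G \<xi> t =
        (LINT x|lborel. initial_profile c V f g x * deriv (deriv \<xi>) x) + \<kappa> * \<xi> 0 + j * deriv \<xi> 0"
      using 1 \<xi> by (auto simp: solves_up_to_def)
    have e2: "AE t in time. profile_defect c' V' G' \<xi> t =
        (LINT x|lborel. initial_profile c' V' f' g' x * deriv (deriv \<xi>) x) + \<kappa>' * \<xi> 0 + j' * deriv \<xi> 0"
      using 2 \<xi> by (auto simp: solves_up_to_def)
    have ii: "integrable lborel (\<lambda>x. u x * k x)" if "sqint lborel u" "sqint lborel k" for u k :: "real \<Rightarrow> real"
      using integrable_inner_sqint[OF that] by simp
    have rhs: "(LINT x|lborel. initial_profile ?c ?V ?f ?g x * deriv (deriv \<xi>) x) =
      (LINT x|lborel. initial_profile c V f g x * deriv (deriv \<xi>) x) + a * (LINT x|lborel. initial_profile c' V' f' g' x * deriv (deriv \<xi>) x)"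
      unfolding I by (intro sl integrable_times_test li1 li2)
    have Th: "slice (profile_growth ?c ?V) (deriv (deriv \<xi>)) t = slice (profile_growth c V) (deriv (deriv \<xi>)) t + a * slice (profile_growth c' V') (deriv (deriv \<xi>)) t" for t
      unfolding slice_def T by (intro sl slice_growth(2)[OF p1] slice_growth(2)[OF p2] test_sqint)
    show ?thesis
      using e1 e2 AE_sqint_slice[OF sqint_velocity[OF p1]] AE_sqint_slice[OF sqint_velocity[OF p2]] AE_sqint_slice[OF Gs(1)] AE_sqint_slice[OF Gs(2)]
    proof eventually_elim
      case (elim t)
      have "slice (profile_velocity ?c ?V) (\<lambda>x. x * \<xi> x) t = slice (profile_velocity c V) (\<lambda>x. x * \<xi> x) t + a * slice (profile_velocity c' V') (\<lambda>x. x * \<xi> x) t"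
        unfolding slice_def W by (intro sl ii elim x_test_sqint)
      moreover have "slice ?G \<xi> t = slice G \<xi> t + a * slice G' \<xi> t"
        unfolding slice_def by (intro sl ii elim test_sqint)
      moreover have "a * (profile_defect c' V' G' \<xi> t) =
        a * ((LINT x|lborel. initial_profile c' V' f' g' x * deriv (deriv \<xi>) x) + \<kappa>' * \<xi> 0 + j' * deriv \<xi> 0)" using elim(2) by simp
      ultimately show ?case using elim(1) unfolding rhs Th by (simp add: algebra_simps)
    qed
  qed
  ultimately show ?thesis unfolding solves_up_to_def by blast
qed

lemma solves_up_to_null:
  assumes "null_source N"
  shows "solves_up_to (\<lambda>_. 0) (\<lambda>_ _. 0) N (\<lambda>_. 0) (\<lambda>_. 0) 0 0"
proof -
  have N: "sqint_strip N"
  proof (rule sqint_cong_AE)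
    show "sqint strip (\<lambda>_. 0 :: real)" by (simp add: sqint_def)
    have "AE (t, r) in strip. N t r = 0" using assms by (simp add: null_source_def)
    then show "AE x in strip. 0 = (case x of (t, r) \<Rightarrow> N t r)" by eventually_elim auto
    show "strip_measurable N" using assms by (simp add: null_source_def)
  qed
  have z: "prim (\<lambda>_. 0) = (\<lambda>_. 0)" by (simp add: prim_def fun_eq_iff)
  have W: "profile_velocity (\<lambda>_. 0) (\<lambda>_ _. 0) = (\<lambda>_ _. 0)" by (simp add: profile_velocity_def z fun_eq_iff)
  have T: "profile_growth (\<lambda>_. 0) (\<lambda>_ _. 0) = (\<lambda>_ _. 0)" by (simp add: profile_growth_def W tint_def fun_eq_iff)
  have I: "initial_profile (\<lambda>_. 0) (\<lambda>_ _. 0) (\<lambda>_. 0) (\<lambda>_. 0) = (\<lambda>_. 0)" by (simp add: initial_profile_def T fun_eq_iff)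
  have "AE t in time. AE r in lborel. N t r = 0"
    using strip.AE_pair[of "\<lambda>p. (case p of (t, r) \<Rightarrow> N t r = 0)"] assms by (simp add: null_source_def)
  then have "AE t in time. slice N k t = 0" for k
  proof eventually_elim
    case (elim t)
    then show ?case unfolding slice_def by (intro integral_eq_zero_AE) (auto elim: eventually_mono)
  qed
  then show ?thesis using N unfolding solves_up_to_def W T I
    by (auto simp: is_profile_def W jump_def tint_def slice_def locally_integrable_def sqint_def)
qed

section \<open>End values of sources\<close>

lemma C0_L2_linear:
  assumes H: "H \<in> C0_L2 I" and H': "H' \<in> C0_L2 I"
  shows "(\<lambda>t x. H t x + a * H' t x) \<in> C0_L2 I"
proof -
  have sq: "sqint lborel (H t)" "sqint lborel (H' t)" if "t \<in> I" for t
    using H H' that by (auto simp: C0_L2_def sqint_eq_square_integrable)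
  have "((\<lambda>t. LINT x|lborel. ((H t x + a * H' t x) - (H s x + a * H' s x))^2) \<longlongrightarrow> 0) (at s within I)" if s: "s \<in> I" for s
  proof (rule Lim_null_comparison)
    let ?d = "\<lambda>H t. LINT x|lborel. (H t x - H s x)^2 :: real"
    have "((\<lambda>t. 2 * ?d H t + 2 * a^2 * ?d H' t) \<longlongrightarrow> 2 * 0 + 2 * a^2 * 0) (at s within I)"
      using H H' s by (intro tendsto_intros) (auto simp: C0_L2_def)
    then show "((\<lambda>t. 2 * ?d H t + 2 * a^2 * ?d H' t) \<longlongrightarrow> 0) (at s within I)" by simp
    have "norm (LINT x|lborel. ((H t x + a * H' t x) - (H s x + a * H' s x))^2) \<le> 2 * ?d H t + 2 * a^2 * ?d H' t"
      if t: "t \<in> I" for t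
    proof -
      have i: "integrable lborel (\<lambda>x. (H t x - H s x)^2)" "integrable lborel (\<lambda>x. (H' t x - H' s x)^2)"
        using sqint_integrable[OF sqint_diff[OF sq(1)[OF t] sq(1)[OF s]]] sqint_integrable[OF sqint_diff[OF sq(2)[OF t] sq(2)[OF s]]] by simp_all
      have "(LINT x|lborel. ((H t x + a * H' t x) - (H s x + a * H' s x))^2)
          \<le> (LINT x|lborel. 2 * (H t x - H s x)^2 + 2 * a^2 * (H' t x - H' s x)^2)"
      proof (rule integral_mono')
        show "integrable lborel (\<lambda>x. 2 * (H t x - H s x)^2 + 2 * a^2 * (H' t x - H' s x)^2)" using i by simp
        show "((H t x + a * H' t x) - (H s x + a * H' s x))^2 \<le> 2 * (H t x - H s x)^2 + 2 * a^2 * (H' t x - H' s x)^2" for x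
        proof -
          have "(H t x + a * H' t x) - (H s x + a * H' s x) = (H t x - H s x) + a * (H' t x - H' s x)" by (simp add: algebra_simps)
          then show ?thesis
            using square_add_le[of "H t x - H s x" "a * (H' t x - H' s x)"] by (simp only: power_mult_distrib mult.assoc)
        qed
      qed simp
      also have "\<dots> = 2 * ?d H t + 2 * a^2 * ?d H' t" using i by simp
      finally show ?thesis by simp
    qed
    then show "\<forall>\<^sub>F t in at s within I. norm (LINT x|lborel. ((H t x + a * H' t x) - (H s x + a * H' s x))^2) \<le> 2 * ?d H t + 2 * a^2 * ?d H' t"
      unfolding eventually_at_filter by (intro always_eventually allI impI)
  qed
  moreover have "sqint lborel (\<lambda>x. H t x + a * H' t x)" if "t \<in> I" for t
    using sqint_add[OF sq(1)[OF that] sqint_scaleR[OF sq(2)[OF that], of a]] by simp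
  ultimately show ?thesis by (auto simp: C0_L2_def sqint_eq_square_integrable)
qed

text \<open>The L2 norm is continuous in time and vanishes for almost every time, hence also at the
  end times.\<close>

lemma C0_L2_null:
  assumes H: "H \<in> C0_L2 {0..1}" and null: "AE (t, x) in strip. H t x = 0" and s: "s \<in> {0..1}"
  shows "AE x in lborel. H s x = 0"
proof -
  let ?n = "\<lambda>t. LINT x|lborel. (H t x)^2"
  have sq: "sqint lborel (H s)" using H s by (auto simp: C0_L2_def sqint_eq_square_integrable)
  have c: "continuous_on {0..1} ?n" by (rule C0_L2_norm_continuous[OF H])
  have "AE t in time. AE x in lborel. H t x = 0"
    using strip.AE_pair[of "\<lambda>p. case p of (t, x) \<Rightarrow> H t x = 0"] null by simp
  then have "AE t in time. ?n t = 0"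
    by eventually_elim (rule integral_eq_zero_AE, auto elim: eventually_mono)
  then have ae: "AE t in lborel. t \<in> {0<..<1} \<longrightarrow> ?n t = 0" by (simp add: AE_time_iff)
  have "?n t = 0" if "t \<in> {0<..<1}" for t
    by (rule continuous_AE_eq[OF open_greaterThanLessThan _ _ ae that]) (auto intro: continuous_on_subset[OF c])
  then have "?n s = 0" using continuous_constant_on_closure[of "{0<..<1}" ?n 0 s] c s by simp
  then have "AE x in lborel. (H s x)^2 = 0"
    using sqint_integrable[OF sq] by (subst (asm) integral_nonneg_eq_0_iff_AE) auto
  then show ?thesis by eventually_elim simp
qed

text \<open>The representatives chosen in \<open>time_trace\<close> and
  \<open>one_sided_value\<close> are quantified away. What remains is a relation between source and
  number that is linear, contains 0 for null sources and is single-valued at the two ends, as the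
  selection lemma and its application require.\<close>

definition end_value :: "real \<Rightarrow> real set \<Rightarrow> field \<Rightarrow> real \<Rightarrow> bool" where
  "end_value s S G c \<longleftrightarrow> (\<exists>H\<in>C0_L2 {0..1}. \<exists>h. (AE (t, x) in strip. G t x = H t x) \<and>
     (AE x in lborel. x \<in> S \<longrightarrow> h x = H s x) \<and> (h \<longlongrightarrow> c) (at 0 within S))"

lemma end_valueI: "time_trace G s g \<Longrightarrow> one_sided_value S g c \<Longrightarrow> end_value s S G c"
  unfolding time_trace_def one_sided_value_def end_value_def by blast

lemma end_value_linear:
  assumes "end_value s S G c" "end_value s S G' c'"
  shows "end_value s S (\<lambda>t x. G t x + a * G' t x) (c + a * c')"
proof -
  obtain H h where H: "H \<in> C0_L2 {0..1}" "AE (t, x) in strip. G t x = H t x"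
    "AE x in lborel. x \<in> S \<longrightarrow> h x = H s x" "(h \<longlongrightarrow> c) (at 0 within S)" using assms(1) by (auto simp: end_value_def)
  obtain H' h' where H': "H' \<in> C0_L2 {0..1}" "AE (t, x) in strip. G' t x = H' t x"
    "AE x in lborel. x \<in> S \<longrightarrow> h' x = H' s x" "(h' \<longlongrightarrow> c') (at 0 within S)" using assms(2) by (auto simp: end_value_def)
  show ?thesis unfolding end_value_def
  proof (intro bexI[of _ "\<lambda>t x. H t x + a * H' t x"] exI[of _ "\<lambda>x. h x + a * h' x"] conjI C0_L2_linear H H')
    show "AE (t, x) in strip. G t x + a * G' t x = H t x + a * H' t x" using H(2) H'(2) by eventually_elim auto
    show "AE x in lborel. x \<in> S \<longrightarrow> h x + a * h' x = H s x + a * H' s x" using H(3) H'(3) by eventually_elim auto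
    show "((\<lambda>x. h x + a * h' x) \<longlongrightarrow> c + a * c') (at 0 within S)" by (intro tendsto_intros H H')
  qed
qed

lemma end_value_null: "null_source N \<Longrightarrow> end_value s S N 0"
  unfolding end_value_def null_source_def
  by (intro bexI[of _ "\<lambda>_ _. 0"] exI[of _ "\<lambda>_. 0"]) (auto simp: C0_L2_def square_integrable_def)

text \<open>By linearity the difference of two values is an end value of the zero source. A function
  that vanishes almost everywhere on \<open>S\<close> cannot have a nonzero limit along
  \<open>S\<close>, as \<open>S\<close> has positive measure near 0.\<close>

lemma end_value_unique:
  assumes v: "end_value s S G c" "end_value s S G c'" and s: "s \<in> {0..1}"
    and S: "S \<in> sets borel" "\<And>\<delta>. \<delta> > 0 \<Longrightarrow> emeasure lborel (S \<inter> {-\<delta><..<\<delta>}) \<noteq> 0"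
  shows "c = c'"
proof (rule ccontr)
  assume ne: "c \<noteq> c'"
  have "end_value s S (\<lambda>_ _. 0) (c - c')" using end_value_linear[OF v, of "-1"] by simp
  then obtain H h where H: "H \<in> C0_L2 {0..1}" "AE (t, x) in strip. 0 = H t x"
    "AE x in lborel. x \<in> S \<longrightarrow> h x = H s x" "(h \<longlongrightarrow> c - c') (at 0 within S)" by (auto simp: end_value_def)
  have "AE (t, x) in strip. H t x = 0" using H(2) by eventually_elim auto
  from C0_L2_null[OF H(1) this s] H(3) have ae: "AE x in lborel. x \<in> S \<longrightarrow> h x = 0" by eventually_elim auto
  have "\<forall>\<^sub>F x in at 0 within S. h x \<noteq> 0"
    using tendsto_imp_eventually_ne[OF H(4), of 0] ne by simp
  then obtain \<delta> where \<delta>: "\<delta> > 0" "\<And>x. x \<in> S \<Longrightarrow> x \<noteq> 0 \<Longrightarrow> \<bar>x\<bar> < \<delta> \<Longrightarrow> h x \<noteq> 0"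
    by (auto simp: eventually_at)
  have "AE x in lborel. x \<notin> S \<inter> {-\<delta><..<\<delta>}" using ae AE_nonzero by eventually_elim (use \<delta>(2) in auto)
  then have "emeasure lborel (S \<inter> {-\<delta><..<\<delta>}) = 0"
    using S(1) by (subst (asm) AE_iff_null_sets[symmetric]) auto
  then show False using S(2)[OF \<delta>(1)] by simp
qed

lemma end_value_unique_left: "end_value 0 {0<..} G c \<Longrightarrow> end_value 0 {0<..} G c' \<Longrightarrow> c = c'"
proof (rule end_value_unique)
  fix \<delta> :: real assume "\<delta> > 0"
  moreover from this have "{0<..} \<inter> {-\<delta><..<\<delta>} = {0<..<\<delta>}" by auto
  ultimately show "emeasure lborel ({0<..} \<inter> {-\<delta><..<\<delta>}) \<noteq> 0" by simp
qed auto

lemma end_value_unique_right: "end_value 1 {..<0} G c \<Longrightarrow> end_value 1 {..<0} G c' \<Longrightarrow> c = c'"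
proof (rule end_value_unique)
  fix \<delta> :: real assume "\<delta> > 0"
  moreover from this have "{..<0} \<inter> {-\<delta><..<\<delta>} = {-\<delta><..<0}" by auto
  ultimately show "emeasure lborel ({..<0} \<inter> {-\<delta><..<\<delta>}) \<noteq> 0" by simp
qed auto

text \<open>Nontriviality of the filter makes derivatives within \<open>S\<close> unique, also at an
  end point of \<open>S\<close>; linearity of \<open>deriv_on\<close> rests on this.\<close>

lemma perfect_connected:
  fixes S :: "real set"
  assumes "connected S" "x \<in> S" "y \<in> S" "x \<noteq> y"
  shows "at x within S \<noteq> bot"
proof -
  have ne: "S \<noteq> {z}" for z using assms(2-4) by auto
  show ?thesis using connected_imp_perfect[OF assms(1,2) ne] by (simp add: trivial_limit_within)
qed

section \<open>Data with prescribed second derivatives at 0\<close>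

lemma deriv_on_linear:
  assumes f: "f \<in> Cc_infty S" and g: "g \<in> Cc_infty S" and S: "\<And>x. x \<in> S \<Longrightarrow> at x within S \<noteq> bot" and "x \<in> S"
  shows "(deriv_on S ^^ n) (\<lambda>x. a * f x + b * g x) x = a * (deriv_on S ^^ n) f x + b * (deriv_on S ^^ n) g x"
  using \<open>x \<in> S\<close>
proof (induction n arbitrary: x)
  case (Suc n)
  have "(deriv_on S ^^ Suc n) (\<lambda>x. a * f x + b * g x) x = deriv_on S (\<lambda>x. a * (deriv_on S ^^ n) f x + b * (deriv_on S ^^ n) g x) x"
    unfolding funpow.simps comp_def by (rule deriv_on_cong) (use Suc in auto)
  also have "\<dots> = a * (deriv_on S ^^ Suc n) f x + b * (deriv_on S ^^ Suc n) g x"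
    unfolding deriv_on_def[of S "\<lambda>x. a * _ x + b * _ x"]
    by (rule vector_derivative_within[OF S[OF Suc.prems]])
      (intro has_vector_derivative_add has_vector_derivative_mult_right Cc_infty_deriv_within f g Suc.prems)
  finally show ?case .
qed simp

lemma Cc_infty_restrict:
  assumes v: "v \<in> Cc_infty UNIV" and S: "closed S" "\<And>x. x \<in> S \<Longrightarrow> at x within S \<noteq> bot"
  shows "(\<lambda>x. if x \<in> S then v x else 0) \<in> Cc_infty S" (is "?f \<in> _")
    and "x \<in> S \<Longrightarrow> (deriv_on S ^^ n) (\<lambda>x. if x \<in> S then v x else 0) x = (deriv ^^ n) v x"
proof -
  have mem: "(deriv ^^ n) v \<in> Cc_infty UNIV" for n by (induction n) (auto intro: deriv_Cc_infty v)
  have D: "((deriv ^^ n) v has_real_derivative (deriv ^^ Suc n) v x) (at x)" for n x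
    using Cc_infty_open_DERIV[OF mem open_UNIV] by simp
  have e: "(deriv_on S ^^ n) ?f x = (deriv ^^ n) v x" if "x \<in> S" for n x
    using that
  proof (induction n arbitrary: x)
    case (Suc n)
    have "(deriv_on S ^^ Suc n) ?f x = deriv_on S ((deriv ^^ n) v) x"
      unfolding funpow.simps comp_def by (rule deriv_on_cong) (use Suc in auto)
    also have "\<dots> = (deriv ^^ Suc n) v x" unfolding deriv_on_def
      by (rule vector_derivative_within[OF S(2)[OF Suc.prems]])
        (use D[of n x] in \<open>simp add: has_real_derivative_iff_has_vector_derivative has_vector_derivative_at_within\<close>)
    finally show ?case .
  qed simp
  then show "x \<in> S \<Longrightarrow> (deriv_on S ^^ n) ?f x = (deriv ^^ n) v x" .
  obtain K where K: "compact K" "\<And>x. x \<notin> K \<Longrightarrow> v x = 0" using Cc_inftyE[OF v] by metis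
  show "?f \<in> Cc_infty S" unfolding Cc_infty_def mem_Collect_eq
  proof (intro conjI allI exI[of _ "K \<inter> S"])
    fix n
    show "(deriv_on S ^^ n) ?f differentiable_on S" unfolding differentiable_on_def
    proof
      fix x assume x: "x \<in> S"
      have "(deriv ^^ n) v differentiable (at x within S)"
        using has_field_derivative_at_within[OF D[of n x]] unfolding differentiable_def has_field_derivative_def by blast
      then show "(deriv_on S ^^ n) ?f differentiable (at x within S)"
        by (rule differentiable_transform_within[OF _ zero_less_one x]) (simp add: e)
    qed
  qed (use K S(1) in \<open>auto intro: compact_Int_closed\<close>)
qed

lemma exists_second_derivative_one:
  obtains v where "v \<in> Cc_infty UNIV" "(deriv ^^ 2) v 0 = 1"
proof -
  obtain k where k: "k \<in> Cc_infty UNIV" "k 0 = 1" by (rule exists_unit_test)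
  \<comment> \<open>Half of \<open>x^2\<close> times a function with value 1 at 0 has second
    derivative 1 there.\<close>
  define v where "v x = x * (x * (1 / 2 * k x))" for x
  have id: "times_differentiable n (\<lambda>x. x)" for n
    by (cases n) (auto intro!: exI[of _ "\<lambda>_. 1"] times_differentiable_const)
  obtain K where K: "compact K" "\<And>x. x \<notin> K \<Longrightarrow> k x = 0" using Cc_inftyE[OF k(1)] by metis
  have "v \<in> Cc_infty UNIV"
  proof (rule Cc_inftyI[OF _ open_UNIV K(1)])
    show "times_differentiable n v" for n unfolding v_def[abs_def]
      by (intro times_differentiable_mult id times_differentiable_const Cc_infty_times_differentiable[OF k(1)])
  qed (use K in \<open>auto simp: v_def\<close>)
  moreover have "(deriv ^^ 2) v 0 = 1"
  proof -
    let ?k1 = "deriv k" and ?k2 = "deriv (deriv k)"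
    have D1: "(k has_real_derivative ?k1 x) (at x)" and D2: "(?k1 has_real_derivative ?k2 x) (at x)" for x
      using Cc_infty_open_DERIV[OF k(1) open_UNIV] Cc_infty_open_DERIV[OF deriv_Cc_infty[OF k(1) open_UNIV] open_UNIV] by auto
    have 1: "deriv v = (\<lambda>x. x * k x + x * x * ?k1 x / 2)"
    proof
      fix x show "deriv v x = x * k x + x * x * ?k1 x / 2"
        unfolding v_def[abs_def] by (rule DERIV_imp_deriv) (auto intro!: derivative_eq_intros D1 simp: algebra_simps)
    qed
    have "deriv (deriv v) 0 = 1"
      unfolding 1 by (rule DERIV_imp_deriv) (auto intro!: derivative_eq_intros D1 D2 simp: k(2))
    then show ?thesis by (simp add: numeral_2_eq_2)
  qed
  ultimately show thesis by (rule that)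
qed

lemma null_source_diff:
  assumes "G \<in> H1_L2" "G' \<in> H1_L2" "AE (t, x) in strip. G t x = G' t x"
  shows "null_source (\<lambda>t x. 1 * G t x + (-1) * G' t x)"
proof -
  have "strip_measurable G" "strip_measurable G'"
    using assms(1,2) by (auto simp: H1_L2_def L2_L2_def square_integrable_def)
  then have "strip_measurable (\<lambda>t x. 1 * G t x + (-1) * G' t x)" by (simp add: split_beta')
  moreover have "AE (t, x) in strip. 1 * G t x + (-1) * G' t x = 0" using assms(3) by eventually_elim auto
  ultimately show ?thesis unfolding null_source_def by blast
qed

theorem proposition1p1:
  shows "\<exists>l0 l1 \<beta>0 \<beta>1.
    linear_on_data l0 \<and> linear_on_data l1 \<and>
    nontrivial_on_data l0 \<and> nontrivial_on_data l1 \<and> independent_on_data l0 l1 \<and>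
    linear_on_sources \<beta>0 \<and> linear_on_sources \<beta>1 \<and>
    (\<forall>G\<in>H1_L2. \<forall>G_Left G_Right G_Left0 G_Right0.
       time_trace G 0 G_Left \<longrightarrow> one_sided_value {0<..} G_Left G_Left0 \<longrightarrow>
       time_trace G 1 G_Right \<longrightarrow> one_sided_value {..<0} G_Right G_Right0 \<longrightarrow>
       (\<forall>(\<Xi>\<^sub>L, \<Xi>\<^sub>R)\<in>data_space.
          (deriv_on {0..} ^^ 2) \<Xi>\<^sub>L 0 = - G_Left0 \<longrightarrow>
          (deriv_on {..0} ^^ 2) \<Xi>\<^sub>R 0 = - G_Right0 \<longrightarrow>
          l1 (\<Xi>\<^sub>L, \<Xi>\<^sub>R) = \<beta>1 G \<longrightarrow>
          l0 (\<Xi>\<^sub>L, \<Xi>\<^sub>R) = \<beta>0 G \<longrightarrow>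
          (\<forall>\<Omega>. weak_solution G \<Xi>\<^sub>L \<Xi>\<^sub>R \<Omega> \<longrightarrow> \<Omega> \<in> H1_H1)))"
proof -
  let ?O = "\<lambda>_. 0 :: real" and ?OO = "\<lambda>_ _. 0 :: real"
  have rel1: "\<exists>c V. solves_up_to c V (\<lambda>t r. G t r + a * G' t r) (\<lambda>r. f r + a * f' r) (\<lambda>r. g r + a * g' r) (j + a * j') (\<kappa> + a * \<kappa>')"
    if "\<exists>c V. solves_up_to c V G f g j \<kappa>" "\<exists>c V. solves_up_to c V G' f' g' j' \<kappa>'" for G f g j \<kappa> G' f' g' j' \<kappa>' a
    using that solves_up_to_linear by blast
  have rel2: "\<exists>c V. solves_up_to c V N ?O ?O 0 0" if "null_source N" for N using solves_up_to_null[OF that] by blast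
  have rel3: "(\<lambda>r. f r + a * f' r) = ?O \<and> (\<lambda>r. g r + a * g' r) = ?O \<and>
      end_value 0 {0<..} (\<lambda>t r. G t r + a * G' t r) (x + a * x') \<and> end_value 1 {..<0} (\<lambda>t r. G t r + a * G' t r) (y + a * y')"
    if "f = ?O \<and> g = ?O \<and> end_value 0 {0<..} G x \<and> end_value 1 {..<0} G y"
      "f' = ?O \<and> g' = ?O \<and> end_value 0 {0<..} G' x' \<and> end_value 1 {..<0} G' y'" for G f g x y G' f' g' x' y' a
    using that end_value_linear by auto
  have rel4: "?O = ?O \<and> ?O = ?O \<and> end_value 0 {0<..} N 0 \<and> end_value 1 {..<0} N 0" if "null_source N" for N
    using end_value_null[OF that] by simp
  \<comment> \<open>Linear choices of the jump and of \<kappa>, valid whenever some pair of values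
    is possible.\<close>
  obtain J K :: "field \<Rightarrow> (real \<Rightarrow> real) \<Rightarrow> (real \<Rightarrow> real) \<Rightarrow> real" where
    JKl: "entry_linear J" "entry_linear K"
    and JK: "\<And>G f g j \<kappa>. \<exists>c V. solves_up_to c V G f g j \<kappa> \<Longrightarrow> \<exists>c V. solves_up_to c V G f g (J G f g) (K G f g)"
    and JK_null: "\<And>N. null_source N \<Longrightarrow> J N ?O ?O = 0 \<and> K N ?O ?O = 0"
    using linear_relation_selection[where rel="\<lambda>G f g j \<kappa>. \<exists>c V. solves_up_to c V G f g j \<kappa>", OF rel1 rel2] by blast
  \<comment> \<open>End values exist only for some sources, whereas \<beta>0 and \<beta>1 have to be
    linear on all of \<open>H1_L2\<close>. \<open>A\<close> and \<open>B\<close> are linear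
    extensions that return the end values whenever both exist.\<close>
  obtain A B :: "field \<Rightarrow> (real \<Rightarrow> real) \<Rightarrow> (real \<Rightarrow> real) \<Rightarrow> real" where
    ABl: "entry_linear A" "entry_linear B"
    and AB: "\<And>G f g x y. f = ?O \<and> g = ?O \<and> end_value 0 {0<..} G x \<and> end_value 1 {..<0} G y \<Longrightarrow>
        f = ?O \<and> g = ?O \<and> end_value 0 {0<..} G (A G f g) \<and> end_value 1 {..<0} G (B G f g)"
    and AB_null: "\<And>N. null_source N \<Longrightarrow> A N ?O ?O = 0 \<and> B N ?O ?O = 0"
    using linear_relation_selection[where rel="\<lambda>G f g x y. f = ?O \<and> g = ?O \<and> end_value 0 {0<..} G x \<and> end_value 1 {..<0} G y", OF rel3 rel4] by blast
  note JK_lin = JKl[unfolded entry_linear_def, rule_format] and AB_lin = ABl[unfolded entry_linear_def, rule_format]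
  let ?d = "\<lambda>f. (deriv_on {0..} ^^ 2) f 0" and ?e = "\<lambda>g. (deriv_on {..0} ^^ 2) g 0"
  have perf: "x \<in> {0..} \<Longrightarrow> at x within {0..} \<noteq> bot" "x \<in> {..0} \<Longrightarrow> at x within {..0} \<noteq> bot" for x :: real
    using perfect_connected[of "{0..}" x "x + 1"] perfect_connected[of "{..0}" x "x - 1"] by auto
  have d_lin: "?d (\<lambda>x. a * f x + b * g x) = a * ?d f + b * ?d g" if "f \<in> Cc_infty {0..}" "g \<in> Cc_infty {0..}" for a b f g
    using deriv_on_linear[OF that perf(1), of 0] by simp
  have e_lin: "?e (\<lambda>x. a * f x + b * g x) = a * ?e f + b * ?e g" if "f \<in> Cc_infty {..0}" "g \<in> Cc_infty {..0}" for a b f g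
    using deriv_on_linear[OF that perf(2), of 0] by simp
  obtain \<psi> where \<psi>: "\<psi> \<in> Cc_infty UNIV" "(deriv ^^ 2) \<psi> 0 = 1" by (rule exists_second_derivative_one)
  \<comment> \<open>One-sided data with second derivative 1 at 0; paired with zero data on the other
    side they witness independence.\<close>
  define f1 g1 where "f1 x = (if x \<in> {0..} then \<psi> x else 0)" and "g1 x = (if x \<in> {..0} then \<psi> x else 0)" for x
  have f1: "f1 \<in> Cc_infty {0..}" "?d f1 = 1" and g1: "g1 \<in> Cc_infty {..0}" "?e g1 = 1"
    using Cc_infty_restrict[OF \<psi>(1) _ perf(1)] Cc_infty_restrict[OF \<psi>(1) _ perf(2)] \<psi>(2)
    by (simp_all add: f1_def[abs_def] g1_def[abs_def])
  have "?O \<in> Cc_infty UNIV" using Cc_infty_UNIV_linear[OF \<psi>(1) \<psi>(1), of "-1"] by simp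
  note z = Cc_infty_restrict(1)[OF this]
  have O: "?O \<in> Cc_infty {0..}" "?O \<in> Cc_infty {..0}" using z[OF _ perf(1)] z[OF _ perf(2)] by simp_all
  have dO: "?d ?O = 0" "?e ?O = 0" using d_lin[OF O(1) O(1), of 0 0] e_lin[OF O(2) O(2), of 0 0] by simp_all
  \<comment> \<open>Chosen so that \<open>l0\<close> and \<open>l1\<close> take the entries of the
    identity matrix on the two data pairs built from \<open>f1\<close> and \<open>g1\<close>;
    nontriviality and independence follow at once.\<close>
  define a0 b0 a1 b1 where "a0 = 1 - J ?OO f1 ?O" and "b0 = - J ?OO ?O g1" and "a1 = - K ?OO f1 ?O" and "b1 = 1 - K ?OO ?O g1"
  define l0 where "l0 = (\<lambda>(f, g). J ?OO f g + a0 * ?d f + b0 * ?e g)"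
  define l1 where "l1 = (\<lambda>(f, g). K ?OO f g + a1 * ?d f + b1 * ?e g)"
  \<comment> \<open>Under the constraints \<open>?d f\<close> and \<open>?e g\<close> are the
    negatives of the values of \<open>A\<close> and \<open>B\<close> at the source, so the
    correction terms on both sides of \<open>l0 (f, g) = \<beta>0 G\<close> agree. What remains says
    that \<open>J G f g\<close> is zero, and likewise for \<open>K\<close>.\<close>
  define \<beta>0 where "\<beta>0 G = - (J G ?O ?O + a0 * A G ?O ?O + b0 * B G ?O ?O)" for G
  define \<beta>1 where "\<beta>1 G = - (K G ?O ?O + a1 * A G ?O ?O + b1 * B G ?O ?O)" for G
  have v: "l0 (f1, ?O) = 1" "l0 (?O, g1) = 0" "l1 (f1, ?O) = 0" "l1 (?O, g1) = 1"
    by (simp_all add: l0_def l1_def f1(2) g1(2) dO a0_def b0_def a1_def b1_def)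
  have p: "(f1, ?O) \<in> data_space" "(?O, g1) \<in> data_space" using O f1 g1 by (auto simp: data_space_def)
  have main: "\<Omega> \<in> H1_H1"
    if G: "G \<in> H1_L2" and L: "time_trace G 0 GL" "one_sided_value {0<..} GL c" and R: "time_trace G 1 GR" "one_sided_value {..<0} GR d"
      and data: "f \<in> Cc_infty {0..}" "g \<in> Cc_infty {..0}" and compat: "?d f = - c" "?e g = - d"
      and l: "l1 (f, g) = \<beta>1 G" "l0 (f, g) = \<beta>0 G" and \<Omega>: "weak_solution G f g \<Omega>" for G GL c GR d f g \<Omega>
  proof -
    have ex: "\<exists>c V. solves_up_to c V G f g (J G f g) (K G f g)"
      by (rule exists_solution_up_to[OF G data L compat(1) R compat(2)]) (use JK in blast)
    have "A G ?O ?O = c" "B G ?O ?O = d"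
      using AB[of ?O ?O G c d] end_valueI[OF L] end_valueI[OF R] end_value_unique_left end_value_unique_right by blast+
    \<comment> \<open>Linearity on all entries separates source from data, although the source with
      zero data, or the data with zero source, need not be related to any numbers.\<close>
    moreover have "J G f g = J G ?O ?O + J ?OO f g" "K G f g = K G ?O ?O + K ?OO f g"
      using JK_lin[of 1 G 1 ?OO ?O f ?O g] by simp_all
    ultimately have "J G f g = 0" "K G f g = 0" using l compat by (simp_all add: l0_def l1_def \<beta>0_def \<beta>1_def)
    with ex obtain c V where "solves_up_to c V G f g 0 0" by auto
    then interpret matched_solution c V G f g using data by unfold_locales
    show ?thesis by (rule solution_H1_H1[OF \<Omega>])
  qed
  have "linear_on_data l0" "linear_on_data l1"
    using JK_lin[of _ ?OO _ ?OO] by (auto simp: linear_on_data_def data_space_def l0_def l1_def d_lin e_lin algebra_simps)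
  moreover have "nontrivial_on_data l0" "nontrivial_on_data l1"
    using v p by (auto simp: nontrivial_on_data_def intro: bexI[of _ "(f1, ?O)"] bexI[of _ "(?O, g1)"])
  moreover have "independent_on_data l0 l1"
    unfolding independent_on_data_def
  proof (intro allI impI)
    fix a b assume *: "\<forall>p\<in>data_space. a * l0 p + b * l1 p = 0"
    show "a = 0 \<and> b = 0" using bspec[OF * p(1)] bspec[OF * p(2)] v by simp
  qed
  moreover have "linear_on_sources \<beta>0" "linear_on_sources \<beta>1"
  proof -
    have lin: "\<beta>0 (\<lambda>t r. c * G t r + d * G' t r) = c * \<beta>0 G + d * \<beta>0 G'" "\<beta>1 (\<lambda>t r. c * G t r + d * G' t r) = c * \<beta>1 G + d * \<beta>1 G'" for c d G G'
      using JK_lin[of c G d G' ?O ?O ?O ?O] AB_lin[of c G d G' ?O ?O ?O ?O] by (simp_all add: \<beta>0_def \<beta>1_def algebra_simps)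
    \<comment> \<open>Sources that agree almost everywhere differ by a null source, on which all
      four selections vanish.\<close>
    have "\<beta>0 G = \<beta>0 G' \<and> \<beta>1 G = \<beta>1 G'" if "G \<in> H1_L2" "G' \<in> H1_L2" "AE (t, r) in strip. G t r = G' t r" for G G'
      using JK_null[OF null_source_diff[OF that]] AB_null[OF null_source_diff[OF that]] lin[of 1 G "-1" G']
      by (simp add: \<beta>0_def[of "\<lambda>t r. _ t r - _ t r"] \<beta>1_def[of "\<lambda>t r. _ t r - _ t r"])
    with lin show "linear_on_sources \<beta>0" "linear_on_sources \<beta>1" unfolding linear_on_sources_def by blast+
  qed
  moreover have "\<forall>G\<in>H1_L2. \<forall>G_Left G_Right G_Left0 G_Right0.
       time_trace G 0 G_Left \<longrightarrow> one_sided_value {0<..} G_Left G_Left0 \<longrightarrow>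
       time_trace G 1 G_Right \<longrightarrow> one_sided_value {..<0} G_Right G_Right0 \<longrightarrow>
       (\<forall>(\<Xi>\<^sub>L, \<Xi>\<^sub>R)\<in>data_space. ?d \<Xi>\<^sub>L = - G_Left0 \<longrightarrow> ?e \<Xi>\<^sub>R = - G_Right0 \<longrightarrow>
          l1 (\<Xi>\<^sub>L, \<Xi>\<^sub>R) = \<beta>1 G \<longrightarrow> l0 (\<Xi>\<^sub>L, \<Xi>\<^sub>R) = \<beta>0 G \<longrightarrow>
          (\<forall>\<Omega>. weak_solution G \<Xi>\<^sub>L \<Xi>\<^sub>R \<Omega> \<longrightarrow> \<Omega> \<in> H1_H1))"
    using main unfolding data_space_def by fast
  ultimately show ?thesis by blast
qed

end
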